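(* Let $q\in\mathcal{Q}_1$ be a generic reflectionless potential such that $T_q$ has infinitely many negative eigenvalues $-\varkappa_1^2<-\varkappa_2^2<\dots$ ($\varkappa_n>0$, $\sum_n\varkappa_n<\infty$), with corresponding right norming constants $m_1,m_2,\dots$. Let $-\mu_1^2<-\mu_2^2<\dots$ be the negative eigenvalues of $T_q'=T_q^-\oplus T_q^+$, where the sign of $\mu_n$ is chosen so that $\mu_n>0$ if $-\mu_n^2$ is an eigenvalue of $T_q^+$ and $\mu_n<0$ if $-\mu_n^2$ is an eigenvalue of $T_q^-$. Set $$a(z)=\prod_{n=1}^\infty\frac{z-i\varkappa_n}{z+i\varkappa_n},\qquad B(z)=\prod_{n=1}^\infty\frac{z-i\mu_n}{z+i\mu_n}.$$ Then for each $n\in\mathbb{N}$, $$m_n^{-2}=i\,\dot a(i\varkappa_n)\,B(i\varkappa_n),$$ where $\dot a$ denotes the derivative of $a$ with respect to $z$.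
   Context: $\mathcal{Q}_1$ is the set of all real-valued functions in $L_1(\mathbb{R})$. For $q\in\mathcal{Q}_1$, $T_q=-\frac{d^2}{dx^2}+q$ is the corresponding self-adjoint Schr\"odinger operator in $L_2(\mathbb{R})$; $T_q^+$ and $T_q^-$ are the self-adjoint operators in $L_2(\mathbb{R}_+)$ and $L_2(\mathbb{R}_-)$ generated by $-\frac{d^2}{dx^2}+q$ and the Dirichlet boundary condition $y(0)=0$; $T_q':=T_q^-\oplus T_q^+$. A potential $q\in\mathcal{Q}_1$ is called special if the negative spectra of $T_q$ and $T_q'$ have nonempty intersection, and generic otherwise. For generic $q$ the eigenvalues strictly interlace, $-\varkappa_1^2<-\mu_1^2<-\varkappa_2^2<-\mu_2^2<\dots$, and each $-\mu_n^2$ is an eigenvalue of exactly one of $T_q^+$, $T_q^-$. Jost solutions: for $\lambda\ne0$ with $\operatorname{Im}\lambda\ge0$, the right Jost solution $e_+(\cdot,\lambda;q)$ is the unique solution of $-y''+qy=\lambda^2y$ with $\lim_{x\to+\infty}e^{-i\lambda x}e_+(x,\lambda;q)=1$; for $\lambda\neq0$ with $\operatorname{Im}\lambda\le0$, the left Jost solution $e_-(\cdot,\lambda;q)$ is the unique solution of the same equation with $\lim_{x\to-\infty}e^{-i\lambda x}e_-(x,\lambda;q)=1$. Reflectionless potentials: for real $k\ne0$ there are unique $a(k),b(k)$ with $e_+(x,k;q)=a(k)e_-(x,k;q)+b(k)e_-(x,-k;q)$, and $|a(k)|^2=1+|b(k)|^2$; the reflection coefficients are $r_-(k)=b(k)/a(k)$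 and $r_+(k)=-b(-k)/a(k)$. A potential $q\in\mathcal{Q}_1$ is called reflectionless if its reflection coefficients vanish identically on $\mathbb{R}\setminus\{0\}$. For reflectionless $q\in\mathcal Q_1$, the coefficient $a$ extends to the upper half-plane and equals the Blaschke product in the claim. Norming constants: if $-\varkappa^2$ ($\varkappa>0$) is an eigenvalue of $T_q$, then $e_+(\cdot,i\varkappa;q)\in L_2(\mathbb{R})$ is an eigenfunction and the right norming constant $m>0$ is defined by $m^{-2}=\int_{\mathbb{R}}|e_+(x,i\varkappa;q)|^2\,dx$. *)

theory Defs
  imports "HOL-Analysis.Analysis"
begin

text \<open>\<open>g\<close> is locally absolutely continuous on the interval \<open>S\<close> and \<open>h\<close> is (a representative of) its
  almost everywhere derivative.\<close>

definition loc_ac_deriv :: "real set \<Rightarrow> (real \<Rightarrow> complex) \<Rightarrow> (real \<Rightarrow> complex) \<Rightarrow> bool" where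
  "loc_ac_deriv S g h \<longleftrightarrow>
     (\<forall>a\<in>S. \<forall>b\<in>S. a \<le> b \<longrightarrow>
        h absolutely_integrable_on {a..b} \<and> g b - g a = integral {a..b} h)"

text \<open>\<open>-y'' + q y = f\<close> on the interval \<open>S\<close>, in the usual sense for locally integrable coefficients:
  \<open>y\<close> and \<open>y'\<close> are locally absolutely continuous and the equation holds almost everywhere.
  The witness \<open>y1\<close> is continuous, hence it is the derivative of \<open>y\<close> everywhere on \<open>S\<close>.\<close>

definition schroedinger_eq ::
    "real set \<Rightarrow> (real \<Rightarrow> real) \<Rightarrow> (real \<Rightarrow> complex) \<Rightarrow> (real \<Rightarrow> complex) \<Rightarrow> bool" where
  "schroedinger_eq S q y f \<longleftrightarrow>
     (\<exists>y1. loc_ac_deriv S y y1 \<and>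
           loc_ac_deriv S y1 (\<lambda>x. complex_of_real (q x) * y x - f x))"

definition Q1 :: "(real \<Rightarrow> real) set" where
  "Q1 = {q. integrable lebesgue q}"


subsection \<open>Operators\<close>

definition L2 :: "real set \<Rightarrow> (real \<Rightarrow> complex) set" where
  "L2 S = {f. f \<in> borel_measurable (lebesgue_on S) \<and>
              integrable (lebesgue_on S) (\<lambda>x. (cmod (f x))\<^sup>2)}"

definition L2_norm :: "real set \<Rightarrow> (real \<Rightarrow> complex) \<Rightarrow> real" where
  "L2_norm S f = sqrt (\<integral>x. (cmod (f x))\<^sup>2 \<partial>lebesgue_on S)"

text \<open>An operator in \<open>L\<^sub>2(S)\<close> is represented by its graph, a set of pairs of functions. The functions
  stand for their classes modulo null subsets of \<open>S\<close>; for the operators below, the first component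
  is the continuously differentiable representative, and the second one is arbitrary in its class.\<close>

type_synonym l2_graph = "((real \<Rightarrow> complex) \<times> (real \<Rightarrow> complex)) set"

definition eigenvalue :: "real set \<Rightarrow> l2_graph \<Rightarrow> complex \<Rightarrow> bool" where
  "eigenvalue S T z \<longleftrightarrow>
     (\<exists>y. (y, \<lambda>x. z * y x) \<in> T \<and> \<not> (AE x in lebesgue_on S. y x = 0))"

text \<open>\<open>z\<close> is in the resolvent set iff \<open>T - z\<close> maps its domain onto \<open>L\<^sub>2(S)\<close> and is bounded below,
  that is, iff it has an everywhere defined bounded inverse.\<close>

definition resolvent_set :: "real set \<Rightarrow> l2_graph \<Rightarrow> complex set" where
  "resolvent_set S T =
     {z. (\<forall>h\<in>L2 S. \<exists>(y, f)\<in>T. AE x in lebesgue_on S. f x - z * y x = h x) \<and>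
         (\<exists>C. \<forall>(y, f)\<in>T. L2_norm S y \<le> C * L2_norm S (\<lambda>x. f x - z * y x))}"

definition op_spectrum :: "real set \<Rightarrow> l2_graph \<Rightarrow> complex set" where
  "op_spectrum S T = - resolvent_set S T"

definition neg_eigenvalues :: "real set \<Rightarrow> l2_graph \<Rightarrow> real set" where
  "neg_eigenvalues S T = {l. l < 0 \<and> eigenvalue S T (complex_of_real l)}"

definition neg_spectrum :: "real set \<Rightarrow> l2_graph \<Rightarrow> real set" where
  "neg_spectrum S T = {l. l < 0 \<and> complex_of_real l \<in> op_spectrum S T}"

text \<open>For \<open>q \<in> Q1\<close> the endpoints \<open>\<plusminus>\<infinity>\<close> are in the limit point case and \<open>0\<close> is a regular endpoint,
  so that the maximal domain (with the Dirichlet condition at \<open>0\<close> for the half-line operators)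
  is the domain of the self-adjoint operator.\<close>

definition T_op :: "(real \<Rightarrow> real) \<Rightarrow> l2_graph" where
  "T_op q = {(y, f). y \<in> L2 UNIV \<and> f \<in> L2 UNIV \<and> schroedinger_eq UNIV q y f}"

definition T_plus :: "(real \<Rightarrow> real) \<Rightarrow> l2_graph" where
  "T_plus q = {(y, f). y \<in> L2 {0..} \<and> f \<in> L2 {0..} \<and> schroedinger_eq {0..} q y f \<and> y 0 = 0}"

definition T_minus :: "(real \<Rightarrow> real) \<Rightarrow> l2_graph" where
  "T_minus q = {(y, f). y \<in> L2 {..0} \<and> f \<in> L2 {..0} \<and> schroedinger_eq {..0} q y f \<and> y 0 = 0}"

text \<open>The direct sum of \<open>T_minus q\<close> and \<open>T_plus q\<close> in \<open>L\<^sub>2(\<real>) = L\<^sub>2(\<real>\<^sub>-) \<oplus> L\<^sub>2(\<real>\<^sub>+)\<close>: the graphs of the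
  summands depend only on the restrictions of the functions to the two closed half-lines.
  There is no condition on the derivative at \<open>0\<close>, since each half-line has its own witness for it.\<close>

definition T_prime :: "(real \<Rightarrow> real) \<Rightarrow> l2_graph" where
  "T_prime q = {(y, f). (y, f) \<in> T_minus q \<and> (y, f) \<in> T_plus q}"

definition special :: "(real \<Rightarrow> real) \<Rightarrow> bool" where
  "special q \<longleftrightarrow> neg_spectrum UNIV (T_op q) \<inter> neg_spectrum UNIV (T_prime q) \<noteq> {}"

definition generic :: "(real \<Rightarrow> real) \<Rightarrow> bool" where
  "generic q \<longleftrightarrow> \<not> special q"


subsection \<open>Jost solutions and scattering\<close>

text \<open>Meaningful for \<open>\<lambda> \<noteq> 0\<close> with \<open>Im \<lambda> \<ge> 0\<close>.\<close>

definition jost_plus :: "(real \<Rightarrow> real) \<Rightarrow> complex \<Rightarrow> real \<Rightarrow> complex" where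
  "jost_plus q l =
     (THE y. schroedinger_eq UNIV q y (\<lambda>x. l\<^sup>2 * y x) \<and>
             ((\<lambda>x. exp (- \<i> * l * of_real x) * y x) \<longlongrightarrow> 1) at_top)"

text \<open>Meaningful for \<open>\<lambda> \<noteq> 0\<close> with \<open>Im \<lambda> \<le> 0\<close>.\<close>

definition jost_minus :: "(real \<Rightarrow> real) \<Rightarrow> complex \<Rightarrow> real \<Rightarrow> complex" where
  "jost_minus q l =
     (THE y. schroedinger_eq UNIV q y (\<lambda>x. l\<^sup>2 * y x) \<and>
             ((\<lambda>x. exp (- \<i> * l * of_real x) * y x) \<longlongrightarrow> 1) at_bot)"

definition scattering_coeffs :: "(real \<Rightarrow> real) \<Rightarrow> real \<Rightarrow> complex \<times> complex" where
  "scattering_coeffs q k =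
     (THE (a, b). \<forall>x. jost_plus q (of_real k) x =
        a * jost_minus q (of_real k) x + b * jost_minus q (of_real (- k)) x)"

definition a_coeff :: "(real \<Rightarrow> real) \<Rightarrow> real \<Rightarrow> complex" where
  "a_coeff q k = fst (scattering_coeffs q k)"

definition b_coeff :: "(real \<Rightarrow> real) \<Rightarrow> real \<Rightarrow> complex" where
  "b_coeff q k = snd (scattering_coeffs q k)"

definition r_minus :: "(real \<Rightarrow> real) \<Rightarrow> real \<Rightarrow> complex" where
  "r_minus q k = b_coeff q k / a_coeff q k"

definition r_plus :: "(real \<Rightarrow> real) \<Rightarrow> real \<Rightarrow> complex" where
  "r_plus q k = - b_coeff q (- k) / a_coeff q k"

definition reflectionless :: "(real \<Rightarrow> real) \<Rightarrow> bool" where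
  "reflectionless q \<longleftrightarrow> q \<in> Q1 \<and> (\<forall>k. k \<noteq> 0 \<longrightarrow> r_minus q k = 0 \<and> r_plus q k = 0)"

text \<open>\<open>m\<close> is the right norming constant for the eigenvalue \<open>-\<kappa>\<^sup>2\<close> of \<open>T_op q\<close>, where \<open>\<kappa> > 0\<close>.\<close>

definition right_norming_constant :: "(real \<Rightarrow> real) \<Rightarrow> real \<Rightarrow> real \<Rightarrow> bool" where
  "right_norming_constant q \<kappa> m \<longleftrightarrow>
     m > 0 \<and> m powi (- 2) = (\<integral>x. (cmod (jost_plus q (\<i> * of_real \<kappa>) x))\<^sup>2 \<partial>lebesgue)"

end

theory Submission
  imports Defs "HOL-Complex_Analysis.Complex_Analysis"
begin

text \<open>Let \<open>F\<close> and \<open>G\<close> be the values at \<open>x = 0\<close> of the right Jost solutions of \<open>q\<close> and of the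
  reflected potential \<open>x \<mapsto> q (- x)\<close> (the latter yields the left Jost solution of \<open>q\<close>), as functions
  of \<open>k\<close> in the upper half-plane, and let \<open>A\<close> be the Wronskian of the two solutions divided by
  \<open>2 i k\<close>. The zeros of \<open>F\<close>, \<open>G\<close> and \<open>A\<close> lie on the imaginary axis, are simple, and correspond to
  the negative eigenvalues of \<open>T_plus q\<close>, \<open>T_minus q\<close> and \<open>T_op q\<close>. At an eigenvalue of \<open>T_op q\<close> the
  left Jost solution is \<open>G / F\<close> times the right one, and differentiating the Wronskian gives
  \<open>i A' F / G = \<integral> |e\<^sub>+|\<^sup>2\<close>. So it suffices to show \<open>A = a\<close> and \<open>F / G = B\<close>.

  If \<open>q\<close> is reflectionless, then \<open>|A| = 1\<close> and \<open>|F| = |G|\<close> on the real line, so that \<open>A / a\<close> and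
  \<open>F / (G B)\<close> are zero-free, unimodular on \<open>\<real> \<setminus> {0}\<close> and tend to \<open>1\<close> at infinity. Extended by
  reflection, they have the origin as their only possible singularity. Lower bounds for \<open>F\<close>, \<open>G\<close>,
  \<open>A\<close> near the origin, off the axes, bound the logarithm of the modulus; a Liouville argument
  with a weight vanishing on the axes shows that both quotients are constant. The product \<open>B\<close>
  converges since the zeros of \<open>F G\<close> interlace with those of \<open>A\<close>.\<close>

section \<open>Locally absolutely continuous functions\<close>

text \<open>The obstacle is the point \<open>k = 0\<close>. For merely integrable \<open>q\<close>
  the Jost functions need not extend continuously to the origin, and the zeros \<i>\<kappa>_n
  accumulate there. Zeros, boundary modulus and behaviour at infinity do not determine a function on
  the half-plane: exp(-ic/k) with c > 0 is zero-free, unimodular on the punctured real line and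
  tends to 1 at infinity. Its log-modulus is of order 1/|k|, so excluding it takes a bound of this
  order with an arbitrarily small factor. That factor is the integral of |q| beyond a large
  \<open>X\<close>; what happens on {0..X} costs only a constant independent of \<open>k\<close>.
  The lower bounds rest on Im (e' cnj e) = Im (k^2) times the mass of the Jost solution e. Since Im
  (k^2) = 2 Re k Im k, they degenerate on both axes, which explains the shape of the weight. F / G =
  B is proved with denominators cleared: the signs of \<mu>_n split B into a Blaschke product over
  the positive \<mu>_n divided by one over the negative \<mu>_n, and crosswise multiplication leaves
  holomorphic functions with the same zeros on both sides. Genericity enters as F, G \<noteq> 0 at
  \<i>\<kappa>_n.\<close>

lemma sigma_finite_lebesgue: "sigma_finite_measure (lebesgue :: 'a::euclidean_space measure)"
proof -
  obtain A :: "'a set set" where A: "countable A" "A \<subseteq> sets lborel" "\<Union>A = space lborel"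
    "\<forall>a\<in>A. emeasure lborel a \<noteq> \<infinity>"
    using lborel.sigma_finite_countable by blast
  show ?thesis
    by standard (use A in \<open>auto intro!: exI[of _ A] simp: subset_iff\<close>)
qed

lemma pair_sigma_finite_lebesgue:
  "pair_sigma_finite (lebesgue :: 'a::euclidean_space measure) (lebesgue :: 'b::euclidean_space measure)"
  by (simp add: pair_sigma_finite_def sigma_finite_lebesgue)

text \<open>Fubini on the two triangles below and above the diagonal; their overlap, the diagonal,
  is null. This is integration by parts for two indefinite Lebesgue integrals and the source of the
  product rule below.\<close>

lemma integral_times_integral_lebesgue:
  fixes u v :: "real \<Rightarrow> complex"
  assumes u: "integrable lebesgue u" and v: "integrable lebesgue v"
  shows "(\<integral>t. u t \<partial>lebesgue) * (\<integral>t. v t \<partial>lebesgue) =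
    (\<integral>t. u t * (LINT s:{..t}|lebesgue. v s) \<partial>lebesgue) + (\<integral>t. v t * (LINT s:{..t}|lebesgue. u s) \<partial>lebesgue)"
    and "integrable lebesgue (\<lambda>t. u t * (LINT s:{..t}|lebesgue. v s))"
proof -
  interpret L: sigma_finite_measure "lebesgue :: real measure" by (rule sigma_finite_lebesgue)
  interpret P: pair_sigma_finite "lebesgue :: real measure" "lebesgue :: real measure"
    by (rule pair_sigma_finite_lebesgue)
  have id_m: "(\<lambda>x::real. x) \<in> borel_measurable lebesgue" by (rule measurable_completion) simp
  have m1: "fst \<in> borel_measurable ((lebesgue::real measure) \<Otimes>\<^sub>M (lebesgue::real measure))"
    "snd \<in> borel_measurable ((lebesgue::real measure) \<Otimes>\<^sub>M (lebesgue::real measure))"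
    by (rule measurable_compose[OF measurable_fst id_m], rule measurable_compose[OF measurable_snd id_m])
  have m2: "(\<lambda>p. f (fst p)) \<in> borel_measurable (lebesgue \<Otimes>\<^sub>M (lebesgue::real measure))"
    "(\<lambda>p. f (snd p)) \<in> borel_measurable ((lebesgue::real measure) \<Otimes>\<^sub>M lebesgue)"
    if "integrable lebesgue f" for f :: "real \<Rightarrow> complex"
    by (rule measurable_compose[OF measurable_fst borel_measurable_integrable[OF that]],
       rule measurable_compose[OF measurable_snd borel_measurable_integrable[OF that]])
  have mP: "Measurable.pred ((lebesgue::real measure) \<Otimes>\<^sub>M lebesgue) (\<lambda>p. snd p \<le> fst p)"
    using m1 by measurable
  \<comment> \<open>The indicator of the triangle \<open>s \<le> t\<close>, written as a factor so
    that both iterated integrals range over the whole line.\<close>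
  define J where "J = (\<lambda>t s::real. of_bool (s \<le> t) :: complex)"
  have mJ: "(\<lambda>p. J (fst p) (snd p)) \<in> borel_measurable (lebesgue \<Otimes>\<^sub>M (lebesgue::real measure))"
    unfolding J_def using mP by measurable
  have K: "integrable ((lebesgue::real measure) \<Otimes>\<^sub>M lebesgue) (\<lambda>(t,s). f t * (J t s * g s))"
    if f: "integrable lebesgue f" and g: "integrable lebesgue g" for f g :: "real \<Rightarrow> complex"
  proof (rule Bochner_Integration.integrable_bound)
    show "integrable ((lebesgue::real measure) \<Otimes>\<^sub>M lebesgue) (\<lambda>p. f (fst p) * g (snd p))"
    proof (rule P.Fubini_integrable)
      show "(\<lambda>p. f (fst p) * g (snd p)) \<in> borel_measurable (lebesgue \<Otimes>\<^sub>M lebesgue)"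
        using m2[OF f] m2[OF g] by measurable
      show "integrable lebesgue (\<lambda>x. LINT y|lebesgue. norm (f (fst (x, y)) * g (snd (x, y))))"
        using f by (auto simp: norm_mult intro: integrable_mult_left)
      show "AE x in lebesgue. integrable lebesgue (\<lambda>y. f (fst (x, y)) * g (snd (x, y)))"
        using g by auto
    qed
    show "(\<lambda>(t,s). f t * (J t s * g s)) \<in> borel_measurable (lebesgue \<Otimes>\<^sub>M lebesgue)"
      unfolding case_prod_beta using m2[OF f] m2[OF g] mJ by measurable
    show "AE x in lebesgue \<Otimes>\<^sub>M lebesgue. norm (case x of (t, s) \<Rightarrow> f t * (J t s * g s)) \<le> norm (f (fst x) * g (snd x))"
      by (auto simp: norm_mult J_def)
  qed
  have inner: "(\<integral>s. f t * (J t s * g s) \<partial>lebesgue) = f t * (LINT s:{..t}|lebesgue. g s)" for f g :: "real \<Rightarrow> complex" and t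
  proof -
    have "(\<integral>s. f t * (J t s * g s) \<partial>lebesgue) = f t * (\<integral>s. J t s * g s \<partial>lebesgue)" by simp
    also have "(\<integral>s. J t s * g s \<partial>lebesgue) = (LINT s:{..t}|lebesgue. g s)"
      unfolding set_lebesgue_integral_def J_def by (intro Bochner_Integration.integral_cong) (auto simp: indicator_def)
    finally show ?thesis .
  qed
  show int: "integrable lebesgue (\<lambda>t. u t * (LINT s:{..t}|lebesgue. v s))"
    using P.integrable_fst'[OF K[OF u v]] by (simp only: inner prod.case)
  have "(\<integral>t. v t * (LINT s:{..t}|lebesgue. u s) \<partial>lebesgue) = (\<integral>t. (\<integral>s. v t * (J t s * u s) \<partial>lebesgue) \<partial>lebesgue)"
    by (simp only: inner)
  also have "\<dots> = (\<integral>s. (\<integral>t. v t * (J t s * u s) \<partial>lebesgue) \<partial>lebesgue)"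
    using P.Fubini_integral[OF K[OF v u]] by simp
  also have "\<dots> = (\<integral>t. u t * (LINT s:{t..}|lebesgue. v s) \<partial>lebesgue)"
  proof (rule Bochner_Integration.integral_cong[OF refl])
    fix s :: real
    have "(\<integral>t. v t * (J t s * u s) \<partial>lebesgue) = (\<integral>t. u s * (v t * J t s) \<partial>lebesgue)" by (simp add: mult_ac)
    also have "\<dots> = u s * (\<integral>t. v t * J t s \<partial>lebesgue)" by simp
    also have "(\<integral>t. v t * J t s \<partial>lebesgue) = (LINT t:{s..}|lebesgue. v t)"
      unfolding set_lebesgue_integral_def J_def by (intro Bochner_Integration.integral_cong) (auto simp: indicator_def)
    finally show "(\<integral>t. v t * (J t s * u s) \<partial>lebesgue) = u s * (LINT t:{s..}|lebesgue. v t)" .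
  qed
  finally have e: "(\<integral>t. v t * (LINT s:{..t}|lebesgue. u s) \<partial>lebesgue) = (\<integral>t. u t * (LINT s:{t..}|lebesgue. v s) \<partial>lebesgue)" .
  have split: "(LINT s:{..t}|lebesgue. v s) + (LINT s:{t..}|lebesgue. v s) = (\<integral>s. v s \<partial>lebesgue)" for t
  proof -
    have i: "set_integrable lebesgue A v" if "A \<in> sets lebesgue" for A
      using v that by (simp add: integrable_mult_indicator set_integrable_def)
    \<comment> \<open>The two closed half-lines meet in the single point \<open>t\<close>, which
      does not affect the integral.\<close>
    have "(LINT s:{t..}|lebesgue. v s) = (LINT s:{t<..}|lebesgue. v s)"
      unfolding set_lebesgue_integral_def
    proof (rule integral_cong_AE)
      show "(\<lambda>x. indicat_real {t..} x *\<^sub>R v x) \<in> borel_measurable lebesgue" 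
        "(\<lambda>x. indicat_real {t<..} x *\<^sub>R v x) \<in> borel_measurable lebesgue"
        using i[of "{t..}"] i[of "{t<..}"] unfolding set_integrable_def by auto
      have "AE x in lebesgue. x \<noteq> t"
        using AE_completion[OF AE_lborel_singleton[of t]] by simp
      then show "AE x in lebesgue. indicat_real {t..} x *\<^sub>R v x = indicat_real {t<..} x *\<^sub>R v x"
        by eventually_elim (auto simp: indicator_def)
    qed
    then have "(LINT s:{..t}|lebesgue. v s) + (LINT s:{t..}|lebesgue. v s) = (LINT s:{..t}\<union>{t<..}|lebesgue. v s)"
      using i by (subst set_integral_Un) auto
    also have "{..t}\<union>{t<..} = UNIV" by auto
    finally show ?thesis by (simp add: set_lebesgue_integral_def)
  qed
  have int2: "integrable lebesgue (\<lambda>t. u t * (LINT s:{t..}|lebesgue. v s))"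
  proof -
    have "u t * (LINT s:{t..}|lebesgue. v s) = u t * (\<integral>s. v s \<partial>lebesgue) - u t * (LINT s:{..t}|lebesgue. v s)" for t
      unfolding split[of t, symmetric] by (simp add: algebra_simps)
    then show ?thesis using int u by auto
  qed
  show "(\<integral>t. u t \<partial>lebesgue) * (\<integral>t. v t \<partial>lebesgue) =
    (\<integral>t. u t * (LINT s:{..t}|lebesgue. v s) \<partial>lebesgue) + (\<integral>t. v t * (LINT s:{..t}|lebesgue. u s) \<partial>lebesgue)"
    unfolding e Bochner_Integration.integral_add[OF int int2, symmetric]
    by (simp add: distrib_left[symmetric] split)
qed

lemma set_integrable_lebesgue_mult_continuous:
  fixes f g :: "real \<Rightarrow> complex"
  assumes "set_integrable lebesgue {a..b} f" "continuous_on {a..b} g"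
  shows "set_integrable lebesgue {a..b} (\<lambda>t. f t * g t)"
  using absolutely_integrable_bounded_measurable_product[OF bilinear_times, of g "{a..b}" f]
    assms continuous_imp_measurable_on_sets_lebesgue[of "{a..b}" g]
    compact_imp_bounded[OF compact_continuous_image[OF assms(2) compact_Icc]]
  by (simp add: mult.commute)

lemma loc_ac_deriv_integrable:
  "loc_ac_deriv S g h \<Longrightarrow> a \<in> S \<Longrightarrow> b \<in> S \<Longrightarrow> a \<le> b \<Longrightarrow> set_integrable lebesgue {a..b} h"
  by (auto simp: loc_ac_deriv_def)

lemma loc_ac_deriv_eq:
  assumes "loc_ac_deriv S g h" "a \<in> S" "b \<in> S" "a \<le> b"
  shows "g b = g a + (LINT t:{a..b}|lebesgue. h t)"
proof -
  have "h absolutely_integrable_on {a..b}" "g b - g a = integral {a..b} h"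
    using assms unfolding loc_ac_deriv_def by auto
  then show ?thesis
    using set_lebesgue_integral_eq_integral(2)[of "{a..b}" h] by (simp add: algebra_simps)
qed

lemma loc_ac_derivI:
  assumes "\<And>a b. a \<in> S \<Longrightarrow> b \<in> S \<Longrightarrow> a \<le> b \<Longrightarrow> set_integrable lebesgue {a..b} h"
    and "\<And>a b. a \<in> S \<Longrightarrow> b \<in> S \<Longrightarrow> a \<le> b \<Longrightarrow> g b = g a + (LINT t:{a..b}|lebesgue. h t)"
  shows "loc_ac_deriv S g h"
  unfolding loc_ac_deriv_def
proof (intro ballI impI conjI)
  fix a b assume ab: "a \<in> S" "b \<in> S" "a \<le> b"
  show "h absolutely_integrable_on {a..b}" by (rule assms(1)[OF ab])
  then show "g b - g a = integral {a..b} h"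
    using assms(2)[OF ab] set_lebesgue_integral_eq_integral(2)[of "{a..b}" h] by (simp add: algebra_simps)
qed

lemma loc_ac_deriv_subset: "loc_ac_deriv S g h \<Longrightarrow> T \<subseteq> S \<Longrightarrow> loc_ac_deriv T g h"
  unfolding loc_ac_deriv_def by blast

lemma loc_ac_deriv_continuous_Icc:
  assumes "loc_ac_deriv S g h" "{a..b} \<subseteq> S"
  shows "continuous_on {a..b} g"
proof (cases "a \<le> b")
  case True
  then have ab: "a \<in> S" "b \<in> S" using assms by auto
  have "h absolutely_integrable_on {a..b}"
    using assms(1) ab True unfolding loc_ac_deriv_def by auto
  then have "h integrable_on {a..b}" by (rule set_lebesgue_integral_eq_integral(1))
  then have "continuous_on {a..b} (\<lambda>x. g a + integral {a..x} h)"
    by (intro continuous_intros indefinite_integral_continuous_1)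
  moreover have "g a + integral {a..x} h = g x" if "x \<in> {a..b}" for x
  proof -
    have "x \<in> S" "a \<le> x" using that assms(2) by auto
    then have "g x - g a = integral {a..x} h" using assms(1) ab unfolding loc_ac_deriv_def by blast
    then show ?thesis by (simp add: algebra_simps)
  qed
  ultimately show ?thesis by (rule continuous_on_eq)
qed simp

text \<open>The product of the increments of \<open>f\<close> and \<open>g\<close> over {a..b} is
  split along the diagonal. On each triangle the inner integral is an increment from
  \<open>a\<close>, so the result is the integral of \<open>f1 (g - g a) + g1 (f - f a)\<close>, and
  expanding it gives the product rule.\<close>

lemma loc_ac_deriv_mult:
  assumes f: "loc_ac_deriv S f f1" and g: "loc_ac_deriv S g g1" and S: "is_interval S"
  shows "loc_ac_deriv S (\<lambda>x. f x * g x) (\<lambda>x. f1 x * g x + f x * g1 x)"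
proof (rule loc_ac_derivI)
  fix a b assume ab: "a \<in> S" "b \<in> S" "a \<le> b"
  have sub: "{a..b} \<subseteq> S"
    using S ab(1,2) unfolding is_interval_1 subset_iff atLeastAtMost_iff by blast
  have fi: "set_integrable lebesgue {a..b} f1" and gi: "set_integrable lebesgue {a..b} g1"
    using loc_ac_deriv_integrable f g ab by auto
  have i1: "set_integrable lebesgue {a..b} (\<lambda>x. f1 x * g x)"
    using set_integrable_lebesgue_mult_continuous[OF fi loc_ac_deriv_continuous_Icc[OF g sub]] .
  have i2: "set_integrable lebesgue {a..b} (\<lambda>x. f x * g1 x)"
    using set_integrable_lebesgue_mult_continuous[OF gi loc_ac_deriv_continuous_Icc[OF f sub]] by (simp add: mult.commute)
  show "set_integrable lebesgue {a..b} (\<lambda>x. f1 x * g x + f x * g1 x)" using i1 i2 by (rule set_integral_add)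
  \<comment> \<open>Cut off to {a..b}, so that the integral over the whole half-line up to
    \<open>t\<close> is the increment between \<open>a\<close> and \<open>t\<close>.\<close>
  define u v where "u = (\<lambda>t. indicat_real {a..b} t *\<^sub>R f1 t)" and "v = (\<lambda>t. indicat_real {a..b} t *\<^sub>R g1 t)"
  have ui: "integrable lebesgue u" and vi: "integrable lebesgue v"
    using fi gi by (auto simp: set_integrable_def u_def v_def)
  have in_gen: "(LINT s:{..t}|lebesgue. indicat_real {a..b} s *\<^sub>R h1 s) = h t - h a"
    if "loc_ac_deriv S h h1" "t \<in> {a..b}" for h h1 and t
  proof -
    have "(LINT s:{..t}|lebesgue. indicat_real {a..b} s *\<^sub>R h1 s) = (LINT s:{a..t}|lebesgue. h1 s)"
      unfolding set_lebesgue_integral_def using that(2)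
      by (intro Bochner_Integration.integral_cong) (auto simp: indicator_def)
    also have "\<dots> = h t - h a"
      using loc_ac_deriv_eq[OF that(1) ab(1) subsetD[OF sub that(2)]] that(2) by (simp add: algebra_simps)
    finally show ?thesis .
  qed
  have in1: "(LINT s:{..t}|lebesgue. v s) = g t - g a" if "t \<in> {a..b}" for t
    unfolding v_def by (rule in_gen[OF g that])
  have in2: "(LINT s:{..t}|lebesgue. u s) = f t - f a" if "t \<in> {a..b}" for t
    unfolding u_def by (rule in_gen[OF f that])
  have 1: "(\<integral>t. u t * (LINT s:{..t}|lebesgue. v s) \<partial>lebesgue) = (LINT t:{a..b}|lebesgue. f1 t * g t - f1 t * g a)"
    unfolding set_lebesgue_integral_def[of _ "{a..b}"]
  proof (intro Bochner_Integration.integral_cong refl)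
    fix t show "u t * (LINT s:{..t}|lebesgue. v s) = indicat_real {a..b} t *\<^sub>R (f1 t * g t - f1 t * g a)"
      by (cases "t \<in> {a..b}") (simp_all add: in1 u_def algebra_simps)
  qed
  have 2: "(\<integral>t. v t * (LINT s:{..t}|lebesgue. u s) \<partial>lebesgue) = (LINT t:{a..b}|lebesgue. f t * g1 t - f a * g1 t)"
    unfolding set_lebesgue_integral_def[of _ "{a..b}"]
  proof (intro Bochner_Integration.integral_cong refl)
    fix t show "v t * (LINT s:{..t}|lebesgue. u s) = indicat_real {a..b} t *\<^sub>R (f t * g1 t - f a * g1 t)"
      by (cases "t \<in> {a..b}") (simp_all add: in2 v_def algebra_simps)
  qed
  have 3: "(\<integral>t. u t \<partial>lebesgue) = f b - f a" "(\<integral>t. v t \<partial>lebesgue) = g b - g a"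
    unfolding loc_ac_deriv_eq[OF f ab] loc_ac_deriv_eq[OF g ab] by (simp_all add: u_def v_def set_lebesgue_integral_def)
  have 4: "(LINT t:{a..b}|lebesgue. f1 t * g t - f1 t * g a) = (LINT t:{a..b}|lebesgue. f1 t * g t) - (f b - f a) * g a"
    unfolding loc_ac_deriv_eq[OF f ab] using i1 fi by (simp add: set_integral_diff(2))
  have 5: "(LINT t:{a..b}|lebesgue. f t * g1 t - f a * g1 t) = (LINT t:{a..b}|lebesgue. f t * g1 t) - f a * (g b - g a)"
    unfolding loc_ac_deriv_eq[OF g ab] using i2 gi by (simp add: set_integral_diff(2))
  have "(f b - f a) * (g b - g a) = (LINT t:{a..b}|lebesgue. f1 t * g t) - (f b - f a) * g a +
    ((LINT t:{a..b}|lebesgue. f t * g1 t) - f a * (g b - g a))"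
    using integral_times_integral_lebesgue(1)[OF ui vi] unfolding 1 2 3 4 5 .
  then have "f b * g b = f a * g a + ((LINT t:{a..b}|lebesgue. f1 t * g t) + (LINT t:{a..b}|lebesgue. f t * g1 t))"
    by (simp add: algebra_simps)
  then show "f b * g b = f a * g a + (LINT t:{a..b}|lebesgue. f1 t * g t + f t * g1 t)"
    by (simp only: set_integral_add(2)[OF i1 i2])
qed

lemma loc_ac_deriv_add:
  assumes "loc_ac_deriv S f f1" "loc_ac_deriv S g g1"
  shows "loc_ac_deriv S (\<lambda>x. f x + g x) (\<lambda>x. f1 x + g1 x)"
proof (rule loc_ac_derivI)
  fix a b assume ab: "a \<in> S" "b \<in> S" "a \<le> b"
  note i = loc_ac_deriv_integrable[OF assms(1) ab] loc_ac_deriv_integrable[OF assms(2) ab]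
  show "set_integrable lebesgue {a..b} (\<lambda>x. f1 x + g1 x)" using i by (rule set_integral_add(1))
  show "f b + g b = f a + g a + (LINT t:{a..b}|lebesgue. f1 t + g1 t)"
    unfolding set_integral_add(2)[OF i] loc_ac_deriv_eq[OF assms(1) ab] loc_ac_deriv_eq[OF assms(2) ab] by simp
qed

lemma loc_ac_deriv_cmult:
  assumes "loc_ac_deriv S f f1"
  shows "loc_ac_deriv S (\<lambda>x. c * f x) (\<lambda>x. c * f1 x)"
proof (rule loc_ac_derivI)
  fix a b assume ab: "a \<in> S" "b \<in> S" "a \<le> b"
  show "set_integrable lebesgue {a..b} (\<lambda>x. c * f1 x)"
    by (rule set_integrable_mult_right) (rule loc_ac_deriv_integrable[OF assms ab])
  show "c * f b = c * f a + (LINT t:{a..b}|lebesgue. c * f1 t)"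
    unfolding set_integral_mult_right loc_ac_deriv_eq[OF assms(1) ab] by (simp add: distrib_left)
qed

lemma loc_ac_deriv_diff:
  assumes "loc_ac_deriv S f f1" "loc_ac_deriv S g g1"
  shows "loc_ac_deriv S (\<lambda>x. f x - g x) (\<lambda>x. f1 x - g1 x)"
  using loc_ac_deriv_add[OF assms(1) loc_ac_deriv_cmult[OF assms(2), of "-1"]] by simp

lemma loc_ac_deriv_const: "loc_ac_deriv S (\<lambda>x. c) (\<lambda>x. 0)"
  by (intro loc_ac_derivI) auto

lemma loc_ac_deriv_cnj:
  assumes "loc_ac_deriv S f f1"
  shows "loc_ac_deriv S (\<lambda>x. cnj (f x)) (\<lambda>x. cnj (f1 x))"
proof (rule loc_ac_derivI)
  fix a b assume ab: "a \<in> S" "b \<in> S" "a \<le> b"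
  have eq: "(\<lambda>x. indicat_real {a..b} x *\<^sub>R cnj (f1 x)) = (\<lambda>x. cnj (indicat_real {a..b} x *\<^sub>R f1 x))"
    by simp
  show "set_integrable lebesgue {a..b} (\<lambda>x. cnj (f1 x))"
    using loc_ac_deriv_integrable[OF assms ab] unfolding set_integrable_def eq complex_integrable_cnj .
  show "cnj (f b) = cnj (f a) + (LINT t:{a..b}|lebesgue. cnj (f1 t))"
    unfolding loc_ac_deriv_eq[OF assms ab] set_lebesgue_integral_def eq complex_cnj_add
    by (simp only: Bochner_Integration.integral_cnj)
qed

lemma loc_ac_deriv_C1:
  assumes "\<And>x. (g has_vector_derivative h x) (at x)" "continuous_on UNIV h"
  shows "loc_ac_deriv S g h"
proof -
  have c: "continuous_on {a..b} h" for a b using assms(2) continuous_on_subset by blast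
  have "integral {a..b} h = g b - g a" if "a \<le> b" for a b
    by (intro integral_unique fundamental_theorem_of_calculus that) (auto intro: has_vector_derivative_at_within assms)
  then show ?thesis
    unfolding loc_ac_deriv_def using absolutely_integrable_continuous_real[OF c] by auto
qed

lemma loc_ac_deriv_exp: "loc_ac_deriv S (\<lambda>x. exp (c * complex_of_real x)) (\<lambda>x. c * exp (c * of_real x))"
proof (rule loc_ac_deriv_C1)
  have "((\<lambda>z. exp (c * z)) has_field_derivative c * exp (c * of_real x)) (at (of_real x))" for x
    by (rule derivative_eq_intros refl | simp)+
  then show "((\<lambda>x. exp (c * complex_of_real x)) has_vector_derivative c * exp (c * of_real x)) (at x)" for x
    by (rule has_vector_derivative_real_field)
  show "continuous_on UNIV (\<lambda>x. c * exp (c * complex_of_real x))"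
    by (intro continuous_intros)
qed

lemma loc_ac_deriv_reflect:
  assumes "loc_ac_deriv S g h"
  shows "loc_ac_deriv (uminus ` S) (\<lambda>x. g (- x)) (\<lambda>x. - h (- x))"
  unfolding loc_ac_deriv_def
proof (intro ballI impI)
  fix a b assume "a \<in> uminus ` S" "b \<in> uminus ` S" and ab: "a \<le> b"
  then have S: "- b \<in> S" "- a \<in> S" by auto
  then have h: "h absolutely_integrable_on {-b..-a}" "g (-a) - g (-b) = integral {-b..-a} h"
    using assms ab unfolding loc_ac_deriv_def by auto
  have "(\<lambda>x. h (- x)) absolutely_integrable_on {a..b}"
    using h(1) absolutely_integrable_reflect_real[of "-a" "-b" h] by simp
  then have "(\<lambda>x. - h (- x)) absolutely_integrable_on {a..b}"
    using absolutely_integrable_scaleR_left[where c="-1"] by fastforce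
  moreover have "integral {a..b} (\<lambda>x. - h (- x)) = - integral {-b..-a} h"
    using Henstock_Kurzweil_Integration.integral_reflect_real[of "-a" "-b" h] by simp
  ultimately show "(\<lambda>x. - h (- x)) absolutely_integrable_on {a..b} \<and> g (- b) - g (- a) = integral {a..b} (\<lambda>x. - h (- x))"
    unfolding h(2)[symmetric] by simp
qed

section \<open>Tail integrals and Gronwall's inequality\<close>

lemma set_integral_nonneg_lebesgue:
  fixes p :: "real \<Rightarrow> real"
  assumes "\<And>t. t \<in> A \<Longrightarrow> p t \<ge> 0"
  shows "(LINT t:A|lebesgue. p t) \<ge> 0"
  unfolding set_lebesgue_integral_def
  by (rule Bochner_Integration.integral_nonneg) (use assms in \<open>auto simp: indicator_def\<close>)

lemma set_integral_sum_lebesgue: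
  fixes f :: "'b \<Rightarrow> real \<Rightarrow> real"
  assumes "\<And>j. j \<in> J \<Longrightarrow> set_integrable lebesgue A (f j)"
  shows "set_integrable lebesgue A (\<lambda>t. \<Sum>j\<in>J. f j t)"
    and "(LINT t:A|lebesgue. \<Sum>j\<in>J. f j t) = (\<Sum>j\<in>J. LINT t:A|lebesgue. f j t)"
  using assms unfolding set_integrable_def set_lebesgue_integral_def scaleR_sum_right
  by (auto intro: Bochner_Integration.integral_sum)

lemma set_integrable_UNIV_subset:
  fixes h :: "real \<Rightarrow> 'a::{banach, second_countable_topology}"
  assumes "integrable lebesgue h" "A \<in> sets lebesgue"
  shows "set_integrable lebesgue A h"
  using assms by (simp add: integrable_mult_indicator set_integrable_def)

lemma loc_ac_deriv_tail:
  assumes h: "\<And>x. x \<in> S \<Longrightarrow> set_integrable lebesgue {x..} h"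
  shows "loc_ac_deriv S (\<lambda>x. LINT t:{x..}|lebesgue. h t) (\<lambda>x. - h x)"
proof (rule loc_ac_derivI)
  fix a b :: real assume ab: "a \<le> b" "a \<in> S"
  have sub: "set_integrable lebesgue B h" if "B \<subseteq> {a..}" "B \<in> sets lebesgue" for B
    using set_integrable_subset[OF h[OF ab(2)] that(2,1)] .
  show "set_integrable lebesgue {a..b} (\<lambda>x. - h x)"
    using sub[of "{a..b}"] by (auto simp: set_integrable_def)
  have "(LINT t:{a..}|lebesgue. h t) = (LINT t:{a..b} \<union> {b<..}|lebesgue. h t)"
    by (rule arg_cong[of _ _ "\<lambda>A. LINT t:A|lebesgue. h t"]) (use ab in auto)
  also have "\<dots> = (LINT t:{a..b}|lebesgue. h t) + (LINT t:{b<..}|lebesgue. h t)"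
    using ab by (intro set_integral_Un sub) auto
  also have "(LINT t:{b<..}|lebesgue. h t) = (LINT t:{b..}|lebesgue. h t)"
    unfolding set_lebesgue_integral_def
  proof (rule integral_cong_AE)
    show "(\<lambda>x. indicat_real {b<..} x *\<^sub>R h x) \<in> borel_measurable lebesgue" 
      "(\<lambda>x. indicat_real {b..} x *\<^sub>R h x) \<in> borel_measurable lebesgue"
      using sub[of "{b<..}"] sub[of "{b..}"] ab by (auto simp: set_integrable_def subset_iff)
    have "AE x in lebesgue. x \<noteq> b"
      using AE_completion[OF AE_lborel_singleton[of b]] by simp
    then show "AE x in lebesgue. indicat_real {b<..} x *\<^sub>R h x = indicat_real {b..} x *\<^sub>R h x"
      by eventually_elim (auto simp: indicator_def)
  qed
  finally show "(LINT t:{b..}|lebesgue. h t) = (LINT t:{a..}|lebesgue. h t) + (LINT t:{a..b}|lebesgue. - h t)"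
    by (simp add: set_lebesgue_integral_def)
qed

lemma loc_ac_deriv_indefinite:
  assumes h: "set_integrable lebesgue {a..b} h"
  shows "loc_ac_deriv {a..b} (\<lambda>x. LINT t:{a..x}|lebesgue. h t) h"
proof (rule loc_ac_derivI)
  fix x y assume xy: "x \<in> {a..b}" "y \<in> {a..b}" "x \<le> y"
  have sub: "set_integrable lebesgue {c..d} h" if "a \<le> c" "d \<le> b" for c d
    using set_integrable_subset[OF h, of "{c..d}"] that by auto
  show "set_integrable lebesgue {x..y} h" using sub xy by auto
  have i: "h integrable_on {a..y}" using sub[of a y] xy by (auto intro: set_lebesgue_integral_eq_integral(1))
  have "(LINT t:{c..d}|lebesgue. h t) = integral {c..d} h" if "a \<le> c" "d \<le> b" for c d
    by (rule set_lebesgue_integral_eq_integral(2)[OF sub[OF that]])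
  then show "(LINT t:{a..y}|lebesgue. h t) = (LINT t:{a..x}|lebesgue. h t) + (LINT t:{x..y}|lebesgue. h t)"
    using Henstock_Kurzweil_Integration.integral_combine[OF _ _ i, of x] xy by simp
qed

lemma loc_ac_deriv_power:
  assumes "loc_ac_deriv S g h" "is_interval S"
  shows "loc_ac_deriv S (\<lambda>x. g x ^ Suc n) (\<lambda>x. of_nat (Suc n) * g x ^ n * h x)"
proof (induction n)
  case (Suc n)
  show ?case
    using loc_ac_deriv_mult[OF assms(1) Suc assms(2)] by (simp add: algebra_simps)
qed (use assms in simp)

lemma tail_integral_mono:
  fixes p :: "real \<Rightarrow> real"
  assumes p: "integrable lebesgue p" "\<And>t. p t \<ge> 0" and "x \<le> y"
  shows "0 \<le> (LINT t:{y..}|lebesgue. p t)" "(LINT t:{y..}|lebesgue. p t) \<le> (LINT t:{x..}|lebesgue. p t)"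
    "(LINT t:{x..}|lebesgue. p t) \<le> (\<integral>t. p t \<partial>lebesgue)"
proof -
  show "0 \<le> (LINT t:{y..}|lebesgue. p t)" by (rule set_integral_nonneg_lebesgue) (use p in auto)
  show "(LINT t:{y..}|lebesgue. p t) \<le> (LINT t:{x..}|lebesgue. p t)"
    using set_integrable_UNIV_subset[OF p(1), of "{x..}"] set_integrable_UNIV_subset[OF p(1), of "{y..}"]
    unfolding set_lebesgue_integral_def set_integrable_def
    by (intro Bochner_Integration.integral_mono) (use p \<open>x \<le> y\<close> in \<open>auto simp: indicator_def\<close>)
  show "(LINT t:{x..}|lebesgue. p t) \<le> (\<integral>t. p t \<partial>lebesgue)"
    using set_integrable_UNIV_subset[OF p(1), of "{x..}"] unfolding set_lebesgue_integral_def set_integrable_def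
    by (intro Bochner_Integration.integral_mono) (use p in \<open>auto simp: indicator_def\<close>)
qed

lemma tail_integral_measurable:
  fixes p :: "real \<Rightarrow> real"
  assumes p: "integrable lebesgue p"
  shows "(\<lambda>x. LINT t:{x..}|lebesgue. p t) \<in> borel_measurable lebesgue"
proof -
  have "integrable lebesgue (\<lambda>x. complex_of_real (p x))" using p by simp
  note ac = loc_ac_deriv_tail[OF set_integrable_UNIV_subset[OF this], of UNIV, simplified]
  have "continuous_on UNIV (\<lambda>x. LINT t:{x..}|lebesgue. complex_of_real (p t))"
  proof -
    have "continuous_on {-r..r} (\<lambda>x. LINT t:{x..}|lebesgue. complex_of_real (p t))" for r :: real
      by (rule loc_ac_deriv_continuous_Icc[OF ac]) simp
    then have "continuous_on {-r<..<r} (\<lambda>x. LINT t:{x..}|lebesgue. complex_of_real (p t))" for r :: real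
      by (rule continuous_on_subset[of "{-r..r}"]) auto
    then have "continuous_on (\<Union>r. {-r<..<r}) (\<lambda>x. LINT t:{x..}|lebesgue. complex_of_real (p t))"
      by (intro continuous_on_open_UN) auto
    moreover have "(\<Union>r. {-r<..<(r::real)}) = UNIV"
    proof (intro equalityI subsetI)
      fix x :: real
      show "x \<in> (\<Union>r. {-r<..<r})" by (intro UN_I[of "\<bar>x\<bar> + 1"]) auto
    qed auto
    ultimately show ?thesis by simp
  qed
  then have "continuous_on UNIV (\<lambda>x. Re (LINT t:{x..}|lebesgue. complex_of_real (p t)))" by (intro continuous_intros)
  then have "(\<lambda>x. Re (LINT t:{x..}|lebesgue. complex_of_real (p t))) \<in> borel_measurable lebesgue"
    by (intro measurable_completion) (simp add: borel_measurable_continuous_onI)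
  then show ?thesis by (simp only: set_integral_complex_of_real Re_complex_of_real)
qed

text \<open>Almost everywhere \<open>R\<close> has derivative \<open>- p\<close>, so
  \<open>p R^n\<close> has the primitive \<open>- R^(n+1) / (n+1)\<close>. The division by n+1 is
  what produces the factorials in the bound of the Neumann series. On a finite interval the boundary
  term at the right end has a favourable sign and is dropped; the half-line follows in the
  limit.\<close>

lemma tail_integral_power:
  fixes p :: "real \<Rightarrow> real"
  assumes p: "integrable lebesgue p" "\<And>t. p t \<ge> 0"
  defines "R \<equiv> \<lambda>x. LINT t:{x..}|lebesgue. p t"
  shows "integrable lebesgue (\<lambda>t. p t * R t ^ n)"
    and "(LINT t:{x..}|lebesgue. p t * R t ^ n) \<le> R x ^ Suc n / of_nat (Suc n)"
proof -
  have R0: "R t \<ge> 0" for t unfolding R_def by (rule tail_integral_mono(1)[OF p order_refl])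
  have Rle: "R t \<le> (\<integral>t. p t \<partial>lebesgue)" for t unfolding R_def by (rule tail_integral_mono(3)[OF p order_refl])
  show int: "integrable lebesgue (\<lambda>t. p t * R t ^ n)"
  proof (rule Bochner_Integration.integrable_bound)
    show "integrable lebesgue (\<lambda>t. p t * (\<integral>t. p t \<partial>lebesgue) ^ n)" using p by simp
    show "(\<lambda>t. p t * R t ^ n) \<in> borel_measurable lebesgue"
      using tail_integral_measurable[OF p(1)] p(1) unfolding R_def by measurable
    show "AE x in lebesgue. norm (p x * R x ^ n) \<le> norm (p x * integral\<^sup>L lebesgue p ^ n)"
      using R0 Rle p(2) by (auto simp: abs_mult intro!: mult_left_mono power_mono order_trans[OF Rle abs_ge_self])
  qed
  have "integrable lebesgue (\<lambda>x. complex_of_real (p x))" using p by simp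
  from loc_ac_deriv_tail[OF set_integrable_UNIV_subset[OF this], of UNIV, simplified] have "loc_ac_deriv UNIV (\<lambda>x. complex_of_real (R x)) (\<lambda>x. - of_real (p x))"
    by (simp only: set_integral_complex_of_real R_def)
  note ac = loc_ac_deriv_power[OF this, of n]
  have fin: "(LINT t:{x..b}|lebesgue. p t * R t ^ n) \<le> R x ^ Suc n / of_nat (Suc n)" if "x \<le> b" for b
  proof -
    have "complex_of_real (R b) ^ Suc n = of_real (R x) ^ Suc n + (LINT t:{x..b}|lebesgue. of_nat (Suc n) * of_real (R t) ^ n * - of_real (p t))"
      by (rule loc_ac_deriv_eq[OF ac _ _ that]) (auto simp: is_interval_univ)
    also have "(LINT t:{x..b}|lebesgue. of_nat (Suc n) * of_real (R t) ^ n * - of_real (p t)) =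
       (LINT t:{x..b}|lebesgue. complex_of_real (- real (Suc n) * (p t * R t ^ n)))"
      by (simp add: algebra_simps)
    also have "\<dots> = of_real (- real (Suc n) * (LINT t:{x..b}|lebesgue. p t * R t ^ n))"
      unfolding set_integral_complex_of_real set_integral_mult_right ..
    finally have "R b ^ Suc n = R x ^ Suc n + - real (Suc n) * (LINT t:{x..b}|lebesgue. p t * R t ^ n)"
      unfolding of_real_power[symmetric] of_real_add[symmetric] of_real_eq_iff .
    moreover have "R b ^ Suc n \<ge> 0" using R0 by simp
    ultimately have "real (Suc n) * (LINT t:{x..b}|lebesgue. p t * R t ^ n) \<le> R x ^ Suc n" by linarith
    then show ?thesis by (simp add: field_simps del: of_nat_Suc)
  qed
  have "((\<lambda>b. LINT t:{x..b}|lebesgue. p t * R t ^ n) \<longlongrightarrow> (LINT t:{x..}|lebesgue. p t * R t ^ n)) at_top"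
    by (rule tendsto_set_lebesgue_integral_at_top) (auto intro: set_integrable_UNIV_subset int)
  then show "(LINT t:{x..}|lebesgue. p t * R t ^ n) \<le> R x ^ Suc n / of_nat (Suc n)"
    by (rule tendsto_upperbound) (use fin in \<open>auto intro!: eventually_mono[OF eventually_ge_at_top[of x]] simp del: power_Suc of_nat_Suc\<close>)
qed

text \<open>The hypothesis is iterated instead of differentiated, as \<open>p\<close> is merely
  integrable: after n rounds the bound consists of n terms of the exponential series in the
  primitive \<open>P\<close> of \<open>p\<close>, plus a remainder \<open>M P^n / n!\<close>, where
  \<open>M\<close> bounds \<open>u\<close>. The remainder tends to 0.\<close>

lemma gronwall_integral:
  fixes u p :: "real \<Rightarrow> real"
  assumes "a \<le> b" and u: "continuous_on {a..b} u" and p: "set_integrable lebesgue {a..b} p" "\<And>t. t \<in> {a..b} \<Longrightarrow> p t \<ge> 0"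
    and C: "C \<ge> 0"
    and le: "\<And>x. x \<in> {a..b} \<Longrightarrow> u x \<le> C + (LINT t:{a..x}|lebesgue. p t * u t)"
  shows "u b \<le> C * exp (LINT t:{a..b}|lebesgue. p t)"
proof -
  define P where "P = (\<lambda>x. LINT t:{a..x}|lebesgue. p t)"
  have "set_integrable lebesgue {a..b} (\<lambda>t. complex_of_real (p t))"
    using p unfolding set_integrable_def by (simp add: scaleR_conv_of_real flip: of_real_mult)
  from loc_ac_deriv_indefinite[OF this] have ac: "loc_ac_deriv {a..b} (\<lambda>x. complex_of_real (P x)) (\<lambda>x. of_real (p x))"
    by (simp only: set_integral_complex_of_real P_def)
  have sub: "set_integrable lebesgue {a..x} p" if "x \<in> {a..b}" for x
    using set_integrable_subset[OF p(1), of "{a..x}"] that by auto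
  have mulc: "set_integrable lebesgue {a..x} (\<lambda>t. p t * g t)" if "continuous_on {a..b} g" "x \<in> {a..b}" for x and g :: "real \<Rightarrow> real"
  proof -
    have cg: "continuous_on {a..x} g" using continuous_on_subset[OF that(1)] that(2) by auto
    show ?thesis
    using absolutely_integrable_bounded_measurable_product_real[of g "{a..x}" p] sub[OF that(2)] 
      continuous_imp_measurable_on_sets_lebesgue[OF cg]
      compact_imp_bounded[OF compact_continuous_image[OF cg compact_Icc]] by (simp add: mult.commute)
  qed
  have contP: "continuous_on {a..b} P"
  proof -
    have "continuous_on {a..b} (\<lambda>x. Re (complex_of_real (P x)))"
      by (rule continuous_on_Re[OF loc_ac_deriv_continuous_Icc[OF ac]]) auto
    then show ?thesis by simp
  qed
  have P0: "P x \<ge> 0" if "x \<in> {a..b}" for x unfolding P_def by (rule set_integral_nonneg_lebesgue) (use p that in auto)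
  have Ppow: "(LINT t:{a..x}|lebesgue. p t * P t ^ n) = P x ^ Suc n / of_nat (Suc n)" if "x \<in> {a..b}" for x n
  proof -
    have "complex_of_real (P x) ^ Suc n = of_real (P a) ^ Suc n + (LINT t:{a..x}|lebesgue. of_nat (Suc n) * of_real (P t) ^ n * of_real (p t))"
      by (rule loc_ac_deriv_eq[OF loc_ac_deriv_power[OF ac]]) (use that in \<open>auto simp: is_interval_cc\<close>)
    also have "(LINT t:{a..x}|lebesgue. of_nat (Suc n) * of_real (P t) ^ n * of_real (p t)) =
       (LINT t:{a..x}|lebesgue. complex_of_real (real (Suc n) * (p t * P t ^ n)))"
      by (simp add: mult_ac)
    also have "\<dots> = of_real (real (Suc n) * (LINT t:{a..x}|lebesgue. p t * P t ^ n))"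
      unfolding set_integral_complex_of_real by (simp add: set_lebesgue_integral_def)
    finally have "P x ^ Suc n = P a ^ Suc n + real (Suc n) * (LINT t:{a..x}|lebesgue. p t * P t ^ n)"
      unfolding of_real_power[symmetric] of_real_add[symmetric] of_real_eq_iff .
    moreover have "P a = 0"
      using loc_ac_deriv_eq[OF ac, of a a] set_lebesgue_integral_eq_integral(2)[of "{a..a}" p] sub[of a] \<open>a \<le> b\<close> by (simp add: P_def)
    ultimately show ?thesis by (simp add: field_simps del: of_nat_Suc)
  qed
  obtain M where M: "M \<ge> 0" "\<And>x. x \<in> {a..b} \<Longrightarrow> u x \<le> M"
  proof -
    have "bounded (u ` {a..b})" using compact_imp_bounded[OF compact_continuous_image[OF u compact_Icc]] .
    then obtain B where B: "\<forall>y\<in>u ` {a..b}. norm y \<le> B" unfolding bounded_iff by blast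
    show ?thesis
      by (rule that[of "max B 0"]) (use B in \<open>force simp: image_iff\<close>)+
  qed
  \<comment> \<open>Each round inserts the previous bound under the integral and uses that
    \<open>p P^j\<close> integrates to \<open>P^(j+1) / (j+1)\<close>.\<close>
  have it: "\<forall>x\<in>{a..b}. u x \<le> C * (\<Sum>j<n. P x ^ j / fact j) + M * (P x ^ n / fact n)" for n
  proof (induction n)
    case 0
    then show ?case using M by auto
  next
    case (Suc n)
    show ?case
    proof
      fix x assume x: "x \<in> {a..b}"
      have iS: "set_integrable lebesgue {a..x} (\<lambda>t. (C / fact j) * (p t * P t ^ j))" for j
        using mulc[OF continuous_on_power[OF contP] x] by simp
      have iM: "set_integrable lebesgue {a..x} (\<lambda>t. (M / fact n) * (p t * P t ^ n))"
        using mulc[OF continuous_on_power[OF contP] x] by simp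
      have "u x \<le> C + (LINT t:{a..x}|lebesgue. p t * u t)" by (rule le[OF x])
      also have "(LINT t:{a..x}|lebesgue. p t * u t) \<le>
         (LINT t:{a..x}|lebesgue. (\<Sum>j<n. (C / fact j) * (p t * P t ^ j)) + (M / fact n) * (p t * P t ^ n))"
      proof (rule set_integral_mono)
        show "set_integrable lebesgue {a..x} (\<lambda>t. p t * u t)" by (rule mulc[OF u x])
        show "set_integrable lebesgue {a..x} (\<lambda>t. (\<Sum>j<n. (C / fact j) * (p t * P t ^ j)) + (M / fact n) * (p t * P t ^ n))"
          by (intro set_integral_add(1) set_integral_sum_lebesgue(1) iS iM)
        fix t assume t: "t \<in> {a..x}"
        then have "p t * u t \<le> p t * (C * (\<Sum>j<n. P t ^ j / fact j) + M * (P t ^ n / fact n))"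
          using Suc p(2)[of t] x by (intro mult_left_mono) auto
        also have "\<dots> = (\<Sum>j<n. (C / fact j) * (p t * P t ^ j)) + (M / fact n) * (p t * P t ^ n)"
          by (simp add: algebra_simps sum_distrib_left)
        finally show "p t * u t \<le> (\<Sum>j<n. (C / fact j) * (p t * P t ^ j)) + (M / fact n) * (p t * P t ^ n)" .
      qed
      also have "\<dots> = (\<Sum>j<n. (C / fact j) * (P x ^ Suc j / of_nat (Suc j))) + (M / fact n) * (P x ^ Suc n / of_nat (Suc n))"
      proof -
        have "(LINT t:{a..x}|lebesgue. (\<Sum>j<n. (C / fact j) * (p t * P t ^ j)) + (M / fact n) * (p t * P t ^ n)) =
          (LINT t:{a..x}|lebesgue. (\<Sum>j<n. (C / fact j) * (p t * P t ^ j))) + (LINT t:{a..x}|lebesgue. (M / fact n) * (p t * P t ^ n))"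
          by (intro set_integral_add(2) set_integral_sum_lebesgue(1) iS iM)
        also have "(LINT t:{a..x}|lebesgue. (\<Sum>j<n. (C / fact j) * (p t * P t ^ j))) = (\<Sum>j<n. LINT t:{a..x}|lebesgue. (C / fact j) * (p t * P t ^ j))"
          by (intro set_integral_sum_lebesgue(2) iS)
        finally show ?thesis by (simp only: set_integral_mult_right Ppow[OF x])
      qed
      finally have "u x \<le> C + ((\<Sum>j<n. (C / fact j) * (P x ^ Suc j / of_nat (Suc j))) + (M / fact n) * (P x ^ Suc n / of_nat (Suc n)))" by simp
      also have "\<dots> = C * (\<Sum>j<Suc n. P x ^ j / fact j) + M * (P x ^ Suc n / fact (Suc n))"
        unfolding sum.lessThan_Suc_shift by (simp add: sum_distrib_left algebra_simps)
      finally show "u x \<le> C * (\<Sum>j<Suc n. P x ^ j / fact j) + M * (P x ^ Suc n / fact (Suc n))" .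
    qed
  qed
  have b: "b \<in> {a..b}" using \<open>a \<le> b\<close> by auto
  have "(\<lambda>n. C * (\<Sum>j<n. P b ^ j / fact j) + M * (P b ^ n / fact n)) \<longlonglongrightarrow> C * exp (P b) + M * 0"
  proof (intro tendsto_intros)
    have "(\<lambda>j. P b ^ j / fact j) sums exp (P b)" using exp_converges[of "P b"] by (simp add: divide_inverse mult.commute)
    then show "(\<lambda>n. \<Sum>j<n. P b ^ j / fact j) \<longlonglongrightarrow> exp (P b)" unfolding sums_def .
    show "(\<lambda>n. P b ^ n / fact n) \<longlonglongrightarrow> 0"
      using summable_LIMSEQ_zero[OF summable_exp[of "P b"]] by (simp add: divide_inverse mult.commute)
  qed
  then have "u b \<le> C * exp (P b) + M * 0"
    by (rule LIMSEQ_le_const) (use it b in blast)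
  then show ?thesis by (simp add: P_def)
qed

section \<open>The Neumann series of the Jost solution\<close>

lemma continuous_on_integral_param:
  fixes f :: "'p::metric_space \<Rightarrow> real \<Rightarrow> complex"
  assumes c: "\<And>t. continuous_on S (\<lambda>p. f p t)"
    and m: "\<And>p. p \<in> S \<Longrightarrow> f p \<in> borel_measurable lebesgue"
    and b: "\<And>p t. p \<in> S \<Longrightarrow> cmod (f p t) \<le> w t" and w: "integrable lebesgue w"
  shows "continuous_on S (\<lambda>p. \<integral>t. f p t \<partial>lebesgue)"
  unfolding continuous_on_sequentially
proof (intro allI ballI impI, elim conjE)
  fix X a assume a: "a \<in> S" and X: "\<forall>n. X n \<in> S" "X \<longlonglongrightarrow> a"
  have "(\<lambda>n. \<integral>t. f (X n) t \<partial>lebesgue) \<longlonglongrightarrow> (\<integral>t. f a t \<partial>lebesgue)"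
  proof (rule integral_dominated_convergence[where w=w])
    show "AE t in lebesgue. (\<lambda>n. f (X n) t) \<longlonglongrightarrow> f a t"
    proof (rule AE_I2)
      fix t show "(\<lambda>n. f (X n) t) \<longlonglongrightarrow> f a t"
        using c[of t] X a unfolding continuous_on_sequentially comp_def by blast
    qed
  qed (use a X m b w in auto)
  then show "((\<lambda>p. \<integral>t. f p t \<partial>lebesgue) \<circ> X) \<longlonglongrightarrow> (\<integral>t. f a t \<partial>lebesgue)" by (simp add: comp_def)
qed

text \<open>Cauchy's estimate bounds the \<open>k\<close>-derivative of the integrand by
  \<open>w t / (r/2)\<close> on a ball around \<open>k\<close>, hence also the difference quotients,
  and dominated convergence yields the derivative of the integral. In this way measurability in
  \<open>t\<close> for each fixed \<open>k\<close> suffices; joint measurability never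
  enters.\<close>

lemma holomorphic_on_integral_param:
  fixes f :: "complex \<Rightarrow> real \<Rightarrow> complex"
  assumes S: "open S" and h: "\<And>t. (\<lambda>k. f k t) holomorphic_on S"
    and m: "\<And>k. k \<in> S \<Longrightarrow> f k \<in> borel_measurable lebesgue"
    and b: "\<And>k t. k \<in> S \<Longrightarrow> cmod (f k t) \<le> w t" and w: "integrable lebesgue w"
  shows "(\<lambda>k. \<integral>t. f k t \<partial>lebesgue) holomorphic_on S"
  unfolding holomorphic_on_open[OF S]
proof
  fix k assume k: "k \<in> S"
  obtain r where r: "r > 0" "cball k r \<subseteq> S" using S k open_contains_cball by blast
  define D where "D = (\<lambda>t. deriv (\<lambda>k. f k t) k)"
  have int: "integrable lebesgue (f l)" if "l \<in> S" for l
    by (rule Bochner_Integration.integrable_bound[OF w m[OF that]])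
       (rule AE_I2, rule order_trans[OF b[OF that]], simp)
  have db: "cmod (deriv (\<lambda>k. f k t) l) \<le> w t / (r/2)" if "l \<in> ball k (r/2)" for l t
  proof (rule Cauchy_inequality[where n=1, simplified])
    have sub: "cball l (r/2) \<subseteq> S"
    proof -
      have "cball l (r/2) \<subseteq> cball k r"
      proof
        fix z assume "z \<in> cball l (r/2)"
        then show "z \<in> cball k r" using that dist_triangle[of k z l] by (simp add: dist_commute)
      qed
      then show ?thesis using r by auto
    qed
    show "(\<lambda>k. f k t) holomorphic_on ball l (r/2)"
      by (rule holomorphic_on_subset[OF h order_trans[OF ball_subset_cball sub]])
    show "continuous_on (cball l (r/2)) (\<lambda>k. f k t)"
      by (rule continuous_on_subset[OF holomorphic_on_imp_continuous_on[OF h] sub])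
    show "0 < r/2" using r by simp
    show "cmod (f x t) \<le> w t" if "cmod (l - x) = r/2" for x
      by (rule b) (use sub that in \<open>auto simp: dist_norm\<close>)
  qed
  have quot: "cmod ((f l t - f k t) / (l - k)) \<le> w t / (r/2)" if l: "l \<in> ball k (r/2)" for l t
  proof (cases "l = k")
    case True
    have "0 \<le> w t" using b[OF k, of t] norm_ge_zero order_trans by blast
    then show ?thesis using True r by simp
  next
    case False
    have "cmod (f l t - f k t) \<le> (w t / (r/2)) * cmod (l - k)"
    proof (rule field_differentiable_bound[of "ball k (r/2)"])
      show "((\<lambda>k. f k t) has_field_derivative deriv (\<lambda>k. f k t) z) (at z within ball k (r/2))" if "z \<in> ball k (r/2)" for z
      proof -
        have "z \<in> S" using that r by auto
        then show ?thesis 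
          by (rule has_field_derivative_at_within[OF holomorphic_derivI[OF h[of t] S]])
      qed
      show "cmod (deriv (\<lambda>k. f k t) z) \<le> w t / (r/2)" if "z \<in> ball k (r/2)" for z by (rule db[OF that])
      show "convex (ball k (r/2))" by simp
      show "l \<in> ball k (r/2)" by (rule l)
      show "k \<in> ball k (r/2)" using r by simp
    qed
    then show ?thesis using False by (simp add: norm_divide field_simps)
  qed
  have lim: "((\<lambda>l. (f l t - f k t) / (l - k)) \<longlongrightarrow> D t) (at k)" for t
    using holomorphic_derivI[OF h[of t] S k] unfolding D_def has_field_derivative_iff .
  \<comment> \<open>A concrete sequence of points \<open>X0 n\<close> tending to \<open>k\<close>
    inside the small ball; it exhibits \<open>D\<close> as a pointwise limit of measurable
    functions.\<close>
  define e where "e = (\<lambda>n. r / 4 * inverse (real (Suc n)))"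
  have e: "e n > 0" "e n \<le> r / 4" for n
    using r mult_left_le[of "inverse (real (Suc n))" "r / 4"] by (auto simp: e_def inverse_le_1_iff)
  define X0 where "X0 = (\<lambda>n. k + of_real (e n))"
  have "e \<longlonglongrightarrow> 0" unfolding e_def by (rule tendsto_mult_right_zero[OF LIMSEQ_inverse_real_of_nat])
  then have X0: "X0 \<longlonglongrightarrow> k" unfolding X0_def
    using tendsto_add[OF tendsto_const tendsto_of_real, of e 0 sequentially k] by simp
  have X0': "X0 n \<noteq> k" for n using e(1)[of n] by (simp add: X0_def)
  have X0b: "X0 n \<in> ball k (r/2)" for n
    using e[of n] r by (simp add: X0_def dist_norm)
  have X0S: "X0 n \<in> S" for n using X0b[of n] r by auto
  have Dm: "D \<in> borel_measurable lebesgue"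
  proof (rule borel_measurable_LIMSEQ_metric)
    show "(\<lambda>t. (f (X0 n) t - f k t) / (X0 n - k)) \<in> borel_measurable lebesgue" for n
      using m[OF k] m[OF X0S, of n] by (auto intro!: borel_measurable_divide borel_measurable_diff)
    show "(\<lambda>n. (f (X0 n) t - f k t) / (X0 n - k)) \<longlonglongrightarrow> D t" for t
      by (rule filterlim_compose[OF lim[of t]]) (simp add: filterlim_at X0 X0')
  qed
  have "((\<lambda>k. \<integral>t. f k t \<partial>lebesgue) has_field_derivative (\<integral>t. D t \<partial>lebesgue)) (at k)"
    unfolding has_field_derivative_iff tendsto_at_iff_sequentially
  proof (intro allI impI)
    fix X assume X: "\<forall>i. X i \<in> UNIV - {k}" "X \<longlonglongrightarrow> k"
    have ev: "eventually (\<lambda>n. X n \<in> ball k (r/2)) sequentially"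
      using tendstoD[OF X(2), of "r/2"] r by (simp add: dist_commute)
    \<comment> \<open>The finitely many terms of \<open>X\<close> outside the ball are replaced by a
      fixed point, because the dominating function must work for every index.\<close>
    define Y where "Y = (\<lambda>n. if X n \<in> ball k (r/2) then X n else X0 0)"
    have Yk: "Y n \<noteq> k" "Y n \<in> ball k (r/2)" for n using X X0' X0b by (auto simp: Y_def)
    have evY: "eventually (\<lambda>n. Y n = X n) sequentially" using ev by eventually_elim (simp add: Y_def)
    have Y: "Y \<longlonglongrightarrow> k" by (rule Lim_transform_eventually[OF X(2)]) (use evY in \<open>eventually_elim, simp\<close>)
    have YS: "Y n \<in> S" for n using Yk(2)[of n] r by auto
    have "(\<lambda>n. \<integral>t. (f (Y n) t - f k t) / (Y n - k) \<partial>lebesgue) \<longlonglongrightarrow> (\<integral>t. D t \<partial>lebesgue)"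
    proof (rule integral_dominated_convergence[where w="\<lambda>t. w t / (r/2)"])
      show "(\<lambda>t. (f (Y n) t - f k t) / (Y n - k)) \<in> borel_measurable lebesgue" for n
        using m[OF k] m[OF YS, of n] by (auto intro!: borel_measurable_divide borel_measurable_diff)
      show "integrable lebesgue (\<lambda>t. w t / (r/2))" using w by simp
      show "AE t in lebesgue. (\<lambda>n. (f (Y n) t - f k t) / (Y n - k)) \<longlonglongrightarrow> D t"
      proof (rule AE_I2)
        fix t show "(\<lambda>n. (f (Y n) t - f k t) / (Y n - k)) \<longlonglongrightarrow> D t"
          by (rule filterlim_compose[OF lim[of t]]) (simp add: filterlim_at Y Yk(1))
      qed
      show "AE t in lebesgue. cmod ((f (Y n) t - f k t) / (Y n - k)) \<le> w t / (r/2)" for n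
        using quot[OF Yk(2)] by blast
    qed (rule Dm)
    moreover have "(\<integral>t. (f (Y n) t - f k t) / (Y n - k) \<partial>lebesgue) = ((\<integral>t. f (Y n) t \<partial>lebesgue) - (\<integral>t. f k t \<partial>lebesgue)) / (Y n - k)" for n
      using Bochner_Integration.integral_diff[OF int[OF YS[of n]] int[OF k]] by (subst integral_divide_zero) simp
    ultimately have "(\<lambda>n. ((\<integral>t. f (Y n) t \<partial>lebesgue) - (\<integral>t. f k t \<partial>lebesgue)) / (Y n - k)) \<longlonglongrightarrow> (\<integral>t. D t \<partial>lebesgue)"
      by (rule Lim_transform_eventually[OF _ always_eventually, rule_format])
    then show "((\<lambda>y. ((\<integral>t. f y t \<partial>lebesgue) - (\<integral>t. f k t \<partial>lebesgue)) / (y - k)) \<circ> X) \<longlonglongrightarrow> (\<integral>t. D t \<partial>lebesgue)"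
      unfolding comp_def by (rule Lim_transform_eventually) (use evY in \<open>eventually_elim, simp\<close>)
  qed
  then show "\<exists>f'. ((\<lambda>k. \<integral>t. f k t \<partial>lebesgue) has_field_derivative f') (at k)" by blast
qed

section \<open>The Volterra kernel and its iterates\<close>

text \<open>For \<open>s \<ge> 0\<close> this is exp(iks) sin(ks) / k, the kernel of the integral
  equation for exp(-ikx) times the Jost solution. The cut-off at \<open>s = 0\<close>, where the
  kernel is continuous, allows integration over the whole line instead of {x..}.\<close>

definition jost_kernel :: "complex \<Rightarrow> real \<Rightarrow> complex" where
  "jost_kernel k s = (if s \<ge> 0 then (exp (2 * \<i> * k * of_real s) - 1) / (2 * \<i> * k) else 0)"

lemma norm_exp_minus_one_le:
  assumes "Re z \<le> 0" shows "cmod (exp z - 1) \<le> cmod z"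
proof -
  have "cmod (exp z - exp 0) \<le> 1 * cmod (z - 0)"
  proof (rule field_differentiable_bound[of "{z. Re z \<le> 0}" exp exp])
    show "convex {z. Re z \<le> 0}" by (rule convex_halfspace_Re_le)
  qed (use assms in \<open>auto intro!: derivative_eq_intros\<close>)
  then show ?thesis by simp
qed

text \<open>The first bound is enough for integrable \<open>q\<close> as long as \<open>k\<close>
  stays away from 0. The second is uniform in \<open>k\<close> but grows with \<open>s\<close>; it
  is applied on a bounded stretch when \<open>k\<close> tends to 0.\<close>

lemma jost_kernel_bounds:
  assumes "Im k \<ge> 0" "k \<noteq> 0"
  shows "cmod (jost_kernel k s) \<le> 1 / cmod k" "s \<ge> 0 \<Longrightarrow> cmod (jost_kernel k s) \<le> s"
proof -
  show "cmod (jost_kernel k s) \<le> 1 / cmod k"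
  proof (cases "s \<ge> 0")
    case True
    have "cmod (exp (2 * \<i> * k * of_real s)) \<le> 1" using True assms by simp
    then have "cmod (exp (2 * \<i> * k * of_real s) - 1) \<le> 2" 
    using norm_triangle_ineq4[of "exp (2 * \<i> * k * of_real s)" 1] unfolding norm_one by linarith
    then show ?thesis using True assms by (simp add: jost_kernel_def norm_divide norm_mult field_simps)
  qed (simp add: jost_kernel_def)
  assume s: "s \<ge> 0"
  have "cmod (exp (2 * \<i> * k * of_real s) - 1) \<le> cmod (2 * \<i> * k * of_real s)"
    by (rule norm_exp_minus_one_le) (use s assms in simp)
  then show "cmod (jost_kernel k s) \<le> s" using s assms by (simp add: jost_kernel_def norm_divide norm_mult field_simps)
qed

lemma continuous_on_jost_kernel: "continuous_on UNIV (jost_kernel k)"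
proof -
  have "continuous_on ({0..} \<union> {..0}) (\<lambda>s::real. if s \<ge> 0 then (exp (2 * \<i> * k * of_real s) - 1) / (2 * \<i> * k) else 0)"
    by (rule continuous_on_cases) (cases "k = 0"; auto intro!: continuous_intros)+
  moreover have "{0..} \<union> {..0} = (UNIV :: real set)" by auto
  ultimately show ?thesis unfolding jost_kernel_def[abs_def] by simp
qed

lemma holomorphic_on_jost_kernel: "0 \<notin> S \<Longrightarrow> (\<lambda>k. jost_kernel k s) holomorphic_on S"
  unfolding jost_kernel_def by (cases "s \<ge> 0") (auto intro!: holomorphic_intros)

text \<open>As \<open>q\<close> is real, the reflection of \<open>k\<close> in the imaginary axis
  conjugates every object built from this kernel. Two uses follow: Jost solutions are real on the
  axis, and estimates for \<open>Re k > 0\<close> carry over to \<open>Re k < 0\<close>.\<close>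

lemma jost_kernel_cnj: "jost_kernel (- cnj k) s = cnj (jost_kernel k s)"
proof -
  have "exp (2 * \<i> * (- cnj k) * of_real s) = cnj (exp (2 * \<i> * k * of_real s))"
    unfolding exp_cnj by simp
  then show ?thesis unfolding jost_kernel_def by simp
qed

primrec jost_iter :: "(real \<Rightarrow> real) \<Rightarrow> complex \<Rightarrow> nat \<Rightarrow> real \<Rightarrow> complex" where
  "jost_iter q k 0 x = 1"
| "jost_iter q k (Suc n) x = (\<integral>t. jost_kernel k (t - x) * of_real (q t) * jost_iter q k n t \<partial>lebesgue)"

lemma jost_iter_cnj: "jost_iter q (- cnj k) n x = cnj (jost_iter q k n x)"
proof (induction n arbitrary: x)
  case (Suc n)
  show ?case unfolding jost_iter.simps Suc jost_kernel_cnj Bochner_Integration.integral_cnj[symmetric] by simp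
qed simp

lemma lebesgue_measurable_continuous:
  fixes g :: "real \<Rightarrow> 'a::euclidean_space"
  shows "continuous_on UNIV g \<Longrightarrow> g \<in> borel_measurable lebesgue"
  by (intro measurable_completion) (simp add: borel_measurable_continuous_onI)

text \<open>A crude bound without factorials. It supplies the measurability and integrability that
  the argument for the sharp bound \<open>jost_iter_bound\<close> presupposes.\<close>

lemma jost_iter_continuous_bounded:
  assumes q: "integrable lebesgue q" and k: "Im k \<ge> 0" "k \<noteq> 0"
  shows "continuous_on UNIV (jost_iter q k n) \<and> (\<forall>x. cmod (jost_iter q k n x) \<le> ((\<integral>t. \<bar>q t\<bar> \<partial>lebesgue) / cmod k) ^ n)"
proof (induction n)
  case (Suc n)
  define C where "C = (\<integral>t. \<bar>q t\<bar> \<partial>lebesgue) / cmod k"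
  let ?f = "\<lambda>x t. jost_kernel k (t - x) * of_real (q t) * jost_iter q k n t"
  let ?w = "\<lambda>t. \<bar>q t\<bar> * (C ^ n / cmod k)"
  have b: "cmod (?f x t) \<le> ?w t" for x t
  proof -
    have "cmod (?f x t) \<le> (1 / cmod k) * \<bar>q t\<bar> * C ^ n"
      unfolding norm_mult using jost_kernel_bounds(1)[OF k, of "t - x"] Suc
      by (intro mult_mono) (auto simp: C_def)
    then show ?thesis by (simp add: mult_ac)
  qed
  have m: "?f x \<in> borel_measurable lebesgue" for x
  proof (intro borel_measurable_times)
    show "(\<lambda>t. jost_kernel k (t - x)) \<in> borel_measurable lebesgue"
      by (rule lebesgue_measurable_continuous)
         (auto intro!: continuous_intros continuous_on_compose2[OF continuous_on_jost_kernel])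
    show "jost_iter q k n \<in> borel_measurable lebesgue" using Suc by (intro lebesgue_measurable_continuous) auto
  qed (use q in simp)
  have w: "integrable lebesgue ?w" using q by simp
  have "continuous_on UNIV (\<lambda>x. \<integral>t. ?f x t \<partial>lebesgue)"
    by (rule continuous_on_integral_param[where w="?w"])
       (use m b w in \<open>auto intro!: continuous_intros continuous_on_compose2[OF continuous_on_jost_kernel]\<close>)
  moreover have fi: "integrable lebesgue (?f x)" for x
  proof (rule Bochner_Integration.integrable_bound[OF w])
    show "?f x \<in> borel_measurable lebesgue" by (rule m)
    show "AE t in lebesgue. cmod (?f x t) \<le> norm (?w t)"
      unfolding real_norm_def by (rule AE_I2, rule order_trans[OF b abs_ge_self])
  qed
  have "cmod (\<integral>t. ?f x t \<partial>lebesgue) \<le> C ^ Suc n" for x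
  proof -
    have "cmod (\<integral>t. ?f x t \<partial>lebesgue) \<le> (\<integral>t. ?w t \<partial>lebesgue)"
      by (rule Bochner_Integration.integral_norm_bound_integral[OF _ w b])
         (rule fi)
    also have "\<dots> = C ^ Suc n" by (simp add: C_def)
    finally show ?thesis .
  qed
  with calculation show ?case unfolding C_def[symmetric] by simp
qed simp

lemma jost_iter_integrand:
  assumes q: "integrable lebesgue q" and k: "Im k \<ge> 0" "k \<noteq> 0" and g: "g \<in> borel_measurable lebesgue" "\<And>t. cmod (g t) \<le> C"
  shows "integrable lebesgue (\<lambda>t. jost_kernel k (t - x) * of_real (q t) * g t)"
proof (rule Bochner_Integration.integrable_bound)
  show "integrable lebesgue (\<lambda>t. \<bar>q t\<bar> * (C / cmod k))" using q by simp
  show "(\<lambda>t. jost_kernel k (t - x) * of_real (q t) * g t) \<in> borel_measurable lebesgue"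
  proof (intro borel_measurable_times)
    show "(\<lambda>t. jost_kernel k (t - x)) \<in> borel_measurable lebesgue"
      by (rule lebesgue_measurable_continuous)
         (auto intro!: continuous_intros continuous_on_compose2[OF continuous_on_jost_kernel])
  qed (use q g in simp_all)
  have "cmod (jost_kernel k (t - x) * of_real (q t) * g t) \<le> (1 / cmod k) * \<bar>q t\<bar> * C" for t
    unfolding norm_mult using jost_kernel_bounds(1)[OF k, of "t - x"] g(2)[of t]
    by (intro mult_mono) auto
  moreover have "0 \<le> C" using g(2)[of 0] norm_ge_zero order_trans by blast
  ultimately show "AE t in lebesgue. norm (jost_kernel k (t - x) * of_real (q t) * g t) \<le> norm (\<bar>q t\<bar> * (C / cmod k))"
    by (auto simp: mult_ac)
qed

text \<open>The majorant \<open>p\<close> is left open because two choices occur: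
  \<open>|q| / |k|\<close> away from the origin, and near it a mixture of both kernel bounds. The
  hypothesis \<open>dom\<close> is restricted to arguments beyond \<open>x0\<close>, since the mixed
  majorant is valid only for nonnegative arguments.\<close>

lemma jost_iter_bound:
  assumes q: "integrable lebesgue q" and k: "Im k \<ge> 0" "k \<noteq> 0"
    and p: "integrable lebesgue p" "\<And>t. p t \<ge> 0"
    and dom: "\<And>x t. x0 \<le> x \<Longrightarrow> x \<le> t \<Longrightarrow> cmod (jost_kernel k (t - x)) * \<bar>q t\<bar> \<le> p t"
    and x: "x0 \<le> x"
  shows "cmod (jost_iter q k n x) \<le> (LINT t:{x..}|lebesgue. p t) ^ n / fact n"
  using x
proof (induction n arbitrary: x)
  case (Suc n)
  define R where "R = (\<lambda>x. LINT t:{x..}|lebesgue. p t)"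
  have R0: "R t \<ge> 0" for t unfolding R_def by (rule tail_integral_mono(1)[OF p order_refl])
  let ?f = "\<lambda>t. jost_kernel k (t - x) * of_real (q t) * jost_iter q k n t"
  let ?w = "\<lambda>t. indicat_real {x..} t *\<^sub>R (p t * R t ^ n) / fact n"
  have i0: "continuous_on UNIV (jost_iter q k n)" "\<And>t. cmod (jost_iter q k n t) \<le> ((\<integral>t. \<bar>q t\<bar> \<partial>lebesgue) / cmod k) ^ n"
    using jost_iter_continuous_bounded[OF q k, of n] by auto
  have fi: "integrable lebesgue ?f"
    by (rule jost_iter_integrand[OF q k lebesgue_measurable_continuous[OF i0(1)] i0(2)])
  have wi: "integrable lebesgue ?w"
    using set_integrable_UNIV_subset[OF tail_integral_power(1)[OF p, of n], of "{x..}"]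
    unfolding set_integrable_def R_def by simp
  have "cmod (jost_iter q k (Suc n) x) \<le> (\<integral>t. ?w t \<partial>lebesgue)"
    unfolding jost_iter.simps
  proof (rule Bochner_Integration.integral_norm_bound_integral[OF fi wi])
    fix t
    show "cmod (?f t) \<le> ?w t"
    proof (cases "x \<le> t")
      case True
      have "cmod (?f t) \<le> p t * (R t ^ n / fact n)"
        unfolding norm_mult using dom[OF Suc.prems True] Suc.IH[of t] Suc.prems True p(2)[of t]
        by (intro mult_mono) (auto simp: R_def)
      then show ?thesis using True by simp
    qed (simp add: jost_kernel_def)
  qed
  also have "\<dots> = (LINT t:{x..}|lebesgue. p t * R t ^ n) / fact n"
    unfolding set_lebesgue_integral_def by simp
  also have "\<dots> \<le> (R x ^ Suc n / of_nat (Suc n)) / fact n"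
    unfolding R_def by (intro divide_right_mono tail_integral_power(2)[OF p]) auto
  also have "\<dots> = R x ^ Suc n / fact (Suc n)" by simp
  finally show ?case unfolding R_def .
qed simp

definition jost_m :: "(real \<Rightarrow> real) \<Rightarrow> complex \<Rightarrow> real \<Rightarrow> complex" where
  "jost_m q k x = (\<Sum>n. jost_iter q k n x)"

lemma jost_m_cnj: "summable (\<lambda>n. jost_iter q k n x) \<Longrightarrow> jost_m q (- cnj k) x = cnj (jost_m q k x)"
  unfolding jost_m_def jost_iter_cnj
  using bounded_linear.suminf[OF bounded_linear_cnj] by metis

lemma sums_exp_real: "(\<lambda>n. (r::real) ^ n / fact n) sums exp r"
  using exp_converges[of r] by (simp add: divide_inverse mult.commute)

lemma jost_m_bounds:
  assumes q: "integrable lebesgue q" and k: "Im k \<ge> 0" "k \<noteq> 0"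
    and p: "integrable lebesgue p" "\<And>t. p t \<ge> 0"
    and dom: "\<And>x t. x0 \<le> x \<Longrightarrow> x \<le> t \<Longrightarrow> cmod (jost_kernel k (t - x)) * \<bar>q t\<bar> \<le> p t"
    and x: "x0 \<le> x"
  shows "summable (\<lambda>n. cmod (jost_iter q k n x))"
    and "cmod (jost_m q k x) \<le> exp (LINT t:{x..}|lebesgue. p t)"
    and "cmod (jost_m q k x - 1) \<le> exp (LINT t:{x..}|lebesgue. p t) - 1"
proof -
  define r where "r = (LINT t:{x..}|lebesgue. p t)"
  have b: "cmod (jost_iter q k n x) \<le> r ^ n / fact n" for n
    unfolding r_def by (rule jost_iter_bound[OF assms])
  have sr: "summable (\<lambda>n. r ^ n / fact n)" using sums_exp_real sums_summable by blast
  show sm: "summable (\<lambda>n. cmod (jost_iter q k n x))"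
    by (rule summable_comparison_test'[OF sr, of 0]) (use b in auto)
  have "cmod (jost_m q k x) \<le> (\<Sum>n. cmod (jost_iter q k n x))" unfolding jost_m_def by (rule summable_norm[OF sm])
  also have "\<dots> \<le> (\<Sum>n. r ^ n / fact n)" by (rule suminf_le[OF _ sm sr]) (rule b)
  finally show "cmod (jost_m q k x) \<le> exp (LINT t:{x..}|lebesgue. p t)" using sums_unique[OF sums_exp_real] by (simp add: r_def)
  have sm1: "summable (\<lambda>n. cmod (jost_iter q k (Suc n) x))" using sm summable_Suc_iff[of "\<lambda>n. cmod (jost_iter q k n x)"] by blast
  have sr1: "summable (\<lambda>n. r ^ Suc n / fact (Suc n))" using sr summable_Suc_iff[of "\<lambda>n. r ^ n / fact n"] by blast
  have "jost_m q k x - 1 = (\<Sum>n. jost_iter q k (Suc n) x)"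
    unfolding jost_m_def using suminf_split_head[OF summable_norm_cancel[OF sm]] by simp
  also have "cmod \<dots> \<le> (\<Sum>n. cmod (jost_iter q k (Suc n) x))" by (rule summable_norm[OF sm1])
  also have "\<dots> \<le> (\<Sum>n. r ^ Suc n / fact (Suc n))" by (rule suminf_le[OF _ sm1 sr1]) (rule b)
  also have "\<dots> = exp r - 1" using suminf_split_head[OF sr] sums_unique[OF sums_exp_real, of r] by simp
  finally show "cmod (jost_m q k x - 1) \<le> exp (LINT t:{x..}|lebesgue. p t) - 1" by (simp add: r_def)
qed

lemma jost_kernel_dom:
  assumes k: "Im k \<ge> 0" "k \<noteq> 0" and "c \<ge> 0"
  shows "cmod (jost_kernel k s) * c \<le> c / cmod k"
  using mult_right_mono[OF jost_kernel_bounds(1)[OF k, of s], of c] assms by simp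

lemma jost_m_bounds_simple:
  assumes q: "integrable lebesgue q" and k: "Im k \<ge> 0" "k \<noteq> 0"
  shows "summable (\<lambda>n. cmod (jost_iter q k n x))"
    and "cmod (jost_m q k x) \<le> exp ((LINT t:{x..}|lebesgue. \<bar>q t\<bar>) / cmod k)"
    and "cmod (jost_m q k x - 1) \<le> exp ((LINT t:{x..}|lebesgue. \<bar>q t\<bar>) / cmod k) - 1"
    and "cmod (jost_m q k x) \<le> exp ((\<integral>t. \<bar>q t\<bar> \<partial>lebesgue) / cmod k)"
proof -
  let ?p = "\<lambda>t. \<bar>q t\<bar> / cmod k"
  have p: "integrable lebesgue ?p" using q by simp
  have eq: "(LINT t:{x..}|lebesgue. ?p t) = (LINT t:{x..}|lebesgue. \<bar>q t\<bar>) / cmod k" by simp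
  show "summable (\<lambda>n. cmod (jost_iter q k n x))"
    by (rule jost_m_bounds(1)[OF q k p, where x0=x]) (auto intro: jost_kernel_dom[OF k])
  show 2: "cmod (jost_m q k x) \<le> exp ((LINT t:{x..}|lebesgue. \<bar>q t\<bar>) / cmod k)"
    unfolding eq[symmetric] by (rule jost_m_bounds(2)[OF q k p, where x0=x]) (auto intro: jost_kernel_dom[OF k])
  show "cmod (jost_m q k x - 1) \<le> exp ((LINT t:{x..}|lebesgue. \<bar>q t\<bar>) / cmod k) - 1"
    unfolding eq[symmetric] by (rule jost_m_bounds(3)[OF q k p, where x0=x]) (auto intro: jost_kernel_dom[OF k])
  have "(LINT t:{x..}|lebesgue. \<bar>q t\<bar>) / cmod k \<le> (\<integral>t. \<bar>q t\<bar> \<partial>lebesgue) / cmod k"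
    using tail_integral_mono(3)[of "\<lambda>t. \<bar>q t\<bar>" x x] q by (intro divide_right_mono) auto
  then show "cmod (jost_m q k x) \<le> exp ((\<integral>t. \<bar>q t\<bar> \<partial>lebesgue) / cmod k)" using 2 by (meson exp_le_cancel_iff order_trans)
qed

lemma jost_m_measurable:
  assumes q: "integrable lebesgue q" and k: "Im k \<ge> 0" "k \<noteq> 0"
  shows "jost_m q k \<in> borel_measurable lebesgue"
proof -
  have "(\<lambda>x. \<Sum>n. jost_iter q k n x) \<in> borel_measurable lebesgue"
    using jost_iter_continuous_bounded[OF q k] by (intro borel_measurable_suminf lebesgue_measurable_continuous) auto
  then show ?thesis unfolding jost_m_def[abs_def] .
qed

text \<open>Sum and integral are interchanged by dominated convergence along the partial sums, which
  are bounded by \<open>C\<close> uniformly in \<open>n\<close> and \<open>t\<close> by the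
  factorial bound.\<close>

lemma jost_m_fixpoint:
  assumes q: "integrable lebesgue q" and k: "Im k \<ge> 0" "k \<noteq> 0"
  shows "jost_m q k x = 1 + (\<integral>t. jost_kernel k (t - x) * of_real (q t) * jost_m q k t \<partial>lebesgue)"
proof -
  define C where "C = exp ((\<integral>t. \<bar>q t\<bar> \<partial>lebesgue) / cmod k)"
  have sm: "summable (\<lambda>n. jost_iter q k n t)" for t using summable_norm_cancel[OF jost_m_bounds_simple(1)[OF q k]] .
  have ii: "continuous_on UNIV (jost_iter q k n)" "\<And>t. cmod (jost_iter q k n t) \<le> ((\<integral>t. \<bar>q t\<bar> \<partial>lebesgue) / cmod k) ^ n" for n
    using jost_iter_continuous_bounded[OF q k, of n] by auto
  have int: "integrable lebesgue (\<lambda>t. jost_kernel k (t - x) * of_real (q t) * jost_iter q k n t)" for n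
    by (rule jost_iter_integrand[OF q k lebesgue_measurable_continuous[OF ii(1)] ii(2)])
  have pb: "cmod (\<Sum>j<n. jost_iter q k j t) \<le> C" for n t
  proof -
    let ?p = "\<lambda>t. \<bar>q t\<bar> / cmod k"
    let ?r = "LINT t:{t..}|lebesgue. ?p t"
    have p: "integrable lebesgue ?p" using q by simp
    have r: "0 \<le> ?r" "?r \<le> (\<integral>t. \<bar>q t\<bar> \<partial>lebesgue) / cmod k"
      using tail_integral_mono(1,3)[OF p _ order_refl, of t] by auto
    have "cmod (\<Sum>j<n. jost_iter q k j t) \<le> (\<Sum>j<n. ?r ^ j / fact j)"
      by (intro sum_norm_le jost_iter_bound[OF q k p, where x0=t]) (auto intro: jost_kernel_dom[OF k])
    also have "\<dots> \<le> (\<Sum>j. ?r ^ j / fact j)"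
      using sums_exp_real[of ?r] r by (intro sum_le_suminf) (auto simp: sums_iff)
    also have "\<dots> \<le> C" unfolding sums_unique[OF sums_exp_real, of ?r, symmetric] C_def using r by simp
    finally show ?thesis .
  qed
  have "(\<lambda>n. \<integral>t. jost_kernel k (t - x) * of_real (q t) * (\<Sum>j<n. jost_iter q k j t) \<partial>lebesgue) \<longlonglongrightarrow>
     (\<integral>t. jost_kernel k (t - x) * of_real (q t) * jost_m q k t \<partial>lebesgue)"
  proof (rule integral_dominated_convergence[where w="\<lambda>t. \<bar>q t\<bar> * (C / cmod k)"])
    show "(\<lambda>t. jost_kernel k (t - x) * of_real (q t) * jost_m q k t) \<in> borel_measurable lebesgue"
      using jost_iter_integrand[OF q k jost_m_measurable[OF q k] jost_m_bounds_simple(4)[OF q k]] by (rule borel_measurable_integrable)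
    show "(\<lambda>t. jost_kernel k (t - x) * of_real (q t) * (\<Sum>j<n. jost_iter q k j t)) \<in> borel_measurable lebesgue" for n
      by (rule borel_measurable_integrable[OF jost_iter_integrand[OF q k _ pb]])
         (use ii in \<open>auto intro!: lebesgue_measurable_continuous continuous_intros\<close>)
    show "integrable lebesgue (\<lambda>t. \<bar>q t\<bar> * (C / cmod k))" using q by simp
    show "AE t in lebesgue. (\<lambda>n. jost_kernel k (t - x) * of_real (q t) * (\<Sum>j<n. jost_iter q k j t)) \<longlonglongrightarrow>
       jost_kernel k (t - x) * of_real (q t) * jost_m q k t"
      unfolding jost_m_def using summable_LIMSEQ[OF sm] by (intro AE_I2 tendsto_mult_left)
    show "AE t in lebesgue. cmod (jost_kernel k (t - x) * of_real (q t) * (\<Sum>j<n. jost_iter q k j t)) \<le> \<bar>q t\<bar> * (C / cmod k)" for n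
    proof (rule AE_I2)
      fix t
      have "cmod (jost_kernel k (t - x) * of_real (q t) * (\<Sum>j<n. jost_iter q k j t)) \<le> (1 / cmod k) * \<bar>q t\<bar> * C"
        unfolding norm_mult using jost_kernel_bounds(1)[OF k, of "t - x"] pb[of t n]
        by (intro mult_mono) auto
      then show "cmod (jost_kernel k (t - x) * of_real (q t) * (\<Sum>j<n. jost_iter q k j t)) \<le> \<bar>q t\<bar> * (C / cmod k)" by (simp add: mult_ac)
    qed
  qed
  moreover have "(\<integral>t. jost_kernel k (t - x) * of_real (q t) * (\<Sum>j<n. jost_iter q k j t) \<partial>lebesgue) = (\<Sum>j<n. jost_iter q k (Suc j) x)" for n
    unfolding sum_distrib_left using int by (subst Bochner_Integration.integral_sum) auto
  ultimately have "(\<lambda>n. jost_iter q k (Suc n) x) sums (\<integral>t. jost_kernel k (t - x) * of_real (q t) * jost_m q k t \<partial>lebesgue)"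
    unfolding sums_def by simp
  then show ?thesis
    unfolding jost_m_def using suminf_split_head[OF sm, of x] by (simp add: sums_iff)
qed

section \<open>Solutions and Wronskians\<close>

text \<open>The derivative is kept as explicit data, since Wronskians and Cauchy data refer to it;
  the spectral parameter is recorded through its square root \<open>k\<close>.\<close>

definition solution :: "real set \<Rightarrow> (real \<Rightarrow> real) \<Rightarrow> complex \<Rightarrow> (real \<Rightarrow> complex) \<Rightarrow> (real \<Rightarrow> complex) \<Rightarrow> bool" where
  "solution S q k y y1 \<longleftrightarrow> loc_ac_deriv S y y1 \<and> loc_ac_deriv S y1 (\<lambda>x. complex_of_real (q x) * y x - k\<^sup>2 * y x)"

lemma schroedinger_eq_iff_solution:
  "schroedinger_eq S q y (\<lambda>x. k\<^sup>2 * y x) \<longleftrightarrow> (\<exists>y1. solution S q k y y1)"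
  unfolding schroedinger_eq_def solution_def ..

lemma solution_subset: "solution S q k y y1 \<Longrightarrow> T \<subseteq> S \<Longrightarrow> solution T q k y y1"
  unfolding solution_def using loc_ac_deriv_subset by blast

lemma solution_lincomb:
  assumes "solution S q k y y1" "solution S q k z z1"
  shows "solution S q k (\<lambda>x. a * y x + b * z x) (\<lambda>x. a * y1 x + b * z1 x)"
proof -
  note s = assms[unfolded solution_def]
  have "loc_ac_deriv S (\<lambda>x. a * y1 x + b * z1 x) (\<lambda>x. a * (of_real (q x) * y x - k\<^sup>2 * y x) + b * (of_real (q x) * z x - k\<^sup>2 * z x))"
    using s by (intro loc_ac_deriv_add loc_ac_deriv_cmult) auto
  then show ?thesis
    unfolding solution_def using s by (auto intro!: loc_ac_deriv_add loc_ac_deriv_cmult simp: algebra_simps)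
qed

lemma solution_reflect:
  assumes "solution S q k y y1"
  shows "solution (uminus ` S) (\<lambda>x. q (- x)) k (\<lambda>x. y (- x)) (\<lambda>x. - y1 (- x))"
proof -
  note s = assms[unfolded solution_def]
  have "loc_ac_deriv (uminus ` S) (\<lambda>x. - y1 (- x)) (\<lambda>x. (-1) * (- (of_real (q (- x)) * y (- x) - k\<^sup>2 * y (- x))))"
    using loc_ac_deriv_cmult[OF loc_ac_deriv_reflect[OF conjunct2[OF s]], of "-1"] by simp
  then show ?thesis
    unfolding solution_def using loc_ac_deriv_reflect[OF conjunct1[OF s]] by simp
qed

lemma solution_cnj:
  assumes "solution S q k y y1"
  shows "solution S q (- cnj k) (\<lambda>x. cnj (y x)) (\<lambda>x. cnj (y1 x))"
  using assms loc_ac_deriv_cnj[of S y y1] loc_ac_deriv_cnj[of S y1 "\<lambda>x. complex_of_real (q x) * y x - k\<^sup>2 * y x"]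
  unfolding solution_def by simp

text \<open>The terms with \<open>q\<close> cancel. Equal frequencies give constancy of the
  Wronskian, different ones the bilinear identity from which all mass formulas below are
  derived.\<close>

lemma solution_wronskian:
  assumes "solution S q k y y1" "solution S q l z z1" "is_interval S"
  shows "loc_ac_deriv S (\<lambda>x. y x * z1 x - y1 x * z x) (\<lambda>x. (k\<^sup>2 - l\<^sup>2) * (y x * z x))"
proof -
  note s = assms(1,2)[unfolded solution_def]
  have "loc_ac_deriv S (\<lambda>x. y x * z1 x - y1 x * z x)
     (\<lambda>x. (y1 x * z1 x + y x * (of_real (q x) * z x - l\<^sup>2 * z x)) - ((of_real (q x) * y x - k\<^sup>2 * y x) * z x + y1 x * z1 x))"
    using s assms(3) by (intro loc_ac_deriv_diff loc_ac_deriv_mult) auto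
  then show ?thesis by (simp add: algebra_simps)
qed

lemma wronskian_const:
  assumes "solution S q k y y1" "solution S q k z z1" "is_interval S" "a \<in> S" "b \<in> S"
  shows "y a * z1 a - y1 a * z a = y b * z1 b - y1 b * z b"
proof -
  have w: "loc_ac_deriv S (\<lambda>x. y x * z1 x - y1 x * z x) (\<lambda>x. 0)"
    using solution_wronskian[OF assms(1-3)] by simp
  show ?thesis
  proof (cases "a \<le> b")
    case True
    then show ?thesis using loc_ac_deriv_eq[OF w assms(4,5)] by (simp add: set_lebesgue_integral_def)
  next
    case False
    then show ?thesis using loc_ac_deriv_eq[OF w assms(5,4)] by (simp add: set_lebesgue_integral_def)
  qed
qed

lemma set_integral_norm_bound_lebesgue:
  fixes f :: "real \<Rightarrow> complex" and p :: "real \<Rightarrow> real"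
  assumes "set_integrable lebesgue A f" "set_integrable lebesgue A p" "\<And>t. t \<in> A \<Longrightarrow> cmod (f t) \<le> p t"
  shows "cmod (LINT t:A|lebesgue. f t) \<le> (LINT t:A|lebesgue. p t)"
  unfolding set_lebesgue_integral_def
proof (rule Bochner_Integration.integral_norm_bound_integral)
  show "cmod (indicat_real A x *\<^sub>R f x) \<le> indicat_real A x *\<^sub>R p x" for x
    using assms(3)[of x] by (auto simp: indicator_def)
qed (use assms in \<open>simp_all add: set_integrable_def\<close>)

text \<open>The equation is read as a first-order system for the pair of \<open>y\<close> and
  \<open>y1\<close>, whose coefficients sum to at most \<open>1 + |q| + |k|^2\<close>.\<close>

lemma solution_gronwall:
  assumes sol: "solution {a..b} q k y y1" and q: "integrable lebesgue q" and ab: "a \<le> b"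
  shows "cmod (y b) + cmod (y1 b) \<le> (cmod (y a) + cmod (y1 a)) * exp (LINT t:{a..b}|lebesgue. 1 + \<bar>q t\<bar> + (cmod k)\<^sup>2)"
proof -
  note s = sol[unfolded solution_def]
  let ?p = "\<lambda>t. 1 + \<bar>q t\<bar> + (cmod k)\<^sup>2"
  let ?u = "\<lambda>t. cmod (y t) + cmod (y1 t)"
  have pint: "set_integrable lebesgue {a..x} ?p" for x
  proof -
    have "set_integrable lebesgue {a..x} (\<lambda>t. \<bar>q t\<bar>)" using q by (intro set_integrable_UNIV_subset) auto
    moreover have "set_integrable lebesgue {a..x} (\<lambda>t. c)" for c :: real by (rule absolutely_integrable_continuous_real) auto
    ultimately show ?thesis by (intro set_integral_add(1)) auto
  qed
  have cy: "continuous_on {a..b} y" "continuous_on {a..b} y1"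
    using loc_ac_deriv_continuous_Icc s by blast+
  then have cu: "continuous_on {a..b} ?u" by (intro continuous_intros)
  show ?thesis
  proof (rule gronwall_integral[OF ab cu pint])
    fix x assume x: "x \<in> {a..b}"
    have i1: "set_integrable lebesgue {a..x} y1" "set_integrable lebesgue {a..x} (\<lambda>x. of_real (q x) * y x - k\<^sup>2 * y x)"
      using loc_ac_deriv_integrable[OF conjunct1[OF s], of a x] loc_ac_deriv_integrable[OF conjunct2[OF s], of a x] x by auto
    have pu: "set_integrable lebesgue {a..x} (\<lambda>t. ?p t * ?u t)"
    proof -
      have cu': "continuous_on {a..x} ?u" using x by (intro continuous_on_subset[OF cu]) auto
      show ?thesis
        using absolutely_integrable_bounded_measurable_product_real[of ?u "{a..x}" ?p] pint[of x]
          continuous_imp_measurable_on_sets_lebesgue[OF cu']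
          compact_imp_bounded[OF compact_continuous_image[OF cu' compact_Icc]] by (simp add: mult.commute)
    qed
    have i1n: "set_integrable lebesgue {a..x} (\<lambda>t. cmod (y1 t))" "set_integrable lebesgue {a..x} (\<lambda>t. cmod (of_real (q t) * y t - k\<^sup>2 * y t))"
      using i1 by (auto intro: set_integrable_norm)
    have "?u x \<le> ?u a + ((LINT t:{a..x}|lebesgue. cmod (y1 t)) + (LINT t:{a..x}|lebesgue. cmod (of_real (q t) * y t - k\<^sup>2 * y t)))"
    proof -
      have 1: "y x = y a + (LINT t:{a..x}|lebesgue. y1 t)" "y1 x = y1 a + (LINT t:{a..x}|lebesgue. of_real (q t) * y t - k\<^sup>2 * y t)"
        using loc_ac_deriv_eq[OF conjunct1[OF s], of a x] loc_ac_deriv_eq[OF conjunct2[OF s], of a x] x by auto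
      have "cmod (y x) \<le> cmod (y a) + (LINT t:{a..x}|lebesgue. cmod (y1 t))"
        unfolding 1(1) by (intro order_trans[OF norm_triangle_ineq] add_left_mono set_integral_norm_bound_lebesgue i1 i1n) auto
      moreover have "cmod (y1 x) \<le> cmod (y1 a) + (LINT t:{a..x}|lebesgue. cmod (of_real (q t) * y t - k\<^sup>2 * y t))"
        unfolding 1(2) by (intro order_trans[OF norm_triangle_ineq] add_left_mono set_integral_norm_bound_lebesgue i1 i1n) auto
      ultimately show ?thesis by linarith
    qed
    also have "(LINT t:{a..x}|lebesgue. cmod (y1 t)) + (LINT t:{a..x}|lebesgue. cmod (of_real (q t) * y t - k\<^sup>2 * y t)) =
       (LINT t:{a..x}|lebesgue. cmod (y1 t) + cmod (of_real (q t) * y t - k\<^sup>2 * y t))"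
      by (rule set_integral_add(2)[OF i1n, symmetric])
    also have "\<dots> \<le> (LINT t:{a..x}|lebesgue. ?p t * ?u t)"
    proof (rule set_integral_mono[OF set_integral_add(1)[OF i1n] pu])
      fix t assume "t \<in> {a..x}"
      have "cmod (of_real (q t) * y t - k\<^sup>2 * y t) \<le> \<bar>q t\<bar> * cmod (y t) + (cmod k)\<^sup>2 * cmod (y t)"
        using norm_triangle_ineq4[of "of_real (q t) * y t" "k\<^sup>2 * y t"] by (simp add: norm_mult norm_power)
      moreover have "0 \<le> \<bar>q t\<bar> * cmod (y1 t) + (cmod k)\<^sup>2 * cmod (y1 t) + cmod (y t)" by simp
      ultimately show "cmod (y1 t) + cmod (of_real (q t) * y t - k\<^sup>2 * y t) \<le> ?p t * ?u t"
        unfolding distrib_left distrib_right by linarith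
    qed
    finally show "?u x \<le> ?u a + (LINT t:{a..x}|lebesgue. ?p t * ?u t)" by simp
  qed auto
qed

lemma solution_unique:
  assumes sol: "solution S q k y y1" and q: "integrable lebesgue q" and S: "is_interval S"
    and x0: "x0 \<in> S" "y x0 = 0" "y1 x0 = 0" and x: "x \<in> S"
  shows "y x = 0 \<and> y1 x = 0"
proof (cases "x0 \<le> x")
  case True
  have sub: "{x0..x} \<subseteq> S"
    using S x x0(1) unfolding is_interval_1 subset_iff atLeastAtMost_iff by blast
  have "cmod (y x) + cmod (y1 x) \<le> 0"
    using solution_gronwall[OF solution_subset[OF sol sub] q True] x0 by simp
  then show ?thesis using norm_ge_zero[of "y x"] norm_ge_zero[of "y1 x"] by (smt (verit) zero_less_norm_iff)
next
  case False
  have sub: "{x..x0} \<subseteq> S"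
    using S x x0(1) unfolding is_interval_1 subset_iff atLeastAtMost_iff by blast
  \<comment> \<open>Gronwall's inequality propagates to the right only; points to the left of
    \<open>x0\<close> are reached through the reflected equation.\<close>
  have "solution (uminus ` {x..x0}) (\<lambda>x. q (- x)) k (\<lambda>x. y (- x)) (\<lambda>x. - y1 (- x))"
    by (rule solution_reflect[OF solution_subset[OF sol sub]])
  then have sr: "solution {-x0..-x} (\<lambda>x. q (- x)) k (\<lambda>x. y (- x)) (\<lambda>x. - y1 (- x))" by simp
  have qr: "integrable lebesgue (\<lambda>x. q (- x))"
    using lebesgue_integrable_real_affine[OF q, of "-1" 0] by simp
  have "cmod (y x) + cmod (y1 x) \<le> 0"
    using solution_gronwall[OF sr qr] x0 False by simp
  then show ?thesis using norm_ge_zero[of "y x"] norm_ge_zero[of "y1 x"] by (smt (verit) zero_less_norm_iff)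
qed

section \<open>The Jost solution and its derivative\<close>

text \<open>Splitting (exp(2ik(t-x)) - 1) / (2ik) into its two terms frees the integrands from
  \<open>x\<close>. \<open>jost_alpha\<close> and \<open>jost_beta\<close> are the two tail
  integrals that remain; both are locally absolutely continuous with explicit derivatives.\<close>

definition jost_alpha :: "(real \<Rightarrow> real) \<Rightarrow> complex \<Rightarrow> real \<Rightarrow> complex" where
  "jost_alpha q k x = (LINT t:{x..}|lebesgue. of_real (q t) * jost_m q k t)"

definition jost_beta :: "(real \<Rightarrow> real) \<Rightarrow> complex \<Rightarrow> real \<Rightarrow> complex" where
  "jost_beta q k x = (LINT t:{x..}|lebesgue. exp (2 * \<i> * k * of_real t) * (of_real (q t) * jost_m q k t))"

definition jost :: "(real \<Rightarrow> real) \<Rightarrow> complex \<Rightarrow> real \<Rightarrow> complex" where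
  "jost q k x = exp (\<i> * k * of_real x) * jost_m q k x"

text \<open>The outcome of differentiating \<open>jost\<close> after it is expressed through
  \<open>jost_alpha\<close> and \<open>jost_beta\<close>; the contributions of their derivatives
  cancel.\<close>

definition jost1 :: "(real \<Rightarrow> real) \<Rightarrow> complex \<Rightarrow> real \<Rightarrow> complex" where
  "jost1 q k x = \<i> * k * exp (\<i> * k * of_real x)
     - (exp (- \<i> * k * of_real x) * jost_beta q k x + exp (\<i> * k * of_real x) * jost_alpha q k x) / 2"

lemma jost_integrable:
  assumes q: "integrable lebesgue q" and k: "Im k \<ge> 0" "k \<noteq> 0"
  shows "integrable lebesgue (\<lambda>t. of_real (q t) * jost_m q k t)"
    and "set_integrable lebesgue {x..} (\<lambda>t. exp (2 * \<i> * k * of_real t) * (of_real (q t) * jost_m q k t))"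
proof -
  show i: "integrable lebesgue (\<lambda>t. of_real (q t) * jost_m q k t)"
  proof (rule Bochner_Integration.integrable_bound)
    show "integrable lebesgue (\<lambda>t. \<bar>q t\<bar> * exp ((\<integral>t. \<bar>q t\<bar> \<partial>lebesgue) / cmod k))" using q by simp
    show "(\<lambda>t. of_real (q t) * jost_m q k t) \<in> borel_measurable lebesgue"
      using q jost_m_measurable[OF q k] by (intro borel_measurable_times) auto
    show "AE t in lebesgue. cmod (of_real (q t) * jost_m q k t) \<le> norm (\<bar>q t\<bar> * exp ((\<integral>t. \<bar>q t\<bar> \<partial>lebesgue) / cmod k))"
      using jost_m_bounds_simple(4)[OF q k] by (auto simp: norm_mult abs_mult intro!: mult_left_mono)
  qed
  show "set_integrable lebesgue {x..} (\<lambda>t. exp (2 * \<i> * k * of_real t) * (of_real (q t) * jost_m q k t))"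
    unfolding set_integrable_def
  proof (rule Bochner_Integration.integrable_bound)
    show "integrable lebesgue (\<lambda>t. exp (- 2 * Im k * x) * cmod (of_real (q t) * jost_m q k t))" using i by (intro integrable_mult_right integrable_norm)
    show "(\<lambda>t. indicat_real {x..} t *\<^sub>R (exp (2 * \<i> * k * of_real t) * (of_real (q t) * jost_m q k t))) \<in> borel_measurable lebesgue"
    proof (intro borel_measurable_scaleR borel_measurable_times[OF _ borel_measurable_integrable[OF i]])
      show "(\<lambda>t. exp (2 * \<i> * k * of_real t)) \<in> borel_measurable lebesgue"
        by (intro lebesgue_measurable_continuous continuous_intros)
      show "indicat_real {x..} \<in> borel_measurable lebesgue" by (rule borel_measurable_indicator) simp
    qed
    show "AE t in lebesgue. norm (indicat_real {x..} t *\<^sub>R (exp (2 * \<i> * k * of_real t) * (of_real (q t) * jost_m q k t)))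
        \<le> norm (exp (- 2 * Im k * x) * cmod (of_real (q t) * jost_m q k t))"
    proof (rule AE_I2)
      fix t
      have "x \<le> t \<Longrightarrow> Im k * x \<le> Im k * t" using k by (intro mult_left_mono) auto
      then show "norm (indicat_real {x..} t *\<^sub>R (exp (2 * \<i> * k * of_real t) * (of_real (q t) * jost_m q k t)))
        \<le> norm (exp (- 2 * Im k * x) * cmod (of_real (q t) * jost_m q k t))"
        by (cases "x \<le> t") (auto simp: norm_mult abs_mult intro!: mult_right_mono)
    qed
  qed
qed

lemma jost_m_eq:
  assumes q: "integrable lebesgue q" and k: "Im k \<ge> 0" "k \<noteq> 0"
  shows "jost_m q k x = 1 + (exp (- 2 * \<i> * k * of_real x) * jost_beta q k x - jost_alpha q k x) / (2 * \<i> * k)"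
proof -
  note i = jost_integrable[OF q k]
  have ia: "set_integrable lebesgue {x..} (\<lambda>t. of_real (q t) * jost_m q k t)" using i(1) by (rule set_integrable_UNIV_subset) simp
  have "(\<integral>t. jost_kernel k (t - x) * of_real (q t) * jost_m q k t \<partial>lebesgue) =
    (LINT t:{x..}|lebesgue. (exp (- 2 * \<i> * k * of_real x) * (exp (2 * \<i> * k * of_real t) * (of_real (q t) * jost_m q k t)) - of_real (q t) * jost_m q k t) / (2 * \<i> * k))"
    unfolding set_lebesgue_integral_def
  proof (rule Bochner_Integration.integral_cong[OF refl])
    fix t
    have e: "exp (2 * \<i> * k * of_real (t - x)) = exp (- 2 * \<i> * k * of_real x) * exp (2 * \<i> * k * of_real t)"
      by (simp add: exp_add[symmetric] algebra_simps)
    show "jost_kernel k (t - x) * of_real (q t) * jost_m q k t = indicat_real {x..} t *\<^sub>R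
      ((exp (- 2 * \<i> * k * of_real x) * (exp (2 * \<i> * k * of_real t) * (of_real (q t) * jost_m q k t)) - of_real (q t) * jost_m q k t) / (2 * \<i> * k))"
      unfolding jost_kernel_def e by (simp add: indicator_def algebra_simps diff_divide_distrib)
  qed
  also have "\<dots> = (exp (- 2 * \<i> * k * of_real x) * jost_beta q k x - jost_alpha q k x) / (2 * \<i> * k)"
    unfolding jost_beta_def jost_alpha_def set_integral_divide_zero
    using i(2)[of x] ia by (subst set_integral_diff(2)) auto
  finally show ?thesis using jost_m_fixpoint[OF q k, of x] by simp
qed

text \<open>In the first derivative the two terms containing \<open>q * jost_m\<close> cancel; in
  the second they add up to exp(ikx) \<open>q * jost_m\<close>, which is \<open>q * jost\<close>.
  Both facts use that exp(-ikx) exp(2ikx) is exp(ikx).\<close>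

lemma solution_jost:
  assumes q: "integrable lebesgue q" and k: "Im k \<ge> 0" "k \<noteq> 0"
  shows "solution UNIV q k (jost q k) (jost1 q k)"
proof -
  note i = jost_integrable[OF q k]
  let ?a = "jost_alpha q k" and ?b = "jost_beta q k" and ?E = "\<lambda>x. exp (\<i> * k * complex_of_real x)" and ?F = "\<lambda>x. exp (- \<i> * k * complex_of_real x)"
  have a: "loc_ac_deriv UNIV ?a (\<lambda>x. - (of_real (q x) * jost_m q k x))"
    unfolding jost_alpha_def[abs_def] by (rule loc_ac_deriv_tail, rule set_integrable_UNIV_subset[OF i(1)]) simp
  have b: "loc_ac_deriv UNIV ?b (\<lambda>x. - (exp (2 * \<i> * k * of_real x) * (of_real (q x) * jost_m q k x)))"
    unfolding jost_beta_def[abs_def] by (rule loc_ac_deriv_tail, rule i(2))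
  have E: "loc_ac_deriv UNIV ?E (\<lambda>x. \<i> * k * ?E x)" by (rule loc_ac_deriv_exp)
  have F: "loc_ac_deriv UNIV ?F (\<lambda>x. - \<i> * k * ?F x)" by (rule loc_ac_deriv_exp)
  have FE: "?F x * exp (2 * \<i> * k * of_real x) = ?E x" for x by (simp add: exp_add[symmetric] algebra_simps)
  have EF2: "?E x * exp (- 2 * \<i> * k * of_real x) = ?F x" for x by (simp add: exp_add[symmetric] algebra_simps)
  note Fb = loc_ac_deriv_mult[OF F b is_interval_univ] and Ea = loc_ac_deriv_mult[OF E a is_interval_univ]
  have y: "jost q k = (\<lambda>x. ?E x + (1 / (2 * \<i> * k)) * (?F x * ?b x - ?E x * ?a x))"
    unfolding jost_def[abs_def] jost_m_eq[OF q k] EF2[symmetric]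
    by (intro ext) (simp add: algebra_simps diff_divide_distrib add_divide_distrib)
  have y1: "jost1 q k = (\<lambda>x. \<i> * k * ?E x + (- 1 / 2) * (?F x * ?b x + ?E x * ?a x))"
    unfolding jost1_def[abs_def] by (simp add: fun_eq_iff)
  have 1: "loc_ac_deriv UNIV (jost q k) (jost1 q k)"
  proof -
    have "loc_ac_deriv UNIV (jost q k) (\<lambda>x. \<i> * k * ?E x + (1 / (2 * \<i> * k)) *
      ((- \<i> * k * ?F x * ?b x + ?F x * - (exp (2 * \<i> * k * of_real x) * (of_real (q x) * jost_m q k x)))
       - (\<i> * k * ?E x * ?a x + ?E x * - (of_real (q x) * jost_m q k x))))"
      unfolding y by (intro loc_ac_deriv_add E loc_ac_deriv_cmult loc_ac_deriv_diff Fb Ea)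
    also have "(\<lambda>x. \<i> * k * ?E x + (1 / (2 * \<i> * k)) *
      ((- \<i> * k * ?F x * ?b x + ?F x * - (exp (2 * \<i> * k * of_real x) * (of_real (q x) * jost_m q k x)))
       - (\<i> * k * ?E x * ?a x + ?E x * - (of_real (q x) * jost_m q k x)))) = jost1 q k"
    proof
      fix x
      have h: "?F x * - (exp (2 * \<i> * k * of_real x) * (of_real (q x) * jost_m q k x)) = - (?E x * (of_real (q x) * jost_m q k x))"
        unfolding FE[symmetric] by (simp add: mult_ac)
      show "\<i> * k * ?E x + (1 / (2 * \<i> * k)) *
        ((- \<i> * k * ?F x * ?b x + ?F x * - (exp (2 * \<i> * k * of_real x) * (of_real (q x) * jost_m q k x)))
         - (\<i> * k * ?E x * ?a x + ?E x * - (of_real (q x) * jost_m q k x))) = jost1 q k x"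
        unfolding h y1 using k(2) by (simp add: field_simps)
    qed
    finally show ?thesis .
  qed
  moreover have "loc_ac_deriv UNIV (jost1 q k) (\<lambda>x. of_real (q x) * jost q k x - k\<^sup>2 * jost q k x)"
  proof -
    have "loc_ac_deriv UNIV (jost1 q k) (\<lambda>x. \<i> * k * (\<i> * k * ?E x) + (- 1 / 2) *
      ((- \<i> * k * ?F x * ?b x + ?F x * - (exp (2 * \<i> * k * of_real x) * (of_real (q x) * jost_m q k x)))
       + (\<i> * k * ?E x * ?a x + ?E x * - (of_real (q x) * jost_m q k x))))"
      unfolding y1 by (intro loc_ac_deriv_add E loc_ac_deriv_cmult Fb Ea)
    also have "(\<lambda>x. \<i> * k * (\<i> * k * ?E x) + (- 1 / 2) *
      ((- \<i> * k * ?F x * ?b x + ?F x * - (exp (2 * \<i> * k * of_real x) * (of_real (q x) * jost_m q k x)))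
       + (\<i> * k * ?E x * ?a x + ?E x * - (of_real (q x) * jost_m q k x)))) = (\<lambda>x. of_real (q x) * jost q k x - k\<^sup>2 * jost q k x)"
    proof
      fix x
      have 1: "?F x * - (exp (2 * \<i> * k * of_real x) * (of_real (q x) * jost_m q k x)) = - (?E x * (of_real (q x) * jost_m q k x))"
        unfolding FE[symmetric] by (simp add: mult_ac)
      have 2: "of_real (q x) * jost q k x = ?E x * (of_real (q x) * jost_m q k x)" by (simp add: jost_def)
      have 3: "k\<^sup>2 * jost q k x = k\<^sup>2 * ?E x + (k / (2 * \<i>)) * (?F x * ?b x - ?E x * ?a x)"
        unfolding y using k(2) by (simp add: field_simps power2_eq_square)
      show "\<i> * k * (\<i> * k * ?E x) + (- 1 / 2) *
      ((- \<i> * k * ?F x * ?b x + ?F x * - (exp (2 * \<i> * k * of_real x) * (of_real (q x) * jost_m q k x)))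
       + (\<i> * k * ?E x * ?a x + ?E x * - (of_real (q x) * jost_m q k x))) = of_real (q x) * jost q k x - k\<^sup>2 * jost q k x"
        unfolding 1 2 3 by (simp add: field_simps power2_eq_square)
    qed
    finally show ?thesis .
  qed
  ultimately show ?thesis unfolding solution_def ..
qed

lemma tail_integral_tendsto_0:
  fixes p :: "real \<Rightarrow> real"
  assumes p: "integrable lebesgue p"
  shows "((\<lambda>x. LINT t:{x..}|lebesgue. p t) \<longlongrightarrow> 0) at_top"
proof -
  have "((\<lambda>x. \<integral>t. indicat_real {x..} t *\<^sub>R p t \<partial>lebesgue) \<longlongrightarrow> (\<integral>t. (0::real) \<partial>(lebesgue :: real measure))) at_top"
  proof (rule integral_dominated_convergence_at_top[where w="\<lambda>t. \<bar>p t\<bar>"])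
    show "AE t in lebesgue. ((\<lambda>x. indicat_real {x..} t *\<^sub>R p t) \<longlongrightarrow> 0) at_top"
    proof (rule AE_I2)
      fix t
      have "eventually (\<lambda>x. 0 = indicat_real {x..} t *\<^sub>R p t) at_top"
        using eventually_gt_at_top[of t] by eventually_elim (simp add: indicator_def)
      then show "((\<lambda>x. indicat_real {x..} t *\<^sub>R p t) \<longlongrightarrow> 0) at_top"
        by (rule Lim_transform_eventually[OF tendsto_const])
    qed
    show "\<forall>\<^sub>F x in at_top. AE t in lebesgue. norm (indicat_real {x..} t *\<^sub>R p t) \<le> \<bar>p t\<bar>"
      by (intro always_eventually allI AE_I2) (auto simp: indicator_def)
  qed (use p in \<open>auto intro!: borel_measurable_times borel_measurable_indicator\<close>)
  then show ?thesis unfolding set_lebesgue_integral_def by simp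
qed

text \<open>The first three bounds hold at every \<open>x\<close> and not only asymptotically: at
  \<open>x = 0\<close> the third one gives the behaviour of \<open>jost1\<close> for large
  \<open>k\<close>.\<close>

lemma jost_asymp:
  assumes q: "integrable lebesgue q" and k: "Im k \<ge> 0" "k \<noteq> 0"
  defines "T \<equiv> \<lambda>x. LINT t:{x..}|lebesgue. \<bar>q t\<bar>" and "C \<equiv> exp ((\<integral>t. \<bar>q t\<bar> \<partial>lebesgue) / cmod k)"
  shows "cmod (jost_alpha q k x) \<le> C * T x"
    and "cmod (exp (- 2 * \<i> * k * of_real x) * jost_beta q k x) \<le> C * T x"
    and "cmod (exp (- \<i> * k * of_real x) * jost1 q k x - \<i> * k) \<le> C * T x"
    and "((\<lambda>x. exp (- \<i> * k * of_real x) * jost q k x) \<longlongrightarrow> 1) at_top"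
    and "((\<lambda>x. exp (- \<i> * k * of_real x) * jost1 q k x) \<longlongrightarrow> \<i> * k) at_top"
    and "(jost_m q k \<longlongrightarrow> 1) at_top"
    and "(jost_alpha q k \<longlongrightarrow> 0) at_top"
proof -
  note i = jost_integrable[OF q k]
  have qi: "integrable lebesgue (\<lambda>t. \<bar>q t\<bar>)" using q by simp
  have T: "(T \<longlongrightarrow> 0) at_top" unfolding T_def by (rule tail_integral_tendsto_0[OF qi])
  have w: "set_integrable lebesgue {x..} (\<lambda>t. C * \<bar>q t\<bar>)" for x
    using set_integrable_UNIV_subset[OF qi, of "{x..}"] by simp
  have wi: "(LINT t:{x..}|lebesgue. C * \<bar>q t\<bar>) = C * T x" for x unfolding T_def by simp
  have qm: "cmod (of_real (q t) * jost_m q k t) \<le> C * \<bar>q t\<bar>" for t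
    unfolding norm_mult C_def using mult_left_mono[OF jost_m_bounds_simple(4)[OF q k, of t], of "\<bar>q t\<bar>"] by (simp add: mult.commute)
  show al: "cmod (jost_alpha q k x) \<le> C * T x" for x
    unfolding jost_alpha_def wi[symmetric]
    by (rule set_integral_norm_bound_lebesgue[OF set_integrable_UNIV_subset[OF i(1)] w qm]) simp
  show be: "cmod (exp (- 2 * \<i> * k * of_real x) * jost_beta q k x) \<le> C * T x" for x
  proof -
    have "cmod (LINT t:{x..}|lebesgue. exp (- 2 * \<i> * k * of_real x) * (exp (2 * \<i> * k * of_real t) * (of_real (q t) * jost_m q k t))) \<le> C * T x"
      unfolding wi[symmetric]
    proof (rule set_integral_norm_bound_lebesgue[OF _ w])
      show "set_integrable lebesgue {x..} (\<lambda>t. exp (- 2 * \<i> * k * of_real x) * (exp (2 * \<i> * k * of_real t) * (of_real (q t) * jost_m q k t)))"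
        by (rule set_integrable_mult_right) (rule i(2))
      fix t assume t: "t \<in> {x..}"
      have e: "exp (- 2 * \<i> * k * of_real x) * exp (2 * \<i> * k * of_real t) = exp (2 * \<i> * k * of_real (t - x))"
        by (simp add: exp_add[symmetric] algebra_simps)
      have "cmod (exp (2 * \<i> * k * of_real (t - x))) \<le> 1" using t k by simp
      then show "cmod (exp (- 2 * \<i> * k * of_real x) * (exp (2 * \<i> * k * of_real t) * (of_real (q t) * jost_m q k t))) \<le> C * \<bar>q t\<bar>"
        unfolding mult.assoc[symmetric, of "exp (- 2 * \<i> * k * of_real x)"] e norm_mult[of "exp (2 * \<i> * k * of_real (t - x))"]
        using mult_mono[OF _ qm, of "cmod (exp (2 * \<i> * k * of_real (t - x)))" 1 t] by simp
    qed
    then show ?thesis unfolding jost_beta_def set_integral_mult_right .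
  qed
  have Fe: "exp (- \<i> * k * of_real x) * exp (\<i> * k * of_real x) = 1" for x by (simp add: exp_add[symmetric])
  have FF: "exp (- \<i> * k * of_real x) * exp (- \<i> * k * of_real x) = exp (- 2 * \<i> * k * of_real x)" for x
    by (simp add: exp_add[symmetric] mult_ac)
  have j1: "exp (- \<i> * k * of_real x) * jost1 q k x - \<i> * k = - (exp (- 2 * \<i> * k * of_real x) * jost_beta q k x + jost_alpha q k x) / 2" for x
  proof -
    have "exp (- \<i> * k * of_real x) * jost1 q k x = \<i> * k * (exp (- \<i> * k * of_real x) * exp (\<i> * k * of_real x)) -
      ((exp (- \<i> * k * of_real x) * exp (- \<i> * k * of_real x)) * jost_beta q k x + (exp (- \<i> * k * of_real x) * exp (\<i> * k * of_real x)) * jost_alpha q k x) / 2"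
      unfolding jost1_def by (simp add: algebra_simps)
    then show ?thesis unfolding Fe FF by (simp add: add_divide_distrib)
  qed
  show j1b: "cmod (exp (- \<i> * k * of_real x) * jost1 q k x - \<i> * k) \<le> C * T x" for x
  proof -
    have "cmod (exp (- 2 * \<i> * k * of_real x) * jost_beta q k x + jost_alpha q k x) \<le> C * T x + C * T x"
      by (intro order_trans[OF norm_triangle_ineq] add_mono al be)
    then show ?thesis unfolding j1 norm_divide norm_minus_cancel by simp
  qed
  have m1: "cmod (jost_m q k x - 1) \<le> exp (T x / cmod k) - 1" for x
    unfolding T_def by (rule jost_m_bounds_simple(3)[OF q k])
  have "((\<lambda>x. exp (T x / cmod k) - 1) \<longlongrightarrow> exp (0 / cmod k) - 1) at_top"
    using k by (intro tendsto_intros T) auto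
  then have "((\<lambda>x. exp (T x / cmod k) - 1) \<longlongrightarrow> 0) at_top" by simp
  then have "((\<lambda>x. jost_m q k x - 1) \<longlongrightarrow> 0) at_top"
    by (rule Lim_null_comparison[rotated]) (intro always_eventually allI m1)
  then show m: "(jost_m q k \<longlongrightarrow> 1) at_top" by (simp add: LIM_zero_iff)
  have "exp (- \<i> * k * of_real x) * jost q k x = jost_m q k x" for x
    unfolding jost_def mult.assoc[symmetric] Fe by simp
  then show "((\<lambda>x. exp (- \<i> * k * of_real x) * jost q k x) \<longlongrightarrow> 1) at_top" using m by simp
  have CT: "((\<lambda>x. C * T x) \<longlongrightarrow> 0) at_top" using tendsto_mult_right_zero[OF T] by simp
  have "((\<lambda>x. exp (- \<i> * k * of_real x) * jost1 q k x - \<i> * k) \<longlongrightarrow> 0) at_top"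
    by (rule Lim_null_comparison[OF _ CT]) (intro always_eventually allI j1b)
  then show "((\<lambda>x. exp (- \<i> * k * of_real x) * jost1 q k x) \<longlongrightarrow> \<i> * k) at_top" by (simp add: LIM_zero_iff)
  show "(jost_alpha q k \<longlongrightarrow> 0) at_top"
    by (rule Lim_null_comparison[OF _ CT]) (intro always_eventually allI al)
qed

section \<open>Growth of solutions other than the Jost solution\<close>

lemma loc_ac_has_vector_derivative:
  assumes "loc_ac_deriv S y y1" "continuous_on {a..b} y1" "{a..b} \<subseteq> S" and t: "t \<in> {a..b}"
  shows "(y has_vector_derivative y1 t) (at t within {a..b})"
proof -
  have "((\<lambda>x. y a + integral {a..x} y1) has_vector_derivative y1 t) (at t within {a..b})"
    using integral_has_vector_derivative[OF assms(2) t] by (auto intro: has_vector_derivative_add derivative_eq_intros)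
  moreover have "y a + integral {a..x} y1 = y x" if "x \<in> {a..b}" for x
  proof -
    have "a \<in> S" "x \<in> S" "a \<le> x" using assms(3) that by auto
    then have "y x - y a = integral {a..x} y1" using assms(1) unfolding loc_ac_deriv_def by blast
    then show ?thesis by (simp add: algebra_simps)
  qed
  ultimately show ?thesis
    using has_vector_derivative_transform[OF t, of y "\<lambda>x. y a + integral {a..x} y1" "y1 t"] by metis
qed

lemma solution_continuous:
  assumes "solution S q k y y1" "{a..b} \<subseteq> S"
  shows "continuous_on {a..b} y" "continuous_on {a..b} y1"
  using assms loc_ac_deriv_continuous_Icc unfolding solution_def by blast+

text \<open>The exponent has modulus \<pi>, whereas nonzero periods of exp have modulus at least
  2\<pi>. Hence the integral of exp(-2ikt) over an interval of length \<pi> / (2|k|) does not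
  vanish, even for real \<open>k\<close>.\<close>

lemma exp_quarter_period_neq_1:
  assumes "k \<noteq> 0"
  shows "exp (- 2 * \<i> * k * of_real (pi / (2 * cmod k))) \<noteq> 1"
proof
  define z where "z = - 2 * \<i> * k * of_real (pi / (2 * cmod k))"
  assume "exp (- 2 * \<i> * k * of_real (pi / (2 * cmod k))) = 1"
  then have "exp z = 1" by (simp add: z_def)
  then obtain n :: int where n: "Re z = 0" "Im z = of_int (2 * n) * pi"
    unfolding exp_eq_1 by auto
  have "pi = cmod z" using assms by (simp add: z_def norm_mult norm_divide)
  also have "cmod z = \<bar>Im z\<bar>" using n(1) by (simp add: cmod_def)
  also have "\<dots> = \<bar>real_of_int (2 * n)\<bar> * pi" unfolding n(2) abs_mult by simp
  finally have *: "pi = \<bar>real_of_int (2 * n)\<bar> * pi" .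
  show False
  proof (cases "n = 0")
    case False
    then have "2 \<le> \<bar>real_of_int (2 * n)\<bar>" by linarith
    then have "2 * pi \<le> \<bar>real_of_int (2 * n)\<bar> * pi" by (intro mult_right_mono) auto
    then show False using * pi_gt_zero by linarith
  qed (use * in simp)
qed

text \<open>Multiples of the Jost solution are the only solutions that do not grow: the quotient of a
  solution by the Jost solution has derivative \<open>- W / jost\<^sup>2\<close>, whose integrals over a
  fixed length do not decay.\<close>

lemma solution_growth:
  assumes q: "integrable lebesgue q" and k: "Im k \<ge> 0" "k \<noteq> 0"
    and sol: "solution {a..} q k y y1" and W: "y a * jost1 q k a - y1 a * jost q k a \<noteq> 0"
  shows "\<exists>c>0. \<exists>L>0. \<exists>X\<ge>max a 0. \<forall>x\<ge>X. c * exp (Im k * x) \<le> cmod (y x) + cmod (y (x + L))"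
proof -
  let ?e = "jost q k" and ?e1 = "jost1 q k"
  define W where "W = y a * ?e1 a - y1 a * ?e a"
  define L where "L = pi / (2 * cmod k)"
  have L: "L > 0" using k by (simp add: L_def)
  define K where "K = cmod (1 - exp (- 2 * \<i> * k * of_real L))"
  have K: "K > 0" using exp_quarter_period_neq_1[OF k(2)] by (simp add: K_def L_def)
  define \<tau> where "\<tau> = Im k"
  have \<tau>: "\<tau> \<ge> 0" using k by (simp add: \<tau>_def)
  \<comment> \<open>Replacing \<open>1 / jost^2\<close> by exp(-2ikt) on {x..x+L} must cost at most
    half of the main term, whose modulus is \<open>|W| exp(2 \<tau> x) K / (2 |k|)\<close>.
    Therefore \<open>1 / jost_m^2\<close> has to be within \<eta> of 1.\<close>
  define \<eta> where "\<eta> = K / (4 * cmod k) / (L * exp (2 * \<tau> * L))"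
  have \<eta>: "\<eta> > 0" using K k L by (simp add: \<eta>_def)
  have solj: "solution {a..} q k ?e ?e1" by (rule solution_subset[OF solution_jost[OF q k]]) simp
  have Wc: "y t * ?e1 t - y1 t * ?e t = W" if "t \<ge> a" for t
    unfolding W_def by (rule wronskian_const[OF sol solj]) (use that in \<open>auto simp: is_interval_ci\<close>)
  have m: "(jost_m q k \<longlongrightarrow> 1) at_top" by (rule jost_asymp(6)[OF q k])
  have m2: "((\<lambda>t. 1 / (jost_m q k t)\<^sup>2) \<longlongrightarrow> 1 / 1\<^sup>2) at_top" using m by (intro tendsto_intros) auto
  have "eventually (\<lambda>t. dist (jost_m q k t) 1 < 1/2 \<and> dist (1 / (jost_m q k t)\<^sup>2) 1 < \<eta>) at_top"
    using tendstoD[OF m, of "1/2"] tendstoD[OF m2 \<eta>] by (intro eventually_conj) auto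
  then obtain X0 where X0: "\<And>t. t \<ge> X0 \<Longrightarrow> dist (jost_m q k t) 1 < 1/2 \<and> dist (1 / (jost_m q k t)\<^sup>2) 1 < \<eta>"
    unfolding eventually_at_top_linorder by blast
  define X where "X = max X0 (max a 0)"
  have nm: "cmod (jost_m q k t) \<ge> 1/2" if "t \<ge> X" for t
  proof -
    have "dist (jost_m q k t) 1 < 1/2" using X0[of t] that by (auto simp: X_def)
    then show ?thesis using norm_triangle_ineq3[of "jost_m q k t" 1] by (simp add: dist_norm)
  qed
  have ne: "cmod (?e t) = exp (- \<tau> * t) * cmod (jost_m q k t)" for t
    unfolding jost_def norm_mult by (simp add: \<tau>_def)
  have e0: "?e t \<noteq> 0" if "t \<ge> X" for t
  proof -
    have "cmod (?e t) > 0" unfolding ne using nm[OF that] by (intro mult_pos_pos) auto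
    then show ?thesis by auto
  qed
  define v where "v = (\<lambda>t. y t * inverse (?e t))"
  have vb: "cmod (v t) \<le> 2 * cmod (y t) * exp (\<tau> * t)" if "t \<ge> X" for t
  proof -
    have "inverse (cmod (?e t)) = exp (\<tau> * t) * inverse (cmod (jost_m q k t))" unfolding ne by (simp add: exp_minus)
    also have "\<dots> \<le> exp (\<tau> * t) * 2"
      using nm[OF that] le_imp_inverse_le[of "1/2" "cmod (jost_m q k t)"] by (intro mult_left_mono) auto
    finally have "inverse (cmod (?e t)) \<le> 2 * exp (\<tau> * t)" by simp
    from mult_left_mono[OF this, of "cmod (y t)"] show ?thesis by (simp add: v_def norm_mult norm_inverse mult_ac)
  qed
  have main: "cmod (v (x + L) - v x) \<ge> cmod W * (K / (4 * cmod k)) * exp (2 * \<tau> * x)" if x: "x \<ge> X" for x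
  proof -
    have sub: "{x..x+L} \<subseteq> {a..}" using x by (auto simp: X_def)
    have vd: "(v has_vector_derivative - W / (?e t)\<^sup>2) (at t within {x..x+L})" if t: "t \<in> {x..x+L}" for t
    proof -
      have tX: "t \<ge> X" "t \<ge> a" using t x by (auto simp: X_def)
      have dy: "(y has_vector_derivative y1 t) (at t within {x..x+L})"
        by (rule loc_ac_has_vector_derivative[OF _ solution_continuous(2)[OF sol sub] sub t]) (use sol in \<open>simp add: solution_def\<close>)
      have de: "(?e has_vector_derivative ?e1 t) (at t within {x..x+L})"
        by (rule loc_ac_has_vector_derivative[OF _ solution_continuous(2)[OF solj sub] sub t]) (use solj in \<open>simp add: solution_def\<close>)
      have "(inverse has_field_derivative - (inverse (?e t) ^ 2)) (at (?e t) within ?e ` {x..x+L})"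
        using DERIV_inverse[OF e0[OF tX(1)]] by (simp add: numeral_2_eq_2)
      from field_vector_diff_chain_within[OF de this]
      have di: "((\<lambda>t. inverse (?e t)) has_vector_derivative ?e1 t * - (inverse (?e t) ^ 2)) (at t within {x..x+L})"
        by (simp add: comp_def)
      have "(v has_vector_derivative y t * (?e1 t * - (inverse (?e t) ^ 2)) + y1 t * inverse (?e t)) (at t within {x..x+L})"
        unfolding v_def by (rule has_vector_derivative_mult[OF dy di])
      moreover have "y t * (?e1 t * - (inverse (?e t) ^ 2)) + y1 t * inverse (?e t) = - W / (?e t)\<^sup>2"
        unfolding Wc[OF tX(2), symmetric] using e0[OF tX(1)] by (simp add: field_simps power2_eq_square)
      ultimately show ?thesis by simp
    qed
    have I1: "((\<lambda>t. - W / (?e t)\<^sup>2) has_integral v (x + L) - v x) {x..x+L}"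
      using L vd by (intro fundamental_theorem_of_calculus) auto
    let ?F = "\<lambda>t. exp (- 2 * \<i> * k * complex_of_real t)"
    have I2: "(?F has_integral (1 / (- 2 * \<i> * k)) * ?F (x + L) - (1 / (- 2 * \<i> * k)) * ?F x) {x..x+L}"
    proof (rule fundamental_theorem_of_calculus)
      fix t :: real
      have "((\<lambda>z. (1 / (- 2 * \<i> * k)) * exp (- 2 * \<i> * k * z)) has_field_derivative exp (- 2 * \<i> * k * of_real t)) (at (of_real t))"
        using k(2) by (auto intro!: derivative_eq_intros)
      then show "((\<lambda>t. (1 / (- 2 * \<i> * k)) * ?F t) has_vector_derivative ?F t) (at t within {x..x+L})"
        using has_vector_derivative_real_field has_vector_derivative_at_within by blast
    qed (use L in simp)
    have FL: "?F (x + L) = ?F x * exp (- 2 * \<i> * k * of_real L)" by (simp add: exp_add[symmetric] algebra_simps)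
    define I where "I = (1 / (- 2 * \<i> * k)) * ?F (x + L) - (1 / (- 2 * \<i> * k)) * ?F x"
    have Iv: "I = ?F x * (1 - exp (- 2 * \<i> * k * of_real L)) / (2 * \<i> * k)"
      unfolding I_def FL using k(2) by (simp add: field_simps)
    have nF: "cmod (?F t) = exp (2 * \<tau> * t)" for t by (simp add: \<tau>_def)
    have nI: "cmod I = exp (2 * \<tau> * x) * (K / (2 * cmod k))"
      unfolding Iv norm_divide norm_mult nF K_def by (simp add: norm_mult)
    have "((\<lambda>t. - W / (?e t)\<^sup>2 + W * ?F t) has_integral (v (x + L) - v x) + W * I) {x..x+L}"
      by (rule has_integral_add[OF I1 has_integral_mult_right[OF I2[folded I_def]]])
    then have hi: "((\<lambda>t. - W / (?e t)\<^sup>2 + W * ?F t) has_integral (v (x + L) - v x) + W * I) (cbox x (x + L))" by simp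
    have bnd: "cmod (- W / (?e t)\<^sup>2 + W * ?F t) \<le> cmod W * (exp (2 * \<tau> * (x + L)) * \<eta>)" if t: "t \<in> {x..x + L}" for t
    proof -
      have tX: "t \<ge> X" using x t by simp
      have inv: "1 / (?e t)\<^sup>2 = ?F t * (1 / (jost_m q k t)\<^sup>2)"
      proof -
        have "(?e t)\<^sup>2 = exp (2 * \<i> * k * of_real t) * (jost_m q k t)\<^sup>2"
          unfolding jost_def power_mult_distrib by (simp add: exp_double[symmetric] mult_ac)
        then show ?thesis by (simp add: exp_minus divide_inverse)
      qed
      have "- W / (?e t)\<^sup>2 + W * ?F t = - W * (1 / (?e t)\<^sup>2) + W * ?F t" by simp
      also have "\<dots> = - W * (?F t * (1 / (jost_m q k t)\<^sup>2 - 1))"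
        unfolding inv by (simp only: right_diff_distrib mult_1_right) simp
      finally have "cmod (- W / (?e t)\<^sup>2 + W * ?F t) = cmod W * (exp (2 * \<tau> * t) * dist (1 / (jost_m q k t)\<^sup>2) 1)"
        unfolding dist_norm by (simp only: norm_mult norm_minus_cancel nF)
      also have "\<dots> \<le> cmod W * (exp (2 * \<tau> * (x + L)) * \<eta>)"
        using X0[of t] tX t \<tau> by (intro mult_left_mono mult_mono) (auto simp: X_def less_imp_le intro!: mult_left_mono)
      finally show ?thesis .
    qed
    have "cmod ((v (x + L) - v x) + W * I) \<le> (cmod W * (exp (2 * \<tau> * (x + L)) * \<eta>)) * measure lborel (cbox x (x + L))"
      by (rule has_integral_bound[OF _ hi]) (use \<eta> bnd in auto)
    also have "\<dots> = cmod W * exp (2 * \<tau> * x) * (K / (4 * cmod k))"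
    proof -
      have e: "exp (2 * \<tau> * (x + L)) = exp (2 * \<tau> * x) * exp (2 * \<tau> * L)" by (simp add: distrib_left exp_add)
      have "exp (2 * \<tau> * (x + L)) * \<eta> * L = exp (2 * \<tau> * x) * (K / (4 * cmod k))"
        unfolding e \<eta>_def using L by (simp add: field_simps)
      moreover have "measure lborel (cbox x (x + L)) = L" using L by simp
      ultimately show ?thesis by (simp only: mult.assoc)
    qed
    finally have "cmod ((v (x + L) - v x) + W * I) \<le> cmod W * exp (2 * \<tau> * x) * (K / (4 * cmod k))" .
    moreover have "cmod (W * I) = cmod W * exp (2 * \<tau> * x) * (K / (2 * cmod k))" unfolding norm_mult nI by simp
    moreover have "cmod (W * I) \<le> cmod ((v (x + L) - v x) + W * I) + cmod (v (x + L) - v x)"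
      using norm_triangle_ineq4[of "(v (x + L) - v x) + W * I" "v (x + L) - v x"] by simp
    moreover have "cmod W * exp (2 * \<tau> * x) * (K / (2 * cmod k)) = 2 * (cmod W * exp (2 * \<tau> * x) * (K / (4 * cmod k)))" by simp
    ultimately have "cmod W * exp (2 * \<tau> * x) * (K / (4 * cmod k)) \<le> cmod (v (x + L) - v x)" by linarith
    then show ?thesis by (simp only: mult_ac)
  qed
  \<comment> \<open>The denominator undoes the passage from the quotient \<open>v\<close> back to
    \<open>y\<close>: \<open>|v t|\<close> is at most \<open>2 |y t| exp(\<tau> t)\<close>, and the
    exponential is taken at the right end \<open>x + L\<close> for both terms.\<close>
  define c where "c = cmod W * (K / (4 * cmod k)) / (2 * exp (\<tau> * L))"
  have c: "c > 0" using W K k by (simp add: c_def W_def)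
  have fin: "c * exp (\<tau> * x) \<le> cmod (y x) + cmod (y (x + L))" if x: "x \<ge> X" for x
  proof -
    have "cmod W * (K / (4 * cmod k)) * exp (2 * \<tau> * x) \<le> cmod (v (x + L)) + cmod (v x)"
      using main[OF x] norm_triangle_ineq4[of "v (x + L)" "v x"] by linarith
    also have "\<dots> \<le> 2 * cmod (y (x + L)) * exp (\<tau> * (x + L)) + 2 * cmod (y x) * exp (\<tau> * x)"
      using x L by (intro add_mono vb) auto
    also have "\<dots> \<le> 2 * cmod (y (x + L)) * exp (\<tau> * (x + L)) + 2 * cmod (y x) * exp (\<tau> * (x + L))"
      using \<tau> L by (intro add_left_mono mult_left_mono) (auto intro!: mult_left_mono)
    also have "\<dots> = (2 * exp (\<tau> * L)) * exp (\<tau> * x) * (cmod (y x) + cmod (y (x + L)))"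
      by (simp add: distrib_left exp_add algebra_simps)
    finally have "cmod W * (K / (4 * cmod k)) * exp (2 * \<tau> * x) \<le> (2 * exp (\<tau> * L)) * exp (\<tau> * x) * (cmod (y x) + cmod (y (x + L)))" .
    moreover have "cmod W * (K / (4 * cmod k)) * exp (2 * \<tau> * x) = (2 * exp (\<tau> * L)) * exp (\<tau> * x) * (c * exp (\<tau> * x))"
    proof -
      have "exp (2 * \<tau> * x) = exp (\<tau> * x) * exp (\<tau> * x)" by (simp add: exp_add[symmetric])
      then show ?thesis by (simp add: c_def mult_ac)
    qed
    ultimately show ?thesis by (simp add: mult_le_cancel_left_pos)
  qed
  show ?thesis
    by (intro exI[of _ c] exI[of _ L] exI[of _ X] conjI c L allI impI) (use fin in \<open>auto simp: X_def \<tau>_def\<close>)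
qed

text \<open>This version reaches real \<open>k\<close>, where square integrability is not at hand:
  decay relative to exp(ikx) contradicts the lower bound of \<open>solution_growth\<close> at two
  points at distance \<open>L\<close>.\<close>

lemma wronskian_zero_of_decay:
  assumes q: "integrable lebesgue q" and k: "Im k \<ge> 0" "k \<noteq> 0"
    and sol: "solution {a..} q k y y1" and lim: "((\<lambda>x. exp (- \<i> * k * of_real x) * y x) \<longlongrightarrow> 0) at_top"
  shows "y a * jost1 q k a - y1 a * jost q k a = 0"
proof (rule ccontr)
  assume "y a * jost1 q k a - y1 a * jost q k a \<noteq> 0"
  from solution_growth[OF q k sol this] obtain c L X where c: "c > 0" "L > 0" "X \<ge> max a 0"
    "\<And>x. x \<ge> X \<Longrightarrow> c * exp (Im k * x) \<le> cmod (y x) + cmod (y (x + L))" by blast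
  have "eventually (\<lambda>x. dist (exp (- \<i> * k * of_real x) * y x) 0 < c / 2) at_top"
    by (rule tendstoD[OF lim]) (use c in simp)
  then obtain N where N: "\<And>x. x \<ge> N \<Longrightarrow> dist (exp (- \<i> * k * of_real x) * y x) 0 < c / 2"
    unfolding eventually_at_top_linorder by blast
  have y: "cmod (y x) < c / 2" if "x \<ge> max N X" for x
  proof -
    have "Im k * x \<ge> 0" using that c k by (intro mult_nonneg_nonneg) auto
    then have "1 * cmod (y x) \<le> exp (Im k * x) * cmod (y x)" by (intro mult_right_mono) auto
    also have "\<dots> = cmod (exp (- \<i> * k * of_real x) * y x)" unfolding norm_mult by simp
    also have "\<dots> < c / 2" using N[of x] that by (simp add: dist_norm)
    finally show ?thesis by simp
  qed
  define x where "x = max N X"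
  have "c * 1 \<le> c * exp (Im k * x)" using c k by (intro mult_left_mono) (auto simp: x_def)
  also have "\<dots> \<le> cmod (y x) + cmod (y (x + L))" by (rule c(4)) (simp add: x_def)
  also have "\<dots> < c / 2 + c / 2" using c by (intro add_strict_mono y) (auto simp: x_def)
  finally show False by simp
qed

text \<open>Otherwise \<open>solution_growth\<close> bounds \<open>|y x|^2 + |y (x + L)|^2\<close>
  below by a positive constant from some \<open>X\<close> on, and such a function is not
  integrable.\<close>

lemma wronskian_zero_of_L2:
  assumes q: "integrable lebesgue q" and k: "Im k \<ge> 0" "k \<noteq> 0"
    and sol: "solution {a..} q k y y1" and L2: "set_integrable lebesgue {a..} (\<lambda>x. (cmod (y x))\<^sup>2)"
  shows "y a * jost1 q k a - y1 a * jost q k a = 0"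
proof (rule ccontr)
  assume "y a * jost1 q k a - y1 a * jost q k a \<noteq> 0"
  from solution_growth[OF q k sol this] obtain c L X where c: "c > 0" "L > 0" "X \<ge> max a 0"
    "\<And>x. x \<ge> X \<Longrightarrow> c * exp (Im k * x) \<le> cmod (y x) + cmod (y (x + L))" by blast
  let ?f = "\<lambda>x. (cmod (y x))\<^sup>2"
  have i1: "set_integrable lebesgue {X..} ?f" by (rule set_integrable_subset[OF L2]) (use c in auto)
  have i2: "set_integrable lebesgue {X..} (\<lambda>x. ?f (x + L))"
  proof -
    have "set_integrable lebesgue {X+L..} ?f" by (rule set_integrable_subset[OF L2]) (use c in auto)
    then have "integrable lebesgue (\<lambda>x. indicat_real {X+L..} (L + 1 * x) *\<^sub>R ?f (L + 1 * x))"
      unfolding set_integrable_def by (rule lebesgue_integrable_real_affine) simp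
    moreover have "(\<lambda>x. indicat_real {X+L..} (L + 1 * x) *\<^sub>R ?f (L + 1 * x)) = (\<lambda>x. indicat_real {X..} x *\<^sub>R ?f (x + L))"
      by (auto simp: indicator_def add.commute)
    ultimately show ?thesis unfolding set_integrable_def by simp
  qed
  have i: "set_integrable lebesgue {X..} (\<lambda>x. ?f x + ?f (x + L))" by (rule set_integral_add(1)[OF i1 i2])
  define M where "M = (LINT x:{X..}|lebesgue. ?f x + ?f (x + L))"
  have low: "c\<^sup>2 / 2 \<le> ?f x + ?f (x + L)" if "x \<ge> X" for x
  proof -
    have "c * 1 \<le> c * exp (Im k * x)" using c k that by (intro mult_left_mono) auto
    also have "\<dots> \<le> cmod (y x) + cmod (y (x + L))" by (rule c(4)[OF that])
    finally have "c\<^sup>2 \<le> (cmod (y x) + cmod (y (x + L)))\<^sup>2" using c by (intro power_mono) auto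
    moreover have "(cmod (y x) + cmod (y (x + L)))\<^sup>2 \<le> 2 * (?f x + ?f (x + L))"
      using sum_squares_bound[of "cmod (y x)" "cmod (y (x + L))"] by (simp add: power2_sum)
    ultimately have "c\<^sup>2 \<le> 2 * (?f x + ?f (x + L))" by (rule order_trans)
    then show ?thesis by simp
  qed
  have bound: "real n * (c\<^sup>2 / 2) \<le> M" for n
  proof -
    have ci: "set_integrable lebesgue {X..X+real n} (\<lambda>x. c\<^sup>2 / 2)" by (rule absolutely_integrable_continuous_real) auto
    have "real n * (c\<^sup>2 / 2) = (LINT x:{X..X+real n}|lebesgue. c\<^sup>2 / 2)"
      using set_lebesgue_integral_eq_integral(2)[OF ci] by simp
    also have "\<dots> \<le> M" unfolding M_def set_lebesgue_integral_def
      using ci i low by (intro Bochner_Integration.integral_mono) (auto simp: set_integrable_def indicator_def)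
    finally show ?thesis .
  qed
  obtain n :: nat where "M / (c\<^sup>2 / 2) < real n" using reals_Archimedean2 by blast
  then have "M < real n * (c\<^sup>2 / 2)" using c by (simp add: field_simps)
  then show False using bound[of n] by linarith
qed

text \<open>The Wronskian is constant, so it also vanishes at a point \<open>X\<close> far out,
  where the Jost solution is nonzero because \<open>jost_m\<close> tends to 1. There the Cauchy data
  are proportional, and uniqueness of solutions does the rest.\<close>

lemma solution_proportional_jost:
  assumes q: "integrable lebesgue q" and k: "Im k \<ge> 0" "k \<noteq> 0"
    and S: "is_interval S" "{a..} \<subseteq> S"
    and sol: "solution S q k y y1" and W: "y a * jost1 q k a - y1 a * jost q k a = 0"
  shows "\<exists>C. \<forall>x\<in>S. y x = C * jost q k x \<and> y1 x = C * jost1 q k x"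
proof -
  have solj: "solution S q k (jost q k) (jost1 q k)" by (rule solution_subset[OF solution_jost[OF q k]]) simp
  have "eventually (\<lambda>x. dist (jost_m q k x) 1 < 1 \<and> x \<ge> a) at_top"
    using tendstoD[OF jost_asymp(6)[OF q k], of 1] by (intro eventually_conj eventually_ge_at_top) auto
  from eventually_happens'[OF trivial_limit_at_top_linorder this] obtain X where X: "dist (jost_m q k X) 1 < 1" "X \<ge> a"
    by blast
  have "jost_m q k X \<noteq> 0" using X(1) by auto
  then have e0: "jost q k X \<noteq> 0" by (simp add: jost_def)
  have XS: "X \<in> S" "a \<in> S" using X(2) S(2) by auto
  have WX: "y X * jost1 q k X - y1 X * jost q k X = 0"
    using wronskian_const[OF sol solj S(1), of a X] W XS by simp
  define C where "C = y X / jost q k X"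
  have d: "solution S q k (\<lambda>x. 1 * y x + (- C) * jost q k x) (\<lambda>x. 1 * y1 x + (- C) * jost1 q k x)"
    by (rule solution_lincomb[OF sol solj])
  have z: "1 * y X + (- C) * jost q k X = 0" "1 * y1 X + (- C) * jost1 q k X = 0"
    using e0 WX by (simp_all add: C_def divide_simps mult.commute)
  show ?thesis
  proof (intro exI ballI)
    fix x assume "x \<in> S"
    from solution_unique[OF d q S(1) XS(1) z this]
    show "y x = C * jost q k x \<and> y1 x = C * jost1 q k x" by simp
  qed
qed

section \<open>Identification with the Jost solutions of the statement\<close>

text \<open>For uniqueness, the difference of two candidates decays relative to exp(ikx), hence is a
  multiple of the Jost solution; comparison of the limits at infinity shows that the multiple is
  0.\<close>

lemma jost_plus_eq:
  assumes q: "integrable lebesgue q" and k: "Im k \<ge> 0" "k \<noteq> 0"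
  shows "schroedinger_eq UNIV q y (\<lambda>x. k\<^sup>2 * y x) \<and> ((\<lambda>x. exp (- \<i> * k * of_real x) * y x) \<longlongrightarrow> 1) at_top \<longleftrightarrow> y = jost q k"
    and "jost_plus q k = jost q k"
proof -
  have *: "schroedinger_eq UNIV q y (\<lambda>x. k\<^sup>2 * y x) \<and> ((\<lambda>x. exp (- \<i> * k * of_real x) * y x) \<longlongrightarrow> 1) at_top \<longleftrightarrow> y = jost q k" for y
  proof
    assume "y = jost q k"
    then show "schroedinger_eq UNIV q y (\<lambda>x. k\<^sup>2 * y x) \<and> ((\<lambda>x. exp (- \<i> * k * of_real x) * y x) \<longlongrightarrow> 1) at_top"
      using solution_jost[OF q k] jost_asymp(4)[OF q k] schroedinger_eq_iff_solution by auto
  next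
    assume a: "schroedinger_eq UNIV q y (\<lambda>x. k\<^sup>2 * y x) \<and> ((\<lambda>x. exp (- \<i> * k * of_real x) * y x) \<longlongrightarrow> 1) at_top"
    then obtain y1 where y1: "solution UNIV q k y y1" unfolding schroedinger_eq_iff_solution by blast
    let ?d = "\<lambda>x. 1 * y x + (- 1) * jost q k x" and ?d1 = "\<lambda>x. 1 * y1 x + (- 1) * jost1 q k x"
    have d: "solution UNIV q k ?d ?d1" by (rule solution_lincomb[OF y1 solution_jost[OF q k]])
    have "((\<lambda>x. exp (- \<i> * k * of_real x) * y x - exp (- \<i> * k * of_real x) * jost q k x) \<longlongrightarrow> 1 - 1) at_top"
      using a jost_asymp(4)[OF q k] by (intro tendsto_diff) auto
    then have lim: "((\<lambda>x. exp (- \<i> * k * of_real x) * ?d x) \<longlongrightarrow> 0) at_top" by (simp add: algebra_simps)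
    have "?d 0 * jost1 q k 0 - ?d1 0 * jost q k 0 = 0"
      by (rule wronskian_zero_of_decay[OF q k _ lim]) (rule solution_subset[OF d], simp)
    from solution_proportional_jost[OF q k is_interval_univ _ d this]
    obtain C where C: "\<And>x. ?d x = C * jost q k x" by auto
    have "((\<lambda>x. C * (exp (- \<i> * k * of_real x) * jost q k x)) \<longlongrightarrow> C * 1) at_top"
      by (intro tendsto_intros jost_asymp(4)[OF q k])
    moreover have "(\<lambda>x. C * (exp (- \<i> * k * of_real x) * jost q k x)) = (\<lambda>x. exp (- \<i> * k * of_real x) * ?d x)"
      unfolding C by (simp add: mult_ac)
    ultimately have "C * 1 = 0" using lim tendsto_unique[OF trivial_limit_at_top_linorder] by metis
    then have "?d x = 0" for x using C[of x] by simp
    then show "y = jost q k" by (simp add: fun_eq_iff)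
  qed
  show "schroedinger_eq UNIV q y (\<lambda>x. k\<^sup>2 * y x) \<and> ((\<lambda>x. exp (- \<i> * k * of_real x) * y x) \<longlongrightarrow> 1) at_top \<longleftrightarrow> y = jost q k" by (rule *)
  show "jost_plus q k = jost q k" unfolding jost_plus_def * by simp
qed

lemma integrable_reflect_lebesgue:
  fixes q :: "real \<Rightarrow> real"
  shows "integrable lebesgue q \<Longrightarrow> integrable lebesgue (\<lambda>x. q (- x))"
  using lebesgue_integrable_real_affine[of q "-1" 0] by simp

lemma schroedinger_eq_reflect:
  assumes "schroedinger_eq S q y (\<lambda>x. k\<^sup>2 * y x)"
  shows "schroedinger_eq (uminus ` S) (\<lambda>x. q (- x)) (\<lambda>x. y (- x)) (\<lambda>x. k\<^sup>2 * y (- x))"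
proof -
  obtain y1 where "solution S q k y y1" using assms unfolding schroedinger_eq_iff_solution by blast
  from solution_reflect[OF this] show ?thesis
    using schroedinger_eq_iff_solution[of "uminus ` S" "\<lambda>x. q (- x)" "\<lambda>x. y (- x)" k] by blast
qed

text \<open>Under \<open>x \<mapsto> - x\<close> the left normalization at frequency
  \<open>k\<close> becomes the right normalization at \<open>- k\<close>, which lies in the upper
  half-plane. From here on left Jost solutions occur only as right ones of the reflected
  potential.\<close>

lemma jost_minus_eq:
  assumes q: "integrable lebesgue q" and k: "Im k \<le> 0" "k \<noteq> 0"
  shows "jost_minus q k = (\<lambda>x. jost (\<lambda>x. q (- x)) (- k) (- x))"
proof -
  let ?q = "\<lambda>x. q (- x)"
  have qr: "integrable lebesgue ?q" by (rule integrable_reflect_lebesgue[OF q])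
  have k': "Im (- k) \<ge> 0" "- k \<noteq> 0" using k by auto
  have lim: "((\<lambda>x. exp (- \<i> * k * of_real x) * y x) \<longlongrightarrow> 1) at_bot \<longleftrightarrow>
     ((\<lambda>x. exp (- \<i> * (- k) * of_real x) * y (- x)) \<longlongrightarrow> 1) at_top" for y
    unfolding filterlim_at_bot_mirror by simp
  have eq: "schroedinger_eq UNIV q y (\<lambda>x. k\<^sup>2 * y x) \<longleftrightarrow> schroedinger_eq UNIV ?q (\<lambda>x. y (- x)) (\<lambda>x. (- k)\<^sup>2 * y (- x))" for y
  proof
    show "schroedinger_eq UNIV ?q (\<lambda>x. y (- x)) (\<lambda>x. (- k)\<^sup>2 * y (- x))" if "schroedinger_eq UNIV q y (\<lambda>x. k\<^sup>2 * y x)"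
      using schroedinger_eq_reflect[OF that] by (simp only: power2_minus surj_uminus)
    show "schroedinger_eq UNIV q y (\<lambda>x. k\<^sup>2 * y x)" if "schroedinger_eq UNIV ?q (\<lambda>x. y (- x)) (\<lambda>x. (- k)\<^sup>2 * y (- x))"
      using schroedinger_eq_reflect[OF that] by (simp only: power2_minus minus_minus surj_uminus)
  qed
  have "schroedinger_eq UNIV q y (\<lambda>x. k\<^sup>2 * y x) \<and> ((\<lambda>x. exp (- \<i> * k * of_real x) * y x) \<longlongrightarrow> 1) at_bot \<longleftrightarrow>
      y = (\<lambda>x. jost ?q (- k) (- x))" for y
  proof -
    have "schroedinger_eq UNIV q y (\<lambda>x. k\<^sup>2 * y x) \<and> ((\<lambda>x. exp (- \<i> * k * of_real x) * y x) \<longlongrightarrow> 1) at_bot \<longleftrightarrow>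
      (\<lambda>x. y (- x)) = jost ?q (- k)"
      unfolding lim eq by (rule jost_plus_eq(1)[OF qr k'])
    also have "\<dots> \<longleftrightarrow> y = (\<lambda>x. jost ?q (- k) (- x))"
    proof
      assume h: "(\<lambda>x. y (- x)) = jost ?q (- k)"
      show "y = (\<lambda>x. jost ?q (- k) (- x))"
        unfolding h[symmetric] by (simp only: minus_minus)
    qed simp
    finally show ?thesis .
  qed
  then show ?thesis unfolding jost_minus_def by (simp only: the_eq_trivial)
qed

lemma jost_cnj:
  assumes q: "integrable lebesgue q" and k: "Im k \<ge> 0" "k \<noteq> 0"
  shows "jost q (- cnj k) x = cnj (jost q k x)" "jost1 q (- cnj k) x = cnj (jost1 q k x)"
proof -
  have m: "jost_m q (- cnj k) t = cnj (jost_m q k t)" for t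
    by (rule jost_m_cnj[OF summable_norm_cancel[OF jost_m_bounds_simple(1)[OF q k]]])
  have e: "exp (\<i> * - cnj k * of_real t) = cnj (exp (\<i> * k * of_real t))" for t unfolding exp_cnj by simp
  have e2: "exp (2 * \<i> * - cnj k * of_real t) = cnj (exp (2 * \<i> * k * of_real t))" for t unfolding exp_cnj by simp
  have e3: "exp (- \<i> * - cnj k * of_real t) = cnj (exp (- \<i> * k * of_real t))" for t unfolding exp_cnj by simp
  show "jost q (- cnj k) x = cnj (jost q k x)" unfolding jost_def m e by simp
  have sc: "(LINT t:A|lebesgue. cnj (f t)) = cnj (LINT t:A|lebesgue. f t)" for A and f :: "real \<Rightarrow> complex"
    unfolding set_lebesgue_integral_def Bochner_Integration.integral_cnj[symmetric] by simp
  have a: "jost_alpha q (- cnj k) x = cnj (jost_alpha q k x)"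
  proof -
    have "jost_alpha q (- cnj k) x = (LINT t:{x..}|lebesgue. cnj (of_real (q t) * jost_m q k t))"
      unfolding jost_alpha_def m by simp
    then show ?thesis unfolding sc jost_alpha_def .
  qed
  have b: "jost_beta q (- cnj k) x = cnj (jost_beta q k x)"
  proof -
    have "jost_beta q (- cnj k) x = (LINT t:{x..}|lebesgue. cnj (exp (2 * \<i> * k * of_real t) * (of_real (q t) * jost_m q k t)))"
      unfolding jost_beta_def m e2 by simp
    then show ?thesis unfolding sc jost_beta_def .
  qed
  show "jost1 q (- cnj k) x = cnj (jost1 q k x)" unfolding jost1_def a b e e3 by simp
qed

section \<open>Dependence on the spectral parameter\<close>

definition upper_half :: "complex set" where "upper_half = {k. Im k > 0}"
text \<open>Punctured at the origin, where the Jost functions need not have limits.\<close>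

definition closed_upper :: "complex set" where "closed_upper = {k. Im k \<ge> 0 \<and> k \<noteq> 0}"

lemma open_upper_half: "open upper_half"
  unfolding upper_half_def by (rule open_halfspace_Im_gt)

lemma upper_half_subset_closed_upper: "upper_half \<subseteq> closed_upper"
  by (auto simp: upper_half_def closed_upper_def)

text \<open>The estimates of the Neumann series are uniform only for \<open>|k| > r\<close>.
  Continuity is local, and each point of \<open>closed_upper\<close> has some distance from 0, so
  this is enough.\<close>

lemma continuous_on_closed_upperI:
  assumes "\<And>r. r > 0 \<Longrightarrow> continuous_on {k. Im k \<ge> 0 \<and> cmod k > r} f"
  shows "continuous_on closed_upper f"
  unfolding continuous_on_eq_continuous_within
proof
  fix k assume k: "k \<in> closed_upper"
  define r where "r = cmod k / 2"
  have r: "r > 0" "cmod k > r" using k by (auto simp: r_def closed_upper_def)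
  have "continuous (at k within {k. Im k \<ge> 0 \<and> cmod k > r}) f"
    using assms[OF r(1)] k r by (auto simp: continuous_on_eq_continuous_within closed_upper_def)
  moreover have "at k within closed_upper = at k within {k. Im k \<ge> 0 \<and> cmod k > r}"
  proof (rule at_within_nhd)
    show "k \<in> {k. cmod k > r}" using r by simp
    show "open {k. cmod k > r}" by (intro open_Collect_less continuous_intros)
    show "closed_upper \<inter> {k. cmod k > r} - {k} = {k. Im k \<ge> 0 \<and> cmod k > r} \<inter> {k. cmod k > r} - {k}"
      using r by (auto simp: closed_upper_def)
  qed
  ultimately show "continuous (at k within closed_upper) f" by simp
qed

lemma holomorphic_on_upper_halfI:
  assumes "\<And>r. r > 0 \<Longrightarrow> f holomorphic_on {k. Im k > 0 \<and> cmod k > r}"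
  shows "f holomorphic_on upper_half"
proof -
  have o: "open {k. Im k > 0 \<and> cmod k > r}" for r by (intro open_Collect_conj open_Collect_less continuous_intros)
  show ?thesis
    unfolding holomorphic_on_open[OF open_upper_half]
  proof
    fix k assume k: "k \<in> upper_half"
    define r where "r = cmod k / 2"
    have "k \<noteq> 0" using k by (auto simp: upper_half_def)
    then have r: "r > 0" "cmod k > r" by (auto simp: r_def)
    show "\<exists>f'. (f has_field_derivative f') (at k)"
      using assms[OF r(1)] k r(2) unfolding holomorphic_on_open[OF o] upper_half_def by blast
  qed
qed

lemma jost_iter_norm_le:
  assumes q: "integrable lebesgue q" and k: "Im k \<ge> 0" "cmod k > r" and r: "r > 0"
  shows "cmod (jost_iter q k n x) \<le> ((\<integral>t. \<bar>q t\<bar> \<partial>lebesgue) / r) ^ n / fact n"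
proof -
  have k0: "k \<noteq> 0" using k r by auto
  let ?p = "\<lambda>t. \<bar>q t\<bar> / cmod k"
  have p: "integrable lebesgue ?p" using q by simp
  have "cmod (jost_iter q k n x) \<le> (LINT t:{x..}|lebesgue. ?p t) ^ n / fact n"
    by (rule jost_iter_bound[OF q k(1) k0 p, where x0=x]) (auto intro: jost_kernel_dom[OF k(1) k0])
  also have "\<dots> \<le> ((\<integral>t. \<bar>q t\<bar> \<partial>lebesgue) / r) ^ n / fact n"
  proof (intro divide_right_mono power_mono)
    have "(LINT t:{x..}|lebesgue. ?p t) \<le> (\<integral>t. ?p t \<partial>lebesgue)" by (rule tail_integral_mono(3)[OF p _ order_refl]) simp
    also have "(\<integral>t. ?p t \<partial>lebesgue) = (\<integral>t. \<bar>q t\<bar> \<partial>lebesgue) / cmod k" by simp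
    also have "\<dots> \<le> (\<integral>t. \<bar>q t\<bar> \<partial>lebesgue) / r"
      by (rule divide_left_mono) (use k r k0 in \<open>auto intro!: mult_pos_pos\<close>)
    finally show "(LINT t:{x..}|lebesgue. ?p t) \<le> (\<integral>t. \<bar>q t\<bar> \<partial>lebesgue) / r" .
    show "0 \<le> (LINT t:{x..}|lebesgue. ?p t)" by (rule tail_integral_mono(1)[OF p _ order_refl]) simp
  qed simp
  finally show ?thesis .
qed

lemma jost_iter_integrand_dom:
  assumes q: "integrable lebesgue q" and k: "Im k \<ge> 0" "cmod k > r" and r: "r > 0"
  shows "cmod (jost_kernel k (t - x) * of_real (q t) * jost_iter q k n t) \<le> \<bar>q t\<bar> * (((\<integral>t. \<bar>q t\<bar> \<partial>lebesgue) / r) ^ n / fact n / r)"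
    and "(\<lambda>t. jost_kernel k (t - x) * of_real (q t) * jost_iter q k n t) \<in> borel_measurable lebesgue"
proof -
  have k0: "k \<noteq> 0" using k r by auto
  have kr: "1 / cmod k \<le> 1 / r" using k r by (simp add: frac_le)
  have "cmod (jost_kernel k (t - x) * of_real (q t) * jost_iter q k n t) \<le> (1 / r) * \<bar>q t\<bar> * (((\<integral>t. \<bar>q t\<bar> \<partial>lebesgue) / r) ^ n / fact n)"
    unfolding norm_mult
    using order_trans[OF jost_kernel_bounds(1)[OF k(1) k0, of "t - x"] kr] jost_iter_norm_le[OF assms, of n t] r
    by (intro mult_mono) auto
  then show "cmod (jost_kernel k (t - x) * of_real (q t) * jost_iter q k n t) \<le> \<bar>q t\<bar> * (((\<integral>t. \<bar>q t\<bar> \<partial>lebesgue) / r) ^ n / fact n / r)"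
    by (simp add: mult_ac)
  have ii: "continuous_on UNIV (jost_iter q k n)" "\<And>t. cmod (jost_iter q k n t) \<le> ((\<integral>t. \<bar>q t\<bar> \<partial>lebesgue) / cmod k) ^ n"
    using jost_iter_continuous_bounded[OF q k(1) k0, of n] by auto
  show "(\<lambda>t. jost_kernel k (t - x) * of_real (q t) * jost_iter q k n t) \<in> borel_measurable lebesgue"
    by (rule borel_measurable_integrable[OF jost_iter_integrand[OF q k(1) k0 lebesgue_measurable_continuous[OF ii(1)] ii(2)]])
qed

lemma jost_iter_regular:
  assumes q: "integrable lebesgue q" and r: "r > 0"
  shows "continuous_on {k. Im k \<ge> 0 \<and> cmod k > r} (\<lambda>k. jost_iter q k n x) \<and>
    (\<lambda>k. jost_iter q k n x) holomorphic_on {k. Im k > 0 \<and> cmod k > r}"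
proof (induction n arbitrary: x)
  case (Suc n)
  let ?w = "\<lambda>t. \<bar>q t\<bar> * (((\<integral>t. \<bar>q t\<bar> \<partial>lebesgue) / r) ^ n / fact n / r)"
  have w: "integrable lebesgue ?w" using q by simp
  have D0: "0 \<notin> {k. Im k \<ge> 0 \<and> cmod k > r}" "0 \<notin> {k. Im k > 0 \<and> cmod k > r}" using r by auto
  have cK: "continuous_on {k. Im k \<ge> 0 \<and> cmod k > r} (\<lambda>k. jost_kernel k s)" for s
  proof -
    have "(\<lambda>k. jost_kernel k s) holomorphic_on - {0}" by (rule holomorphic_on_jost_kernel) simp
    then show ?thesis by (rule continuous_on_subset[OF holomorphic_on_imp_continuous_on]) (use r in auto)
  qed
  have "continuous_on {k. Im k \<ge> 0 \<and> cmod k > r} (\<lambda>k. jost_iter q k (Suc n) x)"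
    unfolding jost_iter.simps
  proof (rule continuous_on_integral_param[where w="?w"])
    show "continuous_on {k. Im k \<ge> 0 \<and> cmod k > r} (\<lambda>k. jost_kernel k (t - x) * of_real (q t) * jost_iter q k n t)" for t
      by (intro continuous_on_mult cK conjunct1[OF Suc.IH] continuous_on_const)
  qed (use jost_iter_integrand_dom[OF q _ _ r] w in auto)
  moreover have "(\<lambda>k. jost_iter q k (Suc n) x) holomorphic_on {k. Im k > 0 \<and> cmod k > r}"
    unfolding jost_iter.simps
  proof (rule holomorphic_on_integral_param[where w="?w"])
    show "(\<lambda>k. jost_kernel k (t - x) * of_real (q t) * jost_iter q k n t) holomorphic_on {k. Im k > 0 \<and> cmod k > r}" for t
      by (intro holomorphic_on_mult holomorphic_on_jost_kernel conjunct2[OF Suc.IH] holomorphic_on_const D0)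
    show "open {k. Im k > 0 \<and> cmod k > r}" by (intro open_Collect_conj open_Collect_less continuous_intros)
  qed (use jost_iter_integrand_dom[OF q _ _ r] w in auto)
  ultimately show ?case ..
qed simp

lemma jost_m_uniform_limit:
  assumes q: "integrable lebesgue q" and r: "r > 0"
  shows "uniform_limit {k. Im k \<ge> 0 \<and> cmod k > r} (\<lambda>n k. \<Sum>i<n. jost_iter q k i x) (\<lambda>k. jost_m q k x) sequentially"
  unfolding jost_m_def
proof (rule Weierstrass_m_test)
  show "cmod (jost_iter q k n x) \<le> ((\<integral>t. \<bar>q t\<bar> \<partial>lebesgue) / r) ^ n / fact n" if "k \<in> {k. Im k \<ge> 0 \<and> cmod k > r}" for n k
    using jost_iter_norm_le[OF q _ _ r] that by auto
  show "summable (\<lambda>n. ((\<integral>t. \<bar>q t\<bar> \<partial>lebesgue) / r) ^ n / fact n)" using sums_exp_real sums_summable by blast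
qed

lemma jost_m_regular:
  assumes q: "integrable lebesgue q" and r: "r > 0"
  shows "continuous_on {k. Im k \<ge> 0 \<and> cmod k > r} (\<lambda>k. jost_m q k x)"
    and "(\<lambda>k. jost_m q k x) holomorphic_on {k. Im k > 0 \<and> cmod k > r}"
proof -
  show "continuous_on {k. Im k \<ge> 0 \<and> cmod k > r} (\<lambda>k. jost_m q k x)"
    by (rule uniform_limit_theorem[OF _ jost_m_uniform_limit[OF assms]])
       (auto intro!: always_eventually continuous_intros conjunct1[OF jost_iter_regular[OF assms]])
  have o: "open {k. Im k > 0 \<and> cmod k > r}" by (intro open_Collect_conj open_Collect_less continuous_intros)
  show "(\<lambda>k. jost_m q k x) holomorphic_on {k. Im k > 0 \<and> cmod k > r}"
  proof (rule holomorphic_uniform_sequence[OF o])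
    show "(\<lambda>k. \<Sum>i<n. jost_iter q k i x) holomorphic_on {k. Im k > 0 \<and> cmod k > r}" for n
      by (intro holomorphic_on_sum conjunct2[OF jost_iter_regular[OF assms]])
    fix k assume "k \<in> {k. Im k > 0 \<and> cmod k > r}"
    then obtain d where d: "d > 0" "cball k d \<subseteq> {k. Im k > 0 \<and> cmod k > r}" using o open_contains_cball by blast
    moreover have "uniform_limit (cball k d) (\<lambda>n k. \<Sum>i<n. jost_iter q k i x) (\<lambda>k. jost_m q k x) sequentially"
      by (rule uniform_limit_on_subset[OF jost_m_uniform_limit[OF assms]]) (use d in auto)
    ultimately show "\<exists>d>0. cball k d \<subseteq> {k. Im k > 0 \<and> cmod k > r} \<and>
      uniform_limit (cball k d) (\<lambda>n k. \<Sum>i<n. jost_iter q k i x) (\<lambda>k. jost_m q k x) sequentially" by blast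
  qed
qed

lemma jost_m_norm_le:
  assumes q: "integrable lebesgue q" and k: "Im k \<ge> 0" "cmod k > r" and r: "r > 0"
  shows "cmod (jost_m q k x) \<le> exp ((\<integral>t. \<bar>q t\<bar> \<partial>lebesgue) / r)"
proof -
  have k0: "k \<noteq> 0" using k r by auto
  then have "cmod (jost_m q k x) \<le> exp ((\<integral>t. \<bar>q t\<bar> \<partial>lebesgue) / cmod k)" using jost_m_bounds_simple(4)[OF q k(1)] by blast
  also have "\<dots> \<le> exp ((\<integral>t. \<bar>q t\<bar> \<partial>lebesgue) / r)"
  proof -
    have "(\<integral>t. \<bar>q t\<bar> \<partial>lebesgue) / cmod k \<le> (\<integral>t. \<bar>q t\<bar> \<partial>lebesgue) / r"
      by (rule divide_left_mono) (use k r k0 in \<open>auto intro!: mult_pos_pos\<close>)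
    then show ?thesis by simp
  qed
  finally show ?thesis .
qed

lemma jost_at_0:
  shows "jost q k 0 = jost_m q k 0"
    and "jost1 q k 0 = \<i> * k - (jost_beta q k 0 + jost_alpha q k 0) / 2"
  by (simp_all add: jost_def jost1_def)

lemma jost_alpha_beta_regular:
  assumes q: "integrable lebesgue q" and r: "r > 0"
  shows "continuous_on {k. Im k \<ge> 0 \<and> cmod k > r} (\<lambda>k. jost_alpha q k 0)"
    and "(\<lambda>k. jost_alpha q k 0) holomorphic_on {k. Im k > 0 \<and> cmod k > r}"
    and "continuous_on {k. Im k \<ge> 0 \<and> cmod k > r} (\<lambda>k. jost_beta q k 0)"
    and "(\<lambda>k. jost_beta q k 0) holomorphic_on {k. Im k > 0 \<and> cmod k > r}"
proof -
  define C where "C = exp ((\<integral>t. \<bar>q t\<bar> \<partial>lebesgue) / r)"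
  let ?w = "\<lambda>t. \<bar>q t\<bar> * C"
  have w: "integrable lebesgue ?w" using q by simp
  let ?D = "{k. Im k \<ge> 0 \<and> cmod k > r}" and ?O = "{k. Im k > 0 \<and> cmod k > r}"
  let ?f = "\<lambda>k t. indicat_real {0..} t *\<^sub>R (of_real (q t) * jost_m q k t)"
  let ?g = "\<lambda>k t. indicat_real {0..} t *\<^sub>R (exp (2 * \<i> * k * of_real t) * (of_real (q t) * jost_m q k t))"
  have o: "open ?O" by (intro open_Collect_conj open_Collect_less continuous_intros)
  have mf: "?f k \<in> borel_measurable lebesgue" "?g k \<in> borel_measurable lebesgue" if "k \<in> ?D" for k
  proof -
    have k: "Im k \<ge> 0" "k \<noteq> 0" using that r by auto
    show "?f k \<in> borel_measurable lebesgue" "?g k \<in> borel_measurable lebesgue"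
      using set_integrable_UNIV_subset[OF jost_integrable(1)[OF q k], of "{0..}"] jost_integrable(2)[OF q k, of 0]
      unfolding set_integrable_def by (auto dest: borel_measurable_integrable)
  qed
  have bf: "cmod (?f k t) \<le> ?w t" if "k \<in> ?D" for k t
  proof -
    have "cmod (of_real (q t) * jost_m q k t) \<le> ?w t"
      unfolding norm_mult C_def using jost_m_norm_le[OF q _ _ r, of k t] that by (intro mult_mono) auto
    moreover have "cmod (?f k t) \<le> cmod (of_real (q t) * jost_m q k t)" by (auto simp: indicator_def)
    ultimately show ?thesis by linarith
  qed
  have bg: "cmod (?g k t) \<le> ?w t" if "k \<in> ?D" for k t
  proof -
    have "cmod (?g k t) \<le> cmod (?f k t)"
    proof (cases "t \<ge> 0")
      case True
      have "cmod (exp (2 * \<i> * k * of_real t)) \<le> 1" using True that by simp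
      then show ?thesis
        using mult_right_mono[of "cmod (exp (2 * \<i> * k * of_real t))" 1 "cmod (of_real (q t) * jost_m q k t)"] True
        unfolding norm_scaleR norm_mult[of "exp (2 * \<i> * k * of_real t)"] by simp
    qed simp
    then show ?thesis using bf[OF that, of t] by linarith
  qed
  have OD: "?O \<subseteq> ?D" by auto
  show "continuous_on ?D (\<lambda>k. jost_alpha q k 0)"
    unfolding jost_alpha_def set_lebesgue_integral_def
    by (rule continuous_on_integral_param[OF _ mf(1) bf w]) (auto intro!: continuous_intros jost_m_regular(1)[OF q r])
  show "continuous_on ?D (\<lambda>k. jost_beta q k 0)"
    unfolding jost_beta_def set_lebesgue_integral_def
    by (rule continuous_on_integral_param[OF _ mf(2) bg w]) (auto intro!: continuous_intros jost_m_regular(1)[OF q r])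
  show "(\<lambda>k. jost_alpha q k 0) holomorphic_on ?O"
    unfolding jost_alpha_def set_lebesgue_integral_def scaleR_conv_of_real
    by (rule holomorphic_on_integral_param[OF o _ mf(1)[unfolded scaleR_conv_of_real] bf[unfolded scaleR_conv_of_real] w])
       (auto intro!: holomorphic_intros jost_m_regular(2)[OF q r])
  show "(\<lambda>k. jost_beta q k 0) holomorphic_on ?O"
    unfolding jost_beta_def set_lebesgue_integral_def scaleR_conv_of_real
    by (rule holomorphic_on_integral_param[OF o _ mf(2)[unfolded scaleR_conv_of_real] bg[unfolded scaleR_conv_of_real] w])
       (auto intro!: holomorphic_intros jost_m_regular(2)[OF q r])
qed

lemma jost_regular:
  assumes q: "integrable lebesgue q"
  shows "continuous_on closed_upper (\<lambda>k. jost q k 0)" "continuous_on closed_upper (\<lambda>k. jost1 q k 0)"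
    and "(\<lambda>k. jost q k 0) holomorphic_on upper_half" "(\<lambda>k. jost1 q k 0) holomorphic_on upper_half"
  unfolding jost_at_0
  by (intro continuous_on_closed_upperI holomorphic_on_upper_halfI continuous_intros holomorphic_intros
      jost_m_regular[OF q] jost_alpha_beta_regular[OF q]; simp)+

section \<open>Quadratic identities for Jost solutions\<close>

lemma norm_jost_le:
  assumes q: "integrable lebesgue q" and k: "Im k \<ge> 0" "k \<noteq> 0"
  shows "cmod (jost q k t) \<le> exp ((\<integral>t. \<bar>q t\<bar> \<partial>lebesgue) / cmod k) * exp (- Im k * t)"
proof -
  have "cmod (jost q k t) = exp (- Im k * t) * cmod (jost_m q k t)" by (simp add: jost_def norm_mult)
  also have "\<dots> \<le> exp (- Im k * t) * exp ((\<integral>t. \<bar>q t\<bar> \<partial>lebesgue) / cmod k)"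
    by (intro mult_left_mono jost_m_bounds_simple(4)[OF q k]) simp
  finally show ?thesis by (simp add: mult.commute)
qed

lemma jost_measurable:
  assumes q: "integrable lebesgue q" and k: "Im k \<ge> 0" "k \<noteq> 0"
  shows "jost q k \<in> borel_measurable lebesgue"
  unfolding jost_def[abs_def]
  by (intro borel_measurable_times jost_m_measurable[OF q k] lebesgue_measurable_continuous continuous_intros)

lemma set_integrable_exp_decay: "c > 0 \<Longrightarrow> set_integrable lebesgue {x..} (\<lambda>t::real. exp (- c * t))"
  by (intro nonnegative_absolutely_integrable_1 integrable_on_exp_minus_to_infinity) auto

lemma jost_product_integrable:
  assumes q: "integrable lebesgue q" and k: "Im k > 0" and l: "Im l > 0"
  shows "set_integrable lebesgue {x..} (\<lambda>t. jost q k t * jost q l t)"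
proof -
  have k0: "Im k \<ge> 0" "k \<noteq> 0" and l0: "Im l \<ge> 0" "l \<noteq> 0" using k l by auto
  let ?C = "\<lambda>k. exp ((\<integral>t. \<bar>q t\<bar> \<partial>lebesgue) / cmod k)"
  have i: "set_integrable lebesgue {x..} (\<lambda>t. (?C k * ?C l) * exp (- (Im k + Im l) * t))"
    using set_integrable_exp_decay[of "Im k + Im l" x] k l by (intro set_integrable_mult_right) auto
  show ?thesis
  proof (rule set_integrable_bound[OF i])
    show "set_borel_measurable lebesgue {x..} (\<lambda>t. jost q k t * jost q l t)"
      unfolding set_borel_measurable_def
      by (intro borel_measurable_scaleR borel_measurable_times jost_measurable[OF q] k0 l0 borel_measurable_indicator) simp
    show "AE t in lebesgue. t \<in> {x..} \<longrightarrow> cmod (jost q k t * jost q l t) \<le> norm ((?C k * ?C l) * exp (- (Im k + Im l) * t))"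
    proof (intro AE_I2 impI)
      fix t
      have "cmod (jost q k t * jost q l t) \<le> (?C k * exp (- Im k * t)) * (?C l * exp (- Im l * t))"
        unfolding norm_mult by (intro mult_mono norm_jost_le[OF q] k0 l0) auto
      also have "\<dots> = (?C k * ?C l) * exp (- (Im k + Im l) * t)" by (simp add: exp_add[symmetric] algebra_simps)
      finally show "cmod (jost q k t * jost q l t) \<le> norm ((?C k * ?C l) * exp (- (Im k + Im l) * t))" by simp
    qed
  qed
qed

text \<open>The Wronskian of the two Jost solutions is integrated from \<open>x\<close> to infinity,
  where it vanishes because exp(i(k+l)b) decays. Two specializations are used:
  \<open>l = - cnj k\<close> turns the product into \<open>|jost|^2\<close>, and
  \<open>l \<rightarrow> k\<close> yields derivatives in \<open>k\<close>.\<close>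

lemma jost_bilinear_identity:
  assumes q: "integrable lebesgue q" and k: "Im k > 0" and l: "Im l > 0"
  shows "jost1 q k x * jost q l x - jost q k x * jost1 q l x = (k\<^sup>2 - l\<^sup>2) * (LINT t:{x..}|lebesgue. jost q k t * jost q l t)"
proof -
  have k0: "Im k \<ge> 0" "k \<noteq> 0" and l0: "Im l \<ge> 0" "l \<noteq> 0" using k l by auto
  let ?W = "\<lambda>x. jost q k x * jost1 q l x - jost1 q k x * jost q l x"
  have ac: "loc_ac_deriv UNIV ?W (\<lambda>x. (k\<^sup>2 - l\<^sup>2) * (jost q k x * jost q l x))"
    by (rule solution_wronskian[OF solution_jost[OF q k0] solution_jost[OF q l0] is_interval_univ])
  have eq: "?W b = ?W x + (k\<^sup>2 - l\<^sup>2) * (LINT t:{x..b}|lebesgue. jost q k t * jost q l t)" if "x \<le> b" for b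
    using loc_ac_deriv_eq[OF ac, of x b] that by simp
  have lim1: "((\<lambda>b. ?W x + (k\<^sup>2 - l\<^sup>2) * (LINT t:{x..b}|lebesgue. jost q k t * jost q l t)) \<longlongrightarrow>
      ?W x + (k\<^sup>2 - l\<^sup>2) * (LINT t:{x..}|lebesgue. jost q k t * jost q l t)) at_top"
    by (rule tendsto_add[OF tendsto_const tendsto_mult_left[OF tendsto_set_lebesgue_integral_at_top[OF _ jost_product_integrable[OF q k l]]]]) simp
  have lim2: "(?W \<longlongrightarrow> 0) at_top"
  proof -
    let ?E = "\<lambda>k x. exp (- \<i> * k * complex_of_real x)"
    have e: "?W b = (exp (\<i> * k * of_real b) * exp (\<i> * l * of_real b)) * ((?E k b * jost q k b) * (?E l b * jost1 q l b) - (?E k b * jost1 q k b) * (?E l b * jost q l b))" for b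
    proof -
      have 1: "exp (\<i> * k * of_real b) * ?E k b = 1" "exp (\<i> * l * of_real b) * ?E l b = 1" by (simp_all add: exp_add[symmetric])
      have "(exp (\<i> * k * of_real b) * exp (\<i> * l * of_real b)) * ((?E k b * jost q k b) * (?E l b * jost1 q l b) - (?E k b * jost1 q k b) * (?E l b * jost q l b))
        = (exp (\<i> * k * of_real b) * ?E k b) * (exp (\<i> * l * of_real b) * ?E l b) * ?W b" by (simp only: algebra_simps)
      then show ?thesis unfolding 1 by simp
    qed
    have "((\<lambda>b. exp (\<i> * k * of_real b) * exp (\<i> * l * of_real b)) \<longlongrightarrow> 0) at_top"
    proof (rule Lim_null_comparison)
      show "\<forall>\<^sub>F b in at_top. cmod (exp (\<i> * k * of_real b) * exp (\<i> * l * of_real b)) \<le> exp (- (Im k + Im l) * b)"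
        by (intro always_eventually allI) (simp add: norm_mult exp_add[symmetric] algebra_simps)
      have c: "Im k + Im l > 0" using k l by simp
      show "((\<lambda>b. exp (- (Im k + Im l) * b)) \<longlongrightarrow> 0) at_top"
        by (rule filterlim_compose[OF exp_at_bot filterlim_tendsto_neg_mult_at_bot[OF tendsto_const _ filterlim_ident]])
           (use c in simp)
    qed
    moreover have "((\<lambda>b. (?E k b * jost q k b) * (?E l b * jost1 q l b) - (?E k b * jost1 q k b) * (?E l b * jost q l b)) \<longlongrightarrow> 1 * (\<i> * l) - (\<i> * k) * 1) at_top"
      by (rule tendsto_diff[OF tendsto_mult[OF jost_asymp(4)[OF q k0] jost_asymp(5)[OF q l0]] tendsto_mult[OF jost_asymp(5)[OF q k0] jost_asymp(4)[OF q l0]]])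
    ultimately have "((\<lambda>b. (exp (\<i> * k * of_real b) * exp (\<i> * l * of_real b)) * ((?E k b * jost q k b) * (?E l b * jost1 q l b) - (?E k b * jost1 q k b) * (?E l b * jost q l b))) \<longlongrightarrow> 0 * (1 * (\<i> * l) - (\<i> * k) * 1)) at_top"
      by (rule tendsto_mult)
    then show ?thesis unfolding e[symmetric] by simp
  qed
  have "((\<lambda>b. ?W x + (k\<^sup>2 - l\<^sup>2) * (LINT t:{x..b}|lebesgue. jost q k t * jost q l t)) \<longlongrightarrow> 0) at_top"
    by (rule Lim_transform_eventually[OF lim2]) (rule eventually_mono[OF eventually_ge_at_top[of x] eq])
  from tendsto_unique[OF trivial_limit_at_top_linorder lim1 this]
  have "?W x + (k\<^sup>2 - l\<^sup>2) * (LINT t:{x..}|lebesgue. jost q k t * jost q l t) = 0" .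
  then show ?thesis by (simp only: minus_diff_eq[of "jost q k x * jost1 q l x", symmetric] eq_neg_iff_add_eq_0[symmetric] minus_minus)
qed

lemma jost_square_integrable:
  assumes q: "integrable lebesgue q" and k: "Im k > 0"
  shows "set_integrable lebesgue {x..} (\<lambda>t. (cmod (jost q k t))\<^sup>2)"
  using set_integrable_norm[OF jost_product_integrable[OF q k k, of x]] by (simp add: norm_mult power2_eq_square)

text \<open>The case \<open>l = - cnj k\<close> of the bilinear identity, in which
  \<open>k^2 - l^2\<close> equals 2i Im (k^2). It expresses that the logarithmic derivative of the
  Jost solution is a Weyl function: its imaginary part has the sign of Im (k^2). This takes the
  place of self-adjointness in the arguments about zeros.\<close>

lemma jost_Im_identity:
  assumes q: "integrable lebesgue q" and k: "Im k > 0"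
  shows "Im (jost1 q k x * cnj (jost q k x)) = Im (k\<^sup>2) * (LINT t:{x..}|lebesgue. (cmod (jost q k t))\<^sup>2)"
proof -
  have k0: "Im k \<ge> 0" "k \<noteq> 0" using k by auto
  have l: "Im (- cnj k) > 0" using k by simp
  have "(LINT t:{x..}|lebesgue. jost q k t * jost q (- cnj k) t) = (LINT t:{x..}|lebesgue. complex_of_real ((cmod (jost q k t))\<^sup>2))"
    unfolding jost_cnj[OF q k0] complex_norm_square by simp
  also have "\<dots> = of_real (LINT t:{x..}|lebesgue. (cmod (jost q k t))\<^sup>2)" by (rule set_integral_complex_of_real)
  finally have I: "(LINT t:{x..}|lebesgue. jost q k t * jost q (- cnj k) t) = of_real (LINT t:{x..}|lebesgue. (cmod (jost q k t))\<^sup>2)" .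
  have "Im (jost1 q k x * cnj (jost q k x) - jost q k x * cnj (jost1 q k x)) = Im ((k\<^sup>2 - (- cnj k)\<^sup>2) * of_real (LINT t:{x..}|lebesgue. (cmod (jost q k t))\<^sup>2))"
    using jost_bilinear_identity[OF q k l, of x, unfolded I] unfolding jost_cnj[OF q k0] by simp
  moreover have "Im (jost1 q k x * cnj (jost q k x) - jost q k x * cnj (jost1 q k x)) = 2 * Im (jost1 q k x * cnj (jost q k x))" by simp
  moreover have "Im ((k\<^sup>2 - (- cnj k)\<^sup>2) * of_real I) = 2 * (Im (k\<^sup>2) * I)" for I by (simp add: power2_eq_square algebra_simps)
  ultimately have "2 * Im (jost1 q k x * cnj (jost q k x)) = 2 * (Im (k\<^sup>2) * (LINT t:{x..}|lebesgue. (cmod (jost q k t))\<^sup>2))"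
    by (simp only:)
  then show ?thesis by (simp only: mult_cancel_left) simp
qed

text \<open>The bilinear identity is divided by \<open>l - k\<close> before \<open>l\<close> tends
  to \<open>k\<close>; the factor \<open>l + k\<close> becomes \<open>2 k\<close>, and the integral
  passes to the limit by continuity in \<open>l\<close>.\<close>

lemma jost_derivative_identity:
  assumes q: "integrable lebesgue q" and k: "Im k > 0"
  shows "deriv (\<lambda>k. jost1 q k 0) k * jost q k 0 - deriv (\<lambda>k. jost q k 0) k * jost1 q k 0 = 2 * k * (LINT t:{0..}|lebesgue. (jost q k t)\<^sup>2)"
proof -
  have kU: "k \<in> upper_half" using k by (simp add: upper_half_def)
  have k0: "Im k \<ge> 0" "k \<noteq> 0" using k by auto
  define r where "r = cmod k / 2"
  have r: "r > 0" "cmod k > r" using k0 by (auto simp: r_def)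
  let ?O = "{l. Im l > 0 \<and> cmod l > r}"
  have o: "open ?O" by (intro open_Collect_conj open_Collect_less continuous_intros)
  have kO: "k \<in> ?O" using k r by simp
  define J where "J = (\<lambda>l. LINT t:{0..}|lebesgue. jost q l t * jost q k t)"
  have "continuous_on ?O J"
    unfolding J_def set_lebesgue_integral_def
  proof (rule continuous_on_integral_param)
    let ?C = "exp ((\<integral>t. \<bar>q t\<bar> \<partial>lebesgue) / r) * exp ((\<integral>t. \<bar>q t\<bar> \<partial>lebesgue) / cmod k)"
    let ?w = "\<lambda>t. indicat_real {0..} t *\<^sub>R (?C * exp (- Im k * t))"
    show "integrable lebesgue ?w"
      using set_integrable_mult_right[of ?C lebesgue "{0..}" "\<lambda>t. exp (- Im k * t)"] set_integrable_exp_decay[OF k, of 0]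
      unfolding set_integrable_def by simp
    show "(\<lambda>t. indicat_real {0..} t *\<^sub>R (jost q l t * jost q k t)) \<in> borel_measurable lebesgue" if "l \<in> ?O" for l
      using jost_product_integrable[OF q _ k, of l 0] that unfolding set_integrable_def by (auto dest: borel_measurable_integrable)
    show "continuous_on ?O (\<lambda>l. indicat_real {0..} t *\<^sub>R (jost q l t * jost q k t))" for t
      unfolding jost_def by (intro continuous_intros continuous_on_subset[OF jost_m_regular(1)[OF q r(1), of t]]) auto
    show "cmod (indicat_real {0..} t *\<^sub>R (jost q l t * jost q k t)) \<le> ?w t" if l: "l \<in> ?O" for l t
    proof (cases "t \<ge> 0")
      case True
      have l0: "Im l \<ge> 0" "cmod l > r" using l by auto
      have "cmod (jost q l t) = exp (- Im l * t) * cmod (jost_m q l t)" by (simp add: jost_def norm_mult)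
      also have "\<dots> \<le> 1 * exp ((\<integral>t. \<bar>q t\<bar> \<partial>lebesgue) / r)"
        using True l0 by (intro mult_mono jost_m_norm_le[OF q l0 r(1)]) auto
      finally have "cmod (jost q l t * jost q k t) \<le> exp ((\<integral>t. \<bar>q t\<bar> \<partial>lebesgue) / r) * (exp ((\<integral>t. \<bar>q t\<bar> \<partial>lebesgue) / cmod k) * exp (- Im k * t))"
        unfolding norm_mult by (intro mult_mono norm_jost_le[OF q k0]) auto
      then show ?thesis using True by (simp add: mult_ac)
    qed simp
  qed
  then have J: "(J \<longlongrightarrow> J k) (at k)"
    using o kO by (simp add: continuous_on_eq_continuous_at isCont_def)
  let ?F = "\<lambda>k. jost q k 0" and ?F1 = "\<lambda>k. jost1 q k 0"
  have dF: "(?F has_field_derivative deriv ?F k) (at k)" by (rule holomorphic_derivI[OF jost_regular(3)[OF q] open_upper_half kU])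
  have dF1: "(?F1 has_field_derivative deriv ?F1 k) (at k)" by (rule holomorphic_derivI[OF jost_regular(4)[OF q] open_upper_half kU])
  have "((\<lambda>l. ?F1 l * ?F k - ?F l * ?F1 k) has_field_derivative deriv ?F1 k * ?F k - deriv ?F k * ?F1 k) (at k)"
    by (intro DERIV_diff DERIV_cmult_right dF dF1)
  then have lim: "((\<lambda>l. ((?F1 l * ?F k - ?F l * ?F1 k) - (?F1 k * ?F k - ?F k * ?F1 k)) / (l - k)) \<longlongrightarrow> deriv ?F1 k * ?F k - deriv ?F k * ?F1 k) (at k)"
    unfolding has_field_derivative_iff .
  have lim2: "((\<lambda>l. (l + k) * J l) \<longlongrightarrow> (k + k) * J k) (at k)" by (intro tendsto_intros J)
  have ev: "eventually (\<lambda>l. (l + k) * J l = ((?F1 l * ?F k - ?F l * ?F1 k) - (?F1 k * ?F k - ?F k * ?F1 k)) / (l - k)) (at k)"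
  proof -
    have "eventually (\<lambda>l. l \<in> upper_half - {k}) (at k)"
      using open_upper_half kU by (rule eventually_at_in_open)
    then show ?thesis
    proof eventually_elim
      case (elim l)
      then have l: "Im l > 0" "l - k \<noteq> 0" by (auto simp: upper_half_def)
      have "(?F1 l * ?F k - ?F l * ?F1 k) - (?F1 k * ?F k - ?F k * ?F1 k) = (l\<^sup>2 - k\<^sup>2) * J l"
        using jost_bilinear_identity[OF q l(1) k, of 0] unfolding J_def by simp
      also have "\<dots> = ((l + k) * J l) * (l - k)" by (simp add: power2_eq_square algebra_simps)
      finally show ?case using l(2) by (simp add: eq_divide_eq)
    qed
  qed
  have lim3: "((\<lambda>l. ((?F1 l * ?F k - ?F l * ?F1 k) - (?F1 k * ?F k - ?F k * ?F1 k)) / (l - k)) \<longlongrightarrow> (k + k) * J k) (at k)"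
    by (rule Lim_transform_eventually[OF lim2 ev])
  have "deriv ?F1 k * ?F k - deriv ?F k * ?F1 k = (k + k) * J k"
    by (rule tendsto_unique[OF at_neq_bot lim lim3])
  then show ?thesis by (simp add: J_def power2_eq_square)
qed

section \<open>Jost functions near the origin\<close>

lemma gronwall_ac:
  assumes f: "loc_ac_deriv {a..b} f h" and ab: "a \<le> b" and p: "set_integrable lebesgue {a..b} p" "\<And>t. t \<in> {a..b} \<Longrightarrow> p t \<ge> 0"
    and h: "\<And>t. t \<in> {a..b} \<Longrightarrow> cmod (h t) \<le> p t * cmod (f t)"
  shows "cmod (f b) \<le> cmod (f a) * exp (LINT t:{a..b}|lebesgue. p t)"
proof (rule gronwall_integral[OF ab _ p norm_ge_zero])
  have cf: "continuous_on {a..b} f" by (rule loc_ac_deriv_continuous_Icc[OF f order_refl])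
  then show cu: "continuous_on {a..b} (\<lambda>t. cmod (f t))" by (rule continuous_on_norm)
  fix x assume x: "x \<in> {a..b}"
  have px: "set_integrable lebesgue {a..x} p" by (rule set_integrable_subset[OF p(1)]) (use x in auto)
  have cu': "continuous_on {a..x} (\<lambda>t. cmod (f t))" using x by (intro continuous_on_subset[OF cu]) auto
  have pu: "set_integrable lebesgue {a..x} (\<lambda>t. p t * cmod (f t))"
    using absolutely_integrable_bounded_measurable_product_real[of "\<lambda>t. cmod (f t)" "{a..x}" p] px
      continuous_imp_measurable_on_sets_lebesgue[OF cu']
      compact_imp_bounded[OF compact_continuous_image[OF cu' compact_Icc]] by (simp add: mult.commute)
  have "f x = f a + (LINT t:{a..x}|lebesgue. h t)" by (rule loc_ac_deriv_eq[OF f]) (use x ab in auto)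
  moreover have "cmod (LINT t:{a..x}|lebesgue. h t) \<le> (LINT t:{a..x}|lebesgue. p t * cmod (f t))"
    by (rule set_integral_norm_bound_lebesgue[OF _ pu]) (use x ab h loc_ac_deriv_integrable[OF f, of a x] in auto)
  ultimately show "cmod (f x) \<le> cmod (f a) + (LINT t:{a..x}|lebesgue. p t * cmod (f t))"
    using norm_triangle_ineq[of "f a" "LINT t:{a..x}|lebesgue. h t"] by simp
qed

lemma set_integral_const_Icc:
  fixes c :: real assumes "a \<le> b"
  shows "set_integrable lebesgue {a..b} (\<lambda>t. c)" "(LINT t:{a..b}|lebesgue. c) = c * (b - a)"
proof -
  show i: "set_integrable lebesgue {a..b} (\<lambda>t. c)" by (rule absolutely_integrable_continuous_real) auto
  show "(LINT t:{a..b}|lebesgue. c) = c * (b - a)"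
    unfolding set_lebesgue_integral_eq_integral(2)[OF i] using assms by simp
qed

lemma small_interval_integral:
  fixes q :: "real \<Rightarrow> real"
  assumes q: "integrable lebesgue q" and e: "e > 0"
  shows "\<exists>d>0. d \<le> 1 \<and> (LINT t:{0..d}|lebesgue. \<bar>q t\<bar> + 1) \<le> e"
proof -
  have i: "set_integrable lebesgue {0..1} (\<lambda>t. \<bar>q t\<bar> + 1)"
    using q by (intro set_integral_add(1) set_integrable_UNIV_subset set_integral_const_Icc(1)) auto
  define G where "G = (\<lambda>x. LINT t:{0..x}|lebesgue. \<bar>q t\<bar> + 1)"
  have ic: "set_integrable lebesgue {0..1} (\<lambda>t. complex_of_real (\<bar>q t\<bar> + 1))"
    using i unfolding set_integrable_def by (simp add: scaleR_conv_of_real del: of_real_add flip: of_real_mult)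
  from loc_ac_deriv_indefinite[OF this] have ac: "loc_ac_deriv {0..1} (\<lambda>x. complex_of_real (G x)) (\<lambda>t. of_real (\<bar>q t\<bar> + 1))"
    by (simp only: set_integral_complex_of_real G_def)
  have "continuous_on {0..1} (\<lambda>x. Re (complex_of_real (G x)))"
    by (rule continuous_on_Re[OF loc_ac_deriv_continuous_Icc[OF ac order_refl]])
  then have "continuous_on {0..1} G" by simp
  then obtain d where d: "d > 0" "\<And>x. x \<in> {0..1} \<Longrightarrow> dist x 0 < d \<Longrightarrow> dist (G x) (G 0) < e"
    unfolding continuous_on_iff using e by (metis atLeastAtMost_iff order_refl zero_le_one)
  have "G 0 = 0"
    using set_lebesgue_integral_eq_integral(2)[OF set_integrable_subset[OF i, of "{0..0}"]] by (simp add: G_def)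
  moreover have "dist (G (min 1 (d/2))) (G 0) < e" using d(1) by (intro d(2)) auto
  ultimately have "G (min 1 (d/2)) \<le> e" by (simp add: dist_norm)
  then show ?thesis using d(1) by (intro exI[of _ "min 1 (d/2)"]) (simp add: G_def)
qed

text \<open>Near 0 a solution is almost linear, so its mass controls both Cauchy data.\<close>

lemma jost_mass_lower_bound:
  assumes q: "integrable lebesgue q"
  shows "\<exists>c>0. \<forall>k. Im k > 0 \<and> cmod k \<le> 1 \<longrightarrow>
    c * (cmod (jost q k 0) + cmod (jost1 q k 0))\<^sup>2 \<le> (LINT t:{0..}|lebesgue. (cmod (jost q k t))\<^sup>2)"
proof -
  \<comment> \<open>The threshold 1/16 makes \<open>S \<le> N + S/16\<close>, where \<open>S\<close>
    is the maximum of \<open>|jost|\<close> on {0..d} and \<open>N = |jost 0| + d |jost1 0|\<close>.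
    Thus \<open>S \<le> 2 N\<close>, and the solution deviates from its tangent line by at most
    \<open>N / 8\<close>.\<close>
  obtain d where d: "d > 0" "d \<le> 1" and K: "(LINT t:{0..d}|lebesgue. \<bar>q t\<bar> + 1) \<le> 1/16"
    using small_interval_integral[OF q, of "1/16"] by auto
  have "(d/8) * (d/32)\<^sup>2 * (cmod (jost q k 0) + cmod (jost1 q k 0))\<^sup>2 \<le> (LINT t:{0..}|lebesgue. (cmod (jost q k t))\<^sup>2)"
    if k: "Im k > 0" "cmod k \<le> 1" for k
  proof -
    have k0: "Im k \<ge> 0" "k \<noteq> 0" using k by auto
    let ?e = "jost q k" and ?e1 = "jost1 q k"
    note sol = solution_jost[OF q k0, unfolded solution_def]
    have ce: "continuous_on {0..d} ?e" "continuous_on {0..d} ?e1"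
      using solution_continuous[OF solution_jost[OF q k0]] by auto
    have "\<exists>x\<in>{0..d}. \<forall>t\<in>{0..d}. cmod (?e t) \<le> cmod (?e x)"
      by (rule continuous_attains_sup) (use d ce in \<open>auto intro: continuous_on_norm\<close>)
    then obtain xm where xm: "xm \<in> {0..d}" "\<And>t. t \<in> {0..d} \<Longrightarrow> cmod (?e t) \<le> cmod (?e xm)" by blast
    define S where "S = cmod (?e xm)"
    have S0: "S \<ge> 0" by (simp add: S_def)
    have iq: "set_integrable lebesgue {0..t} (\<lambda>t. \<bar>q t\<bar> + 1)" if "t \<ge> 0" for t
      using q that by (intro set_integral_add(1) set_integrable_UNIV_subset set_integral_const_Icc(1)) auto
    have e1b: "cmod (?e1 t - ?e1 0) \<le> S / 16" if t: "t \<in> {0..d}" for t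
    proof -
      have "?e1 t - ?e1 0 = (LINT t:{0..t}|lebesgue. of_real (q t) * ?e t - k\<^sup>2 * ?e t)"
        using loc_ac_deriv_eq[OF conjunct2[OF sol], of 0 t] t by simp
      also have "cmod \<dots> \<le> (LINT t:{0..t}|lebesgue. S * (\<bar>q t\<bar> + 1))"
      proof (rule set_integral_norm_bound_lebesgue)
        show "set_integrable lebesgue {0..t} (\<lambda>t. of_real (q t) * ?e t - k\<^sup>2 * ?e t)"
          using loc_ac_deriv_integrable[OF conjunct2[OF sol], of 0 t] t by simp
        show "set_integrable lebesgue {0..t} (\<lambda>t. S * (\<bar>q t\<bar> + 1))"
          using iq[of t] t by (intro set_integrable_mult_right) auto
        fix s assume s: "s \<in> {0..t}"
        have "cmod (of_real (q s) * ?e s - k\<^sup>2 * ?e s) \<le> (\<bar>q s\<bar> + (cmod k)\<^sup>2) * cmod (?e s)"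
          using norm_triangle_ineq4[of "of_real (q s) * ?e s" "k\<^sup>2 * ?e s"] by (simp add: norm_mult norm_power algebra_simps)
        also have "\<dots> \<le> (\<bar>q s\<bar> + 1) * S"
          unfolding S_def using k s t by (intro mult_mono add_left_mono xm(2)) (auto simp: power_le_one)
        finally show "cmod (of_real (q s) * ?e s - k\<^sup>2 * ?e s) \<le> S * (\<bar>q s\<bar> + 1)" by (simp add: mult.commute)
      qed
      also have "\<dots> = S * (LINT t:{0..t}|lebesgue. \<bar>q t\<bar> + 1)" by (rule set_integral_mult_right)
      also have "\<dots> \<le> S * (1/16)"
      proof (rule mult_left_mono[OF order_trans[OF _ K] S0])
        show "(LINT t:{0..t}|lebesgue. \<bar>q t\<bar> + 1) \<le> (LINT t:{0..d}|lebesgue. \<bar>q t\<bar> + 1)"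
          unfolding set_lebesgue_integral_def using iq[of t] iq[of d] t d
          by (intro Bochner_Integration.integral_mono) (auto simp: set_integrable_def indicator_def)
      qed
      finally show ?thesis by simp
    qed
    have eb: "cmod (?e x - ?e 0 - of_real x * ?e1 0) \<le> x * (S / 16)" if x: "x \<in> {0..d}" for x
    proof -
      have ii: "set_integrable lebesgue {0..x} ?e1" "set_integrable lebesgue {0..x} (\<lambda>t. ?e1 0)"
        using loc_ac_deriv_integrable[OF conjunct1[OF sol], of 0 x] x
        by (auto intro: absolutely_integrable_continuous_real)
      have "of_real x * ?e1 0 = (LINT t:{0..x}|lebesgue. ?e1 0)"
        using set_lebesgue_integral_eq_integral(2)[OF ii(2)] x by (simp add: scaleR_conv_of_real)
      then have "?e x - ?e 0 - of_real x * ?e1 0 = (LINT t:{0..x}|lebesgue. ?e1 t - ?e1 0)"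
        using loc_ac_deriv_eq[OF conjunct1[OF sol], of 0 x] x set_integral_diff(2)[OF ii] by simp
      also have "cmod \<dots> \<le> (LINT t:{0..x}|lebesgue. S / 16)"
        by (rule set_integral_norm_bound_lebesgue[OF set_integral_diff(1)[OF ii] set_integral_const_Icc(1)]) (use x e1b in auto)
      also have "\<dots> = x * (S / 16)" using set_integral_const_Icc(2)[of 0 x "S/16"] x by simp
      finally show ?thesis .
    qed
    define a b where "a = cmod (?e 0)" and "b = d * cmod (?e1 0)"
    have ab: "a \<ge> 0" "b \<ge> 0" using d by (simp_all add: a_def b_def)
    define N where "N = a + b"
    have xb: "cmod (of_real x * ?e1 0) = (x / d) * b" if "x \<in> {0..d}" for x
      using that d by (simp add: b_def norm_mult)
    have S: "S \<le> N + S / 16"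
    proof -
      have "S \<le> a + cmod (of_real xm * ?e1 0) + cmod (?e xm - ?e 0 - of_real xm * ?e1 0)"
        unfolding S_def a_def
        using norm_triangle_ineq[of "?e 0 + of_real xm * ?e1 0" "?e xm - ?e 0 - of_real xm * ?e1 0"]
          norm_triangle_ineq[of "?e 0" "of_real xm * ?e1 0"] by simp
      moreover have "(xm / d) * b \<le> 1 * b" using xm(1) d ab by (intro mult_right_mono) auto
      moreover have "xm * (S / 16) \<le> 1 * (S / 16)" using xm(1) d S0 by (intro mult_right_mono) auto
      ultimately show ?thesis using eb[OF xm(1)] xb[OF xm(1)] by (simp add: N_def)
    qed
    have err: "cmod (?e x - ?e 0 - of_real x * ?e1 0) \<le> N / 8" if x: "x \<in> {0..d}" for x
    proof -
      have "x * (S / 16) \<le> 1 * (S / 16)" using x d S0 by (intro mult_right_mono) auto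
      moreover have "S \<le> 2 * N" using S S0 by linarith
      ultimately show ?thesis using eb[OF x] by linarith
    qed
    have tri: "cmod (?e x) \<ge> \<bar>a - (x / d) * b\<bar> - N / 8" if x: "x \<in> {0..d}" for x
    proof -
      have "\<bar>a - (x / d) * b\<bar> \<le> cmod (?e 0 + of_real x * ?e1 0)"
        unfolding a_def xb[OF x, symmetric] using norm_triangle_ineq3[of "?e 0" "- (of_real x * ?e1 0)"] by simp
      moreover have "cmod (?e 0 + of_real x * ?e1 0) \<le> cmod (?e x) + cmod (?e x - ?e 0 - of_real x * ?e1 0)"
        using norm_triangle_ineq4[of "?e x" "?e x - ?e 0 - of_real x * ?e1 0"] by simp
      ultimately show ?thesis using err[OF x] by linarith
    qed
    have N0: "N \<ge> 0" using ab by (simp add: N_def)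
    \<comment> \<open>The tangent line can be small only near one zero. If the value at 0 accounts
      for a quarter of \<open>N\<close>, the solution is large on the first eighth of {0..d};
      otherwise the slope dominates and it is large on the last eighth. The margins left by the
      error \<open>N / 8\<close> are N/32 and 9N/32.\<close>
    obtain u v where uv: "0 \<le> u" "v \<le> d" "v - u = d / 8" "\<And>x. x \<in> {u..v} \<Longrightarrow> N / 32 \<le> cmod (?e x)"
    proof (cases "a \<ge> N / 4")
      case True
      show ?thesis
      proof (rule that[of 0 "d/8"])
        fix x assume x: "x \<in> {0..d/8}"
        then have "x / d \<le> 1 / 8" using d by (simp add: field_simps)
        then have "(x / d) * b \<le> (1 / 8) * b" using ab by (intro mult_right_mono) auto
        moreover have "b \<le> 3 * N / 4" using True by (simp add: N_def)
        ultimately show "N / 32 \<le> cmod (?e x)" using tri[of x] x d True by force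
      qed (use d in auto)
    next
      case False
      show ?thesis
      proof (rule that[of "7*d/8" d])
        fix x assume x: "x \<in> {7*d/8..d}"
        then have "7 / 8 \<le> x / d" using d by (simp add: field_simps)
        then have "(7 / 8) * b \<le> (x / d) * b" using ab by (intro mult_right_mono) auto
        moreover have "b \<ge> 3 * N / 4" using False by (simp add: N_def)
        ultimately show "N / 32 \<le> cmod (?e x)" using tri[of x] x d False N0 by force
      qed (use d in auto)
    qed
    have "(d/8) * (d/32)\<^sup>2 * (cmod (?e 0) + cmod (?e1 0))\<^sup>2 = (d/8) * ((d * (cmod (?e 0) + cmod (?e1 0))) / 32)\<^sup>2"
      by (simp add: power_mult_distrib power_divide)
    also have "\<dots> \<le> (d/8) * (N / 32)\<^sup>2"
    proof (intro mult_left_mono power_mono divide_right_mono)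
      have "d * cmod (?e 0) \<le> 1 * cmod (?e 0)" using d by (intro mult_right_mono) auto
      then show "d * (cmod (?e 0) + cmod (?e1 0)) \<le> N" by (simp add: N_def a_def b_def distrib_left)
    qed (use d in auto)
    also have "\<dots> = (LINT t:{u..v}|lebesgue. (N / 32)\<^sup>2)"
      using set_integral_const_Icc(2)[of u v "(N/32)\<^sup>2"] uv d by simp
    also have "\<dots> \<le> (LINT t:{0..}|lebesgue. (cmod (?e t))\<^sup>2)"
    proof -
      have i1: "set_integrable lebesgue {u..v} (\<lambda>t. (N/32)\<^sup>2)" using uv d by (intro set_integral_const_Icc(1)) auto
      have i2: "set_integrable lebesgue {0..} (\<lambda>t. (cmod (?e t))\<^sup>2)" by (rule jost_square_integrable[OF q k(1)])
      show ?thesis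
        unfolding set_lebesgue_integral_def
      proof (rule Bochner_Integration.integral_mono[OF i1[unfolded set_integrable_def] i2[unfolded set_integrable_def]])
        fix t show "indicat_real {u..v} t *\<^sub>R (N / 32)\<^sup>2 \<le> indicat_real {0..} t *\<^sub>R (cmod (?e t))\<^sup>2"
        proof (cases "t \<in> {u..v}")
          case True
          then have "(N / 32)\<^sup>2 \<le> (cmod (?e t))\<^sup>2" using uv(4)[OF True] N0 by (intro power_mono) auto
          then show ?thesis using True uv(1) by simp
        qed simp
      qed
    qed
    finally show ?thesis .
  qed
  then show ?thesis using d by (intro exI[of _ "(d/8) * (d/32)\<^sup>2"]) auto
qed

section \<open>Lower and upper bounds for the Cauchy data at 0\<close>

lemma jost_Im_nonneg:
  assumes q: "integrable lebesgue q" and k: "Im k > 0" "Re k > 0"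
  shows "Im (jost1 q k x * cnj (jost q k x)) \<ge> 0"
  unfolding jost_Im_identity[OF q k(1)]
  by (intro mult_nonneg_nonneg set_integral_nonneg_lebesgue) (use k in \<open>auto simp: power2_eq_square\<close>)

text \<open>After multiplication by \<open>cnj z\<close> the imaginary parts of both summands are
  nonnegative, so nothing cancels. With \<open>w = jost1\<close> and \<open>z = jost\<close> it is
  applied for \<open>s = k\<close>, to control \<open>jost\<close> by an amplitude, and for
  \<open>s = 1\<close>, to control it uniformly in \<open>k\<close>.\<close>

lemma norm_le_add_mult_of_Im_nonneg:
  assumes "Im (w * cnj z) \<ge> 0" "Re s \<ge> 0"
  shows "Re s * cmod z \<le> cmod (w + \<i> * s * z)"
proof (cases "z = 0")
  case False
  have "Re s * (cmod z)\<^sup>2 \<le> Im (w * cnj z) + Re s * (cmod z)\<^sup>2" using assms by simp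
  also have "\<dots> = Im ((w + \<i> * s * z) * cnj z)"
    unfolding cmod_power2 by (simp add: power2_eq_square algebra_simps)
  also have "\<dots> \<le> cmod ((w + \<i> * s * z) * cnj z)" by (rule abs_Im_le_cmod[THEN order_trans[OF abs_ge_self]])
  also have "\<dots> = cmod (w + \<i> * s * z) * cmod z" by (simp add: norm_mult)
  finally have "(Re s * cmod z) * cmod z \<le> cmod (w + \<i> * s * z) * cmod z" by (simp add: power2_eq_square mult_ac)
  then show ?thesis using False by (simp add: mult_le_cancel_right)
qed simp

text \<open>The quantity \<open>A x = 1 - jost_alpha q k x / (2ik)\<close> is the amplitude of
  exp(ikx) in the splitting of the Jost solution into exp(ikx) and exp(-ikx). It tends to 1 at
  infinity, and its derivative has modulus \<open>|q| |jost_m| / (2|k|)\<close>, at most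
  \<open>|q| |A| / Re k\<close> by positivity of the imaginary part. Gronwall's inequality from
  \<open>X\<close> to infinity then bounds \<open>A X\<close> from below, at the price of an
  exponent that contains only the tail of \<open>|q|\<close> beyond \<open>X\<close>.\<close>

lemma jost_transmitted_lower_bound:
  assumes q: "integrable lebesgue q" and k: "Im k > 0" "Re k > 0"
  shows "exp (- (LINT t:{X..}|lebesgue. \<bar>q t\<bar>) / Re k) \<le> cmod (1 - jost_alpha q k X / (2 * \<i> * k))"
proof -
  have k0: "Im k \<ge> 0" "k \<noteq> 0" using k by auto
  define A where "A = (\<lambda>x. 1 - (1 / (2 * \<i> * k)) * jost_alpha q k x)"
  define T where "T = (LINT t:{X..}|lebesgue. \<bar>q t\<bar>)"
  have a: "loc_ac_deriv UNIV (jost_alpha q k) (\<lambda>x. - (of_real (q x) * jost_m q k x))"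
    unfolding jost_alpha_def[abs_def] by (rule loc_ac_deriv_tail, rule set_integrable_UNIV_subset[OF jost_integrable(1)[OF q k0]]) simp
  have acA: "loc_ac_deriv UNIV A (\<lambda>x. 0 - (1 / (2 * \<i> * k)) * (- (of_real (q x) * jost_m q k x)))"
    unfolding A_def by (intro loc_ac_deriv_diff loc_ac_deriv_const loc_ac_deriv_cmult a)
  have Am: "Re k * cmod (jost_m q k x) \<le> 2 * cmod k * cmod (A x)" for x
  proof -
    let ?E = "exp (- \<i> * k * complex_of_real x)"
    have 1: "?E * exp (\<i> * k * of_real x) = 1" by (simp add: exp_add[symmetric])
    have "?E * jost q k x = jost_m q k x" unfolding jost_def mult.assoc[symmetric] 1 by simp
    then have m: "cmod (jost_m q k x) = cmod ?E * cmod (jost q k x)" by (metis norm_mult)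
    have FF: "exp (- 2 * \<i> * k * of_real x) = ?E * ?E" by (simp add: exp_add[symmetric] mult_ac)
    have c1: "\<i> * k * jost_m q k x = \<i> * k + (?E * ?E * jost_beta q k x - jost_alpha q k x) / 2"
      unfolding jost_m_eq[OF q k0, of x] FF using k0(2) by (simp add: field_simps)
    have c2: "?E * jost1 q k x = \<i> * k * (?E * exp (\<i> * k * of_real x)) - (?E * ?E * jost_beta q k x + (?E * exp (\<i> * k * of_real x)) * jost_alpha q k x) / 2"
      unfolding jost1_def by (simp add: field_simps)
    have "?E * jost1 q k x + \<i> * k * jost_m q k x = 2 * \<i> * k - jost_alpha q k x"
      unfolding c1 c2 1 by (simp add: field_simps)
    also have "\<dots> = 2 * \<i> * k * A x" unfolding A_def using k0(2) by (simp add: field_simps)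
    finally have "?E * (jost1 q k x + \<i> * k * jost q k x) = 2 * \<i> * k * A x"
      using \<open>?E * jost q k x = jost_m q k x\<close> by (simp add: algebra_simps)
    then have "cmod ?E * cmod (jost1 q k x + \<i> * k * jost q k x) = 2 * cmod k * cmod (A x)"
      unfolding norm_mult[symmetric] by (simp add: norm_mult)
    moreover have "cmod ?E * (Re k * cmod (jost q k x)) \<le> cmod ?E * cmod (jost1 q k x + \<i> * k * jost q k x)"
      by (intro mult_left_mono norm_le_add_mult_of_Im_nonneg jost_Im_nonneg[OF q k]) (use k in auto)
    ultimately show ?thesis unfolding m by (simp add: mult_ac)
  qed
  have qi: "integrable lebesgue (\<lambda>t. \<bar>q t\<bar>)" using q by simp
  have le: "cmod (A b) \<le> cmod (A X) * exp (T / Re k)" if "X \<le> b" for b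
  proof -
    have pi: "set_integrable lebesgue {X..b} (\<lambda>t. \<bar>q t\<bar> / Re k)"
      using set_integrable_UNIV_subset[OF qi, of "{X..b}"] by simp
    have "cmod (A b) \<le> cmod (A X) * exp (LINT t:{X..b}|lebesgue. \<bar>q t\<bar> / Re k)"
    proof (rule gronwall_ac[OF loc_ac_deriv_subset[OF acA] that pi])
      fix t
      have "cmod (0 - (1 / (2 * \<i> * k)) * (- (of_real (q t) * jost_m q k t))) = \<bar>q t\<bar> * (cmod (jost_m q k t) / (2 * cmod k))"
        by (simp add: norm_mult norm_divide)
      also have "\<dots> \<le> \<bar>q t\<bar> * (cmod (A t) / Re k)"
      proof (intro mult_left_mono)
        have "cmod (jost_m q k t) * Re k \<le> cmod (A t) * (2 * cmod k)" using Am[of t] by (simp add: mult_ac)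
        then show "cmod (jost_m q k t) / (2 * cmod k) \<le> cmod (A t) / Re k"
          using k k0 by (simp add: divide_simps mult_ac)
      qed simp
      finally show "cmod (0 - (1 / (2 * \<i> * k)) * (- (of_real (q t) * jost_m q k t))) \<le> \<bar>q t\<bar> / Re k * cmod (A t)" by simp
    qed (use k in auto)
    also have "\<dots> \<le> cmod (A X) * exp (T / Re k)"
    proof -
      have "(LINT t:{X..b}|lebesgue. \<bar>q t\<bar>) \<le> T"
        unfolding T_def set_lebesgue_integral_def
        using set_integrable_UNIV_subset[OF qi, of "{X..b}"] set_integrable_UNIV_subset[OF qi, of "{X..}"]
        by (intro Bochner_Integration.integral_mono) (auto simp: set_integrable_def indicator_def)
      then have "(LINT t:{X..b}|lebesgue. \<bar>q t\<bar> / Re k) \<le> T / Re k" using k by (simp add: divide_right_mono)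
      then show ?thesis by (intro mult_left_mono) auto
    qed
    finally show ?thesis .
  qed
  have "((\<lambda>x. cmod (A x)) \<longlongrightarrow> cmod (1 - (1 / (2 * \<i> * k)) * 0)) at_top"
    unfolding A_def by (intro tendsto_intros jost_asymp(7)[OF q k0])
  then have lim: "((\<lambda>x. cmod (A x)) \<longlongrightarrow> 1) at_top" by simp
  have "1 \<le> cmod (A X) * exp (T / Re k)"
    by (rule tendsto_upperbound[OF lim _ trivial_limit_at_top_linorder])
       (rule eventually_mono[OF eventually_ge_at_top[of X] le])
  then have "exp (- T / Re k) * 1 \<le> exp (- T / Re k) * (cmod (A X) * exp (T / Re k))" by (intro mult_left_mono) auto
  also have "\<dots> = cmod (A X)" by (simp add: exp_minus mult_ac)
  finally show ?thesis by (simp add: A_def T_def)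
qed

lemma jost_transmitted_eq:
  assumes q: "integrable lebesgue q" and k: "Im k \<ge> 0" "k \<noteq> 0"
  shows "jost1 q k x + \<i> * k * jost q k x = exp (\<i> * k * of_real x) * (2 * \<i> * k * (1 - jost_alpha q k x / (2 * \<i> * k)))"
proof -
  have e: "exp (\<i> * k * of_real x) * exp (- 2 * \<i> * k * of_real x) = exp (- \<i> * k * of_real x)"
    by (simp add: exp_add[symmetric] algebra_simps)
  have h: "\<i> * k * jost q k x = \<i> * k * exp (\<i> * k * of_real x) + ((exp (\<i> * k * of_real x) * exp (- 2 * \<i> * k * of_real x)) * jost_beta q k x - exp (\<i> * k * of_real x) * jost_alpha q k x) / 2"
    unfolding jost_def jost_m_eq[OF q k, of x] using k(2) by (simp add: field_simps)
  show ?thesis unfolding h e jost1_def using k(2) by (simp add: field_simps)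
qed

text \<open>The lower bound for the amplitude at \<open>X\<close> is carried to 0 by Gronwall's
  inequality for \<open>jost1 + i jost\<close> on {0..X}. Positivity gives
  \<open>|jost| \<le> |jost1 + i jost|\<close>, so the growth rate is at most \<open>|q| + 3\<close>
  and the loss does not depend on \<open>k\<close>. In the constant, \<open>4 X\<close> is
  \<open>3 X\<close> from this rate and \<open>X\<close> from exp(-X Im k); the factor 2/3 combines
  \<open>2ik\<close> with the comparison of \<open>jost1 + ik jost\<close> and
  \<open>jost1 + i jost\<close>, which costs 3.\<close>

lemma jost_data_lower_bound:
  assumes q: "integrable lebesgue q" and k: "Im k > 0" "Re k > 0" "cmod k \<le> 1" and X: "X \<ge> 0"
  shows "(2/3) * exp (- (\<integral>t. \<bar>q t\<bar> \<partial>lebesgue) - 4 * X) * cmod k * exp (- (LINT t:{X..}|lebesgue. \<bar>q t\<bar>) / Re k)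
    \<le> cmod (jost q k 0) + cmod (jost1 q k 0)"
proof -
  have k0: "Im k \<ge> 0" "k \<noteq> 0" using k by auto
  let ?e = "jost q k" and ?e1 = "jost1 q k"
  define T where "T = (LINT t:{X..}|lebesgue. \<bar>q t\<bar>)"
  define Q where "Q = (\<integral>t. \<bar>q t\<bar> \<partial>lebesgue)"
  note sol = solution_jost[OF q k0, unfolded solution_def]
  have e_le: "cmod (?e x) \<le> cmod (?e1 x + \<i> * ?e x)" for x
    using norm_le_add_mult_of_Im_nonneg[OF jost_Im_nonneg[OF q k(1,2)], of 1] by simp
  have ac: "loc_ac_deriv UNIV (\<lambda>x. ?e1 x + \<i> * ?e x) (\<lambda>x. (of_real (q x) * ?e x - k\<^sup>2 * ?e x) + \<i> * ?e1 x)"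
    using sol by (intro loc_ac_deriv_add loc_ac_deriv_cmult) auto
  have qi: "integrable lebesgue (\<lambda>t. \<bar>q t\<bar>)" using q by simp
  have iq: "set_integrable lebesgue {0..X} (\<lambda>t. \<bar>q t\<bar>)" by (rule set_integrable_UNIV_subset[OF qi]) simp
  have i3: "set_integrable lebesgue {0..X} (\<lambda>t. 3::real)" by (rule set_integral_const_Icc(1)[OF X])
  have "cmod (?e1 X + \<i> * ?e X) \<le> cmod (?e1 0 + \<i> * ?e 0) * exp (LINT t:{0..X}|lebesgue. \<bar>q t\<bar> + 3)"
  proof (rule gronwall_ac[OF loc_ac_deriv_subset[OF ac] X set_integral_add(1)[OF iq i3]])
    fix t
    have "(of_real (q t) * ?e t - k\<^sup>2 * ?e t) + \<i> * ?e1 t = \<i> * (?e1 t + \<i> * ?e t) + (of_real (q t) - k\<^sup>2 + 1) * ?e t"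
      by (simp add: algebra_simps)
    also have "cmod \<dots> \<le> cmod (?e1 t + \<i> * ?e t) + cmod (of_real (q t) - k\<^sup>2 + 1) * cmod (?e t)"
      using norm_triangle_ineq[of "\<i> * (?e1 t + \<i> * ?e t)" "(of_real (q t) - k\<^sup>2 + 1) * ?e t"] unfolding norm_mult by simp
    also have "\<dots> \<le> cmod (?e1 t + \<i> * ?e t) + (\<bar>q t\<bar> + 2) * cmod (?e1 t + \<i> * ?e t)"
    proof (intro add_left_mono mult_mono e_le)
      have "(cmod k)\<^sup>2 \<le> 1" using k by (simp add: power_le_one)
      then show "cmod (of_real (q t) - k\<^sup>2 + 1) \<le> \<bar>q t\<bar> + 2"
        using norm_triangle_ineq[of "of_real (q t) - k\<^sup>2" 1] norm_triangle_ineq4[of "of_real (q t)" "k\<^sup>2"]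
        by (simp add: norm_power)
    qed auto
    finally show "cmod ((of_real (q t) * ?e t - k\<^sup>2 * ?e t) + \<i> * ?e1 t) \<le> (\<bar>q t\<bar> + 3) * cmod (?e1 t + \<i> * ?e t)"
      by (simp add: algebra_simps)
  qed auto
  also have "\<dots> \<le> cmod (?e1 0 + \<i> * ?e 0) * exp (Q + 3 * X)"
  proof -
    have "(LINT t:{0..X}|lebesgue. \<bar>q t\<bar>) \<le> Q"
      unfolding Q_def set_lebesgue_integral_def using iq qi
      by (intro Bochner_Integration.integral_mono) (auto simp: set_integrable_def indicator_def)
    then have "(LINT t:{0..X}|lebesgue. \<bar>q t\<bar> + 3) \<le> Q + 3 * X"
      unfolding set_integral_add(2)[OF iq i3] using set_integral_const_Icc(2)[OF X, of 3] by simp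
    then show ?thesis by (intro mult_left_mono) auto
  qed
  finally have 1: "cmod (?e1 X + \<i> * ?e X) \<le> cmod (?e1 0 + \<i> * ?e 0) * exp (Q + 3 * X)" .
  have 2: "cmod (?e1 X + \<i> * k * ?e X) \<le> 3 * cmod (?e1 X + \<i> * ?e X)"
  proof -
    have "?e1 X + \<i> * k * ?e X = (?e1 X + \<i> * ?e X) + \<i> * (k - 1) * ?e X" by (simp add: algebra_simps)
    also have "cmod \<dots> \<le> cmod (?e1 X + \<i> * ?e X) + cmod (k - 1) * cmod (?e X)"
      using norm_triangle_ineq[of "?e1 X + \<i> * ?e X" "\<i> * (k - 1) * ?e X"] by (simp add: norm_mult)
    also have "\<dots> \<le> cmod (?e1 X + \<i> * ?e X) + 2 * cmod (?e1 X + \<i> * ?e X)"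
    proof (intro add_left_mono mult_mono e_le)
      show "cmod (k - 1) \<le> 2" using norm_triangle_ineq4[of k 1] k by simp
    qed auto
    finally show ?thesis by simp
  qed
  have "exp (- T / Re k) \<le> cmod (1 - jost_alpha q k X / (2 * \<i> * k))"
    unfolding T_def by (rule jost_transmitted_lower_bound[OF q k(1,2)])
  then have "exp (- Im k * X) * (2 * cmod k * exp (- T / Re k)) \<le> exp (- Im k * X) * (2 * cmod k * cmod (1 - jost_alpha q k X / (2 * \<i> * k)))"
    by (intro mult_left_mono) auto
  also have "\<dots> = cmod (?e1 X + \<i> * k * ?e X)"
    unfolding jost_transmitted_eq[OF q k0] norm_mult by simp
  finally have 3: "exp (- Im k * X) * (2 * cmod k * exp (- T / Re k)) \<le> cmod (?e1 X + \<i> * k * ?e X)" .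
  have "Im k \<le> 1" using k abs_Im_le_cmod[of k] by linarith
  then have "Im k * X \<le> 1 * X" using X by (intro mult_right_mono) auto
  then have "exp (- X) * (2 * cmod k * exp (- T / Re k)) \<le> exp (- Im k * X) * (2 * cmod k * exp (- T / Re k))"
    by (intro mult_right_mono) auto
  also note 3
  also note 2
  finally have "exp (- X) * (2 * cmod k * exp (- T / Re k)) \<le> 3 * (cmod (?e1 0 + \<i> * ?e 0) * exp (Q + 3 * X))" using 1 by linarith
  moreover have "cmod (?e1 0 + \<i> * ?e 0) \<le> cmod (?e 0) + cmod (?e1 0)"
    using norm_triangle_ineq[of "?e1 0" "\<i> * ?e 0"] by (simp add: norm_mult)
  then have "3 * (cmod (?e1 0 + \<i> * ?e 0) * exp (Q + 3 * X)) \<le> 3 * ((cmod (?e 0) + cmod (?e1 0)) * exp (Q + 3 * X))"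
    by (intro mult_left_mono mult_right_mono) auto
  ultimately have "exp (- X) * (2 * cmod k * exp (- T / Re k)) \<le> 3 * ((cmod (?e 0) + cmod (?e1 0)) * exp (Q + 3 * X))" by linarith
  then have "exp (- (Q + 3 * X)) * (exp (- X) * (2 * cmod k * exp (- T / Re k))) \<le> exp (- (Q + 3 * X)) * (3 * ((cmod (?e 0) + cmod (?e1 0)) * exp (Q + 3 * X)))"
    by (intro mult_left_mono) auto
  moreover have "exp (- (Q + 3 * X)) * (3 * ((cmod (?e 0) + cmod (?e1 0)) * exp (Q + 3 * X))) = 3 * (cmod (?e 0) + cmod (?e1 0))"
  proof -
    have "exp (- (Q + 3 * X)) * exp (Q + 3 * X) = 1" by (simp only: exp_add[symmetric]) simp
    then show ?thesis by (simp only: mult.assoc[symmetric] mult.commute[of _ "exp (Q + 3 * X)"] mult.left_commute)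
  qed
  moreover have "exp (- (Q + 3 * X)) * exp (- X) = exp (- Q - 4 * X)" by (simp add: exp_add[symmetric])
  ultimately have "exp (- Q - 4 * X) * (2 * cmod k * exp (- T / Re k)) \<le> 3 * (cmod (?e 0) + cmod (?e1 0))"
    by (simp only: mult.assoc[symmetric])
  then show ?thesis unfolding T_def Q_def by simp
qed

text \<open>Before \<open>X\<close> the kernel is bounded by its argument, hence by
  \<open>X\<close>; beyond \<open>X\<close> by \<open>1 / |k|\<close>. In the exponent only the
  small tail of \<open>|q|\<close> is divided by \<open>|k|\<close>.\<close>

lemma jost_m_upper_bound:
  assumes q: "integrable lebesgue q" and k: "Im k \<ge> 0" "k \<noteq> 0" and X: "X \<ge> 0" and x: "x \<ge> 0"
  shows "cmod (jost_m q k x) \<le> exp (X * (\<integral>t. \<bar>q t\<bar> \<partial>lebesgue) + (LINT t:{X..}|lebesgue. \<bar>q t\<bar>) / cmod k)"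
proof -
  let ?p = "\<lambda>t. X * \<bar>q t\<bar> + (indicat_real {X..} t *\<^sub>R \<bar>q t\<bar>) / cmod k"
  have qi: "integrable lebesgue (\<lambda>t. \<bar>q t\<bar>)" using q by simp
  have qX: "integrable lebesgue (\<lambda>t. indicat_real {X..} t *\<^sub>R \<bar>q t\<bar>)"
    using set_integrable_UNIV_subset[OF qi, of "{X..}"] unfolding set_integrable_def by simp
  have p: "integrable lebesgue ?p"
    by (intro Bochner_Integration.integrable_add integrable_mult_right integrable_divide qi qX)
  have p0: "?p t \<ge> 0" for t using X by (auto simp: indicator_def)
  have "cmod (jost_m q k x) \<le> exp (LINT t:{x..}|lebesgue. ?p t)"
  proof (rule jost_m_bounds(2)[OF q k p p0 _ x])
    fix x t :: real assume xt: "0 \<le> x" "x \<le> t"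
    show "cmod (jost_kernel k (t - x)) * \<bar>q t\<bar> \<le> ?p t"
    proof (cases "t < X")
      case True
      have "cmod (jost_kernel k (t - x)) \<le> X" using jost_kernel_bounds(2)[OF k, of "t - x"] xt True by simp
      then have "cmod (jost_kernel k (t - x)) * \<bar>q t\<bar> \<le> X * \<bar>q t\<bar>" by (intro mult_right_mono) auto
      then show ?thesis using True by simp
    next
      case False
      have "cmod (jost_kernel k (t - x)) * \<bar>q t\<bar> \<le> \<bar>q t\<bar> / cmod k" by (rule jost_kernel_dom[OF k]) simp
      moreover have "0 \<le> X * \<bar>q t\<bar>" using X by simp
      ultimately show ?thesis using False by simp
    qed
  qed
  also have "(LINT t:{x..}|lebesgue. ?p t) \<le> (\<integral>t. ?p t \<partial>lebesgue)"
    by (rule tail_integral_mono(3)[OF p p0 order_refl])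
  also have "(\<integral>t. ?p t \<partial>lebesgue) = X * (\<integral>t. \<bar>q t\<bar> \<partial>lebesgue) + (LINT t:{X..}|lebesgue. \<bar>q t\<bar>) / cmod k"
    unfolding set_lebesgue_integral_def using qi qX
    by (subst Bochner_Integration.integral_add) auto
  finally show ?thesis by simp
qed

lemma jost_data_upper_bound:
  assumes q: "integrable lebesgue q" and k: "Im k \<ge> 0" "k \<noteq> 0" "cmod k \<le> 1" and X: "X \<ge> 0"
  shows "cmod (jost q k 0) + cmod (jost1 q k 0) \<le> (2 + (\<integral>t. \<bar>q t\<bar> \<partial>lebesgue)) *
    exp (X * (\<integral>t. \<bar>q t\<bar> \<partial>lebesgue) + (LINT t:{X..}|lebesgue. \<bar>q t\<bar>) / cmod k)"
proof -
  define Q where "Q = (\<integral>t. \<bar>q t\<bar> \<partial>lebesgue)"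
  define E where "E = exp (X * Q + (LINT t:{X..}|lebesgue. \<bar>q t\<bar>) / cmod k)"
  have qi: "integrable lebesgue (\<lambda>t. \<bar>q t\<bar>)" using q by simp
  have T0: "(LINT t:{X..}|lebesgue. \<bar>q t\<bar>) \<ge> 0" by (rule set_integral_nonneg_lebesgue) simp
  have Q0: "Q \<ge> 0" unfolding Q_def by (rule Bochner_Integration.integral_nonneg) simp
  have E1: "E \<ge> 1" using X Q0 T0 by (simp add: E_def)
  have m: "cmod (jost_m q k t) \<le> E" if "t \<ge> 0" for t
    unfolding E_def Q_def by (rule jost_m_upper_bound[OF q k(1,2) X that])
  have w: "set_integrable lebesgue {0..} (\<lambda>t. E * \<bar>q t\<bar>)"
    using set_integrable_UNIV_subset[OF qi, of "{0..}"] by simp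
  have wi: "(LINT t:{0..}|lebesgue. E * \<bar>q t\<bar>) \<le> E * Q"
    using mult_left_mono[OF tail_integral_mono(3)[OF qi abs_ge_zero order_refl, of 0], of E] E1 by (simp add: Q_def)
  have qm: "cmod (of_real (q t) * jost_m q k t) \<le> E * \<bar>q t\<bar>" if "t \<in> {0..}" for t
    using mult_left_mono[OF m[of t], of "\<bar>q t\<bar>"] that by (simp add: norm_mult mult.commute)
  have a: "cmod (jost_alpha q k 0) \<le> E * Q"
    unfolding jost_alpha_def
    by (rule order_trans[OF set_integral_norm_bound_lebesgue[OF set_integrable_UNIV_subset[OF jost_integrable(1)[OF q k(1,2)]] w qm] wi]) auto
  have b: "cmod (jost_beta q k 0) \<le> E * Q"
    unfolding jost_beta_def
  proof (rule order_trans[OF set_integral_norm_bound_lebesgue[OF jost_integrable(2)[OF q k(1,2)] w] wi])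
    fix t :: real assume t: "t \<in> {0..}"
    have "cmod (exp (2 * \<i> * k * of_real t)) \<le> 1" using t k by simp
    then have "cmod (exp (2 * \<i> * k * of_real t)) * cmod (of_real (q t) * jost_m q k t) \<le> 1 * cmod (of_real (q t) * jost_m q k t)"
      by (rule mult_right_mono) simp
    then show "cmod (exp (2 * \<i> * k * of_real t) * (of_real (q t) * jost_m q k t)) \<le> E * \<bar>q t\<bar>"
      using qm[OF t] unfolding norm_mult[of "exp (2 * \<i> * k * of_real t)"] by linarith
  qed
  have "cmod (jost1 q k 0) \<le> cmod (\<i> * k) + cmod ((jost_beta q k 0 + jost_alpha q k 0) / 2)"
    unfolding jost_at_0 by (rule norm_triangle_ineq4)
  also have "\<dots> \<le> 1 + E * Q"
    using a b k(3) norm_triangle_ineq[of "jost_beta q k 0" "jost_alpha q k 0"] by (simp add: norm_mult norm_divide)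
  finally have "cmod (jost1 q k 0) \<le> 1 + E * Q" .
  moreover have "cmod (jost q k 0) \<le> E" unfolding jost_at_0 by (rule m) simp
  ultimately have "cmod (jost q k 0) + cmod (jost1 q k 0) \<le> (2 + Q) * E" using E1 by (simp add: algebra_simps)
  then show ?thesis by (simp add: E_def Q_def)
qed

text \<open>In terms of \<open>w = 1/k\<close> the bound reads \<open>\<epsilon> |w|^5 / (Re w Im w)\<^sup>2\<close>, which is what the Liouville
  argument at \<open>w = \<infinity>\<close> tolerates. Since \<open>q\<close> is merely integrable, nothing sharper on \<open>Re k = 0\<close>
  or \<open>Im k = 0\<close> is available.\<close>

definition negligible_at_0 :: "(complex \<Rightarrow> real) \<Rightarrow> bool" where
  "negligible_at_0 u \<longleftrightarrow> (\<forall>\<epsilon>>0. \<exists>r>0. \<forall>k. cmod k < r \<and> Im k > 0 \<and> Re k \<noteq> 0 \<longrightarrow>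
     \<bar>u k\<bar> \<le> \<epsilon> * (cmod k ^ 3 / (Re k * Im k)\<^sup>2))"

text \<open>The form in which the estimates arise: powers of \<open>|Re k| Im k |k|\<close> come
  from the mass bound and the Wronskian, the exponential from Gronwall's inequality. The constant
  \<open>c\<close> may depend on \<epsilon>, because \<epsilon> determines the point
  \<open>X\<close> beyond which the tail of \<open>|q|\<close> is small.\<close>

definition squeezed_at_0 :: "nat \<Rightarrow> (complex \<Rightarrow> complex) \<Rightarrow> bool" where
  "squeezed_at_0 p f \<longleftrightarrow> (\<forall>\<epsilon>>0. \<exists>c>0. \<forall>k. Im k > 0 \<and> Re k \<noteq> 0 \<and> cmod k \<le> 1 \<longrightarrow>
     c * (\<bar>Re k\<bar> * Im k * cmod k) ^ p * exp (- \<epsilon> / \<bar>Re k\<bar>) \<le> cmod (f k) \<and>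
     c * (\<bar>Re k\<bar> * Im k * cmod k) ^ p * cmod (f k) \<le> exp (\<epsilon> / \<bar>Re k\<bar>))"

text \<open>The weight \<open>w = |k|^3 / (Re k Im k)^2\<close> dominates \<open>1 / |Re k|\<close>,
  so the exponentials contribute at most half of \<open>\<epsilon> w\<close>. Constants and the
  logarithm of the power are O(sqrt |k|) times \<open>w\<close>, and a small radius takes care of
  them.\<close>

lemma squeezed_imp_negligible:
  assumes "squeezed_at_0 p f"
  shows "negligible_at_0 (\<lambda>k. ln (cmod (f k)))"
  unfolding negligible_at_0_def
proof (intro allI impI)
  fix \<epsilon> :: real assume \<epsilon>: "\<epsilon> > 0"
  then have e2: "\<epsilon> / 2 > 0" by simp
  obtain c where c: "c > 0" and B: "\<And>k. Im k > 0 \<and> Re k \<noteq> 0 \<and> cmod k \<le> 1 \<Longrightarrow>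
     c * (\<bar>Re k\<bar> * Im k * cmod k) ^ p * exp (- (\<epsilon> / 2) / \<bar>Re k\<bar>) \<le> cmod (f k) \<and>
     c * (\<bar>Re k\<bar> * Im k * cmod k) ^ p * cmod (f k) \<le> exp ((\<epsilon> / 2) / \<bar>Re k\<bar>)"
    using assms e2 unfolding squeezed_at_0_def by blast
  \<comment> \<open>The 7 is the constant in the bound for \<open>ln (1/s)\<close>: 1 from
    \<open>ln y\<close> and 2 from each of the three logarithms of \<open>1 / |k|\<close>. The
    radius makes \<open>M sqrt |k|\<close> at most \<open>\<epsilon> / 2\<close>.\<close>
  define M where "M = \<bar>ln c\<bar> + 7 * real p + 1"
  have M: "M > 0" by (simp add: M_def)
  define r where "r = min 1 ((\<epsilon> / (2 * M))\<^sup>2)"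
  have r: "r > 0" using \<epsilon> M by (simp add: r_def)
  show "\<exists>r>0. \<forall>k. cmod k < r \<and> Im k > 0 \<and> Re k \<noteq> 0 \<longrightarrow> \<bar>ln (cmod (f k))\<bar> \<le> \<epsilon> * (cmod k ^ 3 / (Re k * Im k)\<^sup>2)"
  proof (intro exI[of _ r] conjI r allI impI)
    fix k assume k: "cmod k < r \<and> Im k > 0 \<and> Re k \<noteq> 0"
    define a b \<rho> where "a = \<bar>Re k\<bar>" and "b = Im k" and "\<rho> = cmod k"
    have ab: "a > 0" "b > 0" using k by (auto simp: a_def b_def)
    have \<rho>: "\<rho> > 0" "\<rho> < 1" "a \<le> \<rho>" "b \<le> \<rho>" "a\<^sup>2 + b\<^sup>2 = \<rho>\<^sup>2"
      using k abs_Re_le_cmod[of k] abs_Im_le_cmod[of k] by (auto simp: a_def b_def \<rho>_def r_def cmod_power2)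
    define w where "w = \<rho> ^ 3 / (a * b)\<^sup>2"
    \<comment> \<open>A dimensionless angle factor, at least 1 and large near the axes. It satisfies
      \<open>\<rho> w = y^2\<close>, so the weight absorbs \<open>y\<close> with a gain of
      \<open>\<rho>\<close>.\<close>
    define y where "y = \<rho>\<^sup>2 / (a * b)"
    have abp: "a * b > 0" using ab by simp
    have y1: "y \<ge> 1"
    proof -
      have "a * b \<le> \<rho> * \<rho>" using ab \<rho> by (intro mult_mono) auto
      then show ?thesis using abp by (simp add: y_def power2_eq_square)
    qed
    have wy: "\<rho> * w = y * y" unfolding w_def y_def using \<rho>(1) abp by (simp add: field_simps power2_eq_square power3_eq_cube)
    have w0: "w > 0" unfolding w_def using \<rho>(1) abp by (intro divide_pos_pos zero_less_power)
    have yw: "y \<le> \<rho> * w" unfolding wy using mult_left_mono[OF y1, of y] y1 by simp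
    have aw: "1 / a \<le> w"
    proof -
      have "a * b\<^sup>2 \<le> \<rho> * \<rho>\<^sup>2" using ab \<rho> by (intro mult_mono power_mono) auto
      then have "a * b\<^sup>2 * a \<le> \<rho> ^ 3 * a" using ab by (intro mult_right_mono) (auto simp: power3_eq_cube power2_eq_square)
      then show ?thesis unfolding w_def using ab by (simp add: field_simps power2_eq_square)
    qed
    define s where "s = a * b * \<rho>"
    have s: "s > 0" using ab \<rho> by (simp add: s_def)
    have lnr: "ln (1 / \<rho>) \<le> 2 * (1 / sqrt \<rho>)"
    proof -
      have "ln (1 / \<rho>) = 2 * ln (1 / sqrt \<rho>)" using \<rho>(1) by (simp add: ln_div ln_sqrt)
      moreover have "ln (1 / sqrt \<rho>) \<le> 1 / sqrt \<rho>" using \<rho>(1) by (intro ln_bound) simp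
      ultimately show ?thesis by simp
    qed
    have sq: "1 / sqrt \<rho> \<le> sqrt \<rho> * w"
    proof -
      have "sqrt \<rho> * (1 / sqrt \<rho>) = 1" using \<rho>(1) by simp
      also have "\<dots> \<le> \<rho> * w" using y1 yw by linarith
      also have "\<dots> = sqrt \<rho> * (sqrt \<rho> * w)" using \<rho>(1) by simp
      finally show ?thesis by (rule mult_left_le_imp_le) (use \<rho>(1) in simp)
    qed
    have rs: "\<rho> \<le> sqrt \<rho>" using \<rho> by (intro real_le_rsqrt) (simp add: power2_eq_square)
    have ps: "\<rho> * w \<le> sqrt \<rho> * w" using rs w0 by (intro mult_right_mono) auto
    have ls: "ln (1 / s) \<le> 7 * (sqrt \<rho> * w)"
    proof -
      have "1 / s = y * (1 / \<rho>) * (1 / \<rho>) * (1 / \<rho>)" unfolding s_def y_def using \<rho>(1) abp by (simp add: field_simps power2_eq_square)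
      then have "ln (1 / s) = ln y + 3 * ln (1 / \<rho>)" using \<rho>(1) y1 by (simp add: ln_mult ln_div)
      also have "ln y \<le> y" using y1 by (intro ln_bound) simp
      finally show ?thesis using lnr sq yw ps by linarith
    qed
    have low: "c * s ^ p * exp (- (\<epsilon> / 2) / a) \<le> cmod (f k)" and up: "c * s ^ p * cmod (f k) \<le> exp ((\<epsilon> / 2) / a)"
      using B[of k] k \<rho>(2) by (auto simp: a_def b_def \<rho>_def s_def)
    have cs: "c * s ^ p > 0" using c s by simp
    have f0: "cmod (f k) > 0" by (rule less_le_trans[OF _ low]) (use cs in simp)
    have "ln (c * s ^ p * exp (- (\<epsilon> / 2) / a)) \<le> ln (cmod (f k))"
      using low cs f0 by (subst ln_le_cancel_iff) auto
    then have 1: "ln c + real p * ln s - (\<epsilon> / 2) / a \<le> ln (cmod (f k))"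
      using c s by (simp add: ln_mult ln_realpow)
    have "ln (c * s ^ p * cmod (f k)) \<le> ln (exp ((\<epsilon> / 2) / a))"
      using up cs f0 by (subst ln_le_cancel_iff) auto
    then have 2: "ln c + real p * ln s + ln (cmod (f k)) \<le> (\<epsilon> / 2) / a"
      using c s f0 by (simp add: ln_mult ln_realpow)
    have 3: "- ln s \<le> 7 * (sqrt \<rho> * w)" using ls s by (simp add: ln_div)
    have 4: "real p * (- ln s) \<le> real p * (7 * (sqrt \<rho> * w))" by (intro mult_left_mono 3) simp
    have 5: "\<bar>ln c\<bar> * 1 \<le> \<bar>ln c\<bar> * (sqrt \<rho> * w)" using y1 yw ps by (intro mult_left_mono) auto
    have 6: "(\<epsilon> / 2) * (1 / a) \<le> (\<epsilon> / 2) * w" using \<epsilon> by (intro mult_left_mono aw) auto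
    have "\<bar>ln (cmod (f k))\<bar> \<le> \<bar>ln c\<bar> + real p * (- ln s) + (\<epsilon> / 2) / a" using 1 2 by (simp add: abs_le_iff) linarith
    also have "\<dots> \<le> \<bar>ln c\<bar> * (sqrt \<rho> * w) + real p * (7 * (sqrt \<rho> * w)) + (\<epsilon> / 2) * w" using 4 5 6 by simp
    also have "\<dots> = (\<bar>ln c\<bar> + 7 * real p) * sqrt \<rho> * w + (\<epsilon> / 2) * w" by (simp add: algebra_simps)
    also have "\<dots> \<le> (\<epsilon> / 2) * w + (\<epsilon> / 2) * w"
    proof (intro add_right_mono mult_right_mono)
      have "\<rho> \<le> (\<epsilon> / (2 * M))\<^sup>2" using k by (auto simp: \<rho>_def r_def)
      then have "sqrt \<rho> \<le> \<epsilon> / (2 * M)" using \<epsilon> M by (intro real_le_lsqrt) auto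
      then have "M * sqrt \<rho> \<le> M * (\<epsilon> / (2 * M))" using M by (intro mult_left_mono) auto
      also have "\<dots> = \<epsilon> / 2" using M by simp
      finally have "M * sqrt \<rho> \<le> \<epsilon> / 2" .
      moreover have "(\<bar>ln c\<bar> + 7 * real p) * sqrt \<rho> \<le> M * sqrt \<rho>" using \<rho>(1) by (intro mult_right_mono) (auto simp: M_def)
      ultimately show "(\<bar>ln c\<bar> + 7 * real p) * sqrt \<rho> \<le> \<epsilon> / 2" by linarith
    qed (use w0 in simp)
    also have "\<dots> = \<epsilon> * w" by simp
    finally show "\<bar>ln (cmod (f k))\<bar> \<le> \<epsilon> * (cmod k ^ 3 / (Re k * Im k)\<^sup>2)"
      by (simp add: w_def a_def b_def \<rho>_def power_mult_distrib)
  qed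
qed

text \<open>The point \<open>X\<close> is chosen with the tail of \<open>|q|\<close> below
  \<epsilon>; whatever depends on \<open>X\<close> goes into \<open>c\<close>. The case
  \<open>Re k < 0\<close> is obtained from \<open>Re k > 0\<close> by conjugation.\<close>

lemma jost_data_bounds_all:
  assumes q: "integrable lebesgue q" and e: "\<epsilon> > 0"
  shows "\<exists>c>0. \<forall>k. Im k > 0 \<and> Re k \<noteq> 0 \<and> cmod k \<le> 1 \<longrightarrow>
    c * (\<bar>Re k\<bar> * Im k * cmod k) * exp (- \<epsilon> / \<bar>Re k\<bar>) \<le> cmod (jost q k 0) \<and>
    c * (\<bar>Re k\<bar> * Im k) * (cmod (jost q k 0))\<^sup>2 \<le> \<bar>Im (jost1 q k 0 * cnj (jost q k 0))\<bar> \<and>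
    c * (cmod (jost q k 0) + cmod (jost1 q k 0)) \<le> exp (\<epsilon> / \<bar>Re k\<bar>)"
proof -
  define Q where "Q = (\<integral>t. \<bar>q t\<bar> \<partial>lebesgue)"
  have Q0: "Q \<ge> 0" unfolding Q_def by (rule Bochner_Integration.integral_nonneg) simp
  have qi: "integrable lebesgue (\<lambda>t. \<bar>q t\<bar>)" using q by simp
  have "eventually (\<lambda>x. dist (LINT t:{x..}|lebesgue. \<bar>q t\<bar>) 0 < \<epsilon> \<and> x \<ge> 0) at_top"
    using tendstoD[OF tail_integral_tendsto_0[OF qi] e] by (intro eventually_conj eventually_ge_at_top)
  from eventually_happens'[OF trivial_limit_at_top_linorder this] obtain X where
    X: "X \<ge> 0" "\<bar>LINT t:{X..}|lebesgue. \<bar>q t\<bar>\<bar> < \<epsilon>" by (auto simp: dist_norm)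
  define T where "T = (LINT t:{X..}|lebesgue. \<bar>q t\<bar>)"
  have T: "0 \<le> T" "T \<le> \<epsilon>" using X set_integral_nonneg_lebesgue[of "{X..}" "\<lambda>t. \<bar>q t\<bar>"] by (auto simp: T_def)
  obtain c0 where c0: "c0 > 0" and mass: "\<And>k. Im k > 0 \<and> cmod k \<le> 1 \<Longrightarrow>
    c0 * (cmod (jost q k 0) + cmod (jost1 q k 0))\<^sup>2 \<le> (LINT t:{0..}|lebesgue. (cmod (jost q k t))\<^sup>2)"
    using jost_mass_lower_bound[OF q] by blast
  define c1 where "c1 = 2 * c0 * ((2/3) * exp (- Q - 4 * X))"
  define c where "c = min c1 (min (2 * c0) (1 / ((2 + Q) * exp (X * Q))))"
  have c: "c > 0" "c \<le> c1" "c \<le> 2 * c0" "c \<le> 1 / ((2 + Q) * exp (X * Q))"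
    using c0 Q0 by (auto simp: c_def c1_def)
  have pos: "c * (Re k * Im k * cmod k) * exp (- \<epsilon> / Re k) \<le> cmod (jost q k 0) \<and>
    c * (Re k * Im k) * (cmod (jost q k 0))\<^sup>2 \<le> \<bar>Im (jost1 q k 0 * cnj (jost q k 0))\<bar> \<and>
    c * (cmod (jost q k 0) + cmod (jost1 q k 0)) \<le> exp (\<epsilon> / Re k)"
    if k: "Im k > 0" "Re k > 0" "cmod k \<le> 1" for k
  proof -
    define f g where "f = cmod (jost q k 0)" and "g = cmod (jost1 q k 0)"
    have fg: "f \<ge> 0" "g \<ge> 0" by (auto simp: f_def g_def)
    have k0: "Im k \<ge> 0" "k \<noteq> 0" using k by auto
    have ri: "Re k * Im k > 0" using k by simp
    have "c0 * (f + g)\<^sup>2 \<le> (LINT t:{0..}|lebesgue. (cmod (jost q k t))\<^sup>2)" using mass[of k] k by (simp add: f_def g_def)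
    then have "Im (k\<^sup>2) * (c0 * (f + g)\<^sup>2) \<le> Im (jost1 q k 0 * cnj (jost q k 0))"
      unfolding jost_Im_identity[OF q k(1)] using k by (intro mult_left_mono) (auto simp: power2_eq_square)
    moreover have "Im (k\<^sup>2) = 2 * (Re k * Im k)" by (simp add: power2_eq_square)
    ultimately have I: "2 * c0 * (Re k * Im k) * (f + g)\<^sup>2 \<le> Im (jost1 q k 0 * cnj (jost q k 0))" by (simp add: mult_ac)
    have low: "(2/3) * exp (- Q - 4 * X) * cmod k * exp (- T / Re k) \<le> f + g"
      unfolding Q_def T_def f_def g_def by (rule jost_data_lower_bound[OF q k X(1)])
    have fgp: "f + g > 0" by (rule less_le_trans[OF _ low]) (use k0 in simp)
    have "Im (jost1 q k 0 * cnj (jost q k 0)) \<le> g * f"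
      using abs_Im_le_cmod[of "jost1 q k 0 * cnj (jost q k 0)"] by (simp add: norm_mult f_def g_def)
    also have "\<dots> \<le> (f + g) * f" using fg by (intro mult_right_mono) auto
    finally have "(f + g) * (2 * c0 * (Re k * Im k) * (f + g)) \<le> (f + g) * f" using I by (simp add: power2_eq_square mult_ac)
    \<comment> \<open>The mass bounds the squared Cauchy data from above, and
      \<open>Im (jost1 cnj jost)\<close> is at most \<open>f g\<close>; dividing by
      \<open>f + g\<close> leaves a lower bound for the value \<open>f\<close> alone.\<close>
    then have F: "2 * c0 * (Re k * Im k) * (f + g) \<le> f" using fgp by (simp add: mult_le_cancel_left_pos)
    have "c * (Re k * Im k * cmod k) * exp (- \<epsilon> / Re k) \<le> c1 * (Re k * Im k * cmod k) * exp (- T / Re k)"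
      using c c0 ri T k by (intro mult_mono) (auto simp: c1_def divide_right_mono)
    also have "\<dots> = 2 * c0 * (Re k * Im k) * ((2/3) * exp (- Q - 4 * X) * cmod k * exp (- T / Re k))" by (simp add: c1_def)
    also have "\<dots> \<le> 2 * c0 * (Re k * Im k) * (f + g)" using c0 ri by (intro mult_left_mono low) auto
    also note F
    finally have 1: "c * (Re k * Im k * cmod k) * exp (- \<epsilon> / Re k) \<le> f" .
    have "c * (Re k * Im k) * f\<^sup>2 \<le> 2 * c0 * (Re k * Im k) * (f + g)\<^sup>2"
      using c c0 ri fg k by (intro mult_mono power_mono) auto
    then have 2: "c * (Re k * Im k) * f\<^sup>2 \<le> \<bar>Im (jost1 q k 0 * cnj (jost q k 0))\<bar>" using I by linarith
    have "c * (f + g) \<le> (1 / ((2 + Q) * exp (X * Q))) * ((2 + Q) * exp (X * Q + T / cmod k))"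
      using c fg Q0 jost_data_upper_bound[OF q k0 k(3) X(1)] unfolding Q_def[symmetric] T_def[symmetric] f_def[symmetric] g_def[symmetric]
      by (intro mult_mono) auto
    also have "\<dots> = exp (T / cmod k)" using Q0 by (simp add: exp_add)
    also have "\<dots> \<le> exp (\<epsilon> / Re k)"
    proof -
      have "T / cmod k \<le> \<epsilon> / Re k" using T k abs_Re_le_cmod[of k] by (intro frac_le) auto
      then show ?thesis by simp
    qed
    finally show ?thesis using 1 2 by (simp add: f_def g_def)
  qed
  show ?thesis
  proof (intro exI[of _ c] conjI c(1) allI impI)
    fix k assume k: "Im k > 0 \<and> Re k \<noteq> 0 \<and> cmod k \<le> 1"
    have "c * (\<bar>Re k\<bar> * Im k * cmod k) * exp (- \<epsilon> / \<bar>Re k\<bar>) \<le> cmod (jost q k 0) \<and>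
    c * (\<bar>Re k\<bar> * Im k) * (cmod (jost q k 0))\<^sup>2 \<le> \<bar>Im (jost1 q k 0 * cnj (jost q k 0))\<bar> \<and>
    c * (cmod (jost q k 0) + cmod (jost1 q k 0)) \<le> exp (\<epsilon> / \<bar>Re k\<bar>)"
    proof (cases "Re k > 0")
      case True
      then show ?thesis using pos[of k] k by simp
    next
      case False
      define l where "l = - cnj k"
      have l: "Im l > 0" "Re l > 0" "cmod l \<le> 1" using False k by (auto simp: l_def)
      have k0: "Im k \<ge> 0" "k \<noteq> 0" using k by auto
      have kl: "k = - cnj l" by (simp add: l_def)
      have lj: "jost q l 0 = cnj (jost q k 0)" "jost1 q l 0 = cnj (jost1 q k 0)"
        unfolding l_def by (rule jost_cnj[OF q k0])+
      have "\<bar>Im (cnj (jost1 q k 0) * jost q k 0)\<bar> = \<bar>Im (jost1 q k 0 * cnj (jost q k 0))\<bar>" by simp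
      then show ?thesis using pos[OF l] False k unfolding lj by (simp add: l_def)
    qed
    then show "c * (\<bar>Re k\<bar> * Im k * cmod k) * exp (- \<epsilon> / \<bar>Re k\<bar>) \<le> cmod (jost q k 0)"
      "c * (\<bar>Re k\<bar> * Im k) * (cmod (jost q k 0))\<^sup>2 \<le> \<bar>Im (jost1 q k 0 * cnj (jost q k 0))\<bar>"
      "c * (cmod (jost q k 0) + cmod (jost1 q k 0)) \<le> exp (\<epsilon> / \<bar>Re k\<bar>)" by auto
  qed
qed

lemma squeezed_jost:
  assumes q: "integrable lebesgue q"
  shows "squeezed_at_0 1 (\<lambda>k. jost q k 0)"
  unfolding squeezed_at_0_def
proof (intro allI impI)
  fix \<epsilon> :: real assume "\<epsilon> > 0"
  then obtain c where c: "c > 0" and B: "\<And>k. Im k > 0 \<and> Re k \<noteq> 0 \<and> cmod k \<le> 1 \<Longrightarrow>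
    c * (\<bar>Re k\<bar> * Im k * cmod k) * exp (- \<epsilon> / \<bar>Re k\<bar>) \<le> cmod (jost q k 0) \<and>
    c * (\<bar>Re k\<bar> * Im k) * (cmod (jost q k 0))\<^sup>2 \<le> \<bar>Im (jost1 q k 0 * cnj (jost q k 0))\<bar> \<and>
    c * (cmod (jost q k 0) + cmod (jost1 q k 0)) \<le> exp (\<epsilon> / \<bar>Re k\<bar>)"
    using jost_data_bounds_all[OF q] by blast
  show "\<exists>c>0. \<forall>k. Im k > 0 \<and> Re k \<noteq> 0 \<and> cmod k \<le> 1 \<longrightarrow>
     c * (\<bar>Re k\<bar> * Im k * cmod k) ^ 1 * exp (- \<epsilon> / \<bar>Re k\<bar>) \<le> cmod (jost q k 0) \<and>
     c * (\<bar>Re k\<bar> * Im k * cmod k) ^ 1 * cmod (jost q k 0) \<le> exp (\<epsilon> / \<bar>Re k\<bar>)"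
  proof (intro exI[of _ c] conjI c allI impI)
    fix k assume k: "Im k > 0 \<and> Re k \<noteq> 0 \<and> cmod k \<le> 1"
    show "c * (\<bar>Re k\<bar> * Im k * cmod k) ^ 1 * exp (- \<epsilon> / \<bar>Re k\<bar>) \<le> cmod (jost q k 0)" using B[OF k] by simp
    have "\<bar>Re k\<bar> * Im k * cmod k \<le> 1 * 1 * 1"
      using k abs_Re_le_cmod[of k] abs_Im_le_cmod[of k] by (intro mult_mono) auto
    then have "(\<bar>Re k\<bar> * Im k * cmod k) * (c * cmod (jost q k 0)) \<le> 1 * (c * cmod (jost q k 0))" using c by (intro mult_right_mono) auto
    also have "\<dots> \<le> c * (cmod (jost q k 0) + cmod (jost1 q k 0))" using c by simp
    also have "\<dots> \<le> exp (\<epsilon> / \<bar>Re k\<bar>)" using B[OF k] by blast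
    finally show "c * (\<bar>Re k\<bar> * Im k * cmod k) ^ 1 * cmod (jost q k 0) \<le> exp (\<epsilon> / \<bar>Re k\<bar>)" by (simp add: mult_ac)
  qed
qed

text \<open>The reciprocal of the transmission coefficient; \<open>p\<close> is the reflected potential, whose right
  Jost solution is the left Jost solution of \<open>q\<close>.\<close>

definition wronskian_coeff :: "(real \<Rightarrow> real) \<Rightarrow> (real \<Rightarrow> real) \<Rightarrow> complex \<Rightarrow> complex" where
  "wronskian_coeff q p k = (jost q k 0 * jost1 p k 0 + jost1 q k 0 * jost p k 0) / (2 * \<i> * k)"

text \<open>The imaginary parts of \<open>F1 cnj F\<close> and \<open>G1 cnj G\<close> both have the
  sign of Im (k^2), so there is no cancellation in the imaginary part of
  \<open>(F G1 + F1 G) cnj F cnj G\<close>. This bounds the Wronskian below by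
  \<open>|Re k| Im k |F G|\<close> up to a constant. The power 3 counts this factor and one each
  from the lower bounds of \<open>F\<close> and \<open>G\<close>.\<close>

lemma squeezed_wronskian_coeff:
  assumes q: "integrable lebesgue q" and p: "integrable lebesgue p"
  shows "squeezed_at_0 3 (wronskian_coeff q p)"
  unfolding squeezed_at_0_def
proof (intro allI impI)
  fix \<epsilon> :: real assume "\<epsilon> > 0"
  then have e2: "\<epsilon> / 2 > 0" by simp
  obtain c where c: "c > 0" and B: "\<And>k. Im k > 0 \<and> Re k \<noteq> 0 \<and> cmod k \<le> 1 \<Longrightarrow>
    c * (\<bar>Re k\<bar> * Im k * cmod k) * exp (- (\<epsilon> / 2) / \<bar>Re k\<bar>) \<le> cmod (jost q k 0) \<and>
    c * (\<bar>Re k\<bar> * Im k) * (cmod (jost q k 0))\<^sup>2 \<le> \<bar>Im (jost1 q k 0 * cnj (jost q k 0))\<bar> \<and>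
    c * (cmod (jost q k 0) + cmod (jost1 q k 0)) \<le> exp ((\<epsilon> / 2) / \<bar>Re k\<bar>)"
    using jost_data_bounds_all[OF q e2] by blast
  obtain d where d: "d > 0" and D: "\<And>k. Im k > 0 \<and> Re k \<noteq> 0 \<and> cmod k \<le> 1 \<Longrightarrow>
    d * (\<bar>Re k\<bar> * Im k * cmod k) * exp (- (\<epsilon> / 2) / \<bar>Re k\<bar>) \<le> cmod (jost p k 0) \<and>
    d * (\<bar>Re k\<bar> * Im k) * (cmod (jost p k 0))\<^sup>2 \<le> \<bar>Im (jost1 p k 0 * cnj (jost p k 0))\<bar> \<and>
    d * (cmod (jost p k 0) + cmod (jost1 p k 0)) \<le> exp ((\<epsilon> / 2) / \<bar>Re k\<bar>)"
    using jost_data_bounds_all[OF p e2] by blast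
  \<comment> \<open>In the first entry two factors \<open>c\<close> and \<open>d\<close> belong to
    the lower bounds of \<open>F\<close> and \<open>G\<close>, the other \<open>c\<close> to the
    Wronskian estimate, and the half to the denominator \<open>2ik\<close>. The second entry serves
    the upper bound.\<close>
  define C where "C = min (c * c * d / 2) (c * d)"
  have C: "C > 0" "C \<le> c * c * d / 2" "C \<le> c * d" using c d by (auto simp: C_def)
  show "\<exists>C>0. \<forall>k. Im k > 0 \<and> Re k \<noteq> 0 \<and> cmod k \<le> 1 \<longrightarrow>
     C * (\<bar>Re k\<bar> * Im k * cmod k) ^ 3 * exp (- \<epsilon> / \<bar>Re k\<bar>) \<le> cmod (wronskian_coeff q p k) \<and>
     C * (\<bar>Re k\<bar> * Im k * cmod k) ^ 3 * cmod (wronskian_coeff q p k) \<le> exp (\<epsilon> / \<bar>Re k\<bar>)"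
  proof (intro exI[of _ C] conjI C(1) allI impI)
    fix k assume k: "Im k > 0 \<and> Re k \<noteq> 0 \<and> cmod k \<le> 1"
    define F F1 G G1 where "F = jost q k 0" and "F1 = jost1 q k 0" and "G = jost p k 0" and "G1 = jost1 p k 0"
    define s where "s = \<bar>Re k\<bar> * Im k * cmod k"
    define E where "E = exp (- (\<epsilon> / 2) / \<bar>Re k\<bar>)"
    define N where "N = F * G1 + F1 * G"
    have k0: "cmod k > 0" "cmod k \<le> 1" using k by auto
    have s: "0 < s" "s \<le> 1" "s \<le> cmod k" "s \<le> \<bar>Re k\<bar> * Im k"
    proof -
      show "0 < s" using k k0 by (simp add: s_def)
      have a: "\<bar>Re k\<bar> * Im k \<le> 1 * 1" using k abs_Re_le_cmod[of k] abs_Im_le_cmod[of k] by (intro mult_mono) auto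
      have "\<bar>Re k\<bar> * Im k * cmod k \<le> 1 * cmod k" by (rule mult_right_mono) (use a in auto)
      then show "s \<le> cmod k" by (simp add: s_def)
      then show "s \<le> 1" using k0 by linarith
      have "\<bar>Re k\<bar> * Im k * cmod k \<le> \<bar>Re k\<bar> * Im k * 1" using k by (intro mult_left_mono) auto
      then show "s \<le> \<bar>Re k\<bar> * Im k" by (simp add: s_def)
    qed
    have EE: "E * E = exp (- \<epsilon> / \<bar>Re k\<bar>)" by (simp add: E_def exp_add[symmetric])
    have bF: "c * s * E \<le> cmod F" "c * (\<bar>Re k\<bar> * Im k) * (cmod F)\<^sup>2 \<le> \<bar>Im (F1 * cnj F)\<bar>" "c * (cmod F + cmod F1) \<le> exp ((\<epsilon> / 2) / \<bar>Re k\<bar>)"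
      using B[OF k] by (auto simp: F_def F1_def s_def E_def)
    have bG: "d * s * E \<le> cmod G" "d * (cmod G + cmod G1) \<le> exp ((\<epsilon> / 2) / \<bar>Re k\<bar>)"
      using D[OF k] by (auto simp: G_def G1_def s_def E_def)
    have F0: "cmod F > 0" by (rule less_le_trans[OF _ bF(1)]) (use c s in \<open>simp add: E_def\<close>)
    have G0: "cmod G > 0" by (rule less_le_trans[OF _ bG(1)]) (use d s in \<open>simp add: E_def\<close>)
    have same: "\<bar>Im (F1 * cnj F)\<bar> * (cmod G)\<^sup>2 \<le> \<bar>(cmod F)\<^sup>2 * Im (G1 * cnj G) + (cmod G)\<^sup>2 * Im (F1 * cnj F)\<bar>"
    proof -
      define a b where "a = (LINT t:{0..}|lebesgue. (cmod (jost q k t))\<^sup>2)" and "b = (LINT t:{0..}|lebesgue. (cmod (jost p k t))\<^sup>2)"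
      have a0: "a \<ge> 0" "b \<ge> 0" unfolding a_def b_def by (intro set_integral_nonneg_lebesgue; simp)+
      have I: "Im (F1 * cnj F) = Im (k\<^sup>2) * a" "Im (G1 * cnj G) = Im (k\<^sup>2) * b"
        using jost_Im_identity[OF q, of k 0] jost_Im_identity[OF p, of k 0] k by (auto simp: F_def F1_def G_def G1_def a_def b_def)
      have "\<bar>(cmod F)\<^sup>2 * (Im (k\<^sup>2) * b) + (cmod G)\<^sup>2 * (Im (k\<^sup>2) * a)\<bar> = \<bar>Im (k\<^sup>2)\<bar> * ((cmod F)\<^sup>2 * b + (cmod G)\<^sup>2 * a)"
      proof -
        have "(cmod F)\<^sup>2 * (Im (k\<^sup>2) * b) + (cmod G)\<^sup>2 * (Im (k\<^sup>2) * a) = Im (k\<^sup>2) * ((cmod F)\<^sup>2 * b + (cmod G)\<^sup>2 * a)"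
          by (simp add: algebra_simps)
        then show ?thesis using a0 by (simp add: abs_mult)
      qed
      moreover have "\<bar>Im (k\<^sup>2) * a\<bar> * (cmod G)\<^sup>2 \<le> \<bar>Im (k\<^sup>2)\<bar> * ((cmod F)\<^sup>2 * b + (cmod G)\<^sup>2 * a)"
        using a0 by (simp add: abs_mult algebra_simps)
      ultimately show ?thesis unfolding I by simp
    qed
    have "Im (N * cnj F * cnj G) = (cmod F)\<^sup>2 * Im (G1 * cnj G) + (cmod G)\<^sup>2 * Im (F1 * cnj F)"
      unfolding N_def cmod_power2 by (simp add: power2_eq_square algebra_simps)
    then have "(c * (\<bar>Re k\<bar> * Im k) * (cmod F)\<^sup>2) * (cmod G)\<^sup>2 \<le> \<bar>Im (N * cnj F * cnj G)\<bar>"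
      using same mult_right_mono[OF bF(2), of "(cmod G)\<^sup>2"] by simp
    also have "\<dots> \<le> cmod N * cmod F * cmod G" using abs_Im_le_cmod[of "N * cnj F * cnj G"] by (simp add: norm_mult)
    finally have "(cmod F * cmod G) * (c * (\<bar>Re k\<bar> * Im k) * (cmod F * cmod G)) \<le> (cmod F * cmod G) * cmod N"
      by (simp add: power2_eq_square mult_ac)
    then have N1: "c * (\<bar>Re k\<bar> * Im k) * (cmod F * cmod G) \<le> cmod N"
      using F0 G0 by (simp add: mult_le_cancel_left_pos)
    have coeff: "cmod (wronskian_coeff q p k) = cmod N / (2 * cmod k)"
      by (simp add: wronskian_coeff_def N_def F_def F1_def G_def G1_def norm_divide norm_mult)
    have "C * s ^ 3 * (E * E) \<le> (c * c * d / 2) * s ^ 3 * (E * E)"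
      using C s by (intro mult_right_mono) (auto simp: E_def)
    also have "\<dots> = (c * s * ((c * s * E) * (d * s * E))) / 2" by (simp add: power3_eq_cube)
    also have "\<dots> \<le> (c * (\<bar>Re k\<bar> * Im k) * (cmod F * cmod G)) / 2"
      using c d s bF(1) bG(1) by (intro divide_right_mono mult_mono) (auto simp: E_def)
    also have "\<dots> \<le> cmod N / 2" using N1 by simp
    also have "\<dots> \<le> cmod N / (2 * cmod k)"
      using k0 by (intro divide_left_mono) auto
    finally show "C * (\<bar>Re k\<bar> * Im k * cmod k) ^ 3 * exp (- \<epsilon> / \<bar>Re k\<bar>) \<le> cmod (wronskian_coeff q p k)"
      unfolding coeff EE s_def .
    have "cmod N \<le> (cmod F + cmod F1) * (cmod G + cmod G1)"
    proof -
      have "cmod N \<le> cmod F * cmod G1 + cmod F1 * cmod G" unfolding N_def using norm_triangle_ineq[of "F * G1" "F1 * G"] by (simp add: norm_mult)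
      moreover have "0 \<le> cmod F * cmod G + cmod F1 * cmod G1" by simp
      ultimately show ?thesis unfolding distrib_left distrib_right by linarith
    qed
    then have "(c * d) * cmod N \<le> (c * d) * ((cmod F + cmod F1) * (cmod G + cmod G1))" using c d by (intro mult_left_mono) auto
    also have "\<dots> = (c * (cmod F + cmod F1)) * (d * (cmod G + cmod G1))" by (simp add: mult_ac)
    also have "\<dots> \<le> exp ((\<epsilon> / 2) / \<bar>Re k\<bar>) * exp ((\<epsilon> / 2) / \<bar>Re k\<bar>)" using bF(3) bG(2) c d by (intro mult_mono) auto
    also have "\<dots> = exp (\<epsilon> / \<bar>Re k\<bar>)" by (simp add: exp_add[symmetric])
    finally have up: "(c * d) * cmod N \<le> exp (\<epsilon> / \<bar>Re k\<bar>)" .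
    have "s ^ 3 / cmod k \<le> 1"
    proof -
      have "s ^ 3 = s * (s * s)" by (simp add: power3_eq_cube)
      also have "\<dots> \<le> cmod k * (1 * 1)" using s by (intro mult_mono) auto
      finally show ?thesis using k0 by simp
    qed
    then have "C * s ^ 3 * (cmod N / (2 * cmod k)) \<le> C * 1 * (cmod N / 2)"
    proof -
      assume "s ^ 3 / cmod k \<le> 1"
      then have "(C * (cmod N / 2)) * (s ^ 3 / cmod k) \<le> (C * (cmod N / 2)) * 1" using C(1) by (intro mult_left_mono) auto
      then show ?thesis by (simp add: mult_ac)
    qed
    also have "\<dots> \<le> (c * d) * cmod N" using C by (intro order_trans[OF _ mult_right_mono[OF C(3)]]) auto
    also note up
    finally show "C * (\<bar>Re k\<bar> * Im k * cmod k) ^ 3 * cmod (wronskian_coeff q p k) \<le> exp (\<epsilon> / \<bar>Re k\<bar>)"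
      unfolding coeff s_def .
  qed
qed

section \<open>A Liouville argument\<close>

text \<open>Cauchy's formula for a Taylor coefficient, as a mean over the circle parametrized by
  {0..1}; the contour derivative supplies one factor \<open>w\<close>, which lowers the exponent
  from \<open>Suc m\<close> to \<open>m\<close>.\<close>

lemma circle_mean_coeff:
  assumes f: "f holomorphic_on UNIV" and r: "r > 0"
  shows "((\<lambda>t. f (of_real r * exp (2 * of_real pi * \<i> * of_real t)) / (of_real r * exp (2 * of_real pi * \<i> * of_real t)) ^ m)
     has_integral (deriv ^^ m) f 0 / fact m) {0..1}"
proof -
  let ?w = "\<lambda>t. complex_of_real r * exp (2 * of_real pi * \<i> * of_real t)"
  have "((\<lambda>u. f u / (u - 0) ^ Suc m) has_contour_integral (2 * pi * \<i>) / fact m * (deriv ^^ m) f 0) (circlepath 0 r)"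
    by (rule Cauchy_has_contour_integral_higher_derivative_circlepath)
       (use r f holomorphic_on_imp_continuous_on[OF f] in \<open>auto intro: continuous_on_subset holomorphic_on_subset\<close>)
  then have "((\<lambda>t. f (circlepath 0 r t) / (circlepath 0 r t - 0) ^ Suc m * vector_derivative (circlepath 0 r) (at t within {0..1}))
     has_integral (2 * pi * \<i>) / fact m * (deriv ^^ m) f 0) {0..1}"
    unfolding has_contour_integral_def .
  then have "((\<lambda>t. (2 * pi * \<i>) * (f (?w t) / ?w t ^ m)) has_integral (2 * pi * \<i>) / fact m * (deriv ^^ m) f 0) {0..1}"
  proof (rule has_integral_eq[rotated])
    fix t :: real assume t: "t \<in> {0..1}"
    have "vector_derivative (circlepath 0 r) (at t within {0..1}) = 2 * pi * \<i> * ?w t"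
      using t by (simp add: vector_derivative_circlepath01 mult_ac)
    moreover have "circlepath 0 r t = ?w t" by (simp add: circlepath mult_ac)
    moreover have "?w t \<noteq> 0" using r by simp
    ultimately show "f (circlepath 0 r t) / (circlepath 0 r t - 0) ^ Suc m * vector_derivative (circlepath 0 r) (at t within {0..1}) = (2 * pi * \<i>) * (f (?w t) / ?w t ^ m)"
      by (simp add: field_simps)
  qed
  then have "((\<lambda>t. (1 / (2 * pi * \<i>)) * ((2 * pi * \<i>) * (f (?w t) / ?w t ^ m))) has_integral (1 / (2 * pi * \<i>)) * ((2 * pi * \<i>) / fact m * (deriv ^^ m) f 0)) {0..1}"
    by (rule has_integral_mult_right)
  then show ?thesis by (simp add: mult.assoc[symmetric])
qed

text \<open>On the circle \<open>cnj w = r^2 / w\<close>, so the conjugate of this mean is, up to a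
  factor, the mean of \<open>f w^m\<close>, which vanishes at the centre. Added to the formula for
  coefficients, it shows that coefficients of positive index are means of \<open>2 Re f\<close>;
  this is how a bound on the real part alone suffices.\<close>

lemma circle_mean_cnj_0:
  assumes f: "f holomorphic_on UNIV" and r: "r > 0" and m: "m \<ge> 1"
  shows "((\<lambda>t. cnj (f (of_real r * exp (2 * of_real pi * \<i> * of_real t))) / (of_real r * exp (2 * of_real pi * \<i> * of_real t)) ^ m)
     has_integral 0) {0..1}"
proof -
  let ?w = "\<lambda>t. complex_of_real r * exp (2 * of_real pi * \<i> * of_real t)"
  have "(\<lambda>z. f z * z ^ m) holomorphic_on UNIV" by (intro holomorphic_intros f)
  from circle_mean_coeff[OF this r, of 0] have "((\<lambda>t. f (?w t) * ?w t ^ m) has_integral 0) {0..1}" using m by (cases m) simp_all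
  then have "((\<lambda>t. cnj (f (?w t) * ?w t ^ m)) has_integral 0) {0..1}"
    using has_integral_cnj[of "\<lambda>t. f (?w t) * ?w t ^ m" 0 "{0..1}"] by (simp add: comp_def)
  then have "((\<lambda>t. (1 / of_real (r ^ (2 * m))) * cnj (f (?w t) * ?w t ^ m)) has_integral (1 / of_real (r ^ (2 * m))) * 0) {0..1}"
    by (rule has_integral_mult_right)
  moreover have "(1 / of_real (r ^ (2 * m))) * cnj (f (?w t) * ?w t ^ m) = cnj (f (?w t)) / ?w t ^ m" for t
  proof -
    have "?w t * cnj (?w t) = of_real (r\<^sup>2)"
      using complex_norm_square[of "?w t"] r by (simp add: norm_mult)
    then have "?w t ^ m * cnj (?w t) ^ m = of_real (r ^ (2 * m))"
      by (metis of_real_power power_mult power_mult_distrib)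
    moreover have "?w t \<noteq> 0" "of_real (r ^ (2 * m)) \<noteq> (0 :: complex)" using r by auto
    ultimately show ?thesis by (simp add: field_simps)
  qed
  ultimately show ?thesis by simp
qed

text \<open>The weight \<open>((w/r)^4 - 1)^2\<close> vanishes on the circle \<open>|w| = r\<close> exactly on the coordinate axes,
  where the hypothesis says nothing.\<close>

lemma weight_norm:
  assumes r: "r > 0" and w: "cmod w = r"
  shows "cmod ((w ^ 4 / of_real r ^ 4 - 1)\<^sup>2) = 16 * (Re w * Im w)\<^sup>2 / r ^ 4"
proof -
  have ww: "w * cnj w = of_real (r\<^sup>2)" using complex_norm_square[of w] w by simp
  have "w ^ 4 - of_real r ^ 4 = w ^ 4 - (w * cnj w)\<^sup>2" unfolding ww by simp
  also have "\<dots> = w\<^sup>2 * (w\<^sup>2 - (cnj w)\<^sup>2)" by (simp add: power2_eq_square power4_eq_xxxx algebra_simps)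
  also have "w\<^sup>2 - (cnj w)\<^sup>2 = 4 * \<i> * of_real (Re w * Im w)"
    by (simp add: complex_eq_iff power2_eq_square)
  finally have "cmod (w ^ 4 - of_real r ^ 4) = r\<^sup>2 * (4 * \<bar>Re w * Im w\<bar>)" using w by (simp add: norm_mult norm_power abs_mult)
  moreover have "w ^ 4 / of_real r ^ 4 - 1 = (w ^ 4 - of_real r ^ 4) / of_real r ^ 4" using r by (simp add: field_simps)
  ultimately have "cmod (w ^ 4 / of_real r ^ 4 - 1) = r\<^sup>2 * (4 * \<bar>Re w * Im w\<bar>) / r ^ 4"
    using r by (simp add: norm_divide norm_power)
  also have "\<dots> = 4 * \<bar>Re w * Im w\<bar> / r\<^sup>2" using r by (simp add: power2_eq_square power4_eq_xxxx)
  finally have e: "cmod (w ^ 4 / of_real r ^ 4 - 1) = 4 * \<bar>Re w * Im w\<bar> / r\<^sup>2" .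
  show ?thesis unfolding norm_power e by (simp add: power_divide power_mult_distrib flip: power_mult)
qed

lemma inverse_of_real_power_tendsto_0:
  "m > 0 \<Longrightarrow> ((\<lambda>r. 1 / complex_of_real r ^ m) \<longlongrightarrow> 0) at_top"
proof -
  assume m: "m > 0"
  have "((\<lambda>r::real. inverse r) \<longlongrightarrow> 0) at_top" by (rule tendsto_inverse_0_at_top[OF filterlim_ident])
  from tendsto_power[OF tendsto_of_real[OF this, where 'a=complex], of m] show ?thesis
    using m by (simp add: power_0_left divide_inverse power_inverse)
qed

text \<open>The weight multiplies the coefficient formula into the combination of the coefficients
  with indices \<open>n\<close>, \<open>n - 4\<close> and \<open>n - 8\<close>; all three must be
  positive for the conjugate means to vanish, which requires \<open>n > 8\<close>. As the radius
  grows, the lower two terms disappear.\<close>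

lemma entire_high_coeff_0:
  assumes f: "f holomorphic_on UNIV"
    and growth: "\<And>w. cmod w > R \<Longrightarrow> Re w \<noteq> 0 \<Longrightarrow> Im w \<noteq> 0 \<Longrightarrow> \<bar>Re (f w)\<bar> * (Re w * Im w)\<^sup>2 \<le> cmod w ^ 5"
    and n: "n > 8"
  shows "(deriv ^^ n) f 0 = 0"
proof -
  define c where "c = (\<lambda>m. (deriv ^^ m) f 0 / fact m)"
  \<comment> \<open>The weight has modulus \<open>16 (Re w Im w)^2 / r^4\<close>, which together
    with \<open>2 |Re f|\<close> is at most \<open>32 r^5 / r^4\<close> by the growth hypothesis,
    also on the axes where it is 0. Division by \<open>r^n\<close> with \<open>n \<ge> 2\<close>
    leaves \<open>32 / r\<close>.\<close>
  have bound: "cmod (c n - 2 * c (n - 4) / of_real r ^ 4 + c (n - 8) / of_real r ^ 8) \<le> 32 / r" if r: "r > max 1 R" for r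
  proof -
    have r0: "r > 0" "r > 1" "r > R" using r by auto
    let ?w = "\<lambda>t. complex_of_real r * exp (2 * of_real pi * \<i> * of_real t)"
    have w0: "?w t \<noteq> 0" and nw: "cmod (?w t) = r" for t using r0 by (auto simp: norm_mult)
    have co: "((\<lambda>t. (f (?w t) + cnj (f (?w t))) / ?w t ^ m) has_integral c m) {0..1}" if "m \<ge> 1" for m
      using has_integral_add[OF circle_mean_coeff[OF f r0(1), of m] circle_mean_cnj_0[OF f r0(1) that]]
      by (simp add: c_def add_divide_distrib)
    let ?g = "\<lambda>t. (f (?w t) + cnj (f (?w t))) / ?w t ^ n * (?w t ^ 4 / of_real r ^ 4 - 1)\<^sup>2"
    let ?h = "\<lambda>m t. (f (?w t) + cnj (f (?w t))) / ?w t ^ m"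
    have geq: "?g t = ?h n t + (- 2 / of_real r ^ 4) * ?h (n - 4) t + (1 / of_real r ^ 8) * ?h (n - 8) t" for t
    proof -
      define W where "W = ?w t"
      have W: "W \<noteq> 0" using w0 by (simp add: W_def)
      have p: "W ^ n = W ^ (n - 4) * W ^ 4" "W ^ n = W ^ (n - 8) * W ^ 8" using n by (simp_all flip: power_add)
      have "(W ^ 4 / of_real r ^ 4 - 1)\<^sup>2 = 1 + (- 2 / of_real r ^ 4) * W ^ 4 + (1 / of_real r ^ 8) * W ^ 8"
        by (simp add: power2_eq_square algebra_simps flip: power_add)
      moreover have "1 / W ^ n * W ^ 4 = 1 / W ^ (n - 4)" "1 / W ^ n * W ^ 8 = 1 / W ^ (n - 8)"
        using W by (simp add: p(1), simp add: p(2))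
      ultimately have "1 / W ^ n * (W ^ 4 / of_real r ^ 4 - 1)\<^sup>2 = 1 / W ^ n + (- 2 / of_real r ^ 4) * (1 / W ^ (n - 4)) + (1 / of_real r ^ 8) * (1 / W ^ (n - 8))"
      proof -
        assume e: "(W ^ 4 / of_real r ^ 4 - 1)\<^sup>2 = 1 + (- 2 / of_real r ^ 4) * W ^ 4 + (1 / of_real r ^ 8) * W ^ 8"
          "1 / W ^ n * W ^ 4 = 1 / W ^ (n - 4)" "1 / W ^ n * W ^ 8 = 1 / W ^ (n - 8)"
        have "x * (1 + u * b + v * d) = x + u * (x * b) + v * (x * d)" for x u b v d :: complex
          by (simp add: algebra_simps)
        then show ?thesis unfolding e(1) by (simp only: e(2,3))
      qed
      then have "(f W + cnj (f W)) * (1 / W ^ n * (W ^ 4 / of_real r ^ 4 - 1)\<^sup>2) = (f W + cnj (f W)) * (1 / W ^ n + (- 2 / of_real r ^ 4) * (1 / W ^ (n - 4)) + (1 / of_real r ^ 8) * (1 / W ^ (n - 8)))"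
        by simp
      moreover have "x * (a + u * b + v * d) = x * a + u * (x * b) + v * (x * d)" for x a u b v d :: complex
        by (simp add: algebra_simps)
      ultimately have "(f W + cnj (f W)) * (1 / W ^ n * (W ^ 4 / of_real r ^ 4 - 1)\<^sup>2) = (f W + cnj (f W)) * (1 / W ^ n) +
        (- 2 / of_real r ^ 4) * ((f W + cnj (f W)) * (1 / W ^ (n - 4))) + (1 / of_real r ^ 8) * ((f W + cnj (f W)) * (1 / W ^ (n - 8)))"
        by (simp only:)
      then show ?thesis unfolding W_def[symmetric] by simp
    qed
    have "(?g has_integral (c n + (- 2 / of_real r ^ 4) * c (n - 4) + (1 / of_real r ^ 8) * c (n - 8))) {0..1}"
    proof (rule has_integral_eq[OF geq[symmetric]])
      have "n \<ge> 1" "n - 4 \<ge> 1" "n - 8 \<ge> 1" using n by auto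
      then show "((\<lambda>t. ?h n t + (- 2 / of_real r ^ 4) * ?h (n - 4) t + (1 / of_real r ^ 8) * ?h (n - 8) t) has_integral
         (c n + (- 2 / of_real r ^ 4) * c (n - 4) + (1 / of_real r ^ 8) * c (n - 8))) {0..1}"
        using has_integral_add[OF has_integral_add[OF co[of n] has_integral_mult_right[OF co[of "n - 4"], of "- 2 / of_real r ^ 4"]]
          has_integral_mult_right[OF co[of "n - 8"], of "1 / of_real r ^ 8"]] by blast
    qed
    then have hi: "(?g has_integral (c n + (- 2 / of_real r ^ 4) * c (n - 4) + (1 / of_real r ^ 8) * c (n - 8))) (cbox 0 1)" by simp
    have gb: "cmod (?g t) \<le> 32 / r" for t
    proof -
      define W where "W = ?w t"
      have nW: "cmod W = r" using nw by (simp add: W_def)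
      have "cmod (?g t) = 2 * \<bar>Re (f W)\<bar> / r ^ n * (16 * (Re W * Im W)\<^sup>2 / r ^ 4)"
        unfolding W_def[symmetric] norm_mult norm_divide norm_power[of W] weight_norm[OF r0(1) nW] nW
        by (simp add: complex_add_cnj)
      also have "\<dots> = 32 * (\<bar>Re (f W)\<bar> * (Re W * Im W)\<^sup>2) / (r ^ n * r ^ 4)" by simp
      also have "\<dots> \<le> 32 * r ^ 5 / (r ^ n * r ^ 4)"
      proof (intro divide_right_mono mult_left_mono)
        show "\<bar>Re (f W)\<bar> * (Re W * Im W)\<^sup>2 \<le> r ^ 5"
          using growth[of W] nW r0 by (cases "Re W = 0 \<or> Im W = 0") auto
      qed (use r0 in auto)
      also have "\<dots> \<le> 32 * r ^ 5 / (r ^ 2 * r ^ 4)"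
        using r0 n by (intro divide_left_mono mult_right_mono power_increasing) auto
      also have "\<dots> = 32 / r" using r0 by (simp add: power_def numeral_eq_Suc)
      finally show ?thesis .
    qed
    have "cmod (c n + (- 2 / of_real r ^ 4) * c (n - 4) + (1 / of_real r ^ 8) * c (n - 8)) \<le> 32 / r * measure lborel (cbox 0 (1::real))"
      by (rule has_integral_bound[OF _ hi]) (use r0 gb in auto)
    then show ?thesis by simp
  qed
  have "((\<lambda>r. cmod (c n - 2 * c (n - 4) / complex_of_real r ^ 4 + c (n - 8) / of_real r ^ 8)) \<longlongrightarrow> cmod (c n - 0 + 0)) at_top"
  proof (rule tendsto_norm[OF tendsto_add[OF tendsto_diff[OF tendsto_const]]])
    show "((\<lambda>r. 2 * c (n - 4) / complex_of_real r ^ 4) \<longlongrightarrow> 0) at_top"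
      using tendsto_mult_right_zero[OF inverse_of_real_power_tendsto_0[of 4], of "2 * c (n - 4)"] by simp
    show "((\<lambda>r. c (n - 8) / complex_of_real r ^ 8) \<longlongrightarrow> 0) at_top"
      using tendsto_mult_right_zero[OF inverse_of_real_power_tendsto_0[of 8], of "c (n - 8)"] by simp
  qed
  then have l1: "((\<lambda>r. cmod (c n - 2 * c (n - 4) / complex_of_real r ^ 4 + c (n - 8) / of_real r ^ 8)) \<longlongrightarrow> cmod (c n)) at_top" by simp
  have l2: "((\<lambda>r::real. 32 / r) \<longlongrightarrow> 0) at_top" by real_asymp
  have "cmod (c n) \<le> 0"
    by (rule tendsto_le[OF trivial_limit_at_top_linorder l2 l1])
       (rule eventually_mono[OF eventually_gt_at_top[of "max 1 R"] bound])
  then show ?thesis by (simp add: c_def)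
qed

text \<open>By the vanishing of the high coefficients \<open>f\<close> is a polynomial of degree at
  most 8. On a ray off the axes the hypothesis says that \<open>Re f\<close> is o(r), so the real
  part of the leading term vanishes in every direction of the open quadrant. Two directions already
  force the leading coefficient to be 0.\<close>

lemma entire_const_of_Re_growth:
  assumes f: "f holomorphic_on UNIV"
    and growth: "\<And>\<epsilon>. \<epsilon> > 0 \<Longrightarrow> \<exists>R. \<forall>w. cmod w > R \<and> Re w \<noteq> 0 \<and> Im w \<noteq> 0 \<longrightarrow> \<bar>Re (f w)\<bar> * (Re w * Im w)\<^sup>2 \<le> \<epsilon> * cmod w ^ 5"
  shows "f z = f 0"
proof -
  define c where "c = (\<lambda>m. (deriv ^^ m) f 0 / fact m)"
  obtain R where R: "\<And>w. cmod w > R \<Longrightarrow> Re w \<noteq> 0 \<Longrightarrow> Im w \<noteq> 0 \<Longrightarrow> \<bar>Re (f w)\<bar> * (Re w * Im w)\<^sup>2 \<le> cmod w ^ 5"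
    using growth[of 1] by auto
  have hc: "c n = 0" if "n > 8" for n
    using entire_high_coeff_0[OF f R that] by (simp add: c_def)
  have fs: "f w = (\<Sum>n\<le>8. c n * w ^ n)" for w
  proof -
    have "(\<lambda>n. c n * (w - 0) ^ n) sums f w"
      unfolding c_def
      by (rule holomorphic_power_series[of f 0 "cmod w + 1"]) (use holomorphic_on_subset[OF f] in auto)
    moreover have "(\<lambda>n. c n * (w - 0) ^ n) sums (\<Sum>n\<le>8. c n * (w - 0) ^ n)"
      by (rule sums_finite) (use hc in auto)
    ultimately show ?thesis using sums_unique2 by fastforce
  qed
  have "c n = 0" if n: "n \<ge> 1" for n
  proof (rule ccontr)
    assume "c n \<noteq> 0"
    define A where "A = {n. n \<ge> 1 \<and> c n \<noteq> 0}"
    have "A \<subseteq> {..8}"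
    proof
      fix m assume "m \<in> A"
      then have "\<not> m > 8" using hc[of m] by (auto simp: A_def)
      then show "m \<in> {..8}" by simp
    qed
    then have fin: "finite A" using finite_subset by blast
    have ne: "A \<noteq> {}" using n \<open>c n \<noteq> 0\<close> by (auto simp: A_def)
    define d where "d = Max A"
    have dA: "d \<in> A" using Max_in[OF fin ne] by (simp add: d_def)
    have d: "d \<ge> 1" "d \<le> 8" "c d \<noteq> 0" using dA \<open>A \<subseteq> {..8}\<close> by (auto simp: A_def)
    have dm: "c m = 0" if "m > d" for m
    proof (rule ccontr)
      assume "c m \<noteq> 0"
      then have "m \<in> A" using that d by (simp add: A_def)
      then show False using Max_ge[OF fin, of m] that by (simp add: d_def)
    qed
    \<comment> \<open>On the ray of angle \<theta> the factor \<open>(Re w Im w)^2\<close> is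
      \<open>K r^4\<close> with \<open>K > 0\<close>, so the bound with \<open>e K\<close> in place
      of \<epsilon> reads \<open>|Re f| \<le> e r\<close>, and \<open>r \<le> r^d\<close> because
      \<open>d \<ge> 1\<close>.\<close>
    have key: "Re (c d * exp (\<i> * of_real \<theta>) ^ d) = 0" if th: "0 < \<theta>" "\<theta> < pi / 2" for \<theta>
    proof -
      define u where "u = exp (\<i> * complex_of_real \<theta>)"
      have u: "Re u = cos \<theta>" "Im u = sin \<theta>" "cmod u = 1" by (simp_all add: u_def Re_exp Im_exp)
      have u0: "Re u > 0" "Im u > 0" using th u by (auto intro: cos_gt_zero sin_gt_zero)
      define K where "K = (Re u * Im u)\<^sup>2"
      have K: "K > 0" using u0 by (simp add: K_def)
      have fr: "f (of_real r * u) / of_real r ^ d = (\<Sum>m\<le>d. c m * u ^ m * (of_real r ^ m / of_real r ^ d))" for r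
      proof -
        have "f (of_real r * u) = (\<Sum>m\<le>d. c m * (of_real r * u) ^ m)"
          unfolding fs by (rule sum.mono_neutral_right) (use d dm in auto)
        then show ?thesis by (simp add: sum_divide_distrib power_mult_distrib mult_ac)
      qed
      have "((\<lambda>r. \<Sum>m\<le>d. c m * u ^ m * (complex_of_real r ^ m / of_real r ^ d)) \<longlongrightarrow> (\<Sum>m\<le>d. c m * u ^ m * (if m = d then 1 else 0))) at_top"
      proof (intro tendsto_sum tendsto_mult_left)
        fix m assume m: "m \<in> {..d}"
        show "((\<lambda>r. complex_of_real r ^ m / of_real r ^ d) \<longlongrightarrow> (if m = d then 1 else 0)) at_top"
        proof (cases "m = d")
          case True
          have "eventually (\<lambda>r. 1 = complex_of_real r ^ m / of_real r ^ d) at_top"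
            using eventually_gt_at_top[of 0] by eventually_elim (use True in simp)
          then show ?thesis using True by (simp add: Lim_transform_eventually[OF tendsto_const])
        next
          case False
          have "((\<lambda>r. 1 / complex_of_real r ^ (d - m)) \<longlongrightarrow> 0) at_top"
            by (rule inverse_of_real_power_tendsto_0) (use False m in auto)
          moreover have "eventually (\<lambda>r. 1 / complex_of_real r ^ (d - m) = complex_of_real r ^ m / of_real r ^ d) at_top"
            using eventually_gt_at_top[of 0]
          proof eventually_elim
            case (elim r)
            have "complex_of_real r ^ d = of_real r ^ m * of_real r ^ (d - m)" using m by (simp flip: power_add)
            then show ?case using elim by simp
          qed
          ultimately show ?thesis using False by (simp add: Lim_transform_eventually)
        qed
      qed
      then have "((\<lambda>r. f (complex_of_real r * u) / of_real r ^ d) \<longlongrightarrow> c d * u ^ d) at_top"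
        unfolding fr by (simp add: if_distrib cong: if_cong)
      then have lim: "((\<lambda>r. Re (f (complex_of_real r * u) / of_real r ^ d)) \<longlongrightarrow> Re (c d * u ^ d)) at_top" by (rule tendsto_Re)
      have "\<bar>Re (c d * u ^ d)\<bar> \<le> e" if e: "e > 0" for e
      proof -
        have "e * K > 0" using e K by simp
        from growth[OF this] obtain R where R: "\<And>w. cmod w > R \<Longrightarrow> Re w \<noteq> 0 \<Longrightarrow> Im w \<noteq> 0 \<Longrightarrow> \<bar>Re (f w)\<bar> * (Re w * Im w)\<^sup>2 \<le> e * K * cmod w ^ 5" by blast
        have "eventually (\<lambda>r. \<bar>Re (f (complex_of_real r * u) / of_real r ^ d)\<bar> \<le> e) at_top"
          using eventually_gt_at_top[of "max 1 R"]
        proof eventually_elim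
          case (elim r)
          then have r: "r > 1" "r > R" by auto
          have "\<bar>Re (f (of_real r * u))\<bar> * (r ^ 4 * K) \<le> e * K * r ^ 5"
            using R[of "of_real r * u"] r u0 u(3) by (simp add: norm_mult K_def power_mult_distrib power2_eq_square power4_eq_xxxx mult_ac)
          then have "(r ^ 4 * K) * \<bar>Re (f (of_real r * u))\<bar> \<le> (r ^ 4 * K) * (e * r)" by (simp add: power_def numeral_eq_Suc mult_ac)
          then have "\<bar>Re (f (of_real r * u))\<bar> \<le> e * r" by (rule mult_left_le_imp_le) (use r K in simp)
          also have "\<dots> \<le> e * r ^ d" using e r d power_increasing[of 1 d r] by (intro mult_left_mono) auto
          finally have "\<bar>Re (f (of_real r * u))\<bar> / r ^ d \<le> e" using r by (simp add: pos_divide_le_eq)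
          moreover have "Re (f (of_real r * u) / of_real r ^ d) = Re (f (of_real r * u)) / r ^ d"
            by (simp flip: of_real_power)
          ultimately show ?case using r by (simp add: abs_divide)
        qed
        then show ?thesis by (rule tendsto_upperbound[OF tendsto_rabs[OF lim] _ trivial_limit_at_top_linorder])
      qed
      then have "\<bar>Re (c d * u ^ d)\<bar> \<le> 0" by (rule field_le_epsilon) (simp add: add.commute)
      then show ?thesis by (simp add: u_def)
    qed
    \<comment> \<open>Any two angles in the quadrant would do whose difference times
      \<open>d\<close> is not a multiple of \<pi>. With difference 1/10 and \<open>d \<le> 8\<close>
      the rotation by \<open>d/10\<close> lies strictly between 0 and \<pi>, so its sine is
      positive.\<close>
    have h1: "Re (c d * exp (\<i> * of_real (1/2)) ^ d) = 0" by (rule key) (use pi_gt3 in auto)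
    have h2: "Re (c d * exp (\<i> * of_real (1/2 + 1/10)) ^ d) = 0" by (rule key) (use pi_gt3 in auto)
    define v where "v = c d * exp (\<i> * of_real (1/2)) ^ d"
    have Rv: "Re v = 0" using h1 unfolding v_def .
    have e: "c d * exp (\<i> * of_real (1/2 + 1/10)) ^ d = v * exp (\<i> * of_real (real d / 10))"
    proof -
      have "exp (\<i> * complex_of_real (1/2 + 1/10)) = exp (\<i> * of_real (1/2)) * exp (\<i> * of_real (1/10))"
        unfolding exp_add[symmetric] by (simp only: distrib_left of_real_add)
      moreover have "exp (\<i> * complex_of_real (1/10)) ^ d = exp (\<i> * of_real (real d / 10))"
        unfolding exp_of_nat_mult[symmetric] by (simp add: mult_ac)
      ultimately show ?thesis by (simp add: v_def power_mult_distrib mult.assoc)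
    qed
    have "Re (v * exp (\<i> * of_real (real d / 10))) = - Im v * sin (real d / 10)"
      using Rv by (simp add: Re_exp Im_exp)
    moreover have "sin (real d / 10) > 0" using d pi_gt3 by (intro sin_gt_zero) auto
    ultimately have "Im v = 0" using h2 unfolding e by simp
    then have "v = 0" using Rv by (simp add: complex_eq_iff)
    then show False using d(3) by (simp add: v_def)
  qed
  then have "f w = c 0" for w
    unfolding fs by (subst sum.mono_neutral_right[of _ "{0}"]) auto
  then show ?thesis by simp
qed

text \<open>Reflection extends \<open>f\<close> to the punctured plane, inversion moves the puncture
  to infinity, and a logarithm exists because there are no zeros. Its real part is
  \<open>ln |f|\<close>, which the hypothesis makes too small for a nonconstant entire
  function.\<close>

lemma unimodular_negligible_eq_1:
  assumes hol: "f holomorphic_on upper_half" and cont: "continuous_on closed_upper f"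
    and nz: "\<And>k. k \<in> closed_upper \<Longrightarrow> f k \<noteq> 0"
    and uni: "\<And>x::real. x \<noteq> 0 \<Longrightarrow> cmod (f (of_real x)) = 1"
    and inf: "\<And>e. e > 0 \<Longrightarrow> \<exists>R. \<forall>k\<in>closed_upper. cmod k > R \<longrightarrow> cmod (f k - 1) < e"
    and neg: "negligible_at_0 (\<lambda>k. ln (cmod (f k)))"
    and k: "k \<in> closed_upper"
  shows "f k = 1"
proof -
  \<comment> \<open>Reflection by \<open>1 / cnj f\<close> rather than \<open>cnj f\<close>: the two
    definitions agree on the real line because \<open>f\<close> is unimodular there.\<close>
  define g where "g = (\<lambda>k. if - Im k \<le> 0 then f k else 1 / cnj (f (cnj k)))"
  have cl: "cnj z \<in> closed_upper" if "Im z \<le> 0" "z \<noteq> 0" for z using that by (simp add: closed_upper_def)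
  have cu: "cnj z \<in> upper_half" if "Im z < 0" for z using that by (simp add: upper_half_def)
  have uc: "f z = 1 / cnj (f (cnj z))" if "Im z = 0" "z \<noteq> 0" for z
  proof -
    have z: "z = of_real (Re z)" "Re z \<noteq> 0" using that by (auto simp: complex_eq_iff)
    have "f z * cnj (f z) = 1" using uni[OF z(2)] complex_norm_square[of "f z"] z(1) by simp
    moreover have "cnj z = z" using that by (simp add: complex_eq_iff)
    moreover have "f z \<noteq> 0" by (rule nz) (use that in \<open>simp add: closed_upper_def\<close>)
    ultimately show ?thesis by (simp add: field_simps)
  qed
  have contg: "continuous_on (- {0}) g"
    unfolding g_def
  proof (rule continuous_on_cases_le)
    show "continuous_on {x \<in> - {0}. - Im x \<le> 0} f" by (rule continuous_on_subset[OF cont]) (auto simp: closed_upper_def)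
    have "continuous_on {x \<in> - {0}. 0 \<le> - Im x} (\<lambda>x. f (cnj x))"
      by (rule continuous_on_compose2[OF cont]) (auto intro!: continuous_intros simp: closed_upper_def)
    then show "continuous_on {x \<in> - {0}. 0 \<le> - Im x} (\<lambda>x. 1 / cnj (f (cnj x)))"
      by (intro continuous_intros) (use nz cl in auto)
    show "continuous_on (- {0}) (\<lambda>x. - Im x)" by (intro continuous_intros)
    show "f x = 1 / cnj (f (cnj x))" if "x \<in> - {0}" "- Im x = 0" for x
      by (rule uc) (use that in auto)
  qed
  have up: "g holomorphic_on (- {0} \<inter> {z. 0 < Im z})"
  proof (rule holomorphic_transform)
    show "f holomorphic_on (- {0} \<inter> {z. 0 < Im z})" by (rule holomorphic_on_subset[OF hol]) (auto simp: upper_half_def)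
  qed (auto simp: g_def)
  have down: "g holomorphic_on (- {0} \<inter> {z. Im z < 0})"
  proof (rule holomorphic_transform)
    have o: "open {z. Im z < 0}" by (rule open_halfspace_Im_lt)
    have "(\<lambda>z. cnj (f (cnj z))) holomorphic_on {z. Im z < 0}"
      unfolding holomorphic_on_open[OF o]
    proof
      fix z assume "z \<in> {z. Im z < 0}"
      then have "cnj z \<in> upper_half" using cu by simp
      then obtain f' where "(f has_field_derivative f') (at (cnj z))" using hol unfolding holomorphic_on_open[OF open_upper_half] by blast
      from has_field_derivative_cnj_cnj[OF this] show "\<exists>f'. ((\<lambda>z. cnj (f (cnj z))) has_field_derivative f') (at z)"
        by (auto simp: comp_def)
    qed
    then have "(\<lambda>z. 1 / cnj (f (cnj z))) holomorphic_on {z. Im z < 0}"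
    proof (intro holomorphic_on_divide holomorphic_on_const)
      fix z assume "z \<in> {z. Im z < 0}"
      then have "f (cnj z) \<noteq> 0" by (intro nz cl) auto
      then show "cnj (f (cnj z)) \<noteq> 0" by simp
    qed
    then show "(\<lambda>z. 1 / cnj (f (cnj z))) holomorphic_on (- {0} \<inter> {z. Im z < 0})" by (rule holomorphic_on_subset) auto
  qed (auto simp: g_def)
  have holg: "g holomorphic_on - {0}"
  proof (rule holomorphic_on_paste_across_line[where d=\<i> and k=0])
    show "g holomorphic_on (- {0} \<inter> {z. \<i> \<bullet> z < 0})" using down by (simp add: inner_complex_def)
    show "g holomorphic_on (- {0} \<inter> {z. 0 < \<i> \<bullet> z})" using up by (simp add: inner_complex_def)
  qed (use contg in auto)
  have gnz: "g z \<noteq> 0" if "z \<noteq> 0" for z using that nz[of z] nz[OF cl[of z]] by (auto simp: g_def closed_upper_def)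
  \<comment> \<open>In the variable \<open>1 / k\<close> the limit 1 of \<open>f\<close> at infinity
    removes the singularity at 0, so \<open>h\<close> is entire; the unknown singularity at
    \<open>k = 0\<close> sits at infinity.\<close>
  define h where "h = (\<lambda>z. if z = 0 then 1 else g (inverse z))"
  have h0: "h 0 = 1" by (simp add: h_def)
  have holh0: "h holomorphic_on UNIV - {0}"
  proof (rule holomorphic_transform)
    have "(g \<circ> inverse) holomorphic_on UNIV - {0}"
      by (rule holomorphic_on_compose_gen[OF _ holg]) (auto intro!: holomorphic_intros)
    then show "(\<lambda>z. g (inverse z)) holomorphic_on UNIV - {0}" by (simp add: comp_def)
  qed (auto simp: h_def)
  have lim0: "(h \<longlongrightarrow> h 0) (at 0)"
  proof (rule tendstoI)
    fix e :: real assume e: "e > 0"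
    obtain R1 where R1: "\<forall>k\<in>closed_upper. cmod k > R1 \<longrightarrow> cmod (f k - 1) < e / 2" using inf[of "e / 2"] e by auto
    obtain R2 where R2: "\<forall>k\<in>closed_upper. cmod k > R2 \<longrightarrow> cmod (f k - 1) < 1 / 2" using inf[of "1 / 2"] by auto
    define R where "R = max 1 (max R1 R2)"
    have R: "R > 0" by (simp add: R_def)
    have small: "dist (h z) (h 0) < e" if z: "z \<noteq> 0" "cmod z < 1 / R" for z
    proof -
      define k where "k = inverse z"
      have "R < 1 / cmod z" using z R by (simp add: field_simps)
      then have k: "k \<noteq> 0" "cmod k > R" using z by (auto simp: k_def norm_inverse divide_inverse)
      have hk: "h z = g k" using z by (simp add: h_def k_def)
      show ?thesis
      proof (cases "Im k \<ge> 0")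
        case True
        then have "cmod (f k - 1) < e / 2" using R1 k by (auto simp: closed_upper_def R_def)
        then show ?thesis using True e by (simp add: hk g_def h0 dist_norm)
      next
        case False
        let ?a = "f (cnj k)"
        have kc: "cnj k \<in> closed_upper" "cmod (cnj k) > R1" "cmod (cnj k) > R2" using False k cl by (auto simp: R_def)
        have a: "cmod (?a - 1) < e / 2" "cmod (?a - 1) < 1 / 2" using R1 R2 kc by blast+
        have a2: "cmod ?a > 1 / 2" using a(2) norm_triangle_ineq2[of 1 "1 - ?a"] by (simp add: norm_minus_commute)
        then have a0: "?a \<noteq> 0" by auto
        have "h z - 1 = cnj ((1 - ?a) / ?a)" using False a0 by (simp add: hk g_def diff_divide_distrib)
        then have "cmod (h z - 1) = cmod (?a - 1) / cmod ?a"
          unfolding complex_mod_cnj norm_divide by (simp only: complex_mod_cnj norm_divide norm_minus_commute[of 1])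
        also have "\<dots> \<le> cmod (?a - 1) / (1 / 2)" using a2 by (intro divide_left_mono) auto
        also have "\<dots> < e" using a by simp
        finally show ?thesis by (simp add: h0 dist_norm)
      qed
    qed
    show "eventually (\<lambda>z. dist (h z) (h 0) < e) (at 0)"
      unfolding eventually_at by (intro exI[of _ "1 / R"]) (use R small in auto)
  qed
  have conth: "continuous_on UNIV h"
  proof -
    have "isCont h z" for z
    proof (cases "z = 0")
      case True
      then show ?thesis using lim0 by (simp add: isCont_def)
    next
      case False
      have "continuous_on (UNIV - {0}) h" by (rule holomorphic_on_imp_continuous_on[OF holh0])
      then show ?thesis using False by (simp add: continuous_on_eq_continuous_at open_Diff)
    qed
    then show ?thesis by (simp add: continuous_at_imp_continuous_on)
  qed
  have holh: "h holomorphic_on UNIV"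
    by (rule no_isolated_singularity[OF conth holh0]) auto
  have hnz: "h z \<noteq> 0" for z using gnz[of "inverse z"] by (auto simp: h_def)
  obtain L where L: "L holomorphic_on UNIV" "\<And>z. z \<in> UNIV \<Longrightarrow> h z = exp (L z)"
    by (rule contractible_imp_holomorphic_log[OF holh convex_imp_contractible[OF convex_UNIV]]) (use hnz in auto)
  have ReL: "Re (L z) = ln (cmod (h z))" for z using L(2)[of z] by simp
  have growth: "\<exists>R. \<forall>w. cmod w > R \<and> Re w \<noteq> 0 \<and> Im w \<noteq> 0 \<longrightarrow> \<bar>Re (L w)\<bar> * (Re w * Im w)\<^sup>2 \<le> \<epsilon> * cmod w ^ 5" if eps: "\<epsilon> > 0" for \<epsilon>
  proof -
    obtain r where r: "r > 0" "\<And>k. cmod k < r \<and> Im k > 0 \<and> Re k \<noteq> 0 \<Longrightarrow> \<bar>ln (cmod (f k))\<bar> \<le> \<epsilon> * (cmod k ^ 3 / (Re k * Im k)\<^sup>2)"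
      using neg eps unfolding negligible_at_0_def by blast
    show ?thesis
    proof (intro exI[of _ "1 / r"] allI impI)
      fix w assume w: "cmod w > 1 / r \<and> Re w \<noteq> 0 \<and> Im w \<noteq> 0"
      define \<rho> where "\<rho> = cmod w"
      have rho: "\<rho> > 0" using w r by (auto simp: \<rho>_def intro: less_trans[of 0 "1 / r"])
      have w0: "w \<noteq> 0" using w by auto
      define k0 where "k0 = inverse w"
      \<comment> \<open>The bound is available in the upper half-plane only. Below it
        \<open>|h|\<close> is the reciprocal of \<open>|f|\<close> at the conjugate point, which
        leaves the absolute value of the logarithm unchanged.\<close>
      define k where "k = (if Im k0 > 0 then k0 else cnj k0)"
      have re: "Re k0 = Re w / \<rho>\<^sup>2" "Im k0 = - Im w / \<rho>\<^sup>2" by (simp_all add: k0_def \<rho>_def cmod_power2)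
      have k0i: "Im k0 \<noteq> 0" "Re k0 \<noteq> 0" using w rho by (auto simp: re)
      have nk: "cmod k = 1 / \<rho>" by (auto simp: k_def k0_def norm_inverse \<rho>_def divide_inverse)
      have kk: "cmod k < r" "Im k > 0" "Re k \<noteq> 0"
      proof -
        have "1 / \<rho> < r" using w r(1) rho by (simp add: \<rho>_def field_simps)
        then show "cmod k < r" by (simp add: nk)
      qed (use k0i in \<open>auto simp: k_def\<close>)
      have "\<bar>ln (cmod (h w))\<bar> = \<bar>ln (cmod (f k))\<bar>"
      proof (cases "Im k0 > 0")
        case True
        then show ?thesis using w0 by (simp add: h_def g_def k_def k0_def[symmetric])
      next
        case False
        have "cmod (f k) > 0" using nz[of k] kk by (cases "k = 0") (auto simp: closed_upper_def)
        then show ?thesis using False w0 k0i(1) by (simp add: h_def g_def k_def k0_def[symmetric] norm_divide ln_div)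
      qed
      then have "\<bar>Re (L w)\<bar> \<le> \<epsilon> * (cmod k ^ 3 / (Re k * Im k)\<^sup>2)" using r(2)[of k] kk by (simp add: ReL)
      then have "\<bar>Re (L w)\<bar> * (Re w * Im w)\<^sup>2 \<le> \<epsilon> * (cmod k ^ 3 / (Re k * Im k)\<^sup>2) * (Re w * Im w)\<^sup>2" by (rule mult_right_mono) simp
      also have "(Re k * Im k)\<^sup>2 = (Re w * Im w)\<^sup>2 / \<rho> ^ 8"
      proof -
        have "(Re k * Im k)\<^sup>2 = (Re k0 * Im k0)\<^sup>2" by (simp add: k_def)
        then show ?thesis unfolding re by (simp add: power_mult_distrib power_divide flip: power_mult power_add)
      qed
      also have "\<epsilon> * (cmod k ^ 3 / ((Re w * Im w)\<^sup>2 / \<rho> ^ 8)) * (Re w * Im w)\<^sup>2 = \<epsilon> * (cmod k ^ 3 * \<rho> ^ 8)" using w by simp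
      also have "cmod k ^ 3 * \<rho> ^ 8 = \<rho> ^ 5" using rho unfolding nk by (simp add: power_divide field_simps flip: power_add)
      finally show "\<bar>Re (L w)\<bar> * (Re w * Im w)\<^sup>2 \<le> \<epsilon> * cmod w ^ 5" by (simp add: \<rho>_def)
    qed
  qed
  have "L z = L 0" for z by (rule entire_const_of_Re_growth[OF L(1)]) (rule growth)
  from this[of "inverse k"] have "h (inverse k) = h 0" by (simp only: L(2)[OF UNIV_I])
  moreover have "k \<noteq> 0" "Im k \<ge> 0" using k by (auto simp: closed_upper_def)
  ultimately show ?thesis by (simp add: h_def g_def)
qed

section \<open>Comparison of two functions with the same zeros\<close>

lemma closed_upper_real: "x \<noteq> 0 \<Longrightarrow> complex_of_real x \<in> closed_upper"
  by (simp add: closed_upper_def)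

text \<open>The quotient, with the ratio of derivatives filled in at the common simple zeros, is
  holomorphic and zero-free. All zeros lie on the imaginary axis, so off the axis the logarithm of
  the modulus is a plain difference, and negligibility passes to the quotient.\<close>

lemma quotient_negligible_eq:
  fixes N D :: "complex \<Rightarrow> complex"
  assumes hN: "N holomorphic_on upper_half" and hD: "D holomorphic_on upper_half"
    and cN: "continuous_on closed_upper N" and cD: "continuous_on closed_upper D"
    and zeros: "\<And>k. k \<in> upper_half \<Longrightarrow> N k = 0 \<longleftrightarrow> D k = 0"
    and axis: "\<And>k. k \<in> upper_half \<Longrightarrow> D k = 0 \<Longrightarrow> Re k = 0"
    and sN: "\<And>k. k \<in> upper_half \<Longrightarrow> N k = 0 \<Longrightarrow> deriv N k \<noteq> 0"
    and sD: "\<And>k. k \<in> upper_half \<Longrightarrow> D k = 0 \<Longrightarrow> deriv D k \<noteq> 0"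
    and real: "\<And>x::real. x \<noteq> 0 \<Longrightarrow> cmod (N (of_real x)) = cmod (D (of_real x)) \<and> D (of_real x) \<noteq> 0"
    and iN: "\<And>e. e > 0 \<Longrightarrow> \<exists>R. \<forall>k\<in>closed_upper. cmod k > R \<longrightarrow> cmod (N k - 1) < e"
    and iD: "\<And>e. e > 0 \<Longrightarrow> \<exists>R. \<forall>k\<in>closed_upper. cmod k > R \<longrightarrow> cmod (D k - 1) < e"
    and nN: "negligible_at_0 (\<lambda>k. ln (cmod (N k)))" and nD: "negligible_at_0 (\<lambda>k. ln (cmod (D k)))"
    and k: "k \<in> upper_half"
  shows "N k = D k"
proof -
  define f where "f = (\<lambda>k. if D k = 0 then deriv N k / deriv D k else N k / D k)"
  have Dreal: "D z \<noteq> 0" "cmod (N z) = cmod (D z)" if "z \<in> closed_upper" "Im z = 0" for z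
  proof -
    have "z = of_real (Re z)" "Re z \<noteq> 0" using that by (auto simp: closed_upper_def complex_eq_iff)
    then show "D z \<noteq> 0" "cmod (N z) = cmod (D z)" using real[of "Re z"] by auto
  qed
  have split: "z \<in> upper_half \<or> (z \<in> closed_upper \<and> Im z = 0)" if "z \<in> closed_upper" for z
    using that by (auto simp: closed_upper_def upper_half_def)
  have slope: "((\<lambda>w. g w / (w - z)) \<longlongrightarrow> deriv g z) (at z)" if "g holomorphic_on upper_half" "z \<in> upper_half" "g z = 0" for g z
    using holomorphic_derivI[OF that(1) open_upper_half that(2)] that(3) unfolding has_field_derivative_iff by simp
  have near0: "\<exists>d>0. f holomorphic_on ball z d" if z: "z \<in> upper_half" for z
  proof (cases "D z = 0")
    case False
    have "isCont D z"
      using holomorphic_on_imp_continuous_on[OF hD] z open_upper_half by (simp add: continuous_on_eq_continuous_at)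
    then have "eventually (\<lambda>w. D w \<noteq> 0) (nhds z)"
      using False by (simp add: isCont_def eventually_nhds_conv_at tendsto_imp_eventually_ne)
    moreover have "eventually (\<lambda>w. w \<in> upper_half) (nhds z)" using open_upper_half z by (simp add: eventually_nhds_in_open)
    ultimately have "eventually (\<lambda>w. D w \<noteq> 0 \<and> w \<in> upper_half) (nhds z)" by (rule eventually_conj)
    then obtain d where d: "d > 0" "\<And>w. dist w z < d \<Longrightarrow> D w \<noteq> 0 \<and> w \<in> upper_half" unfolding eventually_nhds_metric by blast
    have b: "D w \<noteq> 0" "w \<in> upper_half" if "w \<in> ball z d" for w using d(2)[of w] that by (auto simp: dist_commute)
    have "f holomorphic_on ball z d"
    proof (rule holomorphic_transform)
      show "(\<lambda>w. N w / D w) holomorphic_on ball z d"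
        by (intro holomorphic_on_divide holomorphic_on_subset[OF hN] holomorphic_on_subset[OF hD]) (use b in auto)
      show "N w / D w = f w" if "w \<in> ball z d" for w using b[OF that] by (simp add: f_def)
    qed
    then show ?thesis using d(1) by blast
  next
    case True
    have N0: "N z = 0" using zeros[OF z] True by simp
    have dD: "deriv D z \<noteq> 0" by (rule sD[OF z True])
    have "eventually (\<lambda>w. D w / (w - z) \<noteq> 0) (at z)" using tendsto_imp_eventually_ne[OF slope[OF hD z True] dD] .
    moreover have "eventually (\<lambda>w. w \<in> upper_half) (at z)" using open_upper_half z by (intro eventually_at_in_open')
    ultimately have ev: "eventually (\<lambda>w. D w / (w - z) \<noteq> 0 \<and> w \<in> upper_half) (at z)" by (rule eventually_conj)
    then obtain d where d: "d > 0" "\<And>w. w \<noteq> z \<Longrightarrow> dist w z < d \<Longrightarrow> D w / (w - z) \<noteq> 0 \<and> w \<in> upper_half" unfolding eventually_at by blast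
    have b: "D w \<noteq> 0" "w \<in> upper_half" if "w \<in> ball z d - {z}" for w using d(2)[of w] that by (auto simp: dist_commute)
    have hol: "f holomorphic_on ball z d - {z}"
    proof (rule holomorphic_transform)
      show "(\<lambda>w. N w / D w) holomorphic_on ball z d - {z}"
        by (intro holomorphic_on_divide holomorphic_on_subset[OF hN] holomorphic_on_subset[OF hD]) (use b in blast)+
      show "N w / D w = f w" if "w \<in> ball z d - {z}" for w using b[OF that] by (simp add: f_def)
    qed
    have "((\<lambda>w. (N w / (w - z)) / (D w / (w - z))) \<longlongrightarrow> deriv N z / deriv D z) (at z)"
      by (rule tendsto_divide[OF slope[OF hN z N0] slope[OF hD z True] dD])
    moreover have "eventually (\<lambda>w. (N w / (w - z)) / (D w / (w - z)) = f w) (at z)"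
      using ev by eventually_elim (auto simp: f_def)
    ultimately have "(f \<longlongrightarrow> deriv N z / deriv D z) (at z)" by (rule Lim_transform_eventually)
    then have "isCont f z" using True by (simp add: isCont_def f_def)
    moreover have "isCont f w" if "w \<in> ball z d - {z}" for w
      using holomorphic_on_imp_continuous_on[OF hol] that by (simp add: continuous_on_eq_continuous_at open_Diff)
    ultimately have "continuous_on (ball z d) f" by (intro continuous_at_imp_continuous_on) blast
    then have "f holomorphic_on ball z d" by (rule no_isolated_singularity[OF _ hol]) auto
    then show ?thesis using d(1) by blast
  qed
  have hf: "f holomorphic_on upper_half"
    unfolding holomorphic_on_open[OF open_upper_half]
  proof
    fix z assume "z \<in> upper_half"
    from near0[OF this] obtain d where "d > 0" "f holomorphic_on ball z d" by blast
    then show "\<exists>f'. (f has_field_derivative f') (at z)"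
      using holomorphic_on_open[OF open_ball, of f z d] by auto
  qed
  have cf: "continuous_on closed_upper f"
    unfolding continuous_on_eq_continuous_within
  proof
    fix z assume z: "z \<in> closed_upper"
    from split[OF z] show "continuous (at z within closed_upper) f"
    proof
      assume "z \<in> upper_half"
      then have "isCont f z" using holomorphic_on_imp_continuous_on[OF hf] open_upper_half by (simp add: continuous_on_eq_continuous_at)
      then show ?thesis by (rule continuous_at_imp_continuous_at_within)
    next
      assume "z \<in> closed_upper \<and> Im z = 0"
      then have D0: "D z \<noteq> 0" using Dreal by blast
      have lN: "(N \<longlongrightarrow> N z) (at z within closed_upper)" and lD: "(D \<longlongrightarrow> D z) (at z within closed_upper)"
        using cN cD z by (auto simp: continuous_on_def)
      have "((\<lambda>w. N w / D w) \<longlongrightarrow> N z / D z) (at z within closed_upper)" by (rule tendsto_divide[OF lN lD D0])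
      moreover have "eventually (\<lambda>w. N w / D w = f w) (at z within closed_upper)"
        using tendsto_imp_eventually_ne[OF lD D0] by eventually_elim (simp add: f_def)
      ultimately have "(f \<longlongrightarrow> N z / D z) (at z within closed_upper)" by (rule Lim_transform_eventually)
      then show ?thesis using D0 by (simp add: continuous_within f_def)
    qed
  qed
  have nzf: "f z \<noteq> 0" if z: "z \<in> closed_upper" for z
    using split[OF z]
  proof
    assume "z \<in> upper_half"
    then show ?thesis using zeros[of z] sN[of z] sD[of z] by (auto simp: f_def)
  next
    assume "z \<in> closed_upper \<and> Im z = 0"
    then have "D z \<noteq> 0" "cmod (N z) = cmod (D z)" using Dreal by blast+
    then show ?thesis by (auto simp: f_def)
  qed
  have neg: "negligible_at_0 (\<lambda>k. ln (cmod (f k)))"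
    unfolding negligible_at_0_def
  proof (intro allI impI)
    fix \<epsilon> :: real assume "\<epsilon> > 0"
    then have e: "\<epsilon> / 2 > 0" by simp
    obtain r1 where r1: "r1 > 0" "\<And>k. cmod k < r1 \<and> Im k > 0 \<and> Re k \<noteq> 0 \<Longrightarrow> \<bar>ln (cmod (N k))\<bar> \<le> \<epsilon> / 2 * (cmod k ^ 3 / (Re k * Im k)\<^sup>2)"
      using nN e unfolding negligible_at_0_def by blast
    obtain r2 where r2: "r2 > 0" "\<And>k. cmod k < r2 \<and> Im k > 0 \<and> Re k \<noteq> 0 \<Longrightarrow> \<bar>ln (cmod (D k))\<bar> \<le> \<epsilon> / 2 * (cmod k ^ 3 / (Re k * Im k)\<^sup>2)"
      using nD e unfolding negligible_at_0_def by blast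
    show "\<exists>r>0. \<forall>k. cmod k < r \<and> Im k > 0 \<and> Re k \<noteq> 0 \<longrightarrow> \<bar>ln (cmod (f k))\<bar> \<le> \<epsilon> * (cmod k ^ 3 / (Re k * Im k)\<^sup>2)"
    proof (intro exI[of _ "min r1 r2"] conjI allI impI)
      fix k assume k: "cmod k < min r1 r2 \<and> Im k > 0 \<and> Re k \<noteq> 0"
      then have "k \<in> upper_half" by (simp add: upper_half_def)
      then have "D k \<noteq> 0" "N k \<noteq> 0" using axis[of k] zeros[of k] k by auto
      then have "ln (cmod (f k)) = ln (cmod (N k)) - ln (cmod (D k))" by (simp add: f_def norm_divide ln_div)
      moreover have "\<epsilon> * (cmod k ^ 3 / (Re k * Im k)\<^sup>2) = \<epsilon> / 2 * (cmod k ^ 3 / (Re k * Im k)\<^sup>2) + \<epsilon> / 2 * (cmod k ^ 3 / (Re k * Im k)\<^sup>2)" by simp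
      ultimately show "\<bar>ln (cmod (f k))\<bar> \<le> \<epsilon> * (cmod k ^ 3 / (Re k * Im k)\<^sup>2)"
        using r1(2)[of k] r2(2)[of k] k by linarith
    qed (use r1 r2 in auto)
  qed
  have inf: "\<exists>R. \<forall>k\<in>closed_upper. cmod k > R \<longrightarrow> cmod (f k - 1) < e" if e: "e > 0" for e
  proof -
    obtain R1 where R1: "\<forall>k\<in>closed_upper. cmod k > R1 \<longrightarrow> cmod (N k - 1) < e / 4" using iN[of "e / 4"] e by auto
    obtain R2 where R2: "\<forall>k\<in>closed_upper. cmod k > R2 \<longrightarrow> cmod (D k - 1) < min (1/2) (e / 4)" using iD[of "min (1/2) (e / 4)"] e by auto
    show ?thesis
    proof (intro exI[of _ "max R1 R2"] ballI impI)
      fix k assume k: "k \<in> closed_upper" "cmod k > max R1 R2"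
      have a: "cmod (N k - 1) < e / 4" "cmod (D k - 1) < 1/2" "cmod (D k - 1) < e / 4" using R1 R2 k by auto
      have d: "cmod (D k) > 1/2" using a(2) norm_triangle_ineq2[of 1 "1 - D k"] by (simp add: norm_minus_commute)
      then have "D k \<noteq> 0" by auto
      then have "f k - 1 = (N k - D k) / D k" by (simp add: f_def diff_divide_distrib)
      then have "cmod (f k - 1) = cmod (N k - D k) / cmod (D k)" by (simp add: norm_divide)
      also have "\<dots> \<le> cmod (N k - D k) / (1/2)" using d by (intro divide_left_mono) auto
      also have "cmod (N k - D k) < e / 2"
        using a norm_triangle_ineq4[of "N k - 1" "D k - 1"] by simp
      finally show "cmod (f k - 1) < e" by simp
    qed
  qed
  have uni: "cmod (f (of_real x)) = 1" if "x \<noteq> 0" for x :: real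
    using real[OF that] by (simp add: f_def norm_divide)
  have fk: "f z = 1" if "z \<in> closed_upper" for z
    by (rule unimodular_negligible_eq_1[OF hf cf nzf uni _ neg that]) (use inf in blast)+
  show ?thesis
  proof (cases "D k = 0")
    case True
    then show ?thesis using zeros[OF k] by simp
  next
    case False
    then show ?thesis using fk[of k] k upper_half_subset_closed_upper by (auto simp: f_def)
  qed
qed

section \<open>Blaschke products\<close>

text \<open>Intended for nonnegative parameters. A parameter 0 contributes the factor 1 at every
  \<open>z \<noteq> 0\<close>, so positive or negative members of a signed sequence can be selected
  by \<open>max\<close> without reindexing, and a factor can be removed by setting its parameter to
  0.\<close>

definition blaschke :: "(nat \<Rightarrow> real) \<Rightarrow> complex \<Rightarrow> complex" where
  "blaschke c z = (\<Prod>n. (z - \<i> * of_real (c n)) / (z + \<i> * of_real (c n)))"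

lemma norm_plus_imag_ge:
  assumes "Im z \<ge> 0" "c \<ge> 0"
  shows "cmod z \<le> cmod (z + \<i> * of_real c)"
proof -
  have "(Im z)\<^sup>2 \<le> (Im z + c)\<^sup>2" using assms by (intro power_mono) auto
  then have "(cmod z)\<^sup>2 \<le> (cmod (z + \<i> * of_real c))\<^sup>2" unfolding cmod_power2 by simp
  then show ?thesis by (rule power2_le_imp_le) simp
qed

lemma blaschke_factor_minus_1:
  assumes "Im z \<ge> 0" "z \<noteq> 0" "c \<ge> 0"
  shows "(z - \<i> * of_real c) / (z + \<i> * of_real c) - 1 = - 2 * \<i> * of_real c / (z + \<i> * of_real c)"
    and "cmod ((z - \<i> * of_real c) / (z + \<i> * of_real c) - 1) \<le> 2 * c / cmod z"
    and "z + \<i> * of_real c \<noteq> 0"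
proof -
  have p: "cmod z > 0" using assms by simp
  have ge: "cmod z \<le> cmod (z + \<i> * of_real c)" by (rule norm_plus_imag_ge[OF assms(1,3)])
  show nz: "z + \<i> * of_real c \<noteq> 0"
  proof
    assume "z + \<i> * of_real c = 0"
    then show False using ge p by simp
  qed
  show e: "(z - \<i> * of_real c) / (z + \<i> * of_real c) - 1 = - 2 * \<i> * of_real c / (z + \<i> * of_real c)"
    using nz by (simp add: field_simps)
  show "cmod ((z - \<i> * of_real c) / (z + \<i> * of_real c) - 1) \<le> 2 * c / cmod z"
  proof -
    have "2 * c / cmod (z + \<i> * of_real c) \<le> 2 * c / cmod z"
      by (rule divide_left_mono[OF ge]) (use assms p nz in auto)
    then show ?thesis unfolding e norm_divide using assms by (simp add: norm_mult)
  qed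
qed

context
  fixes c :: "nat \<Rightarrow> real"
  assumes c0: "\<And>n. c n \<ge> 0" and cs: "summable c"
begin

lemma blaschke_convergent:
  assumes "z \<in> closed_upper"
  shows "convergent_prod (\<lambda>n. (z - \<i> * of_real (c n)) / (z + \<i> * of_real (c n)))"
proof (rule abs_convergent_prod_imp_convergent_prod, rule summable_imp_abs_convergent_prod)
  have z: "Im z \<ge> 0" "z \<noteq> 0" using assms by (auto simp: closed_upper_def)
  have "summable (\<lambda>n. (2 / cmod z) * c n)" using cs by (rule summable_mult)
  then show "summable (\<lambda>i. cmod ((z - \<i> * of_real (c i)) / (z + \<i> * of_real (c i)) - 1))"
    by (rule summable_comparison_test'[where N=0]) (use blaschke_factor_minus_1(2)[OF z c0] in simp)
qed

lemma blaschke_limit: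
  assumes "z \<in> closed_upper"
  shows "(\<lambda>N. \<Prod>n<N. (z - \<i> * of_real (c n)) / (z + \<i> * of_real (c n))) \<longlonglongrightarrow> blaschke c z"
  using convergent_prod_LIMSEQ[OF blaschke_convergent[OF assms]] unfolding blaschke_def LIMSEQ_lessThan_iff_atMost .

lemma blaschke_uniform_limit:
  assumes A: "compact A" "A \<subseteq> {z. Im z \<ge> 0 \<and> cmod z > r}" and r: "r > 0"
  shows "uniform_limit A (\<lambda>N z. \<Prod>n<N. (z - \<i> * of_real (c n)) / (z + \<i> * of_real (c n))) (blaschke c) sequentially"
proof -
  let ?f = "\<lambda>n z. (z - \<i> * of_real (c n)) / (z + \<i> * of_real (c n))"
  have Ac: "z \<in> closed_upper" if "z \<in> A" for z using A(2) that r by (auto simp: closed_upper_def)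
  have "uniformly_convergent_on A (\<lambda>N z. \<Prod>n<N. ?f n z)"
  proof (rule uniformly_convergent_on_prod'[OF _ A(1)])
    show "continuous_on A (?f n)" for n
    proof (intro continuous_intros)
      show "\<forall>z\<in>A. z + \<i> * of_real (c n) \<noteq> 0"
        using Ac blaschke_factor_minus_1(3)[OF _ _ c0] by (auto simp: closed_upper_def)
    qed
    show "uniformly_convergent_on A (\<lambda>N z. \<Sum>n<N. cmod (?f n z - 1))"
    proof (rule Weierstrass_m_test'[where M="\<lambda>n. (2 / r) * c n"])
      show "norm (cmod (?f n z - 1)) \<le> (2 / r) * c n" if "z \<in> A" for n z
      proof -
        have z: "Im z \<ge> 0" "cmod z > r" using A(2) that by auto
        then have z0: "z \<noteq> 0" using r by auto
        have "cmod (?f n z - 1) \<le> 2 * c n / cmod z" by (rule blaschke_factor_minus_1(2)[OF z(1) z0 c0])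
        also have "\<dots> \<le> 2 * c n / r" using z z0 r c0[of n] by (intro divide_left_mono) auto
        finally show ?thesis by simp
      qed
      show "summable (\<lambda>n. (2 / r) * c n)" using cs by (rule summable_mult)
    qed
  qed
  then obtain l where l: "uniform_limit A (\<lambda>N z. \<Prod>n<N. ?f n z) l sequentially" unfolding uniformly_convergent_on_def by blast
  have lb: "l z = blaschke c z" if "z \<in> A" for z
    using LIMSEQ_unique[OF tendsto_uniform_limitI[OF l that] blaschke_limit[OF Ac[OF that]]] .
  show ?thesis by (rule iffD1[OF uniform_limit_cong'[OF refl lb] l])
qed

lemma blaschke_continuous: "continuous_on closed_upper (blaschke c)"
  unfolding continuous_on_eq_continuous_within
proof
  fix z assume z: "z \<in> closed_upper"
  define r where "r = cmod z / 3"
  have r: "r > 0" using z by (auto simp: r_def closed_upper_def)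
  define A where "A = cball z r \<inter> {z. Im z \<ge> 0}"
  have cA: "compact A" unfolding A_def by (intro compact_Int_closed compact_cball closed_halfspace_Im_ge)
  have Ar: "A \<subseteq> {z. Im z \<ge> 0 \<and> cmod z > r}"
  proof
    fix w assume w: "w \<in> A"
    then have "cmod z \<le> cmod w + r" using norm_triangle_ineq2[of z w] by (auto simp: A_def dist_norm)
    then have "cmod w > r" using r unfolding r_def by linarith
    then show "w \<in> {z. Im z \<ge> 0 \<and> cmod z > r}" using w by (auto simp: A_def)
  qed
  have fin: "continuous_on A (\<lambda>z. \<Prod>n<N. (z - \<i> * of_real (c n)) / (z + \<i> * of_real (c n)))" for N
  proof (intro continuous_on_prod continuous_intros ballI)
    fix n w assume "w \<in> A"
    then have "Im w \<ge> 0" "w \<noteq> 0" using Ar r by auto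
    then show "w + \<i> * of_real (c n) \<noteq> 0" using blaschke_factor_minus_1(3)[OF _ _ c0] by blast
  qed
  have cont: "continuous_on A (blaschke c)"
    by (rule uniform_limit_theorem[OF _ blaschke_uniform_limit[OF cA Ar r]]) (use fin in auto)
  have zA: "z \<in> A" using z r by (auto simp: A_def closed_upper_def)
  have "at z within closed_upper = at z within A"
  proof (rule at_within_nhd[of _ "ball z r"])
    show "closed_upper \<inter> ball z r - {z} = A \<inter> ball z r - {z}"
      using Ar r by (auto simp: A_def closed_upper_def)
  qed (use r in auto)
  then show "continuous (at z within closed_upper) (blaschke c)" using cont zA by (simp add: continuous_on_eq_continuous_within)
qed

lemma blaschke_holomorphic: "blaschke c holomorphic_on upper_half"
proof (rule holomorphic_uniform_sequence[OF open_upper_half])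
  show "(\<lambda>z. \<Prod>n<N. (z - \<i> * of_real (c n)) / (z + \<i> * of_real (c n))) holomorphic_on upper_half" for N
  proof (intro holomorphic_on_prod holomorphic_intros)
    fix n z assume "z \<in> upper_half"
    then have "Im z \<ge> 0" "z \<noteq> 0" by (auto simp: upper_half_def)
    then show "z + \<i> * of_real (c n) \<noteq> 0" using blaschke_factor_minus_1(3)[OF _ _ c0] by blast
  qed
  fix z assume z: "z \<in> upper_half"
  then obtain d where d: "d > 0" "cball z d \<subseteq> upper_half" using open_upper_half open_contains_cball by blast
  define e where "e = min d (cmod z / 3)"
  have z0: "cmod z > 0" using z by (auto simp: upper_half_def)
  have e: "e > 0" "cball z e \<subseteq> upper_half" using d z0 by (auto simp: e_def)
  have "cball z e \<subseteq> {z. Im z \<ge> 0 \<and> cmod z > cmod z0}" if "cmod z0 = cmod z / 3" for z0 :: complex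
  proof
    fix w assume w: "w \<in> cball z e"
    then have "cmod z \<le> cmod w + e" using norm_triangle_ineq2[of z w] by (auto simp: dist_norm)
    moreover have "e \<le> cmod z / 3" by (simp add: e_def)
    ultimately have "cmod w > cmod z / 3" using z0 by linarith
    moreover have "Im w \<ge> 0" using e(2) w by (auto simp: upper_half_def)
    ultimately show "w \<in> {z. Im z \<ge> 0 \<and> cmod z > cmod z0}" using that by simp
  qed
  from this[of "z / 3"] have "cball z e \<subseteq> {w. Im w \<ge> 0 \<and> cmod w > cmod z / 3}" by (simp add: norm_divide)
  then have "uniform_limit (cball z e) (\<lambda>N z. \<Prod>n<N. (z - \<i> * of_real (c n)) / (z + \<i> * of_real (c n))) (blaschke c) sequentially"
    by (intro blaschke_uniform_limit[of _ "cmod z / 3"]) (use z0 in auto)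
  then show "\<exists>d>0. cball z d \<subseteq> upper_half \<and> uniform_limit (cball z d) (\<lambda>N z. \<Prod>n<N. (z - \<i> * of_real (c n)) / (z + \<i> * of_real (c n))) (blaschke c) sequentially"
    using e by blast
qed

lemma blaschke_eq_0_iff:
  assumes "z \<in> closed_upper"
  shows "blaschke c z = 0 \<longleftrightarrow> (\<exists>n. z = \<i> * of_real (c n))"
proof -
  have nz: "z + \<i> * of_real (c n) \<noteq> 0" for n
    using assms blaschke_factor_minus_1(3)[OF _ _ c0] by (auto simp: closed_upper_def)
  have "blaschke c z = 0 \<longleftrightarrow> 0 \<in> range (\<lambda>n. (z - \<i> * of_real (c n)) / (z + \<i> * of_real (c n)))"
    unfolding blaschke_def by (rule has_prod_eq_0_iff[OF convergent_prod_has_prod[OF blaschke_convergent[OF assms]]])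
  also have "\<dots> \<longleftrightarrow> (\<exists>n. z = \<i> * of_real (c n))"
    using nz by (auto simp: image_iff)
  finally show ?thesis .
qed

lemma blaschke_norm_real:
  assumes "x \<noteq> 0"
  shows "cmod (blaschke c (of_real x)) = 1"
proof -
  have x: "complex_of_real x \<in> closed_upper" by (rule closed_upper_real[OF assms])
  have "cmod ((of_real x - \<i> * of_real (c n)) / (of_real x + \<i> * of_real (c n))) = 1" for n
  proof -
    have "of_real x - \<i> * of_real (c n) = cnj (of_real x + \<i> * of_real (c n))" by simp
    moreover have "complex_of_real x + \<i> * of_real (c n) \<noteq> 0"
      using x blaschke_factor_minus_1(3)[OF _ _ c0] by (auto simp: closed_upper_def)
    ultimately show ?thesis by (simp only: norm_divide complex_mod_cnj) simp
  qed
  then have "(\<lambda>N. cmod (\<Prod>n<N. (of_real x - \<i> * of_real (c n)) / (of_real x + \<i> * of_real (c n)))) = (\<lambda>N. 1)"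
    by (simp add: prod_norm[symmetric] fun_eq_iff)
  then show ?thesis using LIMSEQ_unique[OF tendsto_norm[OF blaschke_limit[OF x]], of 1] by simp
qed

lemma blaschke_norm_le_1:
  assumes "z \<in> closed_upper"
  shows "cmod (blaschke c z) \<le> 1"
proof (rule Lim_bounded[OF tendsto_norm[OF blaschke_limit[OF assms]]])
  show "\<forall>N\<ge>0. cmod (\<Prod>n<N. (z - \<i> * of_real (c n)) / (z + \<i> * of_real (c n))) \<le> 1"
  proof (intro allI impI)
    fix N
    have "cmod ((z - \<i> * of_real (c n)) / (z + \<i> * of_real (c n))) \<le> 1" for n
    proof -
      have "(Im z - c n)\<^sup>2 \<le> (Im z + c n)\<^sup>2"
        using assms c0[of n] by (simp add: closed_upper_def power2_eq_square algebra_simps)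
      then have "(cmod (z - \<i> * of_real (c n)))\<^sup>2 \<le> (cmod (z + \<i> * of_real (c n)))\<^sup>2" unfolding cmod_power2 by simp
      then have "cmod (z - \<i> * of_real (c n)) \<le> cmod (z + \<i> * of_real (c n))" by (rule power2_le_imp_le) simp
      then show ?thesis by (simp add: norm_divide divide_le_eq_1)
    qed
    then show "cmod (\<Prod>n<N. (z - \<i> * of_real (c n)) / (z + \<i> * of_real (c n))) \<le> 1"
      unfolding prod_norm[symmetric] by (intro prod_le_1) auto
  qed
qed

text \<open>The product differs from 1 by at most exp(2S/|z|) - 1, with \<open>S\<close> the sum of
  the parameters; \<open>R\<close> is the radius at which this equals \<open>e / 2\<close>.\<close>

lemma blaschke_at_infinity:
  assumes e: "e > 0"
  shows "\<exists>R. \<forall>z\<in>closed_upper. cmod z > R \<longrightarrow> cmod (blaschke c z - 1) < e"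
proof -
  define S where "S = suminf c"
  have S: "S \<ge> 0" unfolding S_def by (rule suminf_nonneg[OF cs c0])
  define R where "R = 2 * S / ln (1 + e / 2)"
  have l: "ln (1 + e / 2) > 0" using e by simp
  have R: "R \<ge> 0" using S l by (simp add: R_def)
  show ?thesis
  proof (intro exI[of _ R] ballI impI)
    fix z assume z: "z \<in> closed_upper" "cmod z > R"
    then have z': "Im z \<ge> 0" "z \<noteq> 0" by (auto simp: closed_upper_def)
    have z0: "cmod z > 0" using z' by simp
    have "cmod ((\<Prod>n<N. (z - \<i> * of_real (c n)) / (z + \<i> * of_real (c n))) - 1) \<le> exp (2 * S / cmod z) - 1" for N
    proof -
      let ?g = "\<lambda>n. (z - \<i> * of_real (c n)) / (z + \<i> * of_real (c n)) - 1"
      have "cmod ((\<Prod>n<N. 1 + ?g n) - 1) \<le> (\<Prod>n<N. 1 + cmod (?g n)) - 1" by (rule norm_prod_minus1_le_prod_minus1)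
      also have "(\<Prod>n<N. 1 + cmod (?g n)) \<le> (\<Prod>n<N. exp (2 * c n / cmod z))"
      proof (intro prod_mono conjI)
        fix n
        have "1 + cmod (?g n) \<le> 1 + 2 * c n / cmod z" using blaschke_factor_minus_1(2)[OF z' c0] by simp
        also have "\<dots> \<le> exp (2 * c n / cmod z)" by (rule exp_ge_add_one_self)
        finally show "1 + cmod (?g n) \<le> exp (2 * c n / cmod z)" .
      qed simp
      also have "(\<Prod>n<N. exp (2 * c n / cmod z)) = exp (2 / cmod z * (\<Sum>n<N. c n))"
        by (simp add: exp_sum[symmetric] sum_distrib_left sum_divide_distrib mult_ac)
      also have "\<dots> \<le> exp (2 / cmod z * S)"
        using sum_le_suminf[OF cs, of "{..<N}"] c0 z0 by (simp add: S_def mult_left_mono divide_right_mono)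
      finally show ?thesis by simp
    qed
    then have "cmod (blaschke c z - 1) \<le> exp (2 * S / cmod z) - 1"
      by (intro Lim_bounded[OF tendsto_norm[OF tendsto_diff[OF blaschke_limit[OF z(1)] tendsto_const]]]) auto
    also have "\<dots> \<le> exp (ln (1 + e / 2)) - 1"
    proof -
      have "2 * S \<le> ln (1 + e / 2) * cmod z" using z(2) l by (simp add: R_def pos_divide_less_eq mult.commute)
      then show ?thesis using z0 by (simp add: pos_divide_le_eq)
    qed
    also have "\<dots> < e" using e by simp
    finally show "cmod (blaschke c z - 1) < e" .
  qed
qed

text \<open>The squared modulus of the inverse factor is \<open>1 + 4 d b / m\<close> with
  \<open>m = |z - id|^2\<close> and \<open>b = Im z\<close>. The coefficient
  \<open>4 d |z|^2 / (|z|^2 + d^2)\<close> is kept in this form because it is bounded both by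
  \<open>4 d\<close>, which is summable over the parameters, and by \<open>4 |z|^2 / d\<close>,
  which tends to 0 with \<open>z\<close>.\<close>

lemma blaschke_factor_lower:
  assumes z: "Im z > 0" "Re z \<noteq> 0" and d: "d \<ge> 0"
  shows "exp (- (4 * d * (cmod z)\<^sup>2 / ((cmod z)\<^sup>2 + d\<^sup>2)) * (cmod z ^ 3 / (Re z * Im z)\<^sup>2)) \<le> cmod ((z - \<i> * of_real d) / (z + \<i> * of_real d))"
proof -
  define a b \<rho> where "a = Re z" and "b = Im z" and "\<rho> = cmod z"
  have r2: "\<rho>\<^sup>2 = a\<^sup>2 + b\<^sup>2" by (simp add: \<rho>_def a_def b_def cmod_power2)
  have b: "b > 0" "b \<le> \<rho>" using z abs_Im_le_cmod[of z] by (auto simp: b_def \<rho>_def)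
  have a: "a \<noteq> 0" "a\<^sup>2 > 0" using z by (auto simp: a_def)
  define m where "m = (cmod (z - \<i> * of_real d))\<^sup>2"
  define p where "p = (cmod (z + \<i> * of_real d))\<^sup>2"
  have m: "m = a\<^sup>2 + (b - d)\<^sup>2" and p: "p = a\<^sup>2 + (b + d)\<^sup>2" by (simp_all add: m_def p_def cmod_power2 a_def b_def)
  have mp: "m > 0" using a by (simp add: m add_pos_nonneg)
  have pm: "p = m + 4 * d * b" unfolding m p by (simp add: power2_eq_square algebra_simps)
  have key: "a\<^sup>2 * (\<rho>\<^sup>2 + d\<^sup>2) \<le> 2 * \<rho>\<^sup>2 * m"
  proof -
    \<comment> \<open>An explicit sum of squares bounds the distance from \<open>z\<close> to the
      zero \<open>id\<close> from below, uniformly in \<open>d\<close>.\<close>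
    have "2 * \<rho>\<^sup>2 * m - a\<^sup>2 * (\<rho>\<^sup>2 + d\<^sup>2) = (a\<^sup>2 - b * (d - b))\<^sup>2 + a\<^sup>2 * (d - b)\<^sup>2 + b\<^sup>2 * (d - b)\<^sup>2"
      unfolding m r2 by (simp add: power2_eq_square algebra_simps)
    moreover have "0 \<le> (a\<^sup>2 - b * (d - b))\<^sup>2 + a\<^sup>2 * (d - b)\<^sup>2 + b\<^sup>2 * (d - b)\<^sup>2" by simp
    ultimately show ?thesis by linarith
  qed
  define E where "E = 4 * d * \<rho>\<^sup>2 / (\<rho>\<^sup>2 + d\<^sup>2) * (\<rho> ^ 3 / (a * b)\<^sup>2)"
  have r0: "\<rho> > 0" using b by linarith
  have rd: "\<rho>\<^sup>2 + d\<^sup>2 > 0" using r0 by (simp add: add_pos_nonneg)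
  have "4 * d * b / m \<le> 2 * E"
  proof -
    have "4 * d * b / m \<le> 4 * d * b * (2 * \<rho>\<^sup>2 / (a\<^sup>2 * (\<rho>\<^sup>2 + d\<^sup>2)))"
    proof -
      have "1 / m \<le> 2 * \<rho>\<^sup>2 / (a\<^sup>2 * (\<rho>\<^sup>2 + d\<^sup>2))"
        using key mp a rd by (simp add: divide_simps mult_ac)
      from mult_left_mono[OF this, of "4 * d * b"] show ?thesis using d b by simp
    qed
    also have "\<dots> = 2 * (4 * d * \<rho>\<^sup>2 / (\<rho>\<^sup>2 + d\<^sup>2) * (b / a\<^sup>2))" using a rd by (simp add: field_simps)
    also have "\<dots> \<le> 2 * (4 * d * \<rho>\<^sup>2 / (\<rho>\<^sup>2 + d\<^sup>2) * (\<rho> ^ 3 / (a * b)\<^sup>2))"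
    proof (intro mult_left_mono)
      have "b ^ 3 \<le> \<rho> ^ 3" using b by (intro power_mono) auto
      then have "b * b\<^sup>2 \<le> \<rho> ^ 3" by (simp add: power2_eq_square power3_eq_cube)
      then show "b / a\<^sup>2 \<le> \<rho> ^ 3 / (a * b)\<^sup>2" using a b by (simp add: power_mult_distrib field_simps)
    qed (use d rd in auto)
    finally show ?thesis by (simp add: E_def)
  qed
  then have "p / m \<le> 1 + 2 * E" using mp by (simp add: pm add_divide_distrib)
  also have "\<dots> \<le> exp (2 * E)" by (rule exp_ge_add_one_self)
  finally have "p \<le> exp (2 * E) * m" using mp by (simp add: pos_divide_le_eq)
  then have "exp (- (2 * E)) * p \<le> exp (- (2 * E)) * (exp (2 * E) * m)" by (intro mult_left_mono) auto
  also have "\<dots> = m" by (simp add: exp_minus)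
  finally have "(exp (- E) * cmod (z + \<i> * of_real d))\<^sup>2 \<le> (cmod (z - \<i> * of_real d))\<^sup>2"
    unfolding m_def[symmetric] power_mult_distrib p_def[symmetric] by (simp flip: exp_double)
  then have "exp (- E) * cmod (z + \<i> * of_real d) \<le> cmod (z - \<i> * of_real d)" by (rule power2_le_imp_le) simp
  moreover have "cmod (z + \<i> * of_real d) > 0"
  proof -
    have "z \<noteq> 0" using z by auto
    then have "z + \<i> * of_real d \<noteq> 0" using blaschke_factor_minus_1(3)[of z d] z d by simp
    then show ?thesis by simp
  qed
  ultimately show ?thesis by (simp add: norm_divide pos_le_divide_eq E_def a_def b_def \<rho>_def)
qed

text \<open>Only the lower bound needs work, since the product has modulus at most 1. Parameters
  from \<open>N\<close> on contribute at most four times a small tail of the series; the finitely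
  many others contribute O(|k|^2).\<close>

lemma blaschke_negligible: "negligible_at_0 (\<lambda>z. ln (cmod (blaschke c z)))"
  unfolding negligible_at_0_def
proof (intro allI impI)
  fix \<epsilon> :: real assume eps: "\<epsilon> > 0"
  obtain N where N: "(\<Sum>n. c (n + N)) < \<epsilon> / 8"
  proof -
    have "(\<lambda>N. \<Sum>n. c (n + N)) \<longlonglongrightarrow> 0" by (rule suminf_exist_split2[OF cs])
    then have "eventually (\<lambda>N. (\<Sum>n. c (n + N)) < \<epsilon> / 8) sequentially" using eps by (intro order_tendstoD) auto
    then show ?thesis using that eventually_happens'[OF sequentially_bot] by blast
  qed
  \<comment> \<open>The summand 1 keeps \<open>H\<close> positive if all of the first
    \<open>N\<close> parameters vanish; vanishing parameters must be skipped because they contribute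
    nothing and \<open>4 / c n\<close> is only meant for positive ones.\<close>
  define H where "H = (\<Sum>n<N. if c n = 0 then 0 else 4 / c n) + 1"
  have H: "H > 0" unfolding H_def using c0 by (intro add_nonneg_pos sum_nonneg) auto
  define r where "r = min 1 (\<epsilon> / (2 * H))"
  have r: "r > 0" using eps H by (simp add: r_def)
  show "\<exists>r>0. \<forall>k. cmod k < r \<and> Im k > 0 \<and> Re k \<noteq> 0 \<longrightarrow> \<bar>ln (cmod (blaschke c k))\<bar> \<le> \<epsilon> * (cmod k ^ 3 / (Re k * Im k)\<^sup>2)"
  proof (intro exI[of _ r] conjI r allI impI)
    fix k assume k: "cmod k < r \<and> Im k > 0 \<and> Re k \<noteq> 0"
    define w where "w = cmod k ^ 3 / (Re k * Im k)\<^sup>2"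
    have w: "w \<ge> 0" by (simp add: w_def)
    have kc: "k \<in> closed_upper" using k by (auto simp: closed_upper_def)
    define t where "t = (\<lambda>n. 4 * c n * (cmod k)\<^sup>2 / ((cmod k)\<^sup>2 + (c n)\<^sup>2))"
    have k0: "cmod k > 0" using k by auto
    have t4: "t n \<le> 4 * c n" for n
    proof -
      have "(cmod k)\<^sup>2 / ((cmod k)\<^sup>2 + (c n)\<^sup>2) \<le> 1" using k0 by (simp add: divide_le_eq_1 add_pos_nonneg)
      from mult_left_mono[OF this, of "4 * c n"] show ?thesis using c0[of n] by (simp add: t_def)
    qed
    have tH: "t n \<le> (cmod k)\<^sup>2 * (if c n = 0 then 0 else 4 / c n)" for n
    proof (cases "c n = 0")
      case False
      then have c: "c n > 0" using c0[of n] by simp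
      have "4 * c n * (cmod k)\<^sup>2 / ((cmod k)\<^sup>2 + (c n)\<^sup>2) \<le> 4 * c n * (cmod k)\<^sup>2 / (c n)\<^sup>2"
        using c k0 by (intro divide_left_mono) (auto simp: add_pos_nonneg)
      also have "\<dots> = (cmod k)\<^sup>2 * (4 / c n)" using c by (simp add: power2_eq_square)
      finally show ?thesis using False by (simp add: t_def)
    qed (simp add: t_def)
    have t0: "t n \<ge> 0" for n using c0[of n] by (simp add: t_def)
    have st: "(\<Sum>n<M. t n) \<le> \<epsilon>" for M
    proof -
      \<comment> \<open>Lengthening the sum to \<open>N + M\<close> makes the split at
        \<open>N\<close> valid for every \<open>M\<close>, including \<open>M < N\<close>.\<close>
      have "(\<Sum>n<M. t n) \<le> (\<Sum>n<N + M. t n)" using t0 by (intro sum_mono2) auto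
      also have "\<dots> = (\<Sum>n<N. t n) + (\<Sum>n<M. t (n + N))"
        by (induction M) (simp_all add: add.commute add.left_commute)
      also have "\<dots> \<le> (cmod k)\<^sup>2 * H + \<epsilon> / 2"
      proof (rule add_mono)
        have "(\<Sum>n<N. t n) \<le> (\<Sum>n<N. (cmod k)\<^sup>2 * (if c n = 0 then 0 else 4 / c n))" by (intro sum_mono tH)
        also have "\<dots> \<le> (cmod k)\<^sup>2 * H" unfolding H_def sum_distrib_left[symmetric] by (intro mult_left_mono) auto
        finally show "(\<Sum>n<N. t n) \<le> (cmod k)\<^sup>2 * H" .
        have sh: "summable (\<lambda>n. c (n + N))" using cs by (rule summable_ignore_initial_segment)
        have "(\<Sum>n<M. t (n + N)) \<le> (\<Sum>n<M. 4 * c (n + N))" by (intro sum_mono t4)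
        also have "\<dots> = 4 * (\<Sum>n<M. c (n + N))" by (simp add: sum_distrib_left)
        also have "(\<Sum>n<M. c (n + N)) \<le> (\<Sum>n. c (n + N))" by (intro sum_le_suminf sh) (use c0 in auto)
        finally show "(\<Sum>n<M. t (n + N)) \<le> \<epsilon> / 2" using N by linarith
      qed
      also have "(cmod k)\<^sup>2 * H \<le> \<epsilon> / 2"
      proof -
        have "(cmod k)\<^sup>2 \<le> 1 * r" unfolding power2_eq_square using k k0 by (intro mult_mono) (auto simp: r_def)
        also have "\<dots> \<le> \<epsilon> / (2 * H)" by (simp add: r_def)
        finally have "(cmod k)\<^sup>2 * H \<le> \<epsilon> / (2 * H) * H" using H by (intro mult_right_mono) auto
        then show ?thesis using H by simp
      qed
      finally show ?thesis by simp
    qed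
    have low: "exp (- (\<epsilon> * w)) \<le> cmod (\<Prod>n<M. (k - \<i> * of_real (c n)) / (k + \<i> * of_real (c n)))" for M
    proof -
      have "exp (- (\<epsilon> * w)) \<le> exp (- ((\<Sum>n<M. t n) * w))" using mult_right_mono[OF st[of M] w] by simp
      also have "\<dots> = (\<Prod>n<M. exp (- t n * w))" by (simp add: exp_sum[symmetric] sum_distrib_right sum_negf)
      also have "\<dots> \<le> (\<Prod>n<M. cmod ((k - \<i> * of_real (c n)) / (k + \<i> * of_real (c n))))"
      proof (intro prod_mono conjI)
        show "exp (- t n * w) \<le> cmod ((k - \<i> * of_real (c n)) / (k + \<i> * of_real (c n)))" for n
          unfolding t_def w_def by (rule blaschke_factor_lower) (use k c0 in auto)
      qed simp
      finally show ?thesis by (simp add: prod_norm)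
    qed
    have "exp (- (\<epsilon> * w)) \<le> cmod (blaschke c k)"
      by (rule LIMSEQ_le_const[OF tendsto_norm[OF blaschke_limit[OF kc]]]) (use low in blast)
    moreover from this have pos: "cmod (blaschke c k) > 0" by (rule less_le_trans[OF exp_gt_zero])
    ultimately have "- (\<epsilon> * w) \<le> ln (cmod (blaschke c k))" by (simp only: ln_ge_iff)
    moreover have "ln (cmod (blaschke c k)) \<le> 0" using blaschke_norm_le_1[OF kc] pos by simp
    ultimately show "\<bar>ln (cmod (blaschke c k))\<bar> \<le> \<epsilon> * (cmod k ^ 3 / (Re k * Im k)\<^sup>2)" by (simp add: w_def)
  qed
qed

end

lemma blaschke_deriv_nonzero:
  assumes c0: "\<And>n. c n \<ge> 0" and cs: "summable c" and n: "c n > 0" and inj: "\<And>m. m \<noteq> n \<Longrightarrow> c m \<noteq> c n"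
  shows "deriv (blaschke c) (\<i> * of_real (c n)) \<noteq> 0"
proof -
  \<comment> \<open>With its parameter set to 0 the n-th factor becomes 1, so the product over
    \<open>d\<close> is the original one with that simple zero divided out.\<close>
  define d where "d = c(n := 0)"
  have d0: "d m \<ge> 0" for m using c0 by (simp add: d_def)
  have ds: "summable d"
    by (rule summable_comparison_test'[OF cs, where N=0]) (use c0 in \<open>auto simp: d_def\<close>)
  let ?z = "\<i> * complex_of_real (c n)"
  have zU: "?z \<in> upper_half" using n by (simp add: upper_half_def)
  have fac: "blaschke c z = (z - ?z) / (z + ?z) * blaschke d z" if z: "z \<in> closed_upper" for z
  proof -
    have z0: "z \<noteq> 0" using z by (simp add: closed_upper_def)
    let ?g = "\<lambda>m. if m = n then (z - ?z) / (z + ?z) else 1"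
    have g: "?g has_prod ((z - ?z) / (z + ?z))"
      using has_prod_If_finite[of "\<lambda>m. m = n" "\<lambda>m. (z - ?z) / (z + ?z)"] by simp
    have gc: "convergent_prod ?g" using g by (simp add: has_prod_iff)
    have "blaschke c z = (\<Prod>m. ?g m * ((z - \<i> * of_real (d m)) / (z + \<i> * of_real (d m))))"
      unfolding blaschke_def by (rule prodinf_cong) (use z0 in \<open>auto simp: d_def\<close>)
    also have "\<dots> = prodinf ?g * blaschke d z"
      unfolding blaschke_def by (rule prodinf_mult[OF gc blaschke_convergent[OF d0 ds z], symmetric])
    also have "prodinf ?g = (z - ?z) / (z + ?z)" using g by (simp add: has_prod_iff)
    finally show ?thesis .
  qed
  have hol: "blaschke d holomorphic_on upper_half" by (rule blaschke_holomorphic[OF d0 ds])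
  have zz: "?z + ?z \<noteq> 0" using n by simp
  have d1: "((\<lambda>z. (z - ?z) / (z + ?z)) has_field_derivative 1 / (?z + ?z)) (at ?z)"
    using zz by (auto intro!: derivative_eq_intros simp: field_simps)
  have "((\<lambda>z. (z - ?z) / (z + ?z) * blaschke d z) has_field_derivative
      1 / (?z + ?z) * blaschke d ?z + deriv (blaschke d) ?z * ((?z - ?z) / (?z + ?z))) (at ?z)"
    by (rule DERIV_mult[OF d1 holomorphic_derivI[OF hol open_upper_half zU]])
  then have D: "((\<lambda>z. (z - ?z) / (z + ?z) * blaschke d z) has_field_derivative 1 / (?z + ?z) * blaschke d ?z) (at ?z)" by simp
  have "(blaschke c has_field_derivative 1 / (?z + ?z) * blaschke d ?z) (at ?z)"
    by (rule has_field_derivative_transform_within_open[OF D open_upper_half zU])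
       (use fac upper_half_subset_closed_upper in auto)
  then have "deriv (blaschke c) ?z = 1 / (?z + ?z) * blaschke d ?z" by (rule DERIV_imp_deriv)
  moreover have "blaschke d ?z \<noteq> 0"
  proof
    assume "blaschke d ?z = 0"
    then obtain m where "?z = \<i> * of_real (d m)"
      using blaschke_eq_0_iff[OF d0 ds, of ?z] zU upper_half_subset_closed_upper by blast
    then have "c n = d m" by simp
    then show False using n inj[of m] by (cases "m = n") (auto simp: d_def)
  qed
  ultimately show ?thesis using zz by simp
qed

section \<open>Eigenvalues\<close>

lemma set_integrable_lebesgue_on:
  fixes f :: "real \<Rightarrow> 'a::{banach, second_countable_topology}"
  assumes "S \<in> sets lebesgue"
  shows "integrable (lebesgue_on S) f \<longleftrightarrow> set_integrable lebesgue S f"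
  using assms by (simp add: set_integrable_def integrable_restrict_space)

lemma jost_eventually_nonzero:
  assumes q: "integrable lebesgue q" and k: "Im k \<ge> 0" "k \<noteq> 0"
  shows "\<exists>X\<ge>0. \<forall>x\<ge>X. jost q k x \<noteq> 0"
proof -
  have "eventually (\<lambda>x. dist (jost_m q k x) 1 < 1 \<and> x \<ge> 0) at_top"
    using tendstoD[OF jost_asymp(6)[OF q k], of 1] by (intro eventually_conj eventually_ge_at_top) auto
  then obtain X where X: "\<And>x. x \<ge> X \<Longrightarrow> dist (jost_m q k x) 1 < 1 \<and> x \<ge> 0"
    unfolding eventually_at_top_linorder by blast
  have "jost q k x \<noteq> 0" if "x \<ge> X" for x
    using X[OF that] by (auto simp: jost_def)
  moreover have "X \<ge> 0" using X[of X] by simp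
  ultimately show ?thesis by blast
qed

lemma not_AE_zero_of_half_line:
  fixes f :: "real \<Rightarrow> complex"
  assumes S: "S \<in> sets lebesgue" and X: "{X..} \<subseteq> S" "\<And>x. x \<ge> X \<Longrightarrow> f x \<noteq> 0"
  shows "\<not> (AE x in lebesgue_on S. f x = 0)"
proof
  assume "AE x in lebesgue_on S. f x = 0"
  then have "AE x in lebesgue. x \<in> S \<longrightarrow> f x = 0" using S by (simp add: AE_restrict_space_iff)
  then have "AE x in lebesgue. x \<notin> {X..X+1}" by eventually_elim (use X in force)
  then have "{X..X+1} \<in> null_sets lebesgue" by (simp add: AE_iff_null_sets)
  then have "emeasure lebesgue {X..X+1} = 0" by (rule null_setsD1)
  then show False by simp
qed

lemma jost_mass_pos:
  assumes q: "integrable lebesgue q" and k: "Im k > 0"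
  shows "(LINT t:{0..}|lebesgue. (cmod (jost q k t))\<^sup>2) > 0"
proof -
  have k0: "Im k \<ge> 0" "k \<noteq> 0" using k by auto
  let ?f = "\<lambda>t. indicat_real {0..} t *\<^sub>R (cmod (jost q k t))\<^sup>2"
  have i: "integrable lebesgue ?f" using jost_square_integrable[OF q k, of 0] unfolding set_integrable_def .
  obtain X where X: "X \<ge> 0" "\<And>x. x \<ge> X \<Longrightarrow> jost q k x \<noteq> 0" using jost_eventually_nonzero[OF q k0] by blast
  have "integral\<^sup>L lebesgue ?f \<noteq> 0"
  proof
    assume "integral\<^sup>L lebesgue ?f = 0"
    then have "AE t in lebesgue. ?f t = 0" using integral_nonneg_eq_0_iff_AE[OF i] by (simp add: indicator_def)
    then have "AE t in lebesgue_on {0..}. jost q k t = 0" by (subst AE_restrict_space_iff) (auto elim!: eventually_mono)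
    moreover have "\<not> (AE t in lebesgue_on {0..}. jost q k t = 0)"
      by (rule not_AE_zero_of_half_line[of _ X]) (use X in auto)
    ultimately show False by blast
  qed
  moreover have "integral\<^sup>L lebesgue ?f \<ge> 0" by (rule Bochner_Integration.integral_nonneg) (simp add: indicator_def)
  ultimately show ?thesis unfolding set_lebesgue_integral_def by linarith
qed

text \<open>At a zero the left side of \<open>jost_Im_identity\<close> vanishes while the mass is
  positive, so Im (k^2) = 0. On the axis the Jost solution is real, its square integrates to the
  mass, and \<open>jost_derivative_identity\<close> shows that the zero is simple.\<close>

lemma jost_zero_imp_axis:
  assumes q: "integrable lebesgue q" and k: "Im k > 0" and z: "jost q k 0 = 0"
  shows "Re k = 0" "deriv (\<lambda>k. jost q k 0) k \<noteq> 0"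
proof -
  have "Im (k\<^sup>2) * (LINT t:{0..}|lebesgue. (cmod (jost q k t))\<^sup>2) = 0"
    using jost_Im_identity[OF q k, of 0] z by simp
  then have "Im (k\<^sup>2) = 0" using jost_mass_pos[OF q k] by simp
  then show re: "Re k = 0" using k by (simp add: power2_eq_square)
  have k0: "Im k \<ge> 0" "k \<noteq> 0" using k by auto
  have kk: "- cnj k = k" using re by (simp add: complex_eq_iff)
  have real: "(jost q k t)\<^sup>2 = of_real ((cmod (jost q k t))\<^sup>2)" for t
    using jost_cnj(1)[OF q k0, of t] complex_norm_square[of "jost q k t"] unfolding kk by (simp add: power2_eq_square)
  have "- deriv (\<lambda>k. jost q k 0) k * jost1 q k 0 = 2 * k * (LINT t:{0..}|lebesgue. of_real ((cmod (jost q k t))\<^sup>2))"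
    using jost_derivative_identity[OF q k] z unfolding real by simp
  also have "\<dots> = 2 * k * of_real (LINT t:{0..}|lebesgue. (cmod (jost q k t))\<^sup>2)" by (simp only: set_integral_complex_of_real)
  also have "\<dots> \<noteq> 0" using jost_mass_pos[OF q k] k0 by simp
  finally show "deriv (\<lambda>k. jost q k 0) k \<noteq> 0" by auto
qed

text \<open>Reflection changes the sign of the derivative, so the expression in \<open>W\<close> is,
  up to sign, the Wronskian at 0 of the left and the right Jost solution.\<close>

lemma jost_reflect_eq:
  assumes q: "integrable lebesgue q" and k: "Im k > 0"
    and W: "jost q k 0 * jost1 (\<lambda>x. q (- x)) k 0 + jost1 q k 0 * jost (\<lambda>x. q (- x)) k 0 = 0"
  shows "\<exists>C. C \<noteq> 0 \<and> (\<forall>x. jost (\<lambda>x. q (- x)) k (- x) = C * jost q k x)"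
proof -
  let ?p = "\<lambda>x. q (- x)"
  have p: "integrable lebesgue ?p" by (rule integrable_reflect_lebesgue[OF q])
  have k0: "Im k \<ge> 0" "k \<noteq> 0" using k by auto
  have s: "solution UNIV q k (\<lambda>x. jost ?p k (- x)) (\<lambda>x. - jost1 ?p k (- x))"
    using solution_reflect[OF solution_jost[OF p k0]] by simp
  have "jost ?p k (- 0) * jost1 q k 0 - (- jost1 ?p k (- 0)) * jost q k 0 = 0" using W by (simp add: algebra_simps)
  from solution_proportional_jost[OF q k0 is_interval_univ _ s this]
  obtain C where C: "\<And>x. jost ?p k (- x) = C * jost q k x" by auto
  have "C \<noteq> 0"
  proof
    assume "C = 0"
    then have "jost ?p k x = 0" for x using C[of "- x"] by simp
    then show False using jost_eventually_nonzero[OF p k0] by blast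
  qed
  then show ?thesis using C by blast
qed

lemma jost_half_line_L2:
  assumes q: "integrable lebesgue q" and k: "Im k > 0"
  shows "jost q k \<in> L2 {0..}"
  unfolding L2_def
proof (intro CollectI conjI)
  have k0: "Im k \<ge> 0" "k \<noteq> 0" using k by auto
  show "jost q k \<in> borel_measurable (lebesgue_on {0..})"
    using jost_measurable[OF q k0] by (rule measurable_restrict_space1)
  show "integrable (lebesgue_on {0..}) (\<lambda>x. (cmod (jost q k x))\<^sup>2)"
    using jost_square_integrable[OF q k] by (simp add: set_integrable_lebesgue_on)
qed

lemma L2_cmult: "y \<in> L2 S \<Longrightarrow> (\<lambda>x. c * y x) \<in> L2 S"
  unfolding L2_def by (auto simp: norm_mult power_mult_distrib)

lemma L2_half_line: "y \<in> L2 S \<Longrightarrow> S \<in> sets lebesgue \<Longrightarrow> {0..} \<subseteq> S \<Longrightarrow> set_integrable lebesgue {0..} (\<lambda>x. (cmod (y x))\<^sup>2)"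
  unfolding L2_def by (auto simp: set_integrable_lebesgue_on intro: set_integrable_subset)

text \<open>An eigenfunction violates the lower bound that the definition of the resolvent set
  demands.\<close>

lemma eigenvalue_in_spectrum:
  assumes T: "\<And>y f. (y, f) \<in> T \<Longrightarrow> y \<in> L2 S" and ev: "eigenvalue S T z"
  shows "z \<in> op_spectrum S T"
proof -
  obtain y where y: "(y, \<lambda>x. z * y x) \<in> T" "\<not> (AE x in lebesgue_on S. y x = 0)" using ev unfolding eigenvalue_def by blast
  have i: "integrable (lebesgue_on S) (\<lambda>x. (cmod (y x))\<^sup>2)" using T[OF y(1)] by (simp add: L2_def)
  have "z \<notin> resolvent_set S T"
  proof
    assume "z \<in> resolvent_set S T"
    then obtain C where C: "\<And>y f. (y, f) \<in> T \<Longrightarrow> L2_norm S y \<le> C * L2_norm S (\<lambda>x. f x - z * y x)"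
      unfolding resolvent_set_def by blast
    have "L2_norm S y \<le> C * L2_norm S (\<lambda>x. z * y x - z * y x)" by (rule C[OF y(1)])
    then have "L2_norm S y \<le> 0" by (simp add: L2_norm_def)
    moreover have "(\<integral>x. (cmod (y x))\<^sup>2 \<partial>lebesgue_on S) \<ge> 0" by (rule Bochner_Integration.integral_nonneg) simp
    ultimately have "(\<integral>x. (cmod (y x))\<^sup>2 \<partial>lebesgue_on S) = 0" unfolding L2_norm_def by simp
    then have "AE x in lebesgue_on S. (cmod (y x))\<^sup>2 = 0" using integral_nonneg_eq_0_iff_AE[OF i] by simp
    then have "AE x in lebesgue_on S. y x = 0" by (rule AE_mp) simp
    then show False using y(2) by blast
  qed
  then show ?thesis by (simp add: op_spectrum_def)
qed

text \<open>A square integrable solution is a multiple of the Jost solution on the half-line, so the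
  Dirichlet condition for it is a condition on the Jost solution at 0.\<close>

lemma T_plus_eigenvalue_iff:
  assumes q: "integrable lebesgue q" and \<kappa>: "\<kappa> > 0"
  shows "eigenvalue {0..} (T_plus q) (of_real (- \<kappa>\<^sup>2)) \<longleftrightarrow> jost q (\<i> * of_real \<kappa>) 0 = 0"
proof -
  define k where "k = \<i> * complex_of_real \<kappa>"
  have k: "Im k > 0" "Im k \<ge> 0" "k \<noteq> 0" using \<kappa> by (auto simp: k_def)
  have z: "complex_of_real (- \<kappa>\<^sup>2) = k\<^sup>2" by (simp add: k_def power_mult_distrib)
  have "eigenvalue {0..} (T_plus q) (k\<^sup>2) \<longleftrightarrow> jost q k 0 = 0"
  proof
    assume "eigenvalue {0..} (T_plus q) (k\<^sup>2)"
    then obtain y where y: "y \<in> L2 {0..}" "schroedinger_eq {0..} q y (\<lambda>x. k\<^sup>2 * y x)" "y 0 = 0"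
      and nz: "\<not> (AE x in lebesgue_on {0..}. y x = 0)"
      unfolding eigenvalue_def T_plus_def by blast
    obtain y1 where s: "solution {0..} q k y y1" using y(2) unfolding schroedinger_eq_iff_solution by blast
    have "y 0 * jost1 q k 0 - y1 0 * jost q k 0 = 0"
      by (rule wronskian_zero_of_L2[OF q k(2,3) s L2_half_line[OF y(1)]]) auto
    from solution_proportional_jost[OF q k(2,3) is_interval_ci order_refl s this]
    obtain C where C: "\<And>x. x \<ge> 0 \<Longrightarrow> y x = C * jost q k x" by auto
    have "C \<noteq> 0"
    proof
      assume "C = 0"
      then have "AE x in lebesgue_on {0..}. y x = 0" using C by (intro AE_I2) (simp add: space_restrict_space)
      then show False using nz by blast
    qed
    then show "jost q k 0 = 0" using C[of 0] y(3) by simp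
  next
    assume F: "jost q k 0 = 0"
    obtain X where X: "X \<ge> 0" "\<And>x. x \<ge> X \<Longrightarrow> jost q k x \<noteq> 0" using jost_eventually_nonzero[OF q k(2,3)] by blast
    have "schroedinger_eq {0..} q (jost q k) (\<lambda>x. k\<^sup>2 * jost q k x)"
      unfolding schroedinger_eq_iff_solution using solution_subset[OF solution_jost[OF q k(2,3)]] by blast
    then have "(jost q k, \<lambda>x. k\<^sup>2 * jost q k x) \<in> T_plus q"
      unfolding T_plus_def using F jost_half_line_L2[OF q k(1)] L2_cmult by auto
    moreover have "\<not> (AE x in lebesgue_on {0..}. jost q k x = 0)"
      by (rule not_AE_zero_of_half_line[of _ X]) (use X in auto)
    ultimately show "eigenvalue {0..} (T_plus q) (k\<^sup>2)" unfolding eigenvalue_def by blast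
  qed
  then show ?thesis unfolding z k_def .
qed

lemma measurable_uminus_lebesgue: "(\<lambda>x::real. - x) \<in> lebesgue \<rightarrow>\<^sub>M lebesgue"
  using lebesgue_affine_measurable[of "\<lambda>_. -1" "0::real"] by (simp add: Basis_real_def)

lemma L2_reflect:
  assumes S: "S \<in> sets lebesgue" and y: "y \<in> L2 S"
  shows "(\<lambda>x. y (- x)) \<in> L2 (uminus ` S)"
proof -
  have uS: "uminus ` S \<in> sets lebesgue"
  proof -
    have "uminus ` S = uminus -` S \<inter> space lebesgue" by (auto intro: image_eqI[of _ _ "- x" for x])
    then show ?thesis using measurable_sets[OF measurable_uminus_lebesgue S] by simp
  qed
  have y: "y \<in> borel_measurable (lebesgue_on S)" "set_integrable lebesgue S (\<lambda>x. (cmod (y x))\<^sup>2)"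
    using y S by (auto simp: L2_def set_integrable_lebesgue_on)
  have m0: "(\<lambda>x. indicat_real S x *\<^sub>R y x) \<in> borel_measurable lebesgue"
    using y(1) S by (simp add: borel_measurable_restrict_space_iff scaleR_conv_of_real mult.commute)
  have e: "indicat_real S (- x) = indicat_real (uminus ` S) x" for x :: real by (force simp: indicator_def)
  have "(\<lambda>x. indicat_real (uminus ` S) x *\<^sub>R y (- x)) \<in> borel_measurable lebesgue"
    using measurable_compose[OF measurable_uminus_lebesgue m0] by (simp add: e)
  then have 1: "(\<lambda>x. y (- x)) \<in> borel_measurable (lebesgue_on (uminus ` S))"
    using uS by (simp add: borel_measurable_restrict_space_iff scaleR_conv_of_real mult.commute)
  have "integrable lebesgue (\<lambda>x. indicat_real S (0 + -1 * x) *\<^sub>R (cmod (y (0 + -1 * x)))\<^sup>2)"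
    using lebesgue_integrable_real_affine[OF y(2)[unfolded set_integrable_def], of "-1" 0] by simp
  then have 2: "set_integrable lebesgue (uminus ` S) (\<lambda>x. (cmod (y (- x)))\<^sup>2)" unfolding set_integrable_def by (simp add: e)
  show ?thesis using 1 2 uS by (simp add: L2_def set_integrable_lebesgue_on)
qed

lemma AE_lebesgue_reflect:
  fixes P :: "real \<Rightarrow> bool"
  assumes "AE x in lebesgue. P x"
  shows "AE x in lebesgue. P (- x)"
proof -
  obtain N where N: "N \<in> null_sets lebesgue" "{x. \<not> P x} \<subseteq> N"
    using assms unfolding eventually_ae_filter by auto
  then have "negligible N" by (simp add: negligible_iff_null_sets)
  then have "negligible (uminus ` N)" 
    by (intro negligible_differentiable_image_negligible) (auto intro!: differentiable_on_minus differentiable_on_ident)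
  then have "uminus ` N \<in> null_sets lebesgue" by (simp add: negligible_iff_null_sets)
  moreover have "{x. \<not> P (- x)} \<subseteq> uminus ` N"
  proof
    fix x assume "x \<in> {x. \<not> P (- x)}"
    then have "- x \<in> N" using N(2) by auto
    then show "x \<in> uminus ` N" by (metis image_eqI minus_minus)
  qed
  ultimately show ?thesis unfolding eventually_ae_filter by auto
qed

lemma T_minus_eigenvalue_iff:
  assumes q: "integrable lebesgue q" and \<kappa>: "\<kappa> > 0"
  shows "eigenvalue {..0} (T_minus q) (of_real (- \<kappa>\<^sup>2)) \<longleftrightarrow> jost (\<lambda>x. q (- x)) (\<i> * of_real \<kappa>) 0 = 0"
proof -
  define k where "k = \<i> * complex_of_real \<kappa>"
  have z: "complex_of_real (- \<kappa>\<^sup>2) = k\<^sup>2" by (simp add: k_def power_mult_distrib)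
  have "eigenvalue {..0} (T_minus q) (k\<^sup>2) \<longleftrightarrow> eigenvalue {0..} (T_plus (\<lambda>x. q (- x))) (k\<^sup>2)"
  proof
    assume "eigenvalue {..0} (T_minus q) (k\<^sup>2)"
    then obtain y where y: "y \<in> L2 {..0}" "schroedinger_eq {..0} q y (\<lambda>x. k\<^sup>2 * y x)" "y 0 = 0"
      and nz: "\<not> (AE x in lebesgue_on {..0}. y x = 0)"
      unfolding eigenvalue_def T_minus_def by blast
    have l: "(\<lambda>x. y (- x)) \<in> L2 {0..}" using L2_reflect[OF _ y(1)] by simp
    have "\<not> (AE x in lebesgue_on {0..}. y (- x) = 0)"
    proof
      assume "AE x in lebesgue_on {0..}. y (- x) = 0"
      then have "AE x in lebesgue. x \<in> {0..} \<longrightarrow> y (- x) = 0" by (simp add: AE_restrict_space_iff)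
      from AE_lebesgue_reflect[OF this] have "AE x in lebesgue_on {..0}. y x = 0" by (simp add: AE_restrict_space_iff)
      then show False using nz by blast
    qed
    moreover have "((\<lambda>x. y (- x)), (\<lambda>x. k\<^sup>2 * y (- x))) \<in> T_plus (\<lambda>x. q (- x))"
      unfolding T_plus_def using l L2_cmult[OF l] schroedinger_eq_reflect[OF y(2)] y(3) by auto
    ultimately show "eigenvalue {0..} (T_plus (\<lambda>x. q (- x))) (k\<^sup>2)" unfolding eigenvalue_def by blast
  next
    assume "eigenvalue {0..} (T_plus (\<lambda>x. q (- x))) (k\<^sup>2)"
    then obtain y where y: "y \<in> L2 {0..}" "schroedinger_eq {0..} (\<lambda>x. q (- x)) y (\<lambda>x. k\<^sup>2 * y x)" "y 0 = 0"
      and nz: "\<not> (AE x in lebesgue_on {0..}. y x = 0)"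
      unfolding eigenvalue_def T_plus_def by blast
    have l: "(\<lambda>x. y (- x)) \<in> L2 {..0}" using L2_reflect[OF _ y(1)] by simp
    have "\<not> (AE x in lebesgue_on {..0}. y (- x) = 0)"
    proof
      assume "AE x in lebesgue_on {..0}. y (- x) = 0"
      then have "AE x in lebesgue. x \<in> {..0} \<longrightarrow> y (- x) = 0" by (simp add: AE_restrict_space_iff)
      from AE_lebesgue_reflect[OF this] have "AE x in lebesgue_on {0..}. y x = 0" by (simp add: AE_restrict_space_iff)
      then show False using nz by blast
    qed
    moreover have "((\<lambda>x. y (- x)), (\<lambda>x. k\<^sup>2 * y (- x))) \<in> T_minus q"
      unfolding T_minus_def using l L2_cmult[OF l] schroedinger_eq_reflect[OF y(2)] y(3) by auto
    ultimately show "eigenvalue {..0} (T_minus q) (k\<^sup>2)" unfolding eigenvalue_def by blast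
  qed
  also have "\<dots> \<longleftrightarrow> jost (\<lambda>x. q (- x)) k 0 = 0"
    using T_plus_eigenvalue_iff[OF integrable_reflect_lebesgue[OF q] \<kappa>] unfolding z k_def[symmetric] by simp
  finally show ?thesis unfolding z k_def .
qed

text \<open>Square integrability at both ends makes a solution proportional to the right and to the
  left Jost solution, so their Wronskian vanishes; conversely, if the two are proportional, the
  right one is square integrable on each half-line.\<close>

lemma T_op_eigenvalue_iff:
  assumes q: "integrable lebesgue q" and \<kappa>: "\<kappa> > 0"
  shows "eigenvalue UNIV (T_op q) (of_real (- \<kappa>\<^sup>2)) \<longleftrightarrow> wronskian_coeff q (\<lambda>x. q (- x)) (\<i> * of_real \<kappa>) = 0"
proof -
  let ?p = "\<lambda>x. q (- x)"
  define k where "k = \<i> * complex_of_real \<kappa>"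
  have p: "integrable lebesgue ?p" by (rule integrable_reflect_lebesgue[OF q])
  have k: "Im k > 0" "Im k \<ge> 0" "k \<noteq> 0" using \<kappa> by (auto simp: k_def)
  have z: "complex_of_real (- \<kappa>\<^sup>2) = k\<^sup>2" by (simp add: k_def power_mult_distrib)
  have w: "wronskian_coeff q ?p k = 0 \<longleftrightarrow> jost q k 0 * jost1 ?p k 0 + jost1 q k 0 * jost ?p k 0 = 0"
    using k by (simp add: wronskian_coeff_def)
  have "eigenvalue UNIV (T_op q) (k\<^sup>2) \<longleftrightarrow> wronskian_coeff q ?p k = 0"
    unfolding w
  proof
    assume "eigenvalue UNIV (T_op q) (k\<^sup>2)"
    then obtain y where y: "y \<in> L2 UNIV" "schroedinger_eq UNIV q y (\<lambda>x. k\<^sup>2 * y x)"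
      and nz: "\<not> (AE x in lebesgue_on UNIV. y x = 0)"
      unfolding eigenvalue_def T_op_def by blast
    obtain y1 where s: "solution UNIV q k y y1" using y(2) unfolding schroedinger_eq_iff_solution by blast
    have i: "integrable lebesgue (\<lambda>x. (cmod (y x))\<^sup>2)" using y(1) unfolding L2_def lebesgue_on_UNIV_eq by blast
    have ir: "integrable lebesgue (\<lambda>x. (cmod (y (- x)))\<^sup>2)" by (rule integrable_reflect_lebesgue[OF i])
    have "y 0 * jost1 q k 0 - y1 0 * jost q k 0 = 0"
      by (rule wronskian_zero_of_L2[OF q k(2,3) solution_subset[OF s] set_integrable_UNIV_subset[OF i]]) auto
    from solution_proportional_jost[OF q k(2,3) is_interval_univ _ s this]
    obtain C where C: "\<And>x. y x = C * jost q k x" "\<And>x. y1 x = C * jost1 q k x" by auto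
    have sr: "solution UNIV ?p k (\<lambda>x. y (- x)) (\<lambda>x. - y1 (- x))" using solution_reflect[OF s] by simp
    have "y (- 0) * jost1 ?p k 0 - (- y1 (- 0)) * jost ?p k 0 = 0"
      by (rule wronskian_zero_of_L2[OF p k(2,3) solution_subset[OF sr] set_integrable_UNIV_subset[OF ir]]) auto
    then have "C * (jost q k 0 * jost1 ?p k 0 + jost1 q k 0 * jost ?p k 0) = 0"
      using C[of 0] by (simp add: algebra_simps)
    moreover have "C \<noteq> 0"
    proof
      assume "C = 0"
      then have "AE x in lebesgue_on UNIV. y x = 0" using C by simp
      then show False using nz by blast
    qed
    ultimately show "jost q k 0 * jost1 ?p k 0 + jost1 q k 0 * jost ?p k 0 = 0" by simp
  next
    assume W: "jost q k 0 * jost1 ?p k 0 + jost1 q k 0 * jost ?p k 0 = 0"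
    from jost_reflect_eq[OF q k(1) W] obtain C where C: "C \<noteq> 0" "\<And>x. jost ?p k (- x) = C * jost q k x" by blast
    have i: "integrable lebesgue (\<lambda>x. (cmod (jost q k x))\<^sup>2)"
    proof -
      have i1: "set_integrable lebesgue {0..} (\<lambda>x. (cmod (jost q k x))\<^sup>2)" by (rule jost_square_integrable[OF q k(1)])
      have "integrable lebesgue (\<lambda>x. indicat_real {0..} (- x) *\<^sub>R (cmod (jost ?p k (- x)))\<^sup>2)"
        using integrable_reflect_lebesgue[OF jost_square_integrable[OF p k(1), of 0, unfolded set_integrable_def]] .
      moreover have "indicat_real {0..} (- x) *\<^sub>R (cmod (jost ?p k (- x)))\<^sup>2 = (cmod C)\<^sup>2 * (indicat_real {..0} x *\<^sub>R (cmod (jost q k x))\<^sup>2)" for x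
        unfolding C(2) by (simp add: indicator_def norm_mult power_mult_distrib)
      ultimately have "set_integrable lebesgue {..0} (\<lambda>x. (cmod (jost q k x))\<^sup>2)"
        unfolding set_integrable_def using C(1) by simp
      from set_integrable_Un[OF this i1] have "set_integrable lebesgue ({..0} \<union> {0..}) (\<lambda>x. (cmod (jost q k x))\<^sup>2)" by simp
      moreover have "{..0} \<union> {0..} = (UNIV :: real set)" by auto
      ultimately show ?thesis by (simp add: set_integrable_def)
    qed
    have l: "jost q k \<in> L2 UNIV" using i jost_measurable[OF q k(2,3)] unfolding L2_def lebesgue_on_UNIV_eq by blast
    obtain X where X: "X \<ge> 0" "\<And>x. x \<ge> X \<Longrightarrow> jost q k x \<noteq> 0" using jost_eventually_nonzero[OF q k(2,3)] by blast
    have "schroedinger_eq UNIV q (jost q k) (\<lambda>x. k\<^sup>2 * jost q k x)"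
      unfolding schroedinger_eq_iff_solution using solution_jost[OF q k(2,3)] by blast
    then have "(jost q k, \<lambda>x. k\<^sup>2 * jost q k x) \<in> T_op q" unfolding T_op_def using l L2_cmult by auto
    moreover have "\<not> (AE x in lebesgue_on UNIV. jost q k x = 0)"
      by (rule not_AE_zero_of_half_line[of _ X]) (use X in auto)
    ultimately show "eigenvalue UNIV (T_op q) (k\<^sup>2)" unfolding eigenvalue_def by blast
  qed
  then show ?thesis unfolding z k_def .
qed

section \<open>Eigenvalues of the direct sum\<close>

lemma T_prime_eigenvalueD:
  assumes "eigenvalue UNIV (T_prime q) z"
  shows "eigenvalue {0..} (T_plus q) z \<or> eigenvalue {..0} (T_minus q) z"
proof (rule ccontr)
  assume n: "\<not> ?thesis"
  obtain y where y: "(y, \<lambda>x. z * y x) \<in> T_minus q" "(y, \<lambda>x. z * y x) \<in> T_plus q"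
    "\<not> (AE x in lebesgue_on UNIV. y x = 0)"
    using assms unfolding eigenvalue_def T_prime_def by blast
  have "AE x in lebesgue_on {0..}. y x = 0" "AE x in lebesgue_on {..0}. y x = 0"
    using n y unfolding eigenvalue_def by blast+
  then have "AE x in lebesgue. x \<in> {0..} \<longrightarrow> y x = 0" "AE x in lebesgue. x \<in> {..0} \<longrightarrow> y x = 0"
    by (simp_all add: AE_restrict_space_iff)
  then have "AE x in lebesgue. y x = 0"
    by eventually_elim (metis atLeast_iff atMost_iff linear)
  then show False using y(3) unfolding lebesgue_on_UNIV_eq by blast
qed

lemma schroedinger_eq_zero:
  assumes S: "is_interval S" and y: "\<And>x. x \<in> S \<Longrightarrow> y x = 0"
  shows "schroedinger_eq S q y (\<lambda>x. z * y x)"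
proof -
  have z: "loc_ac_deriv S g h" if g: "\<And>x. x \<in> S \<Longrightarrow> g x = 0" and h: "\<And>x. x \<in> S \<Longrightarrow> h x = 0" for g h
    unfolding loc_ac_deriv_def
  proof (intro ballI impI)
    fix a b assume ab: "a \<in> S" "b \<in> S" "a \<le> b"
    have sub: "h x = 0" if "x \<in> {a..b}" for x
      using that ab S h unfolding is_interval_1 by (metis atLeastAtMost_iff)
    have "h absolutely_integrable_on {a..b} \<longleftrightarrow> (\<lambda>x. 0::complex) absolutely_integrable_on {a..b}"
      by (rule set_integrable_cong) (use sub in auto)
    moreover have "integral {a..b} h = integral {a..b} (\<lambda>x. 0)"
      by (rule integral_cong) (use sub in auto)
    ultimately show "h absolutely_integrable_on {a..b} \<and> g b - g a = integral {a..b} h"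
      using g ab by (simp add: set_integrable_def)
  qed
  show ?thesis unfolding schroedinger_eq_def
    by (intro exI[of _ "\<lambda>x. 0"] conjI z) (use y in auto)
qed

lemma schroedinger_eq_cong:
  assumes S: "is_interval S" and y: "\<And>x. x \<in> S \<Longrightarrow> y x = w x"
    and eq: "schroedinger_eq S q y (\<lambda>x. z * y x)"
  shows "schroedinger_eq S q w (\<lambda>x. z * w x)"
proof -
  have cong: "loc_ac_deriv S g' h'" if l: "loc_ac_deriv S g h" and g: "\<And>x. x \<in> S \<Longrightarrow> g x = g' x" and h: "\<And>x. x \<in> S \<Longrightarrow> h x = h' x" for g h g' h'
    unfolding loc_ac_deriv_def
  proof (intro ballI impI)
    fix a b assume ab: "a \<in> S" "b \<in> S" "a \<le> b"
    have sub: "h x = h' x" if "x \<in> {a..b}" for x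
      using that ab S h unfolding is_interval_1 by (metis atLeastAtMost_iff)
    have "h absolutely_integrable_on {a..b} \<longleftrightarrow> h' absolutely_integrable_on {a..b}"
      by (rule set_integrable_cong) (use sub in auto)
    moreover have "integral {a..b} h = integral {a..b} h'"
      by (rule integral_cong) (use sub in auto)
    ultimately show "h' absolutely_integrable_on {a..b} \<and> g' b - g' a = integral {a..b} h'"
      using g ab l unfolding loc_ac_deriv_def by metis
  qed
  obtain y1 where "loc_ac_deriv S y y1" "loc_ac_deriv S y1 (\<lambda>x. complex_of_real (q x) * y x - z * y x)"
    using eq unfolding schroedinger_eq_def by blast
  then show ?thesis unfolding schroedinger_eq_def
    by (intro exI[of _ y1] conjI) (erule cong; use y in auto)+
qed

lemma L2_cong:
  assumes "\<And>x. x \<in> S \<Longrightarrow> y x = w x" and "y \<in> L2 S"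
  shows "w \<in> L2 S"
proof -
  have "w \<in> borel_measurable (lebesgue_on S) \<longleftrightarrow> y \<in> borel_measurable (lebesgue_on S)"
    by (rule measurable_cong) (use assms(1) in auto)
  moreover have "integrable (lebesgue_on S) (\<lambda>x. (cmod (w x))\<^sup>2) \<longleftrightarrow> integrable (lebesgue_on S) (\<lambda>x. (cmod (y x))\<^sup>2)"
    by (rule Bochner_Integration.integrable_cong) (use assms(1) in auto)
  ultimately show ?thesis using assms(2) by (simp add: L2_def)
qed

lemma L2_Un_half_lines:
  assumes "y \<in> L2 {..0}" "y \<in> L2 {0..}"
  shows "y \<in> L2 UNIV"
proof -
  have y: "y \<in> borel_measurable (lebesgue_on {..0})" "set_integrable lebesgue {..0} (\<lambda>x. (cmod (y x))\<^sup>2)"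
    "y \<in> borel_measurable (lebesgue_on {0..})" "set_integrable lebesgue {0..} (\<lambda>x. (cmod (y x))\<^sup>2)"
    using assms by (auto simp: L2_def set_integrable_lebesgue_on)
  have U: "{..0} \<union> {0..} = (UNIV :: real set)" by auto
  have m: "(\<lambda>x. indicat_real {..0} x *\<^sub>R y x) \<in> borel_measurable lebesgue" "(\<lambda>x. indicat_real {0..} x *\<^sub>R y x) \<in> borel_measurable lebesgue"
    using y(1,3) by (simp_all add: borel_measurable_restrict_space_iff scaleR_conv_of_real mult.commute)
  have "(\<lambda>x. if x \<in> {..0} then indicat_real {..0} x *\<^sub>R y x else indicat_real {0..} x *\<^sub>R y x) \<in> borel_measurable lebesgue"
    by (rule measurable_If_set[OF m]) simp
  also have "(\<lambda>x. if x \<in> {..0} then indicat_real {..0} x *\<^sub>R y x else indicat_real {0..} x *\<^sub>R y x) = y" by (auto simp: fun_eq_iff)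
  finally have "y \<in> borel_measurable lebesgue" .
  moreover have "integrable lebesgue (\<lambda>x. (cmod (y x))\<^sup>2)"
    using set_integrable_Un[OF y(2,4)] unfolding U by (simp add: set_integrable_def)
  ultimately show ?thesis unfolding L2_def lebesgue_on_UNIV_eq by blast
qed

lemma L2_zero: "(\<lambda>x. 0) \<in> L2 S"
  by (simp add: L2_def)

text \<open>A half-line eigenfunction is extended by zero. The Dirichlet condition makes the two
  pieces fit at 0, and no condition on the derivative has to be met, as each half-line has its own
  witness for it.\<close>

lemma T_prime_eigenvalueI:
  assumes "eigenvalue {0..} (T_plus q) z \<or> eigenvalue {..0} (T_minus q) z"
  shows "eigenvalue UNIV (T_prime q) z"
proof -
  have zero: "(w, \<lambda>x. z * w x) \<in> T" if w: "\<And>x. x \<in> S \<Longrightarrow> w x = 0" and S: "is_interval S" "0 \<in> S"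
    and T: "T = {(y, f). y \<in> L2 S \<and> f \<in> L2 S \<and> schroedinger_eq S q y f \<and> y 0 = 0}" for w S T
  proof -
    have "w \<in> L2 S" by (rule L2_cong[OF _ L2_zero]) (simp add: w)
    moreover from this have "(\<lambda>x. z * w x) \<in> L2 S" by (rule L2_cmult)
    moreover have "schroedinger_eq S q w (\<lambda>x. z * w x)" by (rule schroedinger_eq_zero[OF S(1) w])
    ultimately show ?thesis unfolding T using w[OF S(2)] by blast
  qed
  have ext: "(w, \<lambda>x. z * w x) \<in> T" if w: "\<And>x. x \<in> S \<Longrightarrow> y x = w x" and S: "is_interval S" "0 \<in> S"
    and T: "T = {(y, f). y \<in> L2 S \<and> f \<in> L2 S \<and> schroedinger_eq S q y f \<and> y 0 = 0}"
    and y: "(y, \<lambda>x. z * y x) \<in> T" for w y S T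
  proof -
    have y': "y \<in> L2 S" "(\<lambda>x. z * y x) \<in> L2 S" "schroedinger_eq S q y (\<lambda>x. z * y x)" "y 0 = 0"
      using y unfolding T by auto
    have "w \<in> L2 S" by (rule L2_cong[OF w y'(1)])
    moreover from this have "(\<lambda>x. z * w x) \<in> L2 S" by (rule L2_cmult)
    moreover have "schroedinger_eq S q w (\<lambda>x. z * w x)" by (rule schroedinger_eq_cong[OF S(1) w y'(3)])
    moreover have "w 0 = 0" using w[OF S(2)] y'(4) by metis
    ultimately show ?thesis unfolding T by blast
  qed
  from assms show ?thesis
  proof
    assume "eigenvalue {0..} (T_plus q) z"
    then obtain y where y: "(y, \<lambda>x. z * y x) \<in> T_plus q" and nz: "\<not> (AE x in lebesgue_on {0..}. y x = 0)"
      unfolding eigenvalue_def by blast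
    have y0: "y 0 = 0" using y unfolding T_plus_def by blast
    define w where "w = (\<lambda>x. if x \<ge> 0 then y x else 0)"
    have 1: "(w, \<lambda>x. z * w x) \<in> T_plus q"
      by (rule ext[OF _ _ _ T_plus_def y]) (auto simp: w_def is_interval_ci)
    have 2: "(w, \<lambda>x. z * w x) \<in> T_minus q"
      by (rule zero[OF _ _ _ T_minus_def]) (auto simp: w_def is_interval_ic y0)
    have "\<not> (AE x in lebesgue_on UNIV. w x = 0)"
    proof
      assume "AE x in lebesgue_on UNIV. w x = 0"
      then have "AE x in lebesgue. w x = 0" unfolding lebesgue_on_UNIV_eq .
      then have "AE x in lebesgue. x \<in> {0..} \<longrightarrow> y x = 0" by eventually_elim (auto simp: w_def)
      then show False using nz by (simp add: AE_restrict_space_iff)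
    qed
    then show ?thesis using 1 2 unfolding eigenvalue_def T_prime_def by blast
  next
    assume "eigenvalue {..0} (T_minus q) z"
    then obtain y where y: "(y, \<lambda>x. z * y x) \<in> T_minus q" and nz: "\<not> (AE x in lebesgue_on {..0}. y x = 0)"
      unfolding eigenvalue_def by blast
    have y0: "y 0 = 0" using y unfolding T_minus_def by blast
    define w where "w = (\<lambda>x. if x \<le> 0 then y x else 0)"
    have 1: "(w, \<lambda>x. z * w x) \<in> T_minus q"
      by (rule ext[OF _ _ _ T_minus_def y]) (auto simp: w_def is_interval_ic)
    have 2: "(w, \<lambda>x. z * w x) \<in> T_plus q"
      by (rule zero[OF _ _ _ T_plus_def]) (auto simp: w_def is_interval_ci y0)
    have "\<not> (AE x in lebesgue_on UNIV. w x = 0)"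
    proof
      assume "AE x in lebesgue_on UNIV. w x = 0"
      then have "AE x in lebesgue. w x = 0" unfolding lebesgue_on_UNIV_eq .
      then have "AE x in lebesgue. x \<in> {..0} \<longrightarrow> y x = 0" by eventually_elim (auto simp: w_def)
      then show False using nz by (simp add: AE_restrict_space_iff)
    qed
    then show ?thesis using 1 2 unfolding eigenvalue_def T_prime_def by blast
  qed
qed

lemma T_prime_eigenvalue_iff:
  "eigenvalue UNIV (T_prime q) z \<longleftrightarrow> eigenvalue {0..} (T_plus q) z \<or> eigenvalue {..0} (T_minus q) z"
  using T_prime_eigenvalueD T_prime_eigenvalueI by blast

section \<open>Scattering\<close>

lemma solution_uminus_freq: "solution S q (- k) y y1 \<longleftrightarrow> solution S q k y y1"
  by (simp add: solution_def)

text \<open>For real \<open>k\<close> the conjugate of a solution solves the same equation, so this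
  Wronskian is constant in \<open>x\<close> and can be evaluated at infinity, where the solution
  behaves like exp(ikx).\<close>

lemma jost_real_wronskian:
  assumes q: "integrable lebesgue q" and k: "k \<noteq> (0::real)"
  shows "jost q (of_real k) 0 * cnj (jost1 q (of_real k) 0) - jost1 q (of_real k) 0 * cnj (jost q (of_real k) 0) = - 2 * \<i> * of_real k"
proof -
  let ?k = "complex_of_real k"
  let ?f = "jost q ?k" and ?f1 = "jost1 q ?k"
  have k0: "Im ?k \<ge> 0" "?k \<noteq> 0" using k by auto
  have s: "solution UNIV q ?k ?f ?f1" by (rule solution_jost[OF q k0])
  have sc: "solution UNIV q ?k (\<lambda>x. cnj (?f x)) (\<lambda>x. cnj (?f1 x))"
    using solution_cnj[OF s] solution_uminus_freq[of UNIV q ?k "\<lambda>x. cnj (?f x)" "\<lambda>x. cnj (?f1 x)"] by simp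
  have e: "exp (- \<i> * ?k * of_real x) * cnj (exp (- \<i> * ?k * of_real x)) = 1" for x
  proof -
    have "cnj (exp (- \<i> * ?k * of_real x)) = exp (- (- \<i> * ?k * of_real x))" unfolding exp_cnj by simp
    then show ?thesis by (simp only: exp_minus_inverse)
  qed
  have "((\<lambda>x. (exp (- \<i> * ?k * of_real x) * ?f x) * cnj (exp (- \<i> * ?k * of_real x) * ?f1 x)
      - (exp (- \<i> * ?k * of_real x) * ?f1 x) * cnj (exp (- \<i> * ?k * of_real x) * ?f x)) \<longlongrightarrow> 1 * cnj (\<i> * ?k) - \<i> * ?k * cnj 1) at_top"
    by (intro tendsto_diff tendsto_mult lim_cnj[THEN iffD2] jost_asymp(4)[OF q k0] jost_asymp(5)[OF q k0])
  moreover have "(exp (- \<i> * ?k * of_real x) * ?f x) * cnj (exp (- \<i> * ?k * of_real x) * ?f1 x)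
      - (exp (- \<i> * ?k * of_real x) * ?f1 x) * cnj (exp (- \<i> * ?k * of_real x) * ?f x)
      = ?f 0 * cnj (?f1 0) - ?f1 0 * cnj (?f 0)" (is "?l = _") for x
  proof -
    have "?l = (exp (- \<i> * ?k * of_real x) * cnj (exp (- \<i> * ?k * of_real x))) * (?f x * cnj (?f1 x) - ?f1 x * cnj (?f x))"
      unfolding complex_cnj_mult by (simp only: algebra_simps)
    also have "\<dots> = ?f x * cnj (?f1 x) - ?f1 x * cnj (?f x)" unfolding e by simp
    also have "\<dots> = ?f 0 * cnj (?f1 0) - ?f1 0 * cnj (?f 0)" by (rule wronskian_const[OF s sc is_interval_univ]) auto
    finally show ?thesis .
  qed
  ultimately have "((\<lambda>x::real. ?f 0 * cnj (?f1 0) - ?f1 0 * cnj (?f 0)) \<longlongrightarrow> 1 * cnj (\<i> * ?k) - \<i> * ?k * cnj 1) at_top" by simp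
  from tendsto_unique[OF trivial_limit_at_top_linorder tendsto_const this] show ?thesis by simp
qed

lemma jost_real_nonzero:
  assumes q: "integrable lebesgue q" and k: "k \<noteq> (0::real)"
  shows "jost q (of_real k) 0 \<noteq> 0"
  using jost_real_wronskian[OF q k] k by auto

lemma solution_zero_deriv:
  assumes s: "solution UNIV q k y y1" and z: "\<And>x. y x = 0"
  shows "y1 x = 0"
proof -
  have l: "loc_ac_deriv UNIV y y1" using s unfolding solution_def by blast
  have "(y has_vector_derivative y1 x) (at x within {x..x + 1})"
    by (rule loc_ac_has_vector_derivative[OF l solution_continuous(2)[OF s]]) auto
  moreover have "y = (\<lambda>x. 0)" using z by auto
  ultimately have "((\<lambda>x. 0::complex) has_vector_derivative y1 x) (at x within {x..x + 1})" by simp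
  moreover have "((\<lambda>x. 0::complex) has_vector_derivative 0) (at x within {x..x + 1})" by simp
  ultimately show ?thesis
    using vector_derivative_unique_within_closed_interval[of x "x + 1" x "\<lambda>x. 0::complex" "y1 x" 0] by simp
qed

text \<open>The coefficients are computed by Cramer's rule from the Cauchy data at 0, the
  determinant being the Wronskian \<open>- 2ik\<close>. Existence and uniqueness of the pair are
  both proved, since the coefficients are introduced by a definite description.\<close>

lemma scattering_coeffs_at_0:
  assumes q: "integrable lebesgue q" and k: "k \<noteq> (0::real)"
  defines "F \<equiv> jost q (of_real k) 0" and "F1 \<equiv> jost1 q (of_real k) 0"
    and "G \<equiv> jost (\<lambda>x. q (- x)) (of_real k) 0" and "G1 \<equiv> jost1 (\<lambda>x. q (- x)) (of_real k) 0"
  shows "F = a_coeff q k * cnj G + b_coeff q k * G" "F1 = - a_coeff q k * cnj G1 - b_coeff q k * G1"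
proof -
  let ?k = "complex_of_real k" and ?p = "\<lambda>x. q (- x)"
  have p: "integrable lebesgue ?p" by (rule integrable_reflect_lebesgue[OF q])
  have k0: "Im ?k \<ge> 0" "?k \<noteq> 0" using k by auto
  define g g1 where "g = (\<lambda>x. jost ?p ?k (- x))" and "g1 = (\<lambda>x. - jost1 ?p ?k (- x))"
  have s: "solution UNIV q ?k (jost q ?k) (jost1 q ?k)" by (rule solution_jost[OF q k0])
  have sg: "solution UNIV q ?k g g1"
    unfolding g_def g1_def using solution_reflect[OF solution_jost[OF p k0]] by simp
  have sc: "solution UNIV q ?k (\<lambda>x. cnj (g x)) (\<lambda>x. cnj (g1 x))"
    using solution_cnj[OF sg] solution_uminus_freq[of UNIV q ?k "\<lambda>x. cnj (g x)" "\<lambda>x. cnj (g1 x)"] by simp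
  have W: "G * cnj G1 - G1 * cnj G = - 2 * \<i> * ?k" unfolding G_def G1_def by (rule jost_real_wronskian[OF p k])
  have g0: "g 0 = G" "g1 0 = - G1" by (simp_all add: g_def g1_def G_def G1_def)
  define a b where "a = (F * G1 + F1 * G) / (2 * \<i> * ?k)" and "b = (F * cnj G1 + F1 * cnj G) / (- 2 * \<i> * ?k)"
  have det: "F = a * cnj G + b * G" "F1 = - a * cnj G1 - b * G1"
  proof -
    have D: "2 * \<i> * ?k \<noteq> 0" "2 * \<i> * ?k = G1 * cnj G - G * cnj G1" using W k by (auto simp: algebra_simps)
    have ab: "2 * \<i> * ?k * a = F * G1 + F1 * G" "2 * \<i> * ?k * b = - (F * cnj G1 + F1 * cnj G)"
      using k by (simp_all add: a_def b_def)
    have "2 * \<i> * ?k * (a * cnj G + b * G) = (2 * \<i> * ?k * a) * cnj G + (2 * \<i> * ?k * b) * G" by (simp add: algebra_simps)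
    also have "\<dots> = 2 * \<i> * ?k * F" unfolding ab unfolding D(2) by (simp add: algebra_simps)
    finally show "F = a * cnj G + b * G" unfolding mult_cancel_left using D(1) by metis
    have "2 * \<i> * ?k * (- a * cnj G1 - b * G1) = - (2 * \<i> * ?k * a) * cnj G1 - (2 * \<i> * ?k * b) * G1" by (simp add: algebra_simps)
    also have "\<dots> = 2 * \<i> * ?k * F1" unfolding ab unfolding D(2) by (simp add: algebra_simps)
    finally show "F1 = - a * cnj G1 - b * G1" unfolding mult_cancel_left using D(1) by metis
  qed
  have sol: "jost q ?k x = a * cnj (g x) + b * g x" for x
  proof -
    have "solution UNIV q ?k (\<lambda>x. 1 * jost q ?k x + (-1) * (a * cnj (g x) + b * g x)) (\<lambda>x. 1 * jost1 q ?k x + (-1) * (a * cnj (g1 x) + b * g1 x))"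
      by (intro solution_lincomb s sg sc)
    from solution_unique[OF this q is_interval_univ, of 0 x] have "1 * jost q ?k x + (-1) * (a * cnj (g x) + b * g x) = 0"
      unfolding g0 F_def[symmetric] F1_def[symmetric] by (simp add: det)
    then show ?thesis by (simp add: algebra_simps)
  qed
  have uniq: "a' = a \<and> b' = b" if e: "\<And>x. jost q ?k x = a' * cnj (g x) + b' * g x" for a' b'
  proof -
    let ?u = "a' - a" and ?v = "b' - b"
    have s': "solution UNIV q ?k (\<lambda>x. ?u * cnj (g x) + ?v * g x) (\<lambda>x. ?u * cnj (g1 x) + ?v * g1 x)"
      by (intro solution_lincomb sg sc)
    have z: "?u * cnj (g x) + ?v * g x = 0" for x
    proof -
      have "a' * cnj (g x) + b' * g x = a * cnj (g x) + b * g x" using e[of x] sol[of x] by metis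
      then show ?thesis by (simp add: algebra_simps)
    qed
    have 1: "?u * cnj G + ?v * G = 0" using z[of 0] unfolding g0 .
    have 2: "?u * cnj G1 + ?v * G1 = 0" using solution_zero_deriv[OF s' z, of 0] unfolding g0 by (simp add: algebra_simps)
    have "?u * (G * cnj G1 - G1 * cnj G) = (?u * cnj G1 + ?v * G1) * G - (?u * cnj G + ?v * G) * G1" by (simp add: algebra_simps)
    then have "?u = 0" unfolding 1 2 W using k by simp
    moreover have "?v * (G * cnj G1 - G1 * cnj G) = (?u * cnj G + ?v * G) * cnj G1 - (?u * cnj G1 + ?v * G1) * cnj G" by (simp add: algebra_simps)
    then have "?v = 0" unfolding 1 2 W using k by simp
    ultimately show ?thesis by simp
  qed
  \<comment> \<open>With \<open>g\<close> the reflected right solution of the reflected potential,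
    the left Jost solution at \<open>- k\<close> is \<open>g\<close> itself and the one at
    \<open>k\<close> its conjugate.\<close>
  have jm: "jost_minus q ?k x = cnj (g x)" "jost_minus q (of_real (- k)) x = g x" for x
    using jost_minus_eq[OF q, of ?k] jost_minus_eq[OF q, of "- ?k"] jost_cnj(1)[OF p k0, of "- x"] k by (simp_all add: g_def)
  have "scattering_coeffs q k = (a, b)"
    unfolding scattering_coeffs_def jost_plus_eq(2)[OF q k0] jm
  proof (rule the_equality)
    show "case (a, b) of (a, b) \<Rightarrow> \<forall>x. jost q ?k x = a * cnj (g x) + b * g x" using sol by simp
    fix c assume "case c of (a, b) \<Rightarrow> \<forall>x. jost q ?k x = a * cnj (g x) + b * g x"
    then have "\<And>x. jost q ?k x = fst c * cnj (g x) + snd c * g x" by (simp add: case_prod_unfold)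
    from uniq[OF this] show "c = (a, b)" by (simp add: prod_eq_iff)
  qed
  then show "F = a_coeff q k * cnj G + b_coeff q k * G" "F1 = - a_coeff q k * cnj G1 - b_coeff q k * G1"
    using det by (simp_all add: a_coeff_def b_coeff_def)
qed

lemma reflectionless_on_real:
  assumes q: "integrable lebesgue q" and k: "k \<noteq> (0::real)" and r: "r_minus q k = 0"
  shows "cmod (jost q (of_real k) 0) = cmod (jost (\<lambda>x. q (- x)) (of_real k) 0)"
    and "cmod (wronskian_coeff q (\<lambda>x. q (- x)) (of_real k)) = 1"
proof -
  let ?k = "complex_of_real k" and ?p = "\<lambda>x. q (- x)"
  have p: "integrable lebesgue ?p" by (rule integrable_reflect_lebesgue[OF q])
  define F F1 G G1 a b where d: "F = jost q ?k 0" "F1 = jost1 q ?k 0" "G = jost ?p ?k 0" "G1 = jost1 ?p ?k 0"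
    "a = a_coeff q k" "b = b_coeff q k"
  have e: "F = a * cnj G + b * G" "F1 = - a * cnj G1 - b * G1"
    unfolding d by (rule scattering_coeffs_at_0[OF q k])+
  have WF: "F * cnj F1 - F1 * cnj F = - 2 * \<i> * ?k" unfolding d by (rule jost_real_wronskian[OF q k])
  have WG: "G * cnj G1 - G1 * cnj G = - 2 * \<i> * ?k" unfolding d by (rule jost_real_wronskian[OF p k])
  have "F * cnj F1 - F1 * cnj F = (a * cnj a - b * cnj b) * (G * cnj G1 - G1 * cnj G)"
    unfolding e by (simp add: algebra_simps)
  then have "a * cnj a - b * cnj b = 1" unfolding WF WG using k by simp
  then have ab: "complex_of_real ((cmod a)\<^sup>2 - (cmod b)\<^sup>2) = 1" by (simp add: complex_mult_cnj cmod_power2)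
  then have ab: "(cmod a)\<^sup>2 - (cmod b)\<^sup>2 = 1" by (metis of_real_eq_1_iff)
  \<comment> \<open>Since division by zero yields 0, a vanishing reflection coefficient could also
    come from \<open>a = 0\<close>; the relation \<open>|a|^2 - |b|^2 = 1\<close> excludes
    this.\<close>
  have b0: "b = 0"
  proof (rule ccontr)
    assume "b \<noteq> 0"
    then have "a = 0" using r by (simp add: r_minus_def d)
    then show False using ab zero_le_power2[of "cmod b"] by simp
  qed
  then have a1: "cmod a = 1" using ab by (simp add: power2_eq_1_iff) (metis norm_ge_zero order.trans neg_0_le_iff_le not_one_le_zero)
  show "cmod (jost q ?k 0) = cmod (jost ?p ?k 0)"
    unfolding d[symmetric] e(1) b0 using a1 by (simp add: norm_mult)
  have "F * G1 + F1 * G = - a * (G * cnj G1 - G1 * cnj G)" unfolding e b0 by (simp add: algebra_simps)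
  then have "wronskian_coeff q ?p ?k = a" unfolding wronskian_coeff_def d[symmetric] WG using k by simp
  then show "cmod (wronskian_coeff q ?p ?k) = 1" using a1 by simp
qed

lemma tendsto_at_infinity_within_iff:
  fixes f :: "complex \<Rightarrow> complex"
  shows "(f \<longlongrightarrow> l) (inf at_infinity (principal S)) \<longleftrightarrow> (\<forall>e>0. \<exists>R. \<forall>k\<in>S. cmod k > R \<longrightarrow> cmod (f k - l) < e)"
  unfolding tendsto_iff eventually_inf_principal eventually_at_infinity dist_norm
proof (intro iff_allI imp_cong refl iffI)
  fix e assume "\<exists>b. \<forall>x. b \<le> cmod x \<longrightarrow> x \<in> S \<longrightarrow> cmod (f x - l) < e"
  then show "\<exists>R. \<forall>k\<in>S. cmod k > R \<longrightarrow> cmod (f k - l) < e" by (meson less_imp_le)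
next
  fix e assume "\<exists>R. \<forall>k\<in>S. cmod k > R \<longrightarrow> cmod (f k - l) < e"
  then obtain R where R: "\<forall>k\<in>S. cmod k > R \<longrightarrow> cmod (f k - l) < e" by blast
  show "\<exists>b. \<forall>x. b \<le> cmod x \<longrightarrow> x \<in> S \<longrightarrow> cmod (f x - l) < e"
    by (rule exI[of _ "R + 1"]) (use R in auto)
qed

lemma tendsto_exp_div_cmod: "((\<lambda>k. exp (Q / cmod k)) \<longlongrightarrow> 1) at_infinity"
proof -
  have "filterlim cmod at_top at_infinity" by (rule filterlim_norm_at_top)
  then have "((\<lambda>k. Q / cmod k) \<longlongrightarrow> 0) at_infinity" by (intro tendsto_divide_0[OF tendsto_const] filterlim_at_top_imp_at_infinity)
  from tendsto_exp[OF this] show ?thesis by simp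
qed

lemma jost_at_infinity:
  assumes q: "integrable lebesgue q"
  shows "((\<lambda>k. jost q k 0) \<longlongrightarrow> 1) (inf at_infinity (principal closed_upper))"
    and "((\<lambda>k. jost1 q k 0 / (\<i> * k)) \<longlongrightarrow> 1) (inf at_infinity (principal closed_upper))"
proof -
  let ?U = "inf at_infinity (principal closed_upper)"
  define T where "T = (LINT t:{0..}|lebesgue. \<bar>q t\<bar>)"
  define Q where "Q = (\<integral>t. \<bar>q t\<bar> \<partial>lebesgue)"
  have ev: "eventually (\<lambda>k. k \<in> closed_upper) ?U" by (simp add: eventually_inf_principal)
  have l1: "((\<lambda>k. exp (T / cmod k) - 1) \<longlongrightarrow> 0) ?U"
    using tendsto_diff[OF tendsto_exp_div_cmod[of T] tendsto_const[of 1]] by (auto intro: tendsto_mono[OF inf_le1])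
  have "((\<lambda>k. jost q k 0 - 1) \<longlongrightarrow> 0) ?U"
  proof (rule Lim_null_comparison[OF _ l1])
    show "eventually (\<lambda>k. norm (jost q k 0 - 1) \<le> exp (T / cmod k) - 1) ?U"
      using ev
    proof eventually_elim
      case (elim k)
      then have "Im k \<ge> 0" "k \<noteq> 0" by (auto simp: closed_upper_def)
      from jost_m_bounds_simple(3)[OF q this, of 0] show ?case by (simp add: jost_def T_def)
    qed
  qed
  then show "((\<lambda>k. jost q k 0) \<longlongrightarrow> 1) ?U" by (simp add: LIM_zero_iff)
  have n: "filterlim cmod at_top at_infinity" by (rule filterlim_norm_at_top)
  have "((\<lambda>k. T / cmod k) \<longlongrightarrow> 0) at_infinity" by (intro tendsto_divide_0[OF tendsto_const] filterlim_at_top_imp_at_infinity n)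
  from tendsto_mult[OF tendsto_exp_div_cmod[of Q] this]
  have l2: "((\<lambda>k. exp (Q / cmod k) * (T / cmod k)) \<longlongrightarrow> 0) ?U" by (auto intro: tendsto_mono[OF inf_le1])
  have "((\<lambda>k. jost1 q k 0 / (\<i> * k) - 1) \<longlongrightarrow> 0) ?U"
  proof (rule Lim_null_comparison[OF _ l2])
    show "eventually (\<lambda>k. norm (jost1 q k 0 / (\<i> * k) - 1) \<le> exp (Q / cmod k) * (T / cmod k)) ?U"
      using ev
    proof eventually_elim
      case (elim k)
      then have k: "Im k \<ge> 0" "k \<noteq> 0" by (auto simp: closed_upper_def)
      have "cmod (jost1 q k 0 - \<i> * k) \<le> exp (Q / cmod k) * T"
        using jost_asymp(3)[OF q k, of 0] by (simp add: T_def Q_def)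
      moreover have "jost1 q k 0 / (\<i> * k) - 1 = (jost1 q k 0 - \<i> * k) / (\<i> * k)" using k by (simp add: field_simps)
      ultimately show ?case using k by (simp add: norm_divide norm_mult divide_right_mono)
    qed
  qed
  then show "((\<lambda>k. jost1 q k 0 / (\<i> * k)) \<longlongrightarrow> 1) ?U" by (simp add: LIM_zero_iff)
qed

lemma wronskian_coeff_at_infinity:
  assumes q: "integrable lebesgue q" and p: "integrable lebesgue p"
  shows "((\<lambda>k. wronskian_coeff q p k) \<longlongrightarrow> 1) (inf at_infinity (principal closed_upper))"
proof -
  have "((\<lambda>k. (jost q k 0 * (jost1 p k 0 / (\<i> * k)) + (jost1 q k 0 / (\<i> * k)) * jost p k 0) / 2) \<longlongrightarrow> (1 * 1 + 1 * 1) / 2)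
      (inf at_infinity (principal closed_upper))"
    using jost_at_infinity[OF q] jost_at_infinity[OF p] by (intro tendsto_divide tendsto_add tendsto_mult tendsto_const) auto
  moreover have "(jost q k 0 * (jost1 p k 0 / (\<i> * k)) + (jost1 q k 0 / (\<i> * k)) * jost p k 0) / 2 = wronskian_coeff q p k" for k
    by (simp add: wronskian_coeff_def add_divide_distrib mult.assoc) (simp only: mult.left_commute[of \<i> 2] mult.commute[of _ 2] mult.assoc)
  ultimately show ?thesis by simp
qed

lemma wronskian_coeff_regular:
  assumes q: "integrable lebesgue q" and p: "integrable lebesgue p"
  shows "continuous_on closed_upper (wronskian_coeff q p)" "wronskian_coeff q p holomorphic_on upper_half"
proof -
  have e: "wronskian_coeff q p = (\<lambda>k. (jost q k 0 * jost1 p k 0 + jost1 q k 0 * jost p k 0) / (2 * \<i> * k))"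
    by (simp add: fun_eq_iff wronskian_coeff_def)
  show "continuous_on closed_upper (wronskian_coeff q p)"
    unfolding e by (intro continuous_intros jost_regular q p) (auto simp: closed_upper_def)
  show "wronskian_coeff q p holomorphic_on upper_half"
    unfolding e by (intro holomorphic_intros jost_regular q p) (auto simp: upper_half_def)
qed

text \<open>Multiplied by \<open>cnj F cnj G\<close>, the Wronskian has imaginary part Im (k^2)
  times a combination of the two masses with positive value if \<open>F \<noteq> 0\<close>; and off
  the axis \<open>F\<close> does not vanish.\<close>

lemma wronskian_coeff_zero_imp_axis:
  assumes q: "integrable lebesgue q" and p: "integrable lebesgue p" and k: "Im k > 0" and z: "wronskian_coeff q p k = 0"
  shows "Re k = 0"
proof (rule ccontr)
  assume re: "Re k \<noteq> 0"
  define F F1 G G1 where d: "F = jost q k 0" "F1 = jost1 q k 0" "G = jost p k 0" "G1 = jost1 p k 0"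
  have F: "F \<noteq> 0" using jost_zero_imp_axis(1)[OF q k] re by (auto simp: d)
  have N: "F * G1 + F1 * G = 0" using z k by (auto simp: wronskian_coeff_def d)
  define I J where IJ: "I = (LINT t:{0..}|lebesgue. (cmod (jost q k t))\<^sup>2)" "J = (LINT t:{0..}|lebesgue. (cmod (jost p k t))\<^sup>2)"
  have "I > 0" "J > 0" unfolding IJ using jost_mass_pos[OF q k] jost_mass_pos[OF p k] by auto
  have i: "Im (F1 * cnj F) = Im (k\<^sup>2) * I" "Im (G1 * cnj G) = Im (k\<^sup>2) * J"
    unfolding d IJ by (rule jost_Im_identity[OF q k] jost_Im_identity[OF p k])+
  have im: "Im (of_real c * z) = c * Im z" for c z by simp
  have "of_real ((cmod F)\<^sup>2) * (G1 * cnj G) + of_real ((cmod G)\<^sup>2) * (F1 * cnj F) = (F * G1 + F1 * G) * (cnj F * cnj G)"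
    unfolding complex_norm_square by (simp add: algebra_simps)
  then have "Im (of_real ((cmod F)\<^sup>2) * (G1 * cnj G) + of_real ((cmod G)\<^sup>2) * (F1 * cnj F)) = 0" unfolding N by simp
  then have "(cmod F)\<^sup>2 * Im (G1 * cnj G) + (cmod G)\<^sup>2 * Im (F1 * cnj F) = 0"
    unfolding plus_complex.sel im .
  then have "Im (k\<^sup>2) * ((cmod F)\<^sup>2 * J + (cmod G)\<^sup>2 * I) = 0" unfolding i by (simp only: algebra_simps)
  moreover have "(cmod F)\<^sup>2 * J + (cmod G)\<^sup>2 * I > 0" using F \<open>I > 0\<close> \<open>J > 0\<close> by (intro add_pos_nonneg) auto
  ultimately have "Im (k\<^sup>2) = 0" by (metis less_irrefl mult_eq_0_iff)
  then show False using re k by (simp add: power2_eq_square)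
qed

lemma jost_axis_real:
  assumes q: "integrable lebesgue q" and k: "Im k > 0" "Re k = 0"
  shows "(jost q k t)\<^sup>2 = of_real ((cmod (jost q k t))\<^sup>2)"
proof -
  have k0: "Im k \<ge> 0" "k \<noteq> 0" using k by auto
  have "- cnj k = k" using k(2) by (simp add: complex_eq_iff)
  then show ?thesis
    using jost_cnj(1)[OF q k0, of t] complex_norm_square[of "jost q k t"] by (simp add: power2_eq_square)
qed

text \<open>At an eigenvalue the left Jost solution is \<open>C\<close> times the right one.
  Multiplying the derivative of the Wronskian by \<open>C\<close> brings it into the form of two
  derivative identities, one for each half-line, and the two half-line masses add up to the mass on
  the whole line. The factor \<open>2 k\<close> cancels against the denominator
  \<open>2ik\<close>.\<close>

lemma deriv_wronskian_coeff:
  assumes q: "integrable lebesgue q" and k: "Im k > 0"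
  defines "p \<equiv> \<lambda>x. q (- x)"
  assumes z: "wronskian_coeff q p k = 0" and F: "jost q k 0 \<noteq> 0"
  shows "\<i> * deriv (wronskian_coeff q p) k * jost q k 0 = jost p k 0 * of_real (\<integral>x. (cmod (jost q k x))\<^sup>2 \<partial>lebesgue)"
    and "(\<integral>x. (cmod (jost q k x))\<^sup>2 \<partial>lebesgue) > 0"
proof -
  have p: "integrable lebesgue p" unfolding p_def by (rule integrable_reflect_lebesgue[OF q])
  have kU: "k \<in> upper_half" using k by (simp add: upper_half_def)
  have k0: "k \<noteq> 0" using k by auto
  have re: "Re k = 0" by (rule wronskian_coeff_zero_imp_axis[OF q p k z])
  have N: "jost q k 0 * jost1 p k 0 + jost1 q k 0 * jost p k 0 = 0" using z k0 by (simp add: wronskian_coeff_def)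
  from jost_reflect_eq[OF q k N[unfolded p_def]] obtain C where C: "C \<noteq> 0" "\<And>x. jost p k (- x) = C * jost q k x"
    unfolding p_def by blast
  define I J where IJ: "I = (LINT t:{0..}|lebesgue. (cmod (jost q k t))\<^sup>2)" "J = (LINT t:{..0}|lebesgue. (cmod (jost q k t))\<^sup>2)"
  have iI: "set_integrable lebesgue {0..} (\<lambda>x. (cmod (jost q k x))\<^sup>2)" by (rule jost_square_integrable[OF q k])
  have r: "indicat_real {0..} (- x) *\<^sub>R (cmod (jost p k (- x)))\<^sup>2 = (cmod C)\<^sup>2 * (indicat_real {..0} x *\<^sub>R (cmod (jost q k x))\<^sup>2)" for x
    unfolding C(2) by (simp add: indicator_def norm_mult power_mult_distrib)
  have iJ: "set_integrable lebesgue {..0} (\<lambda>x. (cmod (jost q k x))\<^sup>2)"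
    using integrable_reflect_lebesgue[OF jost_square_integrable[OF p k, of 0, unfolded set_integrable_def]] C(1)
    unfolding r set_integrable_def by simp
  have split: "(\<integral>x. (cmod (jost q k x))\<^sup>2 \<partial>lebesgue) = I + J"
  proof -
    have "AE x in lebesgue. \<not> (x \<in> {0..} \<and> x \<in> {..(0::real)})"
    proof (rule AE_I[of _ _ "{0}"])
      show "{x \<in> space lebesgue. \<not> \<not> (x \<in> {0..} \<and> x \<in> {..(0::real)})} \<subseteq> {0}" by auto
    qed auto
    from set_integral_Un_AE[OF this _ _ iI iJ] have "(LINT x:{0..} \<union> {..0}|lebesgue. (cmod (jost q k x))\<^sup>2) = I + J" unfolding IJ by simp
    moreover have "{0..} \<union> {..0} = (UNIV :: real set)" by auto
    ultimately show ?thesis by (simp add: set_lebesgue_integral_def)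
  qed
  have "J \<ge> 0" unfolding IJ set_lebesgue_integral_def by (rule Bochner_Integration.integral_nonneg) (simp add: indicator_def)
  moreover have "I > 0" unfolding IJ by (rule jost_mass_pos[OF q k])
  ultimately show "(\<integral>x. (cmod (jost q k x))\<^sup>2 \<partial>lebesgue) > 0" using split by simp
  have Iq: "(LINT t:{0..}|lebesgue. (jost q k t)\<^sup>2) = of_real I"
    unfolding jost_axis_real[OF q k re] IJ by (rule set_integral_complex_of_real)
  have Ip: "(LINT t:{0..}|lebesgue. (jost p k t)\<^sup>2) = C\<^sup>2 * of_real J"
  proof -
    have "(LINT t:{0..}|lebesgue. (jost p k t)\<^sup>2) = (\<integral>t. indicat_real {0..} t *\<^sub>R (jost p k t)\<^sup>2 \<partial>lebesgue)" by (simp add: set_lebesgue_integral_def)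
    also have "\<dots> = \<bar>-1\<bar> *\<^sub>R (\<integral>t. indicat_real {0..} (0 + -1 * t) *\<^sub>R (jost p k (0 + -1 * t))\<^sup>2 \<partial>lebesgue)"
      by (rule lebesgue_integral_real_affine) simp
    also have "\<dots> = (\<integral>t. C\<^sup>2 * (indicat_real {..0} t *\<^sub>R (jost q k t)\<^sup>2) \<partial>lebesgue)"
      by (simp add: C(2) power_mult_distrib) (rule Bochner_Integration.integral_cong; simp add: indicator_def)
    also have "\<dots> = C\<^sup>2 * (LINT t:{..0}|lebesgue. (jost q k t)\<^sup>2)" unfolding set_lebesgue_integral_def by (rule integral_mult_right_zero)
    also have "\<dots> = C\<^sup>2 * of_real J" unfolding jost_axis_real[OF q k re] IJ by (simp only: set_integral_complex_of_real)
    finally show ?thesis .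
  qed
  define F F1 G G1 where d: "F = (\<lambda>k. jost q k 0)" "F1 = (\<lambda>k. jost1 q k 0)" "G = (\<lambda>k. jost p k 0)" "G1 = (\<lambda>k. jost1 p k 0)"
  have hol: "F holomorphic_on upper_half" "F1 holomorphic_on upper_half" "G holomorphic_on upper_half" "G1 holomorphic_on upper_half"
    unfolding d using jost_regular(3,4)[OF q] jost_regular(3,4)[OF p] by auto
  have G: "G k = C * F k" using C(2)[of 0] by (simp add: d)
  have "F k * (G1 k + C * F1 k) = F k * G1 k + F1 k * G k" unfolding G by (simp add: algebra_simps)
  also have "\<dots> = 0" using N by (simp add: d)
  finally have G1: "G1 k = - C * F1 k" using F by (simp add: d add_eq_0_iff)
  have hq: "deriv F1 k * F k - deriv F k * F1 k = 2 * k * of_real I"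
    using jost_derivative_identity[OF q k] unfolding Iq by (simp add: d)
  have hp: "deriv G1 k * G k - deriv G k * G1 k = 2 * k * (C\<^sup>2 * of_real J)"
    using jost_derivative_identity[OF p k] unfolding Ip by (simp add: d)
  have D: "(f has_field_derivative deriv f k) (at k)" if "f holomorphic_on upper_half" for f
    by (rule holomorphic_derivI[OF that open_upper_half kU])
  have "((\<lambda>k. (F k * G1 k + F1 k * G k) / (2 * \<i> * k)) has_field_derivative
      ((deriv F k * G1 k + deriv G1 k * F k + (deriv F1 k * G k + deriv G k * F1 k)) * (2 * \<i> * k) - (F k * G1 k + F1 k * G k) * (2 * \<i> * 1)) / ((2 * \<i> * k) * (2 * \<i> * k))) (at k)"
    by (intro DERIV_divide DERIV_add DERIV_mult D hol DERIV_cmult DERIV_ident) (use k0 in simp)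
  moreover have "F k * G1 k + F1 k * G k = 0" using N by (simp add: d)
  moreover have "(\<lambda>k. (F k * G1 k + F1 k * G k) / (2 * \<i> * k)) = wronskian_coeff q p" by (simp add: fun_eq_iff wronskian_coeff_def d)
  ultimately have dA: "deriv (wronskian_coeff q p) k = (deriv F k * G1 k + deriv G1 k * F k + (deriv F1 k * G k + deriv G k * F1 k)) / (2 * \<i> * k)"
    using k0 by (intro DERIV_imp_deriv) (simp del: distrib_right_numeral distrib_left_numeral add: mult.assoc)
  have "C * (deriv F k * G1 k + deriv G1 k * F k + (deriv F1 k * G k + deriv G k * F1 k))
      = C\<^sup>2 * (deriv F1 k * F k - deriv F k * F1 k) + (deriv G1 k * G k - deriv G k * G1 k)"
    unfolding G G1 by (simp add: algebra_simps power2_eq_square)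
  also have "\<dots> = C\<^sup>2 * (2 * k) * of_real (I + J)" unfolding hq hp by (simp add: algebra_simps)
  finally have "deriv F k * G1 k + deriv G1 k * F k + (deriv F1 k * G k + deriv G k * F1 k) = C * (2 * k) * of_real (I + J)"
    using C(1) by (simp add: power2_eq_square)
  then have "\<i> * deriv (wronskian_coeff q p) k = C * of_real (I + J)" unfolding dA using k0 by (simp add: field_simps)
  then show "\<i> * deriv (wronskian_coeff q p) k * jost q k 0 = jost p k 0 * of_real (\<integral>x. (cmod (jost q k x))\<^sup>2 \<partial>lebesgue)"
    unfolding split using G by (simp add: d)
qed

section \<open>Interlacing\<close>

text \<open>At consecutive simple zeros of \<open>E\<close> its derivative has opposite signs.
  \<open>N\<close> has the sign of this derivative at each of them, hence changes sign in
  between.\<close>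

lemma zero_between_simple_zeros:
  fixes E N :: "real \<Rightarrow> real"
  assumes st: "s < t" and cE: "continuous_on {s..t} E" and cN: "continuous_on {s..t} N"
    and z: "E s = 0" "E t = 0" and nz: "\<And>x. s < x \<Longrightarrow> x < t \<Longrightarrow> E x \<noteq> 0"
    and ds: "(E has_real_derivative d) (at s)" "N s * d > 0" and dt: "(E has_real_derivative e) (at t)" "N t * e > 0"
  shows "\<exists>x. s < x \<and> x < t \<and> N x = 0"
proof -
  \<comment> \<open>Proved for \<open>E\<close> positive in between, with \<open>E\<close>,
    \<open>N\<close> and the derivatives as parameters, so that it can be applied to
    \<open>- E\<close> and \<open>- N\<close> as well.\<close>
  have *: "\<exists>x. s < x \<and> x < t \<and> N x = 0"
    if cN: "continuous_on {s..t} N" and pos: "\<And>x. s < x \<Longrightarrow> x < t \<Longrightarrow> E x > 0"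
      and z: "E s = 0" "E t = 0"
      and ds: "(E has_real_derivative d) (at s)" "N s * d > 0" and dt: "(E has_real_derivative e) (at t)" "N t * e > 0"
    for E N d e
  proof -
    have "\<not> d < 0"
    proof
      assume "d < 0"
      from DERIV_neg_dec_right[OF ds(1) this] obtain r where r: "r > 0" "\<And>h. h > 0 \<Longrightarrow> h < r \<Longrightarrow> E (s + h) < E s" by auto
      define h where "h = min r (t - s) / 2"
      have "h > 0" "h < r" "s + h < t" using r(1) st by (auto simp: h_def min_def field_simps)
      then show False using r(2)[of h] pos[of "s + h"] z by simp
    qed
    then have Ns: "N s > 0" using ds(2) by (simp add: zero_less_mult_iff)
    have "\<not> e > 0"
    proof
      assume "e > 0"
      from DERIV_pos_inc_left[OF dt(1) this] obtain r where r: "r > 0" "\<And>h. h > 0 \<Longrightarrow> h < r \<Longrightarrow> E (t - h) < E t" by auto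
      define h where "h = min r (t - s) / 2"
      have "h > 0" "h < r" "t - h > s" using r(1) st by (auto simp: h_def min_def field_simps)
      then show False using r(2)[of h] pos[of "t - h"] z by simp
    qed
    then have Nt: "N t < 0" using dt(2) by (simp add: zero_less_mult_iff)
    obtain x where "s \<le> x" "x \<le> t" "N x = 0" using IVT2'[of N t 0 s] Ns Nt st cN by auto
    then show ?thesis using Ns Nt by (intro exI[of _ x]) (auto simp: order_less_le)
  qed
  define c where "c = (s + t) / 2"
  have c: "s < c" "c < t" using st by (auto simp: c_def)
  have sgn: "E x * E c > 0" if x: "s < x" "x < t" for x
  proof (rule ccontr)
    assume n: "\<not> E x * E c > 0"
    have "\<exists>y\<in>closed_segment x c. E y = 0"
    proof (cases "x \<le> c")
      case True
      have "continuous_on {x..c} E" by (rule continuous_on_subset[OF cE]) (use x c in auto)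
      then show ?thesis
        using IVT'[of E x 0 c] IVT2'[of E c 0 x] True n
        by (force simp: closed_segment_eq_real_ivl not_less mult_le_0_iff)
    next
      case False
      have "continuous_on {c..x} E" by (rule continuous_on_subset[OF cE]) (use x c in auto)
      then show ?thesis
        using IVT'[of E c 0 x] IVT2'[of E x 0 c] False n
        by (force simp: closed_segment_eq_real_ivl not_less mult_le_0_iff)
    qed
    then obtain y where "y \<in> closed_segment x c" "E y = 0" by blast
    then show False using nz[of y] x c by (auto simp: closed_segment_eq_real_ivl split: if_splits)
  qed
  show ?thesis
  proof (cases "E c > 0")
    case True
    show ?thesis by (rule *[OF cN _ z ds dt]) (use sgn True in \<open>simp add: zero_less_mult_iff\<close>)
  next
    case False
    then have "E c < 0" using nz[OF c] by simp
    then have "\<And>x. s < x \<Longrightarrow> x < t \<Longrightarrow> - E x > 0" using sgn by (simp add: zero_less_mult_iff)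
    from *[OF continuous_on_minus[OF cN] this _ _ DERIV_minus[OF ds(1)] _ DERIV_minus[OF dt(1)]]
    have "\<exists>x. s < x \<and> x < t \<and> - N x = 0" using z ds(2) dt(2) by simp
    then show ?thesis by simp
  qed
qed

text \<open>Beyond its last zero \<open>E\<close> keeps the sign it has at \<open>t\<close>, so its
  derivative at \<open>s\<close> is positive, and \<open>N\<close> falls from a positive to a
  negative value.\<close>

lemma zero_above_last_simple_zero:
  fixes E N :: "real \<Rightarrow> real"
  assumes st: "s < t" and cE: "continuous_on {s..t} E" and cN: "continuous_on {s..t} N"
    and z: "E s = 0" and nz: "\<And>x. s < x \<Longrightarrow> x \<le> t \<Longrightarrow> E x \<noteq> 0" and Et: "E t > 0" and Nt: "N t < 0"
    and ds: "(E has_real_derivative d) (at s)" "N s * d > 0"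
  shows "\<exists>x. s < x \<and> N x = 0"
proof -
  have pos: "E x > 0" if x: "s < x" "x \<le> t" for x
  proof (rule ccontr)
    assume "\<not> E x > 0"
    then have "E x \<le> 0" by simp
    moreover have "continuous_on {x..t} E" by (rule continuous_on_subset[OF cE]) (use x in auto)
    ultimately obtain y where "x \<le> y" "y \<le> t" "E y = 0" using IVT'[of E x 0 t] Et x by auto
    then show False using nz[of y] x by auto
  qed
  have "\<not> d < 0"
  proof
    assume "d < 0"
    from DERIV_neg_dec_right[OF ds(1) this] obtain r where r: "r > 0" "\<And>h. h > 0 \<Longrightarrow> h < r \<Longrightarrow> E (s + h) < E s" by auto
    define h where "h = min r (t - s) / 2"
    have "h > 0" "h < r" "s + h < t" using r(1) st by (auto simp: h_def min_def field_simps)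
    then show False using r(2)[of h] pos[of "s + h"] z by simp
  qed
  then have Ns: "N s > 0" using ds(2) by (simp add: zero_less_mult_iff)
  obtain x where "s \<le> x" "x \<le> t" "N x = 0" using IVT2'[of N t 0 s] Ns Nt st cN by auto
  then show ?thesis using Ns by (intro exI[of _ x]) (auto simp: order_less_le)
qed

text \<open>Reality comes from the conjugation symmetry. At a zero the derivative identity reads
  \<open>- F' F1 = 2 k I\<close> with \<open>I > 0\<close> the mass; for \<open>k = ix\<close> this
  says that the derivative along the axis has the sign of \<open>F1\<close>.\<close>

lemma jost_on_axis:
  assumes q: "integrable lebesgue q" and x: "x > 0"
  shows "jost q (\<i> * of_real x) 0 = of_real (Re (jost q (\<i> * of_real x) 0))"
    and "jost1 q (\<i> * of_real x) 0 = of_real (Re (jost1 q (\<i> * of_real x) 0))"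
    and "\<exists>d. ((\<lambda>x. Re (jost q (\<i> * of_real x) 0)) has_real_derivative d) (at x) \<and>
          (jost q (\<i> * of_real x) 0 = 0 \<longrightarrow> d * Re (jost1 q (\<i> * of_real x) 0) > 0)"
proof -
  let ?k = "\<i> * complex_of_real x"
  have k: "Im ?k > 0" "Im ?k \<ge> 0" "?k \<noteq> 0" "?k \<in> upper_half" using x by (auto simp: upper_half_def)
  have kk: "- cnj ?k = ?k" and re: "Re ?k = 0" by simp_all
  have "cnj (jost q ?k 0) = jost q ?k 0" "cnj (jost1 q ?k 0) = jost1 q ?k 0"
    using jost_cnj[OF q k(2,3), of 0] unfolding kk by simp_all
  then show r: "jost q ?k 0 = of_real (Re (jost q ?k 0))" "jost1 q ?k 0 = of_real (Re (jost1 q ?k 0))"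
    by (auto simp: complex_eq_iff)
  define F where "F = (\<lambda>k. jost q k 0)"
  have "(F has_field_derivative deriv F ?k) (at ?k)"
    unfolding F_def by (rule holomorphic_derivI[OF jost_regular(3)[OF q] open_upper_half k(4)])
  then have "((\<lambda>z. F (\<i> * z)) has_field_derivative deriv F ?k * \<i>) (at (of_real x))"
    by (rule DERIV_chain2) (auto intro!: derivative_eq_intros)
  then have "((\<lambda>x. F (\<i> * of_real x)) has_vector_derivative deriv F ?k * \<i>) (at x)"
    by (rule has_vector_derivative_real_field)
  from bounded_linear.has_vector_derivative[OF bounded_linear_Re this]
  have D: "((\<lambda>x. Re (F (\<i> * of_real x))) has_real_derivative Re (deriv F ?k * \<i>)) (at x)"
    by (simp only: has_real_derivative_iff_has_vector_derivative)
  define I where "I = (LINT t:{0..}|lebesgue. (cmod (jost q ?k t))\<^sup>2)"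
  have I: "I > 0" unfolding I_def by (rule jost_mass_pos[OF q k(1)])
  have "Re (deriv F ?k * \<i>) * Re (jost1 q ?k 0) > 0" if z: "jost q ?k 0 = 0"
  proof -
    have "(LINT t:{0..}|lebesgue. (jost q ?k t)\<^sup>2) = of_real I"
      unfolding jost_axis_real[OF q k(1) re] I_def by (rule set_integral_complex_of_real)
    then have "- deriv F ?k * of_real (Re (jost1 q ?k 0)) = 2 * ?k * of_real I"
      using jost_derivative_identity[OF q k(1)] z r(2) unfolding F_def by simp
    then have "Im (- deriv F ?k * of_real (Re (jost1 q ?k 0))) = Im (2 * ?k * of_real I)" by (rule arg_cong)
    then have "Re (deriv F ?k * \<i>) * Re (jost1 q ?k 0) = 2 * x * I" by simp
    then show ?thesis using I x by simp
  qed
  then show "\<exists>d. ((\<lambda>x. Re (jost q (\<i> * of_real x) 0)) has_real_derivative d) (at x) \<and>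
          (jost q ?k 0 = 0 \<longrightarrow> d * Re (jost1 q ?k 0) > 0)"
    using D unfolding F_def by blast
qed

lemma continuous_on_axis:
  assumes "continuous_on closed_upper f" and "S \<subseteq> {0<..}"
  shows "continuous_on S (\<lambda>x. Re (f (\<i> * of_real x)))"
proof -
  have "continuous_on S (\<lambda>x. f (\<i> * of_real x))"
    by (rule continuous_on_compose2[OF assms(1)]) (use assms(2) in \<open>auto intro!: continuous_intros simp: closed_upper_def\<close>)
  then show ?thesis by (intro continuous_intros)
qed

lemma eventually_axis_near_1:
  assumes "(f \<longlongrightarrow> 1) (inf at_infinity (principal closed_upper))"
  shows "eventually (\<lambda>x::real. Re (f (\<i> * of_real x)) > 0) at_top"
proof -
  obtain R where R: "\<forall>k\<in>closed_upper. cmod k > R \<longrightarrow> cmod (f k - 1) < 1"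
    using assms unfolding tendsto_at_infinity_within_iff by (meson zero_less_one)
  have "Re (f (\<i> * of_real x)) > 0" if x: "x > max R 0" for x
  proof -
    have "cmod (f (\<i> * of_real x) - 1) < 1" using R x by (auto simp: closed_upper_def norm_mult)
    then show ?thesis using abs_Re_le_cmod[of "f (\<i> * of_real x) - 1"] by simp
  qed
  then show ?thesis using eventually_gt_at_top[of "max R 0"] by (rule eventually_mono[rotated])
qed

text \<open>Only this half of interlacing is required: it transfers summability from \<kappa> to
  |\<mu>|. The product \<open>E\<close> of the two Jost functions on the axis has simple zeros
  exactly at \<nu>, and the Wronskian \<open>N\<close> has the sign of \<open>E'\<close> there. So
  \<open>N\<close> vanishes between consecutive \<nu>, and once above the largest.\<close>

lemma jost_zeros_interlace:
  fixes \<kappa> \<nu> :: "nat \<Rightarrow> real"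
  assumes q: "integrable lebesgue q" and p: "integrable lebesgue p"
    and nb: "\<And>x. x > 0 \<Longrightarrow> jost q (\<i> * of_real x) 0 \<noteq> 0 \<or> jost p (\<i> * of_real x) 0 \<noteq> 0"
    and \<kappa>: "\<And>m n. m < n \<Longrightarrow> \<kappa> n < \<kappa> m" "\<And>x. x > 0 \<Longrightarrow> wronskian_coeff q p (\<i> * of_real x) = 0 \<Longrightarrow> x \<in> range \<kappa>"
    and \<nu>: "\<And>n. \<nu> n > 0" "\<And>m n. m < n \<Longrightarrow> \<nu> n < \<nu> m"
      "\<And>x. x > 0 \<Longrightarrow> jost q (\<i> * of_real x) 0 = 0 \<or> jost p (\<i> * of_real x) 0 = 0 \<longleftrightarrow> x \<in> range \<nu>"
  shows "\<nu> n \<le> \<kappa> n"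
proof -
  define f f1 g g1 where f: "f = (\<lambda>x. Re (jost q (\<i> * of_real x) 0))" and f1: "f1 = (\<lambda>x. Re (jost1 q (\<i> * of_real x) 0))"
    and g: "g = (\<lambda>x. Re (jost p (\<i> * of_real x) 0))" and g1: "g1 = (\<lambda>x. Re (jost1 p (\<i> * of_real x) 0))"
  define E N where E: "E = (\<lambda>x. f x * g x)" and N: "N = (\<lambda>x. f x * g1 x + f1 x * g x)"
  have F: "jost q (\<i> * of_real x) 0 = of_real (f x)" "jost1 q (\<i> * of_real x) 0 = of_real (f1 x)"
    "jost p (\<i> * of_real x) 0 = of_real (g x)" "jost1 p (\<i> * of_real x) 0 = of_real (g1 x)" if "x > 0" for x
    unfolding f f1 g g1 using jost_on_axis(1,2)[OF q that] jost_on_axis(1,2)[OF p that] by auto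
  have NA: "N x = - 2 * x * Re (wronskian_coeff q p (\<i> * of_real x))" and
    NA0: "N x = 0 \<longleftrightarrow> wronskian_coeff q p (\<i> * of_real x) = 0" if x: "x > 0" for x
  proof -
    have "wronskian_coeff q p (\<i> * of_real x) = of_real (N x) / (2 * \<i> * (\<i> * of_real x))"
      unfolding wronskian_coeff_def F[OF x] N by simp
    also have "\<dots> = of_real (- N x / (2 * x))" using x by (simp add: field_simps)
    finally have e: "wronskian_coeff q p (\<i> * of_real x) = of_real (- N x / (2 * x))" .
    show "N x = - 2 * x * Re (wronskian_coeff q p (\<i> * of_real x))" unfolding e Re_complex_of_real using x by simp
    show "N x = 0 \<longleftrightarrow> wronskian_coeff q p (\<i> * of_real x) = 0" unfolding e using x by simp
  qed
  have E0: "E x = 0 \<longleftrightarrow> x \<in> range \<nu>" if x: "x > 0" for x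
    using \<nu>(3)[OF x] unfolding F[OF x] E by simp
  have cE: "continuous_on S E" and cN: "continuous_on S N" if "S \<subseteq> {0<..}" for S
    unfolding E N f f1 g g1 using that
    by (intro continuous_intros continuous_on_axis jost_regular q p; assumption)+
  \<comment> \<open>Just one of \<open>f\<close> and \<open>g\<close> vanishes at a zero of
    \<open>E\<close>. If it is \<open>f\<close>, then \<open>N = f1 g\<close> and
    \<open>E' = f' g\<close>, so the product is \<open>f' f1 g^2 > 0\<close>; likewise for
    \<open>g\<close>.\<close>
  have D: "\<exists>d. (E has_real_derivative d) (at x) \<and> N x * d > 0" if x: "x > 0" and z: "E x = 0" for x
  proof -
    obtain d where d: "(f has_real_derivative d) (at x)" "f x = 0 \<longrightarrow> d * f1 x > 0"
      using jost_on_axis(3)[OF q x] unfolding F[OF x] of_real_eq_0_iff f[symmetric] f1[symmetric] Re_complex_of_real by blast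
    obtain e where e: "(g has_real_derivative e) (at x)" "g x = 0 \<longrightarrow> e * g1 x > 0"
      using jost_on_axis(3)[OF p x] unfolding F[OF x] of_real_eq_0_iff g[symmetric] g1[symmetric] Re_complex_of_real by blast
    have dE: "(E has_real_derivative d * g x + e * f x) (at x)" unfolding E by (rule DERIV_mult[OF d(1) e(1)])
    have nb': "f x \<noteq> 0 \<or> g x \<noteq> 0" using nb[OF x] unfolding F[OF x] by simp
    have "N x * (d * g x + e * f x) > 0"
    proof (cases "f x = 0")
      case True
      have "N x * (d * g x + e * f x) = (d * f1 x) * (g x)\<^sup>2" unfolding N True by (simp add: power2_eq_square)
      also have "\<dots> > 0" using d(2) True nb' by simp
      finally show ?thesis .
    next
      case False
      then have g0: "g x = 0" using z by (simp add: E)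
      have "N x * (d * g x + e * f x) = (e * g1 x) * (f x)\<^sup>2" unfolding N g0 by (simp add: power2_eq_square)
      also have "\<dots> > 0" using e(2) g0 False by simp
      finally show ?thesis .
    qed
    then show ?thesis using dE by blast
  qed
  have \<nu>le: "\<nu> j \<le> \<nu> i" if "i \<le> j" for i j using \<nu>(2)[of i j] that by (cases "i = j") auto
  have z0: "\<exists>x. \<nu> 0 < x \<and> N x = 0"
  proof -
    have "eventually (\<lambda>x. f x > 0) at_top" "eventually (\<lambda>x. g x > 0) at_top"
      "eventually (\<lambda>x. Re (wronskian_coeff q p (\<i> * of_real x)) > 0) at_top"
      unfolding f g by (intro eventually_axis_near_1 jost_at_infinity wronskian_coeff_at_infinity q p)+
    \<comment> \<open>Far up the axis both Jost functions and the Wronskian coefficient are near 1;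
      the factor \<open>2ik\<close> is negative on the axis, so \<open>E\<close> is positive and
      \<open>N\<close> negative.\<close>
    then have "eventually (\<lambda>x. x > \<nu> 0 \<and> E x > 0 \<and> N x < 0) at_top"
      using eventually_gt_at_top[of "\<nu> 0"]
    proof eventually_elim
      case (elim x)
      then have "x > 0" using \<nu>(1)[of 0] by simp
      then show ?case using elim NA[of x] by (simp add: E)
    qed
    then obtain t where t: "t > \<nu> 0" "E t > 0" "N t < 0" using eventually_happens'[OF trivial_limit_at_top_linorder] by blast
    have sub: "{\<nu> 0..t} \<subseteq> {0<..}" using \<nu>(1)[of 0] by auto
    have z: "E (\<nu> 0) = 0" using E0 \<nu>(1) by blast
    obtain d where "(E has_real_derivative d) (at (\<nu> 0))" "N (\<nu> 0) * d > 0" using D[OF \<nu>(1) z] by blast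
    moreover have "E x \<noteq> 0" if "\<nu> 0 < x" "x \<le> t" for x
    proof
      assume "E x = 0"
      moreover have "x > 0" using that \<nu>(1)[of 0] by linarith
      ultimately obtain j where "x = \<nu> j" using E0[of x] by blast
      then show False using \<nu>(2)[of 0 j] that by (cases "j = 0") auto
    qed
    ultimately show ?thesis using zero_above_last_simple_zero[OF t(1) cE[OF sub] cN[OF sub] z _ t(2,3)] by blast
  qed
  have zS: "\<exists>x. \<nu> (Suc j) < x \<and> x < \<nu> j \<and> N x = 0" for j
  proof -
    have sub: "{\<nu> (Suc j)..\<nu> j} \<subseteq> {0<..}" using \<nu>(1)[of "Suc j"] by auto
    have z: "E (\<nu> i) = 0" for i using E0 \<nu>(1) by blast
    obtain d e where "(E has_real_derivative d) (at (\<nu> (Suc j)))" "N (\<nu> (Suc j)) * d > 0"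
      "(E has_real_derivative e) (at (\<nu> j))" "N (\<nu> j) * e > 0" using D[OF \<nu>(1) z] by metis
    moreover have "E x \<noteq> 0" if x: "\<nu> (Suc j) < x" "x < \<nu> j" for x
    proof
      assume "E x = 0"
      moreover have "x > 0" using x \<nu>(1)[of "Suc j"] by linarith
      ultimately obtain i where i: "x = \<nu> i" using E0[of x] by blast
      have "i \<le> j \<or> i \<ge> Suc j" by auto
      then have "\<nu> i \<ge> \<nu> j \<or> \<nu> i \<le> \<nu> (Suc j)" using \<nu>le by blast
      then show False using x i by auto
    qed
    ultimately show ?thesis using zero_between_simple_zeros[OF \<nu>(2)[OF lessI] cE[OF sub] cN[OF sub] z z] by blast
  qed
  have "\<exists>i. \<nu> j < \<kappa> i \<and> (\<forall>l. j = Suc l \<longrightarrow> \<kappa> i < \<nu> l)" for j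
  proof -
    obtain x where x: "\<nu> j < x" "\<forall>l. j = Suc l \<longrightarrow> x < \<nu> l" "N x = 0" using z0 zS by (cases j) auto
    then have "x > 0" using \<nu>(1)[of j] by simp
    then have "x \<in> range \<kappa>" using x(3) NA0 \<kappa>(2) by blast
    then show ?thesis using x by blast
  qed
  \<comment> \<open>\<open>\<kappa> (r j)\<close> lies above \<open>\<nu> j\<close> and, for
    \<open>j > 0\<close>, below \<open>\<nu> (j - 1)\<close>. Since \<kappa> decreases,
    \<open>r\<close> is strictly increasing, whence \<open>n \<le> r n\<close> and
    \<open>\<nu> n < \<kappa> (r n) \<le> \<kappa> n\<close>.\<close>
  then obtain r where r: "\<And>j. \<nu> j < \<kappa> (r j)" "\<And>l. \<kappa> (r (Suc l)) < \<nu> l" by metis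
  have "strict_mono r"
  proof (rule strict_mono_Suc_iff[THEN iffD2, rule_format])
    fix l
    have "\<kappa> (r (Suc l)) < \<kappa> (r l)" using r(1)[of l] r(2)[of l] by simp
    then show "r l < r (Suc l)" using \<kappa>(1) by (metis less_irrefl linorder_neqE_nat order.strict_trans)
  qed
  then have "n \<le> r n" by (rule strict_mono_imp_increasing)
  then have "\<kappa> (r n) \<le> \<kappa> n" using \<kappa>(1)[of n "r n"] by (cases "n = r n") auto
  then show ?thesis using r(1)[of n] by simp
qed

section \<open>Reflectionless potentials\<close>

lemma negligible_at_0_ln_mult:
  assumes f: "negligible_at_0 (\<lambda>k. ln (cmod (f k)))" and g: "negligible_at_0 (\<lambda>k. ln (cmod (g k)))"
    and nz: "\<And>k. Im k > 0 \<Longrightarrow> Re k \<noteq> 0 \<Longrightarrow> f k \<noteq> 0 \<and> g k \<noteq> 0"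
  shows "negligible_at_0 (\<lambda>k. ln (cmod (f k * g k)))"
  unfolding negligible_at_0_def
proof (intro allI impI)
  fix \<epsilon> :: real assume "\<epsilon> > 0"
  then have "\<epsilon> / 2 > 0" by simp
  obtain r where r: "r > 0" "\<And>k. cmod k < r \<and> Im k > 0 \<and> Re k \<noteq> 0 \<Longrightarrow> \<bar>ln (cmod (f k))\<bar> \<le> \<epsilon> / 2 * (cmod k ^ 3 / (Re k * Im k)\<^sup>2)"
    using f \<open>\<epsilon> / 2 > 0\<close> unfolding negligible_at_0_def by blast
  obtain s where s: "s > 0" "\<And>k. cmod k < s \<and> Im k > 0 \<and> Re k \<noteq> 0 \<Longrightarrow> \<bar>ln (cmod (g k))\<bar> \<le> \<epsilon> / 2 * (cmod k ^ 3 / (Re k * Im k)\<^sup>2)"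
    using g \<open>\<epsilon> / 2 > 0\<close> unfolding negligible_at_0_def by blast
  have "\<bar>ln (cmod (f k * g k))\<bar> \<le> \<epsilon> * (cmod k ^ 3 / (Re k * Im k)\<^sup>2)" if k: "cmod k < min r s \<and> Im k > 0 \<and> Re k \<noteq> 0" for k
  proof -
    have "ln (cmod (f k * g k)) = ln (cmod (f k)) + ln (cmod (g k))" using nz[of k] k by (simp add: norm_mult ln_mult)
    moreover have "\<bar>ln (cmod (f k))\<bar> \<le> \<epsilon> / 2 * (cmod k ^ 3 / (Re k * Im k)\<^sup>2)" "\<bar>ln (cmod (g k))\<bar> \<le> \<epsilon> / 2 * (cmod k ^ 3 / (Re k * Im k)\<^sup>2)"
      using r(2)[of k] s(2)[of k] k by auto
    ultimately show ?thesis by linarith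
  qed
  then show "\<exists>r>0. \<forall>k. cmod k < r \<and> 0 < Im k \<and> Re k \<noteq> 0 \<longrightarrow> \<bar>ln (cmod (f k * g k))\<bar> \<le> \<epsilon> * (cmod k ^ 3 / (Re k * Im k)\<^sup>2)"
    using r(1) s(1) by (intro exI[of _ "min r s"]) auto
qed

lemma deriv_mult_simple_zero:
  assumes hol: "f holomorphic_on upper_half" "g holomorphic_on upper_half" and k: "k \<in> upper_half"
    and z: "f k = 0" "deriv f k \<noteq> 0" "g k \<noteq> 0"
  shows "deriv (\<lambda>k. f k * g k) k \<noteq> 0" "deriv (\<lambda>k. g k * f k) k \<noteq> 0"
proof -
  have "((\<lambda>k. f k * g k) has_field_derivative deriv f k * g k + deriv g k * f k) (at k)"
    by (intro DERIV_mult holomorphic_derivI[OF _ open_upper_half k] hol)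
  then have "deriv (\<lambda>k. f k * g k) k = deriv f k * g k" using z by (simp add: DERIV_imp_deriv)
  then show "deriv (\<lambda>k. f k * g k) k \<noteq> 0" using z by simp
  then show "deriv (\<lambda>k. g k * f k) k \<noteq> 0" by (simp add: mult.commute)
qed

lemma upper_half_axis: "k \<in> upper_half \<Longrightarrow> Re k = 0 \<Longrightarrow> k = \<i> * of_real (Im k)"
  by (simp add: complex_eq_iff)

text \<open>One side of the identity F B_- = G B_+ with everything that
  \<open>quotient_negligible_eq\<close> asks of it. Simplicity of the zeros rests on
  \<open>disj\<close>, which separates the zeros of the two factors.\<close>

lemma jost_times_blaschke:
  assumes q: "integrable lebesgue q" and c0: "\<And>n. c n \<ge> 0" and cs: "summable c"
    and inj: "\<forall>m n. c m = c n \<and> c n > 0 \<longrightarrow> m = n"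
    and disj: "\<forall>n. c n > 0 \<longrightarrow> jost q (\<i> * of_real (c n)) 0 \<noteq> 0"
    and f_def: "f = (\<lambda>k. jost q k 0 * blaschke c k)"
  shows "f holomorphic_on upper_half" "continuous_on closed_upper f"
    and "k \<in> upper_half \<Longrightarrow> f k = 0 \<longleftrightarrow> jost q k 0 = 0 \<or> (\<exists>n. k = \<i> * of_real (c n))"
    and "k \<in> upper_half \<Longrightarrow> f k = 0 \<Longrightarrow> Re k = 0"
    and "k \<in> upper_half \<Longrightarrow> f k = 0 \<Longrightarrow> deriv f k \<noteq> 0"
    and "x \<noteq> 0 \<Longrightarrow> cmod (f (of_real x)) = cmod (jost q (of_real x) 0) \<and> f (of_real x) \<noteq> 0"
    and "e > 0 \<Longrightarrow> \<exists>R. \<forall>k\<in>closed_upper. cmod k > R \<longrightarrow> cmod (f k - 1) < e"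
    and "negligible_at_0 (\<lambda>k. ln (cmod (f k)))"
proof -
  note b = c0 cs
  show "f holomorphic_on upper_half" unfolding f_def by (intro holomorphic_intros jost_regular q blaschke_holomorphic b)
  show "continuous_on closed_upper f" unfolding f_def by (intro continuous_intros jost_regular q blaschke_continuous b)
  have z: "f k = 0 \<longleftrightarrow> jost q k 0 = 0 \<or> (\<exists>n. k = \<i> * of_real (c n))" if k: "k \<in> upper_half" for k
    using blaschke_eq_0_iff[OF b subsetD[OF upper_half_subset_closed_upper k]] unfolding f_def by simp
  show "k \<in> upper_half \<Longrightarrow> f k = 0 \<longleftrightarrow> jost q k 0 = 0 \<or> (\<exists>n. k = \<i> * of_real (c n))" by (rule z)
  have re: "Re k = 0" if k: "k \<in> upper_half" and "f k = 0" for k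
    using z[OF k] that jost_zero_imp_axis(1)[OF q, of k] by (auto simp: upper_half_def)
  show "k \<in> upper_half \<Longrightarrow> f k = 0 \<Longrightarrow> Re k = 0" by (rule re)
  show "deriv f k \<noteq> 0" if k: "k \<in> upper_half" and fk: "f k = 0"
  proof (cases "jost q k 0 = 0")
    case True
    have "blaschke c k \<noteq> 0"
    proof
      assume "blaschke c k = 0"
      then obtain n where n: "k = \<i> * of_real (c n)"
        using blaschke_eq_0_iff[OF b subsetD[OF upper_half_subset_closed_upper k]] by blast
      then have "c n > 0" using k by (simp add: upper_half_def)
      then show False using disj True n by blast
    qed
    moreover have "deriv (\<lambda>k. jost q k 0) k \<noteq> 0" using jost_zero_imp_axis(2)[OF q] k True by (simp add: upper_half_def)
    ultimately show ?thesis
      unfolding f_def using deriv_mult_simple_zero(1)[OF jost_regular(3)[OF q] blaschke_holomorphic[OF b] k True] by blast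
  next
    case False
    then obtain n where n: "k = \<i> * of_real (c n)" using z[OF k] fk by blast
    then have cn: "c n > 0" using k by (simp add: upper_half_def)
    have "blaschke c k = 0" using blaschke_eq_0_iff[OF b subsetD[OF upper_half_subset_closed_upper k]] n by blast
    moreover have "deriv (blaschke c) k \<noteq> 0"
      unfolding n by (rule blaschke_deriv_nonzero[OF b cn]) (use inj cn in metis)
    ultimately show ?thesis
      unfolding f_def using deriv_mult_simple_zero(2)[OF blaschke_holomorphic[OF b] jost_regular(3)[OF q] k _ _ False] by blast
  qed
  show "x \<noteq> 0 \<Longrightarrow> cmod (f (of_real x)) = cmod (jost q (of_real x) 0) \<and> f (of_real x) \<noteq> 0"
    using blaschke_norm_real[OF b, of x] jost_real_nonzero[OF q, of x] unfolding f_def by (auto simp: norm_mult)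
  have "(blaschke c \<longlongrightarrow> 1) (inf at_infinity (principal closed_upper))"
    unfolding tendsto_at_infinity_within_iff using blaschke_at_infinity[OF b] by blast
  from tendsto_mult[OF jost_at_infinity(1)[OF q] this]
  show "e > 0 \<Longrightarrow> \<exists>R. \<forall>k\<in>closed_upper. cmod k > R \<longrightarrow> cmod (f k - 1) < e"
    unfolding tendsto_at_infinity_within_iff f_def by simp
  show "negligible_at_0 (\<lambda>k. ln (cmod (f k)))"
    unfolding f_def
  proof (rule negligible_at_0_ln_mult[OF squeezed_imp_negligible[OF squeezed_jost[OF q]] blaschke_negligible[OF b]])
    fix k assume k: "Im k > 0" "Re k \<noteq> 0"
    then have "k \<in> upper_half" by (simp add: upper_half_def)
    from re[OF this] k(2) have "f k \<noteq> 0" by blast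
    then show "jost q k 0 \<noteq> 0 \<and> blaschke c k \<noteq> 0" unfolding f_def by simp
  qed
qed

text \<open>Simplicity of the zeros comes from the formula for the derivative at an eigenvalue: as
  both Jost functions are nonzero there, it is a nonzero multiple of the positive mass.\<close>

lemma wronskian_coeff_eq_blaschke:
  assumes q: "integrable lebesgue q" and r: "\<And>k. k \<noteq> 0 \<Longrightarrow> r_minus q k = 0"
    and \<kappa>: "\<And>n. \<kappa> n > 0" "inj \<kappa>" "summable \<kappa>"
    and zeros: "\<And>x. x > 0 \<Longrightarrow> wronskian_coeff q (\<lambda>x. q (- x)) (\<i> * of_real x) = 0 \<longleftrightarrow> x \<in> range \<kappa>"
    and nz: "\<And>n. jost q (\<i> * of_real (\<kappa> n)) 0 \<noteq> 0" "\<And>n. jost (\<lambda>x. q (- x)) (\<i> * of_real (\<kappa> n)) 0 \<noteq> 0"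
    and k: "k \<in> upper_half"
  shows "wronskian_coeff q (\<lambda>x. q (- x)) k = blaschke \<kappa> k"
proof -
  let ?p = "\<lambda>x. q (- x)"
  have p: "integrable lebesgue ?p" by (rule integrable_reflect_lebesgue[OF q])
  have \<kappa>0: "\<And>n. \<kappa> n \<ge> 0" using \<kappa>(1) less_imp_le by blast
  note b = \<kappa>0 \<kappa>(3)
  let ?A = "wronskian_coeff q ?p"
  have bz: "blaschke \<kappa> k = 0 \<longleftrightarrow> (\<exists>n. k = \<i> * of_real (\<kappa> n))" if "k \<in> upper_half" for k
    by (rule blaschke_eq_0_iff[OF b subsetD[OF upper_half_subset_closed_upper that]])
  have Az: "?A k = 0 \<longleftrightarrow> (\<exists>n. k = \<i> * of_real (\<kappa> n))" if k: "k \<in> upper_half" for k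
  proof
    assume z: "?A k = 0"
    have "Im k > 0" using k by (simp add: upper_half_def)
    from wronskian_coeff_zero_imp_axis[OF q p this z] have e: "k = \<i> * of_real (Im k)" by (rule upper_half_axis[OF k])
    then have "Im k \<in> range \<kappa>" using zeros[OF \<open>Im k > 0\<close>] z by simp
    then obtain n where "Im k = \<kappa> n" by blast
    with e show "\<exists>n. k = \<i> * of_real (\<kappa> n)" by auto
  next
    assume "\<exists>n. k = \<i> * of_real (\<kappa> n)"
    then show "?A k = 0" using zeros \<kappa>(1) by blast
  qed
  show ?thesis
  proof (rule quotient_negligible_eq[OF wronskian_coeff_regular(2)[OF q p] blaschke_holomorphic[OF b]
      wronskian_coeff_regular(1)[OF q p] blaschke_continuous[OF b]])
    show "?A k = 0 \<longleftrightarrow> blaschke \<kappa> k = 0" if "k \<in> upper_half" for k using Az[OF that] bz[OF that] by blast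
    show "Re k = 0" if "k \<in> upper_half" "blaschke \<kappa> k = 0" for k using bz[OF that(1)] that(2) by auto
    show "deriv ?A k \<noteq> 0" if k: "k \<in> upper_half" and z: "?A k = 0" for k
    proof -
      obtain n where n: "k = \<i> * of_real (\<kappa> n)" using Az[OF k] z by blast
      have F: "jost q k 0 \<noteq> 0" "jost ?p k 0 \<noteq> 0" using nz unfolding n by auto
      have ik: "Im k > 0" using k by (simp add: upper_half_def)
      have "jost ?p k 0 * of_real (\<integral>x. (cmod (jost q k x))\<^sup>2 \<partial>lebesgue) \<noteq> 0"
        using deriv_wronskian_coeff(2)[OF q ik z F(1)] F(2) by simp
      then show ?thesis using deriv_wronskian_coeff(1)[OF q ik z F(1)] by auto
    qed
    show "deriv (blaschke \<kappa>) k \<noteq> 0" if k: "k \<in> upper_half" and z: "blaschke \<kappa> k = 0" for k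
    proof -
      obtain n where n: "k = \<i> * of_real (\<kappa> n)" using bz[OF k] z by blast
      show ?thesis unfolding n by (rule blaschke_deriv_nonzero[OF b \<kappa>(1)]) (use \<kappa>(2) in \<open>auto dest: injD\<close>)
    qed
    show "cmod (?A (of_real x)) = cmod (blaschke \<kappa> (of_real x)) \<and> blaschke \<kappa> (of_real x) \<noteq> 0" if "x \<noteq> 0" for x
      using reflectionless_on_real(2)[OF q that r[OF that]] blaschke_norm_real[OF b that] by auto
    show "\<exists>R. \<forall>k\<in>closed_upper. cmod k > R \<longrightarrow> cmod (?A k - 1) < e" if "e > 0" for e
      using wronskian_coeff_at_infinity[OF q p] that unfolding tendsto_at_infinity_within_iff by blast
    show "\<exists>R. \<forall>k\<in>closed_upper. cmod k > R \<longrightarrow> cmod (blaschke \<kappa> k - 1) < e" if "e > 0" for e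
      by (rule blaschke_at_infinity[OF b that])
    show "negligible_at_0 (\<lambda>k. ln (cmod (?A k)))" by (rule squeezed_imp_negligible[OF squeezed_wronskian_coeff[OF q p]])
    show "negligible_at_0 (\<lambda>k. ln (cmod (blaschke \<kappa> k)))" by (rule blaschke_negligible[OF b])
  qed (rule k)
qed

text \<open>On the left the zeros of \<open>F\<close> correspond to the positive \<mu>, those of the
  Blaschke factor to the negative ones; on the right the roles are exchanged. Both sides therefore
  vanish exactly at i|\<mu> n| for nonzero \<mu> n, and injectivity of |\<mu>| keeps the zeros
  simple.\<close>

lemma jost_reflect_blaschke:
  assumes q: "integrable lebesgue q" and r: "\<And>k. k \<noteq> 0 \<Longrightarrow> r_minus q k = 0"
    and \<mu>: "summable (\<lambda>n. \<bar>\<mu> n\<bar>)" "inj (\<lambda>n. \<bar>\<mu> n\<bar>)"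
    and zeros: "\<And>x. x > 0 \<Longrightarrow> jost q (\<i> * of_real x) 0 = 0 \<longleftrightarrow> x \<in> range \<mu>"
      "\<And>x. x > 0 \<Longrightarrow> jost (\<lambda>x. q (- x)) (\<i> * of_real x) 0 = 0 \<longleftrightarrow> - x \<in> range \<mu>"
    and k: "k \<in> upper_half"
  shows "jost q k 0 * blaschke (\<lambda>n. max (- \<mu> n) 0) k = jost (\<lambda>x. q (- x)) k 0 * blaschke (\<lambda>n. max (\<mu> n) 0) k"
proof -
  let ?p = "\<lambda>x. q (- x)"
  have p: "integrable lebesgue ?p" by (rule integrable_reflect_lebesgue[OF q])
  define c d where c: "c = (\<lambda>n. max (- \<mu> n) 0)" and d: "d = (\<lambda>n. max (\<mu> n) 0)"
  have c0: "\<And>n. c n \<ge> 0" and d0: "\<And>n. d n \<ge> 0" by (auto simp: c d)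
  have cs: "summable c" by (rule summable_comparison_test'[OF \<mu>(1), where N = 0]) (auto simp: c)
  have ds: "summable d" by (rule summable_comparison_test'[OF \<mu>(1), where N = 0]) (auto simp: d)
  have ci: "\<forall>m n. c m = c n \<and> c n > 0 \<longrightarrow> m = n"
    using injD[OF \<mu>(2)] by (auto simp: c max_def split: if_splits)
  have di: "\<forall>m n. d m = d n \<and> d n > 0 \<longrightarrow> m = n"
    using injD[OF \<mu>(2)] by (auto simp: d max_def split: if_splits)
  have excl: False if "\<mu> m = x" "\<mu> n = - x" "x > 0" for m n x
    using that injD[OF \<mu>(2), of m n] by auto
  have cj: "\<forall>n. c n > 0 \<longrightarrow> jost q (\<i> * of_real (c n)) 0 \<noteq> 0"
  proof (intro allI impI notI)
    fix n assume cn: "c n > 0" and "jost q (\<i> * of_real (c n)) 0 = 0"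
    then obtain m where "\<mu> m = c n" using zeros(1)[OF cn] by auto
    moreover have "\<mu> n = - c n" using cn by (auto simp: c max_def split: if_splits)
    ultimately show False using excl cn by blast
  qed
  have dj: "\<forall>n. d n > 0 \<longrightarrow> jost ?p (\<i> * of_real (d n)) 0 \<noteq> 0"
  proof (intro allI impI notI)
    fix n assume dn: "d n > 0" and "jost ?p (\<i> * of_real (d n)) 0 = 0"
    then obtain m where "\<mu> m = - d n" using zeros(2)[OF dn] by (metis rangeE)
    moreover have "\<mu> n = d n" using dn by (auto simp: d max_def split: if_splits)
    ultimately show False using excl dn by blast
  qed
  define f g where f: "f = (\<lambda>k. jost q k 0 * blaschke c k)" and g: "g = (\<lambda>k. jost ?p k 0 * blaschke d k)"
  note N = jost_times_blaschke[OF q c0 cs ci cj f]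
  note D = jost_times_blaschke[OF p d0 ds di dj g]
  have axis: "jost q k 0 = 0 \<or> (\<exists>n. k = \<i> * of_real (c n)) \<longleftrightarrow> jost ?p k 0 = 0 \<or> (\<exists>n. k = \<i> * of_real (d n))"
    if e: "k = \<i> * of_real x" and x: "x > 0" for k x
  proof -
    have "(\<exists>n. k = \<i> * of_real (c n)) \<longleftrightarrow> - x \<in> range \<mu>"
    proof -
      have "k = \<i> * of_real (c n) \<longleftrightarrow> - x = \<mu> n" for n
        unfolding e mult_cancel_left of_real_eq_iff c using x by (auto simp: max_def)
      then show ?thesis by auto
    qed
    moreover have "(\<exists>n. k = \<i> * of_real (d n)) \<longleftrightarrow> x \<in> range \<mu>"
    proof -
      have "k = \<i> * of_real (d n) \<longleftrightarrow> x = \<mu> n" for n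
        unfolding e mult_cancel_left of_real_eq_iff d using x by (auto simp: max_def)
      then show ?thesis by auto
    qed
    ultimately show ?thesis using zeros[OF x] unfolding e by blast
  qed
  have zer: "f k = 0 \<longleftrightarrow> g k = 0" if k: "k \<in> upper_half" for k
  proof (cases "Re k = 0")
    case True
    have "Im k > 0" using k by (simp add: upper_half_def)
    from axis[OF upper_half_axis[OF k True] this] show ?thesis unfolding N(3)[OF k] D(3)[OF k] .
  next
    case False
    then show ?thesis using N(4)[OF k] D(4)[OF k] by blast
  qed
  have real: "cmod (f (of_real x)) = cmod (g (of_real x)) \<and> g (of_real x) \<noteq> 0" if "x \<noteq> 0" for x
    using N(6)[OF that] D(6)[OF that] reflectionless_on_real(1)[OF q that r[OF that]] by simp
  have "f k = g k"
    by (rule quotient_negligible_eq[where N = f and D = g]) (fact N(1) D(1) N(2) D(2) zer D(4) N(5) D(5) real N(7) D(7) N(8) D(8) k)+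
  then show ?thesis unfolding f g c d .
qed

text \<open>For negative \<mu> n the factor is the reciprocal of the Blaschke factor with parameter
  \<open>- \<mu> n\<close>; in each factor one of the two \<open>max\<close> terms is 0 and
  contributes 1.\<close>

lemma blaschke_signed:
  assumes \<mu>: "summable (\<lambda>n. \<bar>\<mu> n\<bar>)" and z: "z \<in> upper_half"
  shows "(\<Prod>n. (z - \<i> * of_real (\<mu> n)) / (z + \<i> * of_real (\<mu> n))) =
    blaschke (\<lambda>n. max (\<mu> n) 0) z / blaschke (\<lambda>n. max (- \<mu> n) 0) z"
proof -
  define c d where c: "c = (\<lambda>n. max (- \<mu> n) 0)" and d: "d = (\<lambda>n. max (\<mu> n) 0)"
  have c0: "\<And>n. c n \<ge> 0" and d0: "\<And>n. d n \<ge> 0" by (auto simp: c d)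
  have cs: "summable c" by (rule summable_comparison_test'[OF \<mu>(1), where N = 0]) (auto simp: c)
  have ds: "summable d" by (rule summable_comparison_test'[OF \<mu>(1), where N = 0]) (auto simp: d)
  have zc: "z \<in> closed_upper" "z \<noteq> 0" "Im z > 0" using z by (auto simp: upper_half_def closed_upper_def)
  have f: "(z - \<i> * of_real (\<mu> n)) / (z + \<i> * of_real (\<mu> n)) =
    ((z - \<i> * of_real (d n)) / (z + \<i> * of_real (d n))) / ((z - \<i> * of_real (c n)) / (z + \<i> * of_real (c n)))" for n
    using zc(2) by (cases "\<mu> n \<ge> 0") (auto simp: c d max_def)
  show ?thesis
    unfolding f c[symmetric] d[symmetric] blaschke_def
    by (rule prodinf_divide[OF blaschke_convergent[OF d0 ds zc(1)] blaschke_convergent[OF c0 cs zc(1)], symmetric])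
qed

theorem theorem5p4:
  fixes q :: "real \<Rightarrow> real"
    and \<kappa> \<mu> m :: "nat \<Rightarrow> real"
    and a B :: "complex \<Rightarrow> complex"
  assumes "q \<in> Q1"
    and "generic q"
    and "reflectionless q"
    and "\<And>n. \<kappa> n > 0"
    and "strict_mono (\<lambda>n. - (\<kappa> n)\<^sup>2)"
    and "neg_eigenvalues UNIV (T_op q) = range (\<lambda>n. - (\<kappa> n)\<^sup>2)"
    and "summable \<kappa>"
    and "\<And>n. right_norming_constant q (\<kappa> n) (m n)"
    and "strict_mono (\<lambda>n. - (\<mu> n)\<^sup>2)"
    and "neg_eigenvalues UNIV (T_prime q) = range (\<lambda>n. - (\<mu> n)\<^sup>2)"
    and "\<And>n. - (\<mu> n)\<^sup>2 \<in> neg_eigenvalues {0..} (T_plus q) \<Longrightarrow> \<mu> n > 0"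
    and "\<And>n. - (\<mu> n)\<^sup>2 \<in> neg_eigenvalues {..0} (T_minus q) \<Longrightarrow> \<mu> n < 0"
    and "a = (\<lambda>z. \<Prod>n. (z - \<i> * of_real (\<kappa> n)) / (z + \<i> * of_real (\<kappa> n)))"
    and "B = (\<lambda>z. \<Prod>n. (z - \<i> * of_real (\<mu> n)) / (z + \<i> * of_real (\<mu> n)))"
  shows "complex_of_real (m n powi (- 2)) =
         \<i> * deriv a (\<i> * of_real (\<kappa> n)) * B (\<i> * of_real (\<kappa> n))"
proof -
  let ?p = "\<lambda>x. q (- x)"
  have q: "integrable lebesgue q" using assms(1) by (simp add: Q1_def)
  have p: "integrable lebesgue ?p" by (rule integrable_reflect_lebesgue[OF q])
  have r: "r_minus q k = 0" if "k \<noteq> 0" for k using assms(3) that by (simp add: reflectionless_def)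
  note \<kappa>pos = assms(4)
  have \<kappa>dec: "\<kappa> j < \<kappa> i" if "i < j" for i j
  proof -
    have "(\<kappa> j)\<^sup>2 < (\<kappa> i)\<^sup>2" using strict_monoD[OF assms(5) that] by simp
    then show ?thesis using \<kappa>pos[of i] by (simp add: power2_less_imp_less)
  qed
  have \<mu>dec: "\<bar>\<mu> j\<bar> < \<bar>\<mu> i\<bar>" if "i < j" for i j
  proof -
    have "(\<mu> j)\<^sup>2 < (\<mu> i)\<^sup>2" using strict_monoD[OF assms(9) that] by simp
    then show ?thesis using power2_less_imp_less[of "\<bar>\<mu> j\<bar>" "\<bar>\<mu> i\<bar>"] by simp
  qed
  have inj\<mu>: "inj (\<lambda>n. \<bar>\<mu> n\<bar>)" by (rule linorder_injI) (use \<mu>dec in force)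
  have inj\<kappa>: "inj \<kappa>" by (rule linorder_injI) (use \<kappa>dec in force)
  have \<mu>0: "\<bar>\<mu> i\<bar> > 0" for i
  proof -
    have "- (\<mu> i)\<^sup>2 \<in> neg_eigenvalues UNIV (T_prime q)" using assms(10) by blast
    then show ?thesis by (auto simp: neg_eigenvalues_def)
  qed
  have neg: "- x\<^sup>2 < 0" if "x > 0" for x :: real using that by simp
  have sq: "- x\<^sup>2 \<in> range (\<lambda>n. - (\<kappa> n)\<^sup>2) \<longleftrightarrow> x \<in> range \<kappa>" if x: "x > 0" for x
  proof -
    have "- x\<^sup>2 = - (\<kappa> n)\<^sup>2 \<longleftrightarrow> x = \<kappa> n" for n
      using x \<kappa>pos[of n] by (simp add: power2_eq_iff_nonneg less_imp_le)
    then show ?thesis by auto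
  qed
  have sq\<mu>: "- x\<^sup>2 = - (\<mu> n)\<^sup>2 \<longleftrightarrow> x = \<bar>\<mu> n\<bar>" if x: "x > 0" for x n
    using x by (auto simp: power2_eq_iff abs_if)
  have ev: "- x\<^sup>2 \<in> neg_eigenvalues S T \<longleftrightarrow> eigenvalue S T (of_real (- x\<^sup>2))" if "x > 0" for x S T
    using neg[OF that] by (simp add: neg_eigenvalues_def)
  have zA: "wronskian_coeff q ?p (\<i> * of_real x) = 0 \<longleftrightarrow> x \<in> range \<kappa>" if x: "x > 0" for x
    using T_op_eigenvalue_iff[OF q x] ev[OF x] sq[OF x] unfolding assms(6)[symmetric] by blast
  have zF: "jost q (\<i> * of_real x) 0 = 0 \<longleftrightarrow> - x\<^sup>2 \<in> neg_eigenvalues {0..} (T_plus q)" if x: "x > 0" for x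
    using T_plus_eigenvalue_iff[OF q x] ev[OF x] by blast
  have zG: "jost ?p (\<i> * of_real x) 0 = 0 \<longleftrightarrow> - x\<^sup>2 \<in> neg_eigenvalues {..0} (T_minus q)" if x: "x > 0" for x
    using T_minus_eigenvalue_iff[OF q x] ev[OF x] by blast
  have zFG: "jost q (\<i> * of_real x) 0 = 0 \<or> jost ?p (\<i> * of_real x) 0 = 0 \<longleftrightarrow> - x\<^sup>2 \<in> neg_eigenvalues UNIV (T_prime q)" if x: "x > 0" for x
    using zF[OF x] zG[OF x] ev[OF x] T_prime_eigenvalue_iff by blast
  have z\<nu>: "jost q (\<i> * of_real x) 0 = 0 \<or> jost ?p (\<i> * of_real x) 0 = 0 \<longleftrightarrow> x \<in> range (\<lambda>n. \<bar>\<mu> n\<bar>)" if x: "x > 0" for x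
    unfolding zFG[OF x] assms(10) using sq\<mu>[OF x] by auto
  have Fpos: "\<mu> j > 0" if "jost q (\<i> * of_real \<bar>\<mu> j\<bar>) 0 = 0" for j
    using assms(11)[of j] zF[OF \<mu>0[of j]] that by simp
  have Gneg: "\<mu> j < 0" if "jost ?p (\<i> * of_real \<bar>\<mu> j\<bar>) 0 = 0" for j
    using assms(12)[of j] zG[OF \<mu>0[of j]] that by simp
  \<comment> \<open>At a common zero the corresponding \<mu> j would be required to be positive by
    the right half-line and negative by the left one.\<close>
  have nb: "jost q (\<i> * of_real x) 0 \<noteq> 0 \<or> jost ?p (\<i> * of_real x) 0 \<noteq> 0" if x: "x > 0" for x
    using z\<nu>[OF x] Fpos Gneg by (metis less_asym rangeE)
  have zF\<mu>: "jost q (\<i> * of_real x) 0 = 0 \<longleftrightarrow> x \<in> range \<mu>" if x: "x > 0" for x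
  proof
    assume z: "jost q (\<i> * of_real x) 0 = 0"
    then obtain j where j: "x = \<bar>\<mu> j\<bar>" using z\<nu>[OF x] by blast
    then show "x \<in> range \<mu>" using Fpos[of j] z by simp
  next
    assume "x \<in> range \<mu>"
    then obtain j where j: "x = \<mu> j" by blast
    then have j': "x = \<bar>\<mu> j\<bar>" using x by simp
    have "jost ?p (\<i> * of_real x) 0 \<noteq> 0" using Gneg[of j] j x unfolding j'[symmetric] by auto
    then show "jost q (\<i> * of_real x) 0 = 0" using z\<nu>[OF x] j' by blast
  qed
  have zG\<mu>: "jost ?p (\<i> * of_real x) 0 = 0 \<longleftrightarrow> - x \<in> range \<mu>" if x: "x > 0" for x
  proof
    assume z: "jost ?p (\<i> * of_real x) 0 = 0"
    then obtain j where j: "x = \<bar>\<mu> j\<bar>" using z\<nu>[OF x] by blast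
    then have "- x = \<mu> j" using Gneg[of j] z by simp
    then show "- x \<in> range \<mu>" by blast
  next
    assume "- x \<in> range \<mu>"
    then obtain j where j: "- x = \<mu> j" by blast
    then have j': "x = \<bar>\<mu> j\<bar>" using x by simp
    have "jost q (\<i> * of_real x) 0 \<noteq> 0" using Fpos[of j] j x unfolding j'[symmetric] by auto
    then show "jost ?p (\<i> * of_real x) 0 = 0" using z\<nu>[OF x] j' by blast
  qed
  \<comment> \<open>Interlacing provides the summability of |\<mu>| on which convergence of
    \<open>B\<close> depends.\<close>
  have le: "\<bar>\<mu> j\<bar> \<le> \<kappa> j" for j
    by (rule jost_zeros_interlace[OF q p nb \<kappa>dec _ \<mu>0 \<mu>dec z\<nu>]) (auto simp: zA)
  have \<mu>s: "summable (\<lambda>n. \<bar>\<mu> n\<bar>)"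
    by (rule summable_comparison_test'[OF assms(7), where N = 0]) (use le in simp)
  \<comment> \<open>Here genericity is used: otherwise \<open>- (\<kappa> j)^2\<close> would lie in
    the spectra of both operators.\<close>
  have nz: "jost q (\<i> * of_real (\<kappa> j)) 0 \<noteq> 0 \<and> jost ?p (\<i> * of_real (\<kappa> j)) 0 \<noteq> 0" for j
  proof (rule ccontr)
    assume "\<not> ?thesis"
    then have "eigenvalue UNIV (T_prime q) (of_real (- (\<kappa> j)\<^sup>2))"
      using zFG[OF \<kappa>pos[of j]] ev[OF \<kappa>pos[of j]] by blast
    then have 1: "of_real (- (\<kappa> j)\<^sup>2) \<in> op_spectrum UNIV (T_prime q)"
    proof (rule eigenvalue_in_spectrum[rotated])
      fix y f assume "(y, f) \<in> T_prime q"
      then have y: "y \<in> L2 {..0}" "y \<in> L2 {0..}" by (auto simp: T_prime_def T_minus_def T_plus_def)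
      show "y \<in> L2 UNIV" using L2_Un_half_lines[OF y] .
    qed
    have "eigenvalue UNIV (T_op q) (of_real (- (\<kappa> j)\<^sup>2))"
      using ev[OF \<kappa>pos[of j]] assms(6) by blast
    then have 2: "of_real (- (\<kappa> j)\<^sup>2) \<in> op_spectrum UNIV (T_op q)"
      by (rule eigenvalue_in_spectrum[rotated]) (auto simp: T_op_def)
    have "- (\<kappa> j)\<^sup>2 \<in> neg_spectrum UNIV (T_op q) \<inter> neg_spectrum UNIV (T_prime q)"
      unfolding neg_spectrum_def using 1 2 neg[OF \<kappa>pos[of j]] by blast
    then show False using assms(2) unfolding generic_def special_def by blast
  qed
  define k where "k = \<i> * complex_of_real (\<kappa> n)"
  have k: "Im k > 0" "Im k \<ge> 0" "k \<noteq> 0" "k \<in> upper_half" using \<kappa>pos[of n] by (auto simp: k_def upper_half_def)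
  have Feq: "jost q k 0 * blaschke (\<lambda>n. max (- \<mu> n) 0) k = jost ?p k 0 * blaschke (\<lambda>n. max (\<mu> n) 0) k"
    by (rule jost_reflect_blaschke[OF q r \<mu>s inj\<mu> zF\<mu> zG\<mu> k(4)])
  have Aeq: "wronskian_coeff q ?p z = blaschke \<kappa> z" if "z \<in> upper_half" for z
    by (rule wronskian_coeff_eq_blaschke[OF q r \<kappa>pos inj\<kappa> assms(7) zA _ _ that]) (use nz in blast)+
  have FG: "jost q k 0 \<noteq> 0" "jost ?p k 0 \<noteq> 0" using nz by (auto simp: k_def)
  have Bk: "B k = blaschke (\<lambda>n. max (\<mu> n) 0) k / blaschke (\<lambda>n. max (- \<mu> n) 0) k"
    unfolding assms(14) by (rule blaschke_signed[OF \<mu>s k(4)])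
  have c0: "max (- \<mu> j) 0 \<ge> 0" for j by simp
  have cs: "summable (\<lambda>n. max (- \<mu> n) 0)" by (rule summable_comparison_test'[OF \<mu>s, where N = 0]) auto
  have bnz: "blaschke (\<lambda>n. max (- \<mu> n) 0) k \<noteq> 0"
  proof
    assume "blaschke (\<lambda>n. max (- \<mu> n) 0) k = 0"
    then obtain j where "k = \<i> * of_real (max (- \<mu> j) 0)"
      using blaschke_eq_0_iff[OF c0 cs subsetD[OF upper_half_subset_closed_upper k(4)]] by blast
    then have e: "\<kappa> n = max (- \<mu> j) 0" unfolding k_def mult_cancel_left of_real_eq_iff by simp
    then have "- \<kappa> n = \<mu> j" using \<kappa>pos[of n] by (auto simp: max_def split: if_splits)
    then show False using zG\<mu>[OF \<kappa>pos[of n]] FG unfolding k_def by (metis rangeI)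
  qed
  have B: "jost ?p k 0 * B k = jost q k 0" unfolding Bk using Feq bnz by (simp add: field_simps)
  have "a = blaschke \<kappa>" unfolding assms(13) by (simp add: fun_eq_iff blaschke_def)
  then have da: "deriv (wronskian_coeff q ?p) k = deriv a k"
    using Aeq by (intro complex_derivative_transform_within_open[OF _ _ open_upper_half k(4)])
      (use wronskian_coeff_regular(2)[OF q p] blaschke_holomorphic[OF less_imp_le[OF \<kappa>pos] assms(7)] in auto)
  have zk: "wronskian_coeff q ?p k = 0" unfolding k_def using zA[OF \<kappa>pos[of n]] by blast
  have "m n powi (- 2) = (\<integral>x. (cmod (jost q k x))\<^sup>2 \<partial>lebesgue)"
    using assms(8)[of n] jost_plus_eq(2)[OF q k(2,3)] unfolding right_norming_constant_def k_def by simp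
  then have M: "\<i> * deriv a k * jost q k 0 = jost ?p k 0 * of_real (m n powi (- 2))"
    using deriv_wronskian_coeff(1)[OF q k(1) zk FG(1)] unfolding da by simp
  \<comment> \<open>The mass formula contains F / G at \<open>k\<close>, which is
    \<open>B k\<close>; both relations are kept multiplied by the nonzero value
    \<open>jost ?p k 0\<close>, cancelled at the very end.\<close>
  have "jost ?p k 0 * (\<i> * deriv a k * B k) = \<i> * deriv a k * (jost ?p k 0 * B k)" by (simp only: ac_simps)
  also have "\<dots> = jost ?p k 0 * of_real (m n powi (- 2))" unfolding B M ..
  finally show ?thesis using FG(2) unfolding k_def[symmetric] mult_cancel_left by metis
qed

end
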